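(* Let $d\ge 1$, $\sigma>0$, let $N_0\in\mathbf N$ satisfy $N_0\sigma>1$, let $p_0\in[1,\infty]$, $p,q\in(0,\infty]$, $\omega\in\mathscr P(\mathbf R^{2d})$, and let $f\in C^\infty(\mathbf R^d)$ be given by its Hermite series $f=\sum_{\alpha\in\mathbf N^d}c_\alpha(f)h_\alpha$. Then the following conditions are equivalent: (1) $f\in\mathcal H_{\flat_\sigma}(\mathbf R^d)$ (respectively $f\in\mathcal H_{0,\flat_\sigma}(\mathbf R^d)$); (2) for some $r>0$ (respectively for every $r>0$), $$\{c_\alpha(f)\,r^{-|\alpha|}(\alpha!)^{\frac1{2\sigma}}\}_{\alpha\in\mathbf N^d}\in\ell^q(\mathbf N^d);$$ (3) for some $r>0$ (respectively for every $r>0$), $$\|H_d^Nf\|_{L^{p_0}}\lesssim 2^N r^{\frac N{\log(N\sigma)}}\left(\frac{2N\sigma}{\log(N\sigma)}\right)^{N\left(1-\frac1{\log(N\sigma)}\right)},\qquad N\in\mathbf N,\ N\ge N_0;$$ (4) for some $r>0$ (respectively for every $r>0$), $$\|H_d^Nf\|_{M^{p,q}_{(\omega)}}\lesssim 2^N r^{\frac N{\log(N\sigma)}}\left(\frac{2N\sigma}{\log(N\sigma)}\right)^{N\left(1-\frac1{\log(N\sigma)}\right)},\qquad N\in\mathbf N,\ N\ge N_0.$$ Here there are two parallel assertions: the conditions (1)–(4) in the "for some $r$" version with $\mathcal H_{\flat_\sigma}$ are equivalent, and the conditions (1)–(4) in the "for every $r$" version with $\mathcal H_{0,\flat_\sigma}$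 are equivalent.
   Context: $\mathbf N=\{0,1,2,\dots\}$; $\log$ is the natural logarithm. $A(\theta)\lesssim B(\theta)$ means $A(\theta)\le cB(\theta)$ for a constant $c>0$ independent of $\theta$; in (3) and (4) the variable is $N$, so $c$ is independent of $N$ (but may depend on $f,r$ and the other fixed parameters). $H_d=|x|^2-\Delta_x$ is the harmonic oscillator on $\mathbf R^d$, and $h_\alpha$, $\alpha\in\mathbf N^d$, are the $L^2$-normalized Hermite functions $h_\alpha(x)=\pi^{-d/4}(-1)^{|\alpha|}(2^{|\alpha|}\alpha!)^{-1/2}e^{|x|^2/2}\partial^\alpha e^{-|x|^2}$, which form an orthonormal basis of $L^2(\mathbf R^d)$ and satisfy $H_dh_\alpha=(2|\alpha|+d)h_\alpha$. That $f$ is given by its Hermite series means that $f$ is a tempered distribution, $c_\alpha(f)=\langle f,h_\alpha\rangle$ (which is $\int f h_\alpha\,dx$ when the integral converges), and the series converges to $f$ in $\mathscr S'(\mathbf R^d)$. The Pilipović space $\mathcal H_{\flat_\sigma}(\mathbf R^d)$ (respectively $\mathcal H_{0,\flat_\sigma}(\mathbf R^d)$) consists of all $f=\sum_\alpha c_\alpha(f)h_\alpha$ such that $|c_\alpha(f)|\lesssim r^{|\alpha|}\alpha!^{-\frac1{2\sigma}}$, $\alpha\in\mathbf N^d$, for some $r>0$ (respectively for every $r>0$). $\mathscr P(\mathbf R^{2d})$ is the set of moderate weights of polynomial type: functions $\omega\in L^\infty_{loc}(\mathbf R^{2d})$ with $\omega>0$ everywhere, $1/\omega\in L^\infty_{loc}(\mathbf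 R^{2d})$, and such that for some integer $M\ge0$, $\omega(X+Y)\lesssim\omega(X)(1+|Y|)^M$ for all $X,Y\in\mathbf R^{2d}$. Modulation spaces: fix $\phi\in\mathscr S(\mathbf R^d)\setminus\{0\}$. The short-time Fourier transform of $f\in\mathscr S'(\mathbf R^d)$ is $V_\phi f(x,\xi)=(2\pi)^{-d/2}\int f(y)\overline{\phi(y-x)}e^{-i\langle y,\xi\rangle}\,dy$ (in the distributional sense). For measurable $F$ on $\mathbf R^{2d}$, $\|F\|_{L^{p,q}}=\|g_F\|_{L^q(\mathbf R^d)}$ with $g_F(\xi)=\|F(\cdot,\xi)\|_{L^p(\mathbf R^d)}$. Then $\|f\|_{M^{p,q}_{(\omega)}}=\|V_\phi f\cdot\omega\|_{L^{p,q}}$, and $M^{p,q}_{(\omega)}(\mathbf R^d)$ is the set of $f\in\mathscr S'(\mathbf R^d)$ for which this is finite; different choices of $\phi$ give equivalent quasi-norms. *)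

theory Defs
  imports "HOL-Analysis.Analysis" "HOL-Probability.Essential_Supremum"
begin

subsection \<open>Smooth functions and partial derivatives\<close>

definition pderivative :: "'n \<Rightarrow> (real^'n \<Rightarrow> 'b::real_normed_vector) \<Rightarrow> real^'n \<Rightarrow> 'b" where
  "pderivative i f x = frechet_derivative f (at x) (axis i 1)"

definition iter_pderivative :: "'n list \<Rightarrow> (real^'n \<Rightarrow> 'b::real_normed_vector) \<Rightarrow> real^'n \<Rightarrow> 'b" where
  "iter_pderivative js f = foldr pderivative js f"

text \<open>If all iterated partial derivatives exist and are Frechet differentiable, they are all
  continuous; so this is the usual class of infinitely differentiable functions.\<close>

definition smooth :: "(real^'n \<Rightarrow> 'b::real_normed_vector) \<Rightarrow> bool" where
  "smooth f \<longleftrightarrow> (\<forall>js x. iter_pderivative js f differentiable (at x))"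

text \<open>Multi-indices are functions \<open>'n \<Rightarrow> nat\<close> on the finite coordinate type \<open>'n\<close>, so that
  \<open>CARD('n)\<close> is the dimension.\<close>

definition mabs :: "('n::finite \<Rightarrow> nat) \<Rightarrow> nat" where
  "mabs \<alpha> = (\<Sum>i\<in>UNIV. \<alpha> i)"

definition mfact :: "('n::finite \<Rightarrow> nat) \<Rightarrow> nat" where
  "mfact \<alpha> = (\<Prod>i\<in>UNIV. fact (\<alpha> i))"

text \<open>The coordinate type carries no order, so the order of differentiation is an arbitrary
  choice; it is irrelevant for smooth functions.\<close>

definition mderivative ::
    "('n::finite \<Rightarrow> nat) \<Rightarrow> (real^'n \<Rightarrow> 'b::real_normed_vector) \<Rightarrow> real^'n \<Rightarrow> 'b" where
  "mderivative \<alpha> f = iter_pderivative (SOME js. \<forall>i. count_list js i = \<alpha> i) f"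

definition laplacian :: "(real^'n \<Rightarrow> 'b::real_normed_vector) \<Rightarrow> real^'n \<Rightarrow> 'b" where
  "laplacian f x = (\<Sum>i\<in>UNIV. pderivative i (pderivative i f) x)"

definition harmonic_osc :: "(real^'n \<Rightarrow> complex) \<Rightarrow> real^'n \<Rightarrow> complex" where
  "harmonic_osc f x = of_real ((norm x)\<^sup>2) * f x - laplacian f x"


subsection \<open>Schwartz functions and tempered distributions\<close>

definition schwartz :: "(real^'n \<Rightarrow> complex) set" where
  "schwartz = {\<phi>. smooth \<phi> \<and>
     (\<forall>k js. bounded (range (\<lambda>x. (1 + norm x) ^ k * cmod (iter_pderivative js \<phi> x))))}"

definition test_function :: "(real^'n \<Rightarrow> complex) set" where
  "test_function = {\<phi>. smooth \<phi> \<and> compact (closure {x. \<phi> x \<noteq> 0})}"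

text \<open>A tempered distribution is represented by a functional of which only the values on
  Schwartz functions matter. The pairing is bilinear: \<open>u\<close> is complex linear, and a function \<open>f\<close>
  acts by integration against \<open>f\<close> without conjugation.\<close>

definition tempered_distribution :: "((real^'n \<Rightarrow> complex) \<Rightarrow> complex) \<Rightarrow> bool" where
  "tempered_distribution u \<longleftrightarrow>
     (\<forall>\<phi>\<in>schwartz. \<forall>\<psi>\<in>schwartz. u (\<lambda>x. \<phi> x + \<psi> x) = u \<phi> + u \<psi>) \<and>
     (\<forall>a. \<forall>\<phi>\<in>schwartz. u (\<lambda>x. a * \<phi> x) = a * u \<phi>) \<and>
     (\<exists>C k. \<forall>\<phi>\<in>schwartz. cmod (u \<phi>) \<le>
        C * (\<Sum>js | length js \<le> k. SUP x. (1 + norm x) ^ k * cmod (iter_pderivative js \<phi> x)))"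

text \<open>A function is a tempered distribution when the distribution it defines on test functions
  extends to a tempered distribution; by density of the test functions the extension is unique on
  Schwartz functions. No growth of \<open>f\<close> itself is required.\<close>

definition represents :: "(real^'n \<Rightarrow> complex) \<Rightarrow> ((real^'n \<Rightarrow> complex) \<Rightarrow> complex) \<Rightarrow> bool" where
  "represents f u \<longleftrightarrow> tempered_distribution u \<and>
     (\<forall>\<phi>\<in>test_function. integrable lebesgue (\<lambda>x. f x * \<phi> x) \<and>
                         u \<phi> = (LINT x|lebesgue. f x * \<phi> x))"

definition tempered_function :: "(real^'n \<Rightarrow> complex) \<Rightarrow> bool" where
  "tempered_function f \<longleftrightarrow> (\<exists>u. represents f u)"

definition distribution_of :: "(real^'n \<Rightarrow> complex) \<Rightarrow> (real^'n \<Rightarrow> complex) \<Rightarrow> complex" where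
  "distribution_of f = (SOME u. represents f u)"


subsection \<open>Hermite expansions and Pilipovic spaces\<close>

definition hermite_function :: "('n::finite \<Rightarrow> nat) \<Rightarrow> real^'n \<Rightarrow> complex" where
  "hermite_function \<alpha> x = of_real
     (pi powr (- real CARD('n) / 4) * (-1) ^ mabs \<alpha> * (2 ^ mabs \<alpha> * real (mfact \<alpha>)) powr (- 1 / 2)
      * exp ((norm x)\<^sup>2 / 2) * mderivative \<alpha> (\<lambda>y. exp (- (norm y)\<^sup>2)) x)"

definition hermite_coeff ::
    "((real^'n \<Rightarrow> complex) \<Rightarrow> complex) \<Rightarrow> ('n::finite \<Rightarrow> nat) \<Rightarrow> complex" where
  "hermite_coeff u \<alpha> = u (hermite_function \<alpha>)"

text \<open>Convergence of the (unordered) Hermite series to \<open>u\<close>, tested against each Schwartz function.\<close>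

definition hermite_series :: "((real^'n \<Rightarrow> complex) \<Rightarrow> complex) \<Rightarrow> bool" where
  "hermite_series u \<longleftrightarrow> (\<forall>\<phi>\<in>schwartz.
     ((\<lambda>\<alpha>. hermite_coeff u \<alpha> * (LINT x|lebesgue. hermite_function \<alpha> x * \<phi> x))
        has_sum u \<phi>) UNIV)"

definition pilipovic :: "real \<Rightarrow> ((real^'n \<Rightarrow> complex) \<Rightarrow> complex) set" where
  "pilipovic \<sigma> = {u. tempered_distribution u \<and> hermite_series u \<and>
     (\<exists>r>0. \<exists>c>0. \<forall>\<alpha>. cmod (hermite_coeff u \<alpha>)
        \<le> c * (r ^ mabs \<alpha> * real (mfact \<alpha>) powr (- 1 / (2 * \<sigma>))))}"

definition pilipovic0 :: "real \<Rightarrow> ((real^'n \<Rightarrow> complex) \<Rightarrow> complex) set" where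
  "pilipovic0 \<sigma> = {u. tempered_distribution u \<and> hermite_series u \<and>
     (\<forall>r>0. \<exists>c>0. \<forall>\<alpha>. cmod (hermite_coeff u \<alpha>)
        \<le> c * (r ^ mabs \<alpha> * real (mfact \<alpha>) powr (- 1 / (2 * \<sigma>))))}"


subsection \<open>Lebesgue quasi-norms and modulation spaces\<close>

definition ennreal_powr :: "ennreal \<Rightarrow> real \<Rightarrow> ennreal" where
  "ennreal_powr x a = (if x = top then top else ennreal (enn2real x powr a))"

text \<open>The quasi-norm for an exponent \<open>p\<close> in \<open>(0, \<infinity>]\<close> of a function with values in \<open>[0, \<infinity>]\<close>; taking
  such values allows the quasi-norm to be iterated. On counting measure it is the quasi-norm of
  the sequence space.\<close>

definition Lp_enorm :: "ennreal \<Rightarrow> 'a measure \<Rightarrow> ('a \<Rightarrow> ennreal) \<Rightarrow> ennreal" where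
  "Lp_enorm p M g =
     (if p = top then esssup M g
      else ennreal_powr (\<integral>\<^sup>+x. ennreal_powr (g x) (enn2real p) \<partial>M) (1 / enn2real p))"

definition Linf_loc :: "('a::euclidean_space \<Rightarrow> real) \<Rightarrow> bool" where
  "Linf_loc w \<longleftrightarrow> w \<in> borel_measurable lebesgue \<and>
     (\<forall>K. compact K \<longrightarrow> (\<exists>C. AE x in lebesgue. x \<in> K \<longrightarrow> \<bar>w x\<bar> \<le> C))"

definition poly_moderate_weight :: "('a::euclidean_space \<Rightarrow> real) \<Rightarrow> bool" where
  "poly_moderate_weight w \<longleftrightarrow> Linf_loc w \<and> (\<forall>X. w X > 0) \<and> Linf_loc (\<lambda>X. 1 / w X) \<and>
     (\<exists>M::nat. \<exists>c>0. \<forall>X Y. w (X + Y) \<le> c * (w X * (1 + norm Y) ^ M))"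

definition stft ::
    "(real^'n \<Rightarrow> complex) \<Rightarrow> ((real^'n \<Rightarrow> complex) \<Rightarrow> complex) \<Rightarrow> real^'n \<Rightarrow> real^'n \<Rightarrow> complex" where
  "stft \<phi> u x \<xi> = of_real ((2 * pi) powr (- real CARD('n) / 2)) *
     u (\<lambda>y. cnj (\<phi> (y - x)) * exp (- (\<i> * of_real (y \<bullet> \<xi>))))"

definition modulation_enorm ::
    "(real^'n \<Rightarrow> complex) \<Rightarrow> ennreal \<Rightarrow> ennreal \<Rightarrow> ((real^'n) \<times> (real^'n) \<Rightarrow> real)
      \<Rightarrow> ((real^'n \<Rightarrow> complex) \<Rightarrow> complex) \<Rightarrow> ennreal" where
  "modulation_enorm \<phi> p q w u =
     Lp_enorm q lebesgue (\<lambda>\<xi>. Lp_enorm p lebesgue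
       (\<lambda>x. ennreal (cmod (stft \<phi> u x \<xi> * of_real (w (x, \<xi>))))))"

definition growth_bound :: "real \<Rightarrow> real \<Rightarrow> nat \<Rightarrow> real" where
  "growth_bound \<sigma> r N =
     2 ^ N * r powr (real N / ln (real N * \<sigma>)) *
     (2 * real N * \<sigma> / ln (real N * \<sigma>)) powr (real N * (1 - 1 / ln (real N * \<sigma>)))"

end

theory Submission
  imports Defs "HOL-Complex_Analysis.Cauchy_Integral_Formula" "HOL-Real_Asymp.Real_Asymp"
    "HOL-Probability.Characteristic_Functions" "HOL-Probability.Sinc_Integral"
begin

text \<open>
  Since \<open>H\<^sup>N h\<^sub>\<alpha> = (2|\<alpha>| + d)\<^sup>N h\<^sub>\<alpha>\<close>, the theorem compares \<open>\<lambda>\<^sup>N |c\<^sub>\<alpha>|\<close>, \<open>\<lambda> = 2|\<alpha>| + d\<close>, with the growth function on the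
  right-hand side of (3) and (4). All norms involved agree with a weighted supremum of the Hermite
  coefficients up to a polynomial factor in \<open>|\<alpha>|\<close>, and such factors, like the ones coming from \<open>\<ell>\<^sup>q\<close>, are
  absorbed by changing \<open>r\<close>. One direction uses that \<open>h\<^sub>\<alpha>\<close> and its short-time Fourier transform have seminorms
  polynomial in \<open>|\<alpha>|\<close>. In the other direction a coefficient is bounded by the Lebesgue norm through duality;
  for quasi-Banach modulation norms, STFT inversion dominates \<open>F = |V\<^sub>\<phi> f|\<close> by its average against a rapidly
  decreasing kernel, and a self-improving estimate turns this into a pointwise bound by a weighted \<open>L\<^sup>s\<close>
  norm with \<open>s\<close> small. What remains is one-variable: with \<open>\<tau> = |\<alpha>| + d / 2\<close>, Stirling's bounds give
  \<open>\<alpha>! \<approx> exp (\<tau> ln \<tau>)\<close> up to factors \<open>C\<^sup>\<tau>\<close>, and optimizing \<open>(2\<tau>)\<^sup>N exp (- \<tau> ln \<tau> / (2\<sigma>))\<close> over \<open>\<tau>\<close>, respectively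
  over \<open>N\<close>, reproduces the growth function.
\<close>


section \<open>Calculus of smooth functions\<close>

text \<open>The constants in (3) and (4) may not depend on N, although infinitely many functions
  \<open>H^N f\<close> are involved. Each comparison of a norm with the coefficients is therefore
  stated for all functions (or distributions) and all bounds at once, with constants fixed
  beforehand, and is applied to every N. The same uniformity in \<alpha> and in phase space is why
  Schwartz seminorms are treated along indexed families with polynomial bounds. Nothing is known
  about the growth of f: as a distribution it is tied to its values only through compactly supported
  test functions, and its Hermite series converges only after pairing. Pointwise bounds on
  \<open>H^N f\<close> are recovered by testing, and even measurability of the short-time Fourier
  transform is read off the Hermite series. The coefficient bound with parameter r is the hub. Every
  other condition is linked to it by two implications that replace r by \<kappa> r^e with \<kappa>,
  e > 0 independent of r. Such a map is onto the positive reals, so the same implications serve both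
  "for some r" and "for every r".\<close>

lemma pderivative_eqI: "(f has_derivative f') (at x) \<Longrightarrow> pderivative i f x = f' (axis i 1)"
  by (simp add: pderivative_def frechet_derivative_at[symmetric])

lemma pderivative_add:
  assumes "\<And>x. f differentiable (at x)" "\<And>x. g differentiable (at x)"
  shows "pderivative i (\<lambda>x. f x + g x) = (\<lambda>x. pderivative i f x + pderivative i g x)"
proof
  fix x
  obtain f' g' where *: "(f has_derivative f') (at x)" "(g has_derivative g') (at x)"
    using assms unfolding differentiable_def by blast
  show "pderivative i (\<lambda>x. f x + g x) x = pderivative i f x + pderivative i g x"
    using pderivative_eqI[OF has_derivative_add[OF *]] *[THEN pderivative_eqI] by simp
qed

lemma pderivative_mult:
  fixes f g :: "real^'n \<Rightarrow> 'b::real_normed_field"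
  assumes "\<And>x. f differentiable (at x)" "\<And>x. g differentiable (at x)"
  shows "pderivative i (\<lambda>x. f x * g x) = (\<lambda>x. f x * pderivative i g x + pderivative i f x * g x)"
proof
  fix x
  obtain f' g' where *: "(f has_derivative f') (at x)" "(g has_derivative g') (at x)"
    using assms unfolding differentiable_def by blast
  show "pderivative i (\<lambda>x. f x * g x) x = f x * pderivative i g x + pderivative i f x * g x"
    using pderivative_eqI[OF has_derivative_mult[OF *]] *[THEN pderivative_eqI] by simp
qed

lemma pderivative_const: "pderivative i (\<lambda>_. c) = (\<lambda>_. 0)"
  by (rule ext, rule pderivative_eqI[of _ "\<lambda>_. 0", simplified]) auto

lemma pderivative_bounded_linear:
  assumes "bounded_linear L" "\<And>x. f differentiable (at x)"
  shows "pderivative i (\<lambda>x. L (f x)) = (\<lambda>x. L (pderivative i f x))"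
proof
  fix x
  obtain f' where *: "(f has_derivative f') (at x)"
    using assms unfolding differentiable_def by blast
  show "pderivative i (\<lambda>x. L (f x)) x = L (pderivative i f x)"
    using pderivative_eqI[OF bounded_linear.has_derivative[OF assms(1) *]] *[THEN pderivative_eqI]
    by simp
qed

lemma pderivative_affine:
  assumes "\<And>x. f differentiable (at x)"
  shows "pderivative i (\<lambda>x. f (a + c *\<^sub>R x)) = (\<lambda>x. c *\<^sub>R pderivative i f (a + c *\<^sub>R x))"
proof
  fix x
  obtain f' where *: "(f has_derivative f') (at (a + c *\<^sub>R x))"
    using assms unfolding differentiable_def by blast
  have "((\<lambda>x. f (a + c *\<^sub>R x)) has_derivative (\<lambda>h. f' (c *\<^sub>R h))) (at x)"
    by (rule has_derivative_compose[of "\<lambda>x. a + c *\<^sub>R x" "\<lambda>h. c *\<^sub>R h" x UNIV f f'])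
       (use * in \<open>auto intro!: derivative_eq_intros\<close>)
  then show "pderivative i (\<lambda>x. f (a + c *\<^sub>R x)) x = c *\<^sub>R pderivative i f (a + c *\<^sub>R x)"
    using *[THEN pderivative_eqI] pderivative_eqI linear_scale[OF has_derivative_linear[OF *]]
    by metis
qed

lemma iter_Nil [simp]: "iter_pderivative [] f = f"
  and iter_Cons: "iter_pderivative (i # js) f = pderivative i (iter_pderivative js f)"
  and iter_snoc: "iter_pderivative (js @ [i]) f = iter_pderivative js (pderivative i f)"
  by (simp_all add: iter_pderivative_def)

lemma iter_append: "iter_pderivative (is @ js) f = iter_pderivative is (iter_pderivative js f)"
  by (simp add: iter_pderivative_def)

lemma smooth_differentiable: "smooth f \<Longrightarrow> f differentiable (at x)"
  using smooth_def[of f] iter_Nil by metis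

lemma smooth_iter: "smooth f \<Longrightarrow> smooth (iter_pderivative js f)"
  unfolding smooth_def by (metis iter_append)

lemma smooth_pderivative: "smooth f \<Longrightarrow> smooth (pderivative i f)"
  using smooth_iter[of f "[i]"] by (simp add: iter_Cons)

lemma smooth_continuous: "smooth f \<Longrightarrow> continuous_on S f"
  using smooth_differentiable differentiable_imp_continuous_within
  by (metis continuous_at_imp_continuous_on)

lemma smooth_coinduct:
  assumes "f \<in> S" "\<And>g x. g \<in> S \<Longrightarrow> g differentiable (at x)" "\<And>g i. g \<in> S \<Longrightarrow> pderivative i g \<in> S"
  shows "smooth f"
proof -
  have "iter_pderivative js f \<in> S" for js
    by (induction js) (auto simp: iter_Cons assms)
  with assms(2) show ?thesis unfolding smooth_def by blast
qed

text \<open>By Leibniz' rule it suffices that the partial derivatives of the generators lie in the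
  generated algebra: then the whole algebra is stable under differentiation. This yields smoothness
  of the bump and of the Hermite functions without a formula for their higher derivatives.\<close>

inductive_set alg :: "(real^'n \<Rightarrow> 'b::real_normed_field) set \<Rightarrow> (real^'n \<Rightarrow> 'b) set" for G where
  gen: "g \<in> G \<Longrightarrow> g \<in> alg G"
| const: "(\<lambda>_. c) \<in> alg G"
| add: "f \<in> alg G \<Longrightarrow> g \<in> alg G \<Longrightarrow> (\<lambda>x. f x + g x) \<in> alg G"
| mult: "f \<in> alg G \<Longrightarrow> g \<in> alg G \<Longrightarrow> (\<lambda>x. f x * g x) \<in> alg G"

lemma alg_smooth:
  assumes G: "\<And>g x. g \<in> G \<Longrightarrow> g differentiable (at x)" "\<And>g i. g \<in> G \<Longrightarrow> pderivative i g \<in> alg G"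
    and "f \<in> alg G"
  shows "smooth f"
proof -
  have *: "(\<forall>x. g differentiable (at x)) \<and> (\<forall>i. pderivative i g \<in> alg G)" if "g \<in> alg G" for g
    using that
  proof induction
    case (mult f g)
    then show ?case
      by (simp add: pderivative_mult alg.add alg.mult)
  next
    case (add f g)
    then show ?case
      by (simp add: pderivative_add alg.add)
  qed (auto simp: G pderivative_const intro: alg.const)
  show ?thesis using smooth_coinduct[OF \<open>f \<in> alg G\<close>] * by blast
qed

lemma alg_smooth_smooth: "f \<in> alg (Collect smooth) \<Longrightarrow> smooth f"
  by (rule alg_smooth[of "Collect smooth"])
     (simp_all add: smooth_differentiable alg.gen smooth_pderivative)

lemma smooth_const: "smooth (\<lambda>_. c :: 'b::real_normed_field)"
  by (rule alg_smooth_smooth, rule alg.const)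

lemma smooth_add:
  fixes f g :: "real^'n \<Rightarrow> 'b::real_normed_field"
  shows "smooth f \<Longrightarrow> smooth g \<Longrightarrow> smooth (\<lambda>x. f x + g x)"
  by (rule alg_smooth_smooth, rule alg.add) (simp_all add: alg.gen)

lemma smooth_mult:
  fixes f g :: "real^'n \<Rightarrow> 'b::real_normed_field"
  shows "smooth f \<Longrightarrow> smooth g \<Longrightarrow> smooth (\<lambda>x. f x * g x)"
  by (rule alg_smooth_smooth, rule alg.mult) (simp_all add: alg.gen)

lemma iter_add:
  assumes "smooth f" "smooth g"
  shows "iter_pderivative js (\<lambda>x. f x + g x) = (\<lambda>x. iter_pderivative js f x + iter_pderivative js g x)"
  by (induction js) (auto simp: iter_Cons assms pderivative_add smooth_iter smooth_differentiable)

lemma iter_bounded_linear: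
  assumes "bounded_linear L" "smooth f"
  shows "iter_pderivative js (\<lambda>x. L (f x)) = (\<lambda>x. L (iter_pderivative js f x))"
  by (induction js) (auto simp: iter_Cons assms pderivative_bounded_linear smooth_iter smooth_differentiable)

lemma smooth_bounded_linear:
  assumes "bounded_linear L" "smooth f"
  shows "smooth (\<lambda>x. L (f x))"
  unfolding smooth_def iter_bounded_linear[OF assms]
  using smooth_differentiable[OF smooth_iter[OF assms(2)]] bounded_linear.has_derivative[OF assms(1)]
  unfolding differentiable_def by blast

lemma iter_affine:
  assumes "smooth f"
  shows "iter_pderivative js (\<lambda>x. f (a + c *\<^sub>R x)) = (\<lambda>x. c ^ length js *\<^sub>R iter_pderivative js f (a + c *\<^sub>R x))"
proof (induction js)
  case (Cons i js)
  have d: "iter_pderivative js f differentiable (at x)" for x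
    using assms by (auto simp: smooth_def)
  have d': "(\<lambda>x. iter_pderivative js f (a + c *\<^sub>R x)) differentiable (at x)" for x
    by (rule differentiable_compose[OF d]) (auto intro!: derivative_intros)
  show ?case
    unfolding iter_Cons Cons.IH
    using pderivative_bounded_linear[OF bounded_linear_scaleR_right d', of i "c ^ length js"]
      pderivative_affine[OF d, of i a c] by (simp add: mult.commute)
qed simp

lemma smooth_affine:
  assumes "smooth f"
  shows "smooth (\<lambda>x. f (a + c *\<^sub>R x))"
  unfolding smooth_def iter_affine[OF assms]
proof (intro allI)
  fix js and x :: "real^'a"
  have d: "iter_pderivative js f differentiable (at x)" for x
    using assms by (auto simp: smooth_def)
  show "(\<lambda>x. c ^ length js *\<^sub>R iter_pderivative js f (a + c *\<^sub>R x)) differentiable at x"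
    by (intro differentiable_scaleR differentiable_compose[OF d]) (auto intro!: derivative_intros)
qed

lemma smooth_sum:
  fixes f :: "'i \<Rightarrow> real^'n \<Rightarrow> 'b::real_normed_field"
  assumes "\<And>i. i \<in> I \<Longrightarrow> smooth (f i)"
  shows "smooth (\<lambda>x. \<Sum>i\<in>I. f i x)"
  using assms by (induction I rule: infinite_finite_induct) (auto intro!: smooth_add smooth_const)

lemma smooth_cmult: "smooth f \<Longrightarrow> smooth (\<lambda>x. c * f x :: 'b::real_normed_field)"
  by (intro smooth_mult smooth_const)

lemma smooth_cnj: "smooth f \<Longrightarrow> smooth (\<lambda>x. cnj (f x))"
  by (rule smooth_bounded_linear[OF bounded_linear_cnj])

lemma iter_cmult:
  "smooth f \<Longrightarrow> iter_pderivative js (\<lambda>x. c * f x) = (\<lambda>x. c * iter_pderivative js f x :: 'b::real_normed_field)"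
  by (rule iter_bounded_linear[OF bounded_linear_mult_right])

lemma iter_cnj: "smooth f \<Longrightarrow> iter_pderivative js (\<lambda>x. cnj (f x)) = (\<lambda>x. cnj (iter_pderivative js f x))"
  by (rule iter_bounded_linear[OF bounded_linear_cnj])

lemma has_derivative_coord: "((\<lambda>x. of_real (x $ i) :: 'b::real_normed_field) has_derivative (\<lambda>h. of_real (h $ i))) (at x)"
  by (auto intro!: derivative_eq_intros bounded_linear.has_derivative[OF bounded_linear_vec_nth])

lemma smooth_coord: "smooth (\<lambda>x::real^'n. of_real (x $ i) :: 'b::real_normed_field)"
proof (rule alg_smooth[of "{\<lambda>x. of_real (x $ i)}"])
  show "pderivative j g \<in> alg {\<lambda>x. of_real (x $ i)}" if "g \<in> {\<lambda>x. of_real (x $ i)}"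
    for j and g :: "real^'n \<Rightarrow> 'b"
  proof -
    have "pderivative j g = (\<lambda>_. of_real (axis j 1 $ i))"
      using that by (auto intro!: ext pderivative_eqI[OF has_derivative_coord])
    then show ?thesis by (simp add: alg.const)
  qed
qed (use has_derivative_coord in \<open>auto simp: differentiable_def intro!: alg.gen\<close>)

lemma pderivative_coord:
  "pderivative j (\<lambda>x::real^'n. of_real (x $ i) :: 'b::real_normed_field) = (\<lambda>_. if j = i then 1 else 0)"
  by (auto intro!: ext simp: pderivative_eqI[OF has_derivative_coord] axis_def)

lemma norm_sq_coords: "(norm (x::real^'n))\<^sup>2 = (\<Sum>i\<in>UNIV. (x $ i)\<^sup>2)"
  by (simp add: norm_vec_def L2_set_def sum_nonneg)

lemma smooth_norm_sq: "smooth (\<lambda>x::real^'n. of_real ((norm x)\<^sup>2) :: 'b::real_normed_field)"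
  unfolding norm_sq_coords unfolding of_real_sum power2_eq_square of_real_mult
  by (intro smooth_sum smooth_mult smooth_coord)

lemma smooth_laplacian: "smooth f \<Longrightarrow> smooth (laplacian f :: real^'n \<Rightarrow> complex)"
  unfolding laplacian_def[abs_def] by (intro smooth_sum smooth_pderivative)

lemma smooth_harmonic_osc:
  assumes "smooth f" shows "smooth (harmonic_osc f)"
proof -
  have "smooth (\<lambda>x. of_real ((norm x)\<^sup>2) * f x + (-1) * laplacian f x)"
    by (intro smooth_add smooth_mult smooth_cmult smooth_norm_sq smooth_laplacian assms)
  then show ?thesis
    by (simp add: harmonic_osc_def[abs_def])
qed

subsection \<open>Bump functions\<close>

text \<open>\<open>flat 0\<close> is the classical smooth function that is not analytic at 0. The
  powers of 1 / t are included because they make the family stable under differentiation, up to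
  linear combinations.\<close>

definition flat :: "nat \<Rightarrow> real \<Rightarrow> real" where
  "flat k t = (if t > 0 then inverse t ^ k * exp (- inverse t) else 0)"

lemma flat_deriv: "(flat k has_real_derivative (flat (k + 2) t - real k * flat (k + 1) t)) (at t)"
proof -
  consider "t > 0" | "t < 0" | "t = 0" by linarith
  then show ?thesis
  proof cases
    case 1
    have "((\<lambda>t. inverse t ^ k * exp (- inverse t)) has_real_derivative
       (real k * inverse t ^ (k - 1) * (- (inverse t ^ 2)) * exp (- inverse t)
        + inverse t ^ k * (exp (- inverse t) * inverse t ^ 2))) (at t)"
      using 1 by (auto intro!: derivative_eq_intros simp: power2_eq_square)
    also have "(real k * inverse t ^ (k - 1) * (- (inverse t ^ 2)) * exp (- inverse t)
        + inverse t ^ k * (exp (- inverse t) * inverse t ^ 2)) = flat (k + 2) t - real k * flat (k + 1) t"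
      using 1 by (cases k) (auto simp: flat_def power2_eq_square algebra_simps)
    finally show ?thesis
      by (rule has_field_derivative_transform_within_open[of _ _ _ "{0<..}"]) (use 1 in \<open>auto simp: flat_def\<close>)
  next
    case 2
    have "((\<lambda>t::real. 0::real) has_real_derivative 0) (at t)" by simp
    then have "(flat k has_real_derivative 0) (at t)"
      by (rule has_field_derivative_transform_within_open[of _ _ _ "{..<0}"]) (use 2 in \<open>auto simp: flat_def\<close>)
    then show ?thesis using 2 by (simp add: flat_def)
  next
    case 3
    have r: "((\<lambda>h. flat k h / h) \<longlongrightarrow> 0) (at_right 0)"
    proof (rule Lim_transform_eventually)
      show "((\<lambda>h::real. inverse h ^ k * exp (- inverse h) / h) \<longlongrightarrow> 0) (at_right 0)"
        by real_asymp
      show "\<forall>\<^sub>F h in at_right 0. inverse h ^ k * exp (- inverse h) / h = flat k h / h"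
        by (auto simp: eventually_at_right_field flat_def intro!: exI[of _ 1])
    qed
    have l: "((\<lambda>h. flat k h / h) \<longlongrightarrow> 0) (at_left 0)"
    proof (rule Lim_transform_eventually)
      show "((\<lambda>h::real. 0::real) \<longlongrightarrow> 0) (at_left 0)" by simp
      show "\<forall>\<^sub>F h in at_left 0. 0 = flat k h / h"
        by (auto simp: eventually_at_left_field flat_def intro!: exI[of _ "-1"])
    qed
    from l r have "((\<lambda>h. flat k h / h) \<longlongrightarrow> 0) (at 0)"
      by (simp add: filterlim_split_at)
    then show ?thesis
      using 3 by (simp add: DERIV_def flat_def)
  qed
qed

text \<open>The factor e normalizes the value at the origin to 1.\<close>

definition bump :: "real^'n \<Rightarrow> complex" where
  "bump x = of_real (exp 1 * flat 0 (1 - (norm x)\<^sup>2))"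

text \<open>Differentiating \<open>flat k (1 - |x|^2)\<close> gives products of coordinates with
  functions of the same kind for larger k, so these functions and the coordinates generate an
  algebra that is stable under differentiation.\<close>

lemma smooth_bump: "smooth (bump :: real^'n \<Rightarrow> complex)"
proof -
  define r :: "nat \<Rightarrow> real^'n \<Rightarrow> complex" where "r = (\<lambda>k x. of_real (flat k (1 - (norm x)\<^sup>2)))"
  define c :: "'n \<Rightarrow> real^'n \<Rightarrow> complex" where "c = (\<lambda>i x. of_real (x $ i))"
  let ?G = "range r \<union> range c"
  have dr: "(r k has_derivative (\<lambda>h. of_real ((flat (k+2) (1 - (norm x)\<^sup>2) - real k * flat (k+1) (1 - (norm x)\<^sup>2))
       * (- 2 * (x \<bullet> h))))) (at x)" for k x
  proof -
    have "((\<lambda>x::real^'n. 1 - x \<bullet> x) has_derivative (\<lambda>h. - 2 * (x \<bullet> h))) (at x)"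
      by (auto intro!: derivative_eq_intros simp: inner_commute)
    from DERIV_compose_FDERIV[OF flat_deriv this, of k]
    have "((\<lambda>x. flat k (1 - x \<bullet> x)) has_derivative (\<lambda>h. (- 2 * (x \<bullet> h)) *
       (flat (k+2) (1 - x \<bullet> x) - real k * flat (k+1) (1 - x \<bullet> x)))) (at x)" by simp
    from has_derivative_of_real[OF this, where 'a=complex] show ?thesis
      by (simp add: r_def power2_norm_eq_inner mult_ac)
  qed
  have pr: "pderivative i (r k) = (\<lambda>x. (r (k+2) x + (- of_nat k) * r (k+1) x) * ((-2) * c i x))" for i k
    by (rule ext, subst pderivative_eqI[OF dr]) (simp add: r_def c_def inner_axis)
  have "r 0 \<in> alg ?G" by (intro alg.gen) auto
  then have "smooth (r 0)"
  proof (rule alg_smooth[rotated 2])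
    fix g x i assume g: "g \<in> ?G"
    show "g differentiable at x"
      using g dr[THEN differentiableI] has_derivative_coord[where 'b=complex, THEN differentiableI]
      by (auto simp only: c_def)
    have "pderivative i (c j) \<in> alg ?G" for i j
      unfolding c_def pderivative_coord by (rule alg.const)
    moreover have "pderivative i (r k) \<in> alg ?G" for i k
      unfolding pr by (intro alg.mult alg.add alg.const alg.gen) auto
    ultimately show "pderivative i g \<in> alg ?G" using g by auto
  qed
  then have "smooth (\<lambda>x. of_real (exp 1) * r 0 x)" by (rule smooth_cmult)
  then show ?thesis by (simp add: bump_def[abs_def] r_def)
qed

lemma bump_zero: "bump 0 = 1"
  by (simp add: bump_def flat_def mult_exp_exp of_real_mult[symmetric] del: of_real_mult)

lemma bump_nonneg: "bump x = of_real (cmod (bump x))"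
  by (simp add: bump_def flat_def norm_mult del: of_real_mult)

lemma bump_outside: "norm x \<ge> 1 \<Longrightarrow> bump x = 0"
  using power_mono[of 1 "norm x" 2] by (simp add: bump_def flat_def del: one_le_power)

text \<open>Needed to bound n (1 - bump (x / n)) by a polynomial in x uniformly in n, a quantitative
  form of the density of test functions. For |x|^2 >= 1/2 it follows from 0 <= bump <= 1, otherwise
  from exp y >= 1 + y.\<close>

lemma one_minus_bump: "cmod (1 - bump x) \<le> 2 * (norm x)\<^sup>2"
proof -
  define s where "s = (norm x)\<^sup>2"
  have s: "s \<ge> 0" by (simp add: s_def)
  define b where "b = exp 1 * flat 0 (1 - s)"
  have "1 - bump x = of_real (1 - b)" by (simp add: bump_def b_def s_def)
  then have eq: "cmod (1 - bump x) = \<bar>1 - b\<bar>" by (metis norm_of_real)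
  have b1: "0 \<le> b" by (simp add: b_def flat_def)
  have b2: "b \<le> 1"
  proof (cases "s < 1")
    case True
    have "1 \<le> inverse (1 - s)" using True s by (simp add: one_le_inverse)
    then have "exp 1 * exp (- inverse (1 - s)) \<le> exp (0::real)"
      unfolding mult_exp_exp exp_le_cancel_iff by simp
    with True show ?thesis by (simp add: b_def flat_def)
  qed (simp add: b_def flat_def)
  show ?thesis
  proof (cases "s \<ge> 1/2")
    case True
    then show ?thesis unfolding eq s_def[symmetric] using b1 b2 by linarith
  next
    case False
    then have "1 - s > 0" by simp
    then have bs: "b = exp (1 - inverse (1 - s))"
      unfolding b_def flat_def by (simp only: if_True power_0 mult_1 mult_exp_exp) simp
    have "1 - inverse (1 - s) \<ge> - 2 * s"
    proof -
      have "inverse (1 - s) \<le> 1 + 2 * s"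
      proof -
        have "1 \<le> (1 + 2 * s) * (1 - s)"
        proof -
          have "s * (2 * s) \<le> s * 1" by (rule mult_left_mono) (use False s in auto)
          then show ?thesis by (simp add: algebra_simps)
        qed
        then show ?thesis using False by (simp add: field_simps)
      qed
      then show ?thesis by simp
    qed
    then have "1 - b \<le> 2 * s" using exp_ge_add_one_self[of "1 - inverse (1 - s)"] bs by linarith
    then show ?thesis unfolding eq s_def[symmetric] using b2 by linarith
  qed
qed

subsection \<open>Test functions\<close>

lemma iter_outside_support:
  assumes "x \<notin> closure {x. f x \<noteq> 0}"
  shows "iter_pderivative js f x = (0::'b::real_normed_vector)"
  using assms
proof (induction js arbitrary: x)
  case Nil
  then have "x \<notin> {x. f x \<noteq> 0}" by (meson closure_subset in_mono)
  then show ?case by simp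
next
  case (Cons i js)
  have "((\<lambda>_. 0 :: 'b) has_derivative (\<lambda>_. 0)) (at x)" by simp
  then have "(iter_pderivative js f has_derivative (\<lambda>_. 0)) (at x)"
    by (rule has_derivative_transform_within_open[of _ _ _ _ "- closure {x. f x \<noteq> 0}"])
       (use Cons in auto)
  from pderivative_eqI[OF this] show ?case by (simp add: iter_Cons)
qed

lemma test_function_schwartz:
  assumes "\<phi> \<in> test_function" shows "\<phi> \<in> schwartz"
proof -
  have sm: "smooth \<phi>" and co: "compact (closure {x. \<phi> x \<noteq> 0})" using assms by (auto simp: test_function_def)
  have "bounded (range (\<lambda>x. (1 + norm x) ^ k * cmod (iter_pderivative js \<phi> x)))" for k js
  proof -
    let ?h = "\<lambda>x. (1 + norm x) ^ k * cmod (iter_pderivative js \<phi> x)"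
    have "continuous_on (closure {x. \<phi> x \<noteq> 0}) ?h"
      by (intro continuous_intros smooth_continuous smooth_iter sm)
    then have "compact (?h ` closure {x. \<phi> x \<noteq> 0})" using co by (rule compact_continuous_image)
    then have "bounded (insert 0 (?h ` closure {x. \<phi> x \<noteq> 0}))" using compact_imp_bounded by simp
    moreover have "range ?h \<subseteq> insert 0 (?h ` closure {x. \<phi> x \<noteq> 0})"
    proof safe
      fix x assume "?h x \<notin> ?h ` closure {x. \<phi> x \<noteq> 0}"
      then have "x \<notin> closure {x. \<phi> x \<noteq> 0}" by blast
      then show "?h x = 0" by (simp add: iter_outside_support)
    qed
    ultimately show ?thesis using bounded_subset by blast
  qed
  with sm show ?thesis by (auto simp: schwartz_def)
qed

lemma test_functionI:
  assumes "smooth \<phi>" "\<And>x. norm x > R \<Longrightarrow> \<phi> x = 0" shows "\<phi> \<in> test_function"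
proof -
  have "closure {x. \<phi> x \<noteq> 0} \<subseteq> cball 0 R"
    by (rule closure_minimal) (use assms(2) not_le in \<open>auto, blast\<close>)
  then have "compact (closure {x. \<phi> x \<noteq> 0})"
    by (meson bounded_cball bounded_closed_imp_seq_compact bounded_subset closed_closure compact_eq_seq_compact_metric)
  with assms(1) show ?thesis by (simp add: test_function_def)
qed

lemma test_function_mult:
  assumes "smooth f" "\<phi> \<in> test_function" shows "(\<lambda>x. f x * \<phi> x) \<in> test_function"
proof -
  have "bounded (closure {x. \<phi> x \<noteq> 0})" using assms(2) by (auto simp: test_function_def compact_imp_bounded)
  then obtain R where R: "\<And>x. x \<in> closure {x. \<phi> x \<noteq> 0} \<Longrightarrow> norm x \<le> R" by (auto simp: bounded_iff)
  show ?thesis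
    by (rule test_functionI[of _ R])
       (use assms R closure_subset[of "{x. \<phi> x \<noteq> 0}"] in \<open>force simp: test_function_def intro: smooth_mult\<close>)+
qed

lemma test_function_pderivative:
  assumes "\<phi> \<in> test_function" shows "pderivative i \<phi> \<in> test_function"
proof -
  have "bounded (closure {x. \<phi> x \<noteq> 0})" using assms by (auto simp: test_function_def compact_imp_bounded)
  then obtain R where R: "\<And>x. x \<in> closure {x. \<phi> x \<noteq> 0} \<Longrightarrow> norm x \<le> R" by (auto simp: bounded_iff)
  have "smooth \<phi>" using assms by (auto simp: test_function_def)
  moreover have "pderivative i \<phi> x = 0" if "norm x > R" for x
    using iter_outside_support[of x \<phi> "[i]"] R[of x] that by (force simp: iter_Cons)
  ultimately show ?thesis
    by (intro test_functionI[of _ R] smooth_pderivative)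
qed

lemma bump_affine_test:
  fixes a :: "real^'n"
  assumes "c \<noteq> 0" shows "(\<lambda>x. bump (a + c *\<^sub>R x)) \<in> test_function"
proof (rule test_functionI)
  show "smooth (\<lambda>x. bump (a + c *\<^sub>R x))" by (intro smooth_affine smooth_bump)
  fix x :: "real^'n" assume "norm x > (1 + norm a) / \<bar>c\<bar>"
  then have "\<bar>c\<bar> * norm x > 1 + norm a" using assms by (simp add: field_simps)
  then have "norm (c *\<^sub>R x) > 1 + norm a" by simp
  then have "norm (a + c *\<^sub>R x) \<ge> 1" using norm_triangle_ineq2[of "c *\<^sub>R x" "- a"] by (simp add: add.commute)
  then show "bump (a + c *\<^sub>R x) = 0" by (rule bump_outside)
qed

section \<open>Families of Schwartz functions with polynomially growing seminorms\<close>

text \<open>C and m are chosen before the index. The index type is left free so that a parameter and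
  a space variable can be bounded jointly.\<close>

definition polyb :: "('i \<Rightarrow> real) \<Rightarrow> ('i \<Rightarrow> 'b::real_normed_vector) \<Rightarrow> bool" where
  "polyb P f \<longleftrightarrow> (\<exists>C m. \<forall>i. norm (f i) \<le> C * P i ^ m)"

lemma polybI: "(\<And>i. norm (f i) \<le> C * P i ^ m) \<Longrightarrow> polyb P f"
  unfolding polyb_def by blast

text \<open>Because P >= 1 the exponent may be raised at will, so that several bounds can be brought
  to a common exponent.\<close>

lemma polybE:
  assumes "polyb P f" "\<And>i. P i \<ge> 1"
  obtains C m where "C > 0" "\<And>i m'. m' \<ge> m \<Longrightarrow> norm (f i) \<le> C * P i ^ m'"
proof -
  obtain C m where *: "\<And>i. norm (f i) \<le> C * P i ^ m" using assms(1) unfolding polyb_def by blast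
  have "norm (f i) \<le> (\<bar>C\<bar> + 1) * P i ^ m'" if "m' \<ge> m" for i m'
  proof -
    have "C * P i ^ m \<le> (\<bar>C\<bar> + 1) * P i ^ m'"
      using assms(2)[of i] that by (intro mult_mono power_increasing) auto
    with *[of i] show ?thesis by linarith
  qed
  then show ?thesis using that[of "\<bar>C\<bar> + 1" m] by auto
qed

lemma polyb_mono:
  assumes "polyb P g" "\<And>i. norm (f i) \<le> norm (g i)" shows "polyb P f"
  using assms unfolding polyb_def by (meson order_trans)

lemma polyb_weaken:
  assumes "polyb P f" "\<And>i. P i \<ge> 1" "\<And>i. P i \<le> Q i" shows "polyb Q f"
proof -
  obtain C m where C: "C > 0" "\<And>i m'. m' \<ge> m \<Longrightarrow> norm (f i) \<le> C * P i ^ m'"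
    using polybE[OF assms(1,2)] by blast
  show ?thesis
  proof (rule polybI[of _ C _ m])
    fix i
    have "C * P i ^ m \<le> C * Q i ^ m"
      using C assms(2)[of i] assms(3)[of i] by (intro mult_left_mono power_mono) auto
    with C(2)[of m i] show "norm (f i) \<le> C * Q i ^ m" by simp
  qed
qed

lemma polyb_const: "(\<And>i. P i \<ge> 1) \<Longrightarrow> polyb P (\<lambda>_. c)"
  by (rule polybI[of _ "norm c" _ 0]) simp

lemma polyb_add:
  assumes "polyb P f" "polyb P g" "\<And>i. P i \<ge> 1" shows "polyb P (\<lambda>i. f i + g i)"
proof -
  obtain C m where C: "C > 0" "\<And>i m'. m' \<ge> m \<Longrightarrow> norm (f i) \<le> C * P i ^ m'"
    using polybE[OF assms(1,3)] by blast
  obtain D n where D: "D > 0" "\<And>i m'. m' \<ge> n \<Longrightarrow> norm (g i) \<le> D * P i ^ m'"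
    using polybE[OF assms(2,3)] by blast
  show ?thesis
  proof (rule polybI[of _ "C + D" _ "m + n"])
    show "norm (f i + g i) \<le> (C + D) * P i ^ (m + n)" for i
      using C(2)[of "m+n" i] D(2)[of "m+n" i] norm_triangle_ineq[of "f i" "g i"]
      by (simp add: distrib_right)
  qed
qed

lemma polyb_mult:
  fixes f g :: "'i \<Rightarrow> 'b::real_normed_algebra"
  assumes "polyb P f" "polyb P g" "\<And>i. P i \<ge> 1" shows "polyb P (\<lambda>i. f i * g i)"
proof -
  obtain C m where C: "C > 0" "\<And>i m'. m' \<ge> m \<Longrightarrow> norm (f i) \<le> C * P i ^ m'"
    using polybE[OF assms(1,3)] by blast
  obtain D n where D: "D > 0" "\<And>i m'. m' \<ge> n \<Longrightarrow> norm (g i) \<le> D * P i ^ m'"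
    using polybE[OF assms(2,3)] by blast
  show ?thesis
  proof (rule polybI[of _ "C * D" _ "m + n"])
    fix i
    have "norm (f i * g i) \<le> norm (f i) * norm (g i)" by (rule norm_mult_ineq)
    also have "\<dots> \<le> (C * P i ^ m) * (D * P i ^ n)"
      using C(1) assms(3)[of i] by (intro mult_mono C(2) D(2)) auto
    finally show "norm (f i * g i) \<le> C * D * P i ^ (m + n)"
      by (simp add: power_add mult_ac)
  qed
qed

lemma polyb_sum:
  assumes "\<And>j. j \<in> J \<Longrightarrow> polyb P (f j)" "\<And>i. P i \<ge> 1" shows "polyb P (\<lambda>i. \<Sum>j\<in>J. f j i)"
  using assms(1) by (induction J rule: infinite_finite_induct) (auto intro!: polyb_add polyb_const assms(2))

lemma polyb_norm: "polyb P (\<lambda>i. norm (f i)) \<longleftrightarrow> polyb P f"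
  by (simp add: polyb_def)

lemma polyb_reindex: "polyb P f \<Longrightarrow> polyb (\<lambda>j. P (s j)) (\<lambda>j. f (s j))"
  unfolding polyb_def by blast

text \<open>The index \<open>\<iota>\<close> will be a multi-index (Hermite functions) or a point of phase space (time-frequency
  shifts); tempered distributions map such families to polynomially bounded ones.\<close>

definition schwf :: "('i \<Rightarrow> real) \<Rightarrow> ('i \<Rightarrow> real^'n \<Rightarrow> complex) \<Rightarrow> bool" where
  "schwf P F \<longleftrightarrow> (\<forall>\<iota>. smooth (F \<iota>)) \<and> (\<forall>k js. polyb (\<lambda>z. P (fst z))
     (\<lambda>z. (1 + norm (snd z)) ^ k * cmod (iter_pderivative js (F (fst z)) (snd z))))"

text \<open>The multipliers of \<open>schwf\<close>: growth in x is now permitted, with an exponent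
  that may depend on the derivative but not on the index. The product weight lets a single power
  control the growth in the index and in x.\<close>

definition modf :: "('i \<Rightarrow> real) \<Rightarrow> ('i \<Rightarrow> real^'n \<Rightarrow> complex) \<Rightarrow> bool" where
  "modf P F \<longleftrightarrow> (\<forall>\<iota>. smooth (F \<iota>)) \<and> (\<forall>js. polyb (\<lambda>z. P (fst z) * (1 + norm (snd z)))
     (\<lambda>z. iter_pderivative js (F (fst z)) (snd z)))"

lemma schwf_smooth: "schwf P F \<Longrightarrow> smooth (F \<iota>)" by (simp add: schwf_def)
lemma modf_smooth: "modf P F \<Longrightarrow> smooth (F \<iota>)" by (simp add: modf_def)

lemma one_le_mult_one_plus_norm: "(1::real) \<le> p \<Longrightarrow> 1 \<le> p * (1 + norm x)"
  using mult_mono[of 1 p 1 "1 + norm x"] by simp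

lemma schwf_weaken:
  assumes "schwf P F" "\<And>i. P i \<ge> 1" "\<And>i. P i \<le> Q i" shows "schwf Q F"
  unfolding schwf_def
proof safe
  fix k js
  show "polyb (\<lambda>z. Q (fst z)) (\<lambda>z. (1 + norm (snd z)) ^ k * cmod (iter_pderivative js (F (fst z)) (snd z)))"
    by (rule polyb_weaken[of "\<lambda>z. P (fst z)"]) (use assms in \<open>simp_all add: schwf_def\<close>)
qed (use assms in \<open>simp add: schwf_def\<close>)

lemma modf_weaken:
  assumes "modf P F" "\<And>i. P i \<ge> 1" "\<And>i. P i \<le> Q i" shows "modf Q F"
  unfolding modf_def
proof safe
  fix js
  show "polyb (\<lambda>z. Q (fst z) * (1 + norm (snd z))) (\<lambda>z. iter_pderivative js (F (fst z)) (snd z))"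
    by (rule polyb_weaken[of "\<lambda>z. P (fst z) * (1 + norm (snd z))"])
      (use assms in \<open>simp_all add: modf_def one_le_mult_one_plus_norm mult_right_mono\<close>)
qed (use assms in \<open>simp add: modf_def\<close>)

lemma schwf_pderivative: "schwf P F \<Longrightarrow> schwf P (\<lambda>\<iota>. pderivative i (F \<iota>))"
  unfolding schwf_def by (auto intro: smooth_pderivative simp: iter_snoc[symmetric])

lemma modf_pderivative: "modf P F \<Longrightarrow> modf P (\<lambda>\<iota>. pderivative i (F \<iota>))"
  unfolding modf_def by (auto intro: smooth_pderivative simp: iter_snoc[symmetric])

lemma schwf_reindex: assumes "schwf P F" shows "schwf (\<lambda>j. P (s j)) (\<lambda>j. F (s j))"
  using assms unfolding schwf_def
proof safe
  fix k js assume "\<forall>k js. polyb (\<lambda>z. P (fst z))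
     (\<lambda>z. (1 + norm (snd z)) ^ k * cmod (iter_pderivative js (F (fst z)) (snd z)))"
  from polyb_reindex[OF this[rule_format, of k js], of "\<lambda>z. (s (fst z), snd z)"]
  show "polyb (\<lambda>z. P (s (fst z))) (\<lambda>z. (1 + norm (snd z)) ^ k * cmod (iter_pderivative js (F (s (fst z))) (snd z)))"
    by simp
qed auto

lemma modf_reindex: assumes "modf P F" shows "modf (\<lambda>j. P (s j)) (\<lambda>j. F (s j))"
  using assms unfolding modf_def
proof safe
  fix js assume "\<forall>js. polyb (\<lambda>z. P (fst z) * (1 + norm (snd z)))
     (\<lambda>z. iter_pderivative js (F (fst z)) (snd z))"
  from polyb_reindex[OF this[rule_format, of js], of "\<lambda>z. (s (fst z), snd z)"]
  show "polyb (\<lambda>z. P (s (fst z)) * (1 + norm (snd z))) (\<lambda>z. iter_pderivative js (F (s (fst z))) (snd z))"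
    by simp
qed auto

lemma schwf_schwartz:
  assumes "schwf P F" shows "F \<iota> \<in> schwartz"
  unfolding schwartz_def
proof safe
  show "smooth (F \<iota>)" using assms by (rule schwf_smooth)
  fix k js
  obtain C m where "\<And>z. norm ((1 + norm (snd z)) ^ k * cmod (iter_pderivative js (F (fst z)) (snd z)))
      \<le> C * P (fst z) ^ m"
    using assms unfolding schwf_def polyb_def by metis
  from this[of "(\<iota>, _)"]
  show "bounded (range (\<lambda>x. (1 + norm x) ^ k * cmod (iter_pderivative js (F \<iota>) x)))"
    unfolding bounded_iff by auto
qed

lemma schwartz_schwf:
  assumes "\<phi> \<in> schwartz" "\<And>i. P i \<ge> 1" shows "schwf P (\<lambda>_. \<phi>)"
  unfolding schwf_def
proof safe
  show "smooth \<phi>" using assms by (simp add: schwartz_def)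
  fix k js
  obtain C where "\<And>x. norm ((1 + norm x) ^ k * cmod (iter_pderivative js \<phi> x)) \<le> C"
    using assms(1) unfolding schwartz_def bounded_iff by blast
  then show "polyb (\<lambda>z. P (fst z)) (\<lambda>z. (1 + norm (snd z)) ^ k * cmod (iter_pderivative js \<phi> (snd z)))"
    by (intro polybI[of _ C _ 0]) auto
qed

lemma schwartz_smooth: "\<phi> \<in> schwartz \<Longrightarrow> smooth \<phi>" by (simp add: schwartz_def)

lemma schwf_add:
  assumes "schwf P F" "schwf P G" "\<And>i. P i \<ge> 1" shows "schwf P (\<lambda>\<iota> x. F \<iota> x + G \<iota> x)"
proof -
  have sm: "smooth (F \<iota>)" "smooth (G \<iota>)" for \<iota> using assms by (auto simp: schwf_def)
  have "polyb (\<lambda>z. P (fst z)) (\<lambda>z. (1 + norm (snd z)) ^ k * cmod (iter_pderivative js (\<lambda>x. F (fst z) x + G (fst z) x) (snd z)))" for k js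
  proof (rule polyb_mono)
    show "polyb (\<lambda>z. P (fst z)) (\<lambda>z. (1 + norm (snd z)) ^ k * cmod (iter_pderivative js (F (fst z)) (snd z))
      + (1 + norm (snd z)) ^ k * cmod (iter_pderivative js (G (fst z)) (snd z)))"
      using assms by (intro polyb_add) (auto simp: schwf_def)
    show "norm ((1 + norm (snd z)) ^ k * cmod (iter_pderivative js (\<lambda>x. F (fst z) x + G (fst z) x) (snd z))) \<le>
      norm ((1 + norm (snd z)) ^ k * cmod (iter_pderivative js (F (fst z)) (snd z))
      + (1 + norm (snd z)) ^ k * cmod (iter_pderivative js (G (fst z)) (snd z)))" for z
      unfolding iter_add[OF sm] distrib_left[symmetric] norm_mult
      by (intro mult_left_mono) (auto intro: norm_triangle_ineq)
  qed
  with sm show ?thesis by (auto simp: schwf_def intro: smooth_add)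
qed

text \<open>Leibniz' rule for the innermost derivative splits the product into two products of the
  same type, so the induction over the list keeps F and G arbitrary. Without derivatives, a
  multiplier of degree m is paid for by the decay of G with weight k + m.\<close>

lemma schwf_mult:
  fixes F G :: "'i \<Rightarrow> real^'n \<Rightarrow> complex"
  assumes "modf P F" "schwf P G" and P: "\<And>i. P i \<ge> 1" shows "schwf P (\<lambda>\<iota> x. F \<iota> x * G \<iota> x)"
proof -
  let ?b = "\<lambda>H k js. polyb (\<lambda>z. P (fst z)) (\<lambda>z. (1 + norm (snd z)) ^ k * cmod (iter_pderivative js (H (fst z)) (snd z)))"
  have "\<forall>k. ?b (\<lambda>\<iota> x. F \<iota> x * G \<iota> x) k js" if "modf P F" "schwf P G" for js and F G :: "'i \<Rightarrow> real^'n \<Rightarrow> complex"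
    using that
  proof (induction js arbitrary: F G rule: rev_induct)
    case Nil
    have P': "P (fst z) * (1 + norm (snd z)) \<ge> 1" for z :: "'i \<times> (real^'n)"
      by (intro one_le_mult_one_plus_norm P)
    have "polyb (\<lambda>z. P (fst z) * (1 + norm (snd z))) (\<lambda>z. iter_pderivative [] (F (fst z)) (snd z))"
      using Nil(1) unfolding modf_def by blast
    then obtain C m where C: "C > 0"
      "\<And>z m'. m' \<ge> m \<Longrightarrow> norm (F (fst z) (snd z)) \<le> C * (P (fst z) * (1 + norm (snd z))) ^ m'"
      using polybE[where P="\<lambda>z. P (fst z) * (1 + norm (snd z))" and f="\<lambda>z. F (fst z) (snd z)", OF _ P']
      unfolding iter_Nil by blast
    show ?case
    proof
      fix k
      have "?b G (k + m) []" using Nil(2) unfolding schwf_def by blast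
      then obtain D n where D: "D > 0" "\<And>z m'. m' \<ge> n \<Longrightarrow> norm ((1 + norm (snd z)) ^ (k+m) * cmod (G (fst z) (snd z))) \<le> D * P (fst z) ^ m'"
        using polybE[of "\<lambda>z. P (fst z)" "\<lambda>z. (1 + norm (snd z)) ^ (k+m) * cmod (G (fst z) (snd z))"] P by auto
      have "norm ((1 + norm (snd z)) ^ k * cmod (F (fst z) (snd z) * G (fst z) (snd z))) \<le> (C * D) * P (fst z) ^ (m + n)" for z
      proof -
        have "norm ((1 + norm (snd z)) ^ k * cmod (F (fst z) (snd z) * G (fst z) (snd z)))
          = cmod (F (fst z) (snd z)) * ((1 + norm (snd z)) ^ k * cmod (G (fst z) (snd z)))"
          by (simp add: norm_mult)
        also have "\<dots> \<le> (C * (P (fst z) * (1 + norm (snd z))) ^ m) * ((1 + norm (snd z)) ^ k * cmod (G (fst z) (snd z)))"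
          by (intro mult_right_mono C(2)) auto
        also have "\<dots> = C * P (fst z) ^ m * norm ((1 + norm (snd z)) ^ (k+m) * cmod (G (fst z) (snd z)))"
          by (simp add: power_mult_distrib power_add)
        also have "\<dots> \<le> C * P (fst z) ^ m * (D * P (fst z) ^ n)"
          using C(1) order_trans[OF zero_le_one P[of "fst z"]] by (intro mult_left_mono D(2)) auto
        finally show ?thesis by (simp add: power_add mult_ac)
      qed
      then show "?b (\<lambda>\<iota> x. F \<iota> x * G \<iota> x) k []" by (intro polybI[of _ "C * D"]) auto
    qed
  next
    case (snoc i js)
    have sm: "smooth (F \<iota>)" "smooth (G \<iota>)" for \<iota> using snoc by (auto simp: modf_def schwf_def)
    have eq: "iter_pderivative (js @ [i]) (\<lambda>x. F \<iota> x * G \<iota> x) =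
       (\<lambda>x. iter_pderivative js (\<lambda>x. F \<iota> x * pderivative i (G \<iota>) x) x
          + iter_pderivative js (\<lambda>x. pderivative i (F \<iota>) x * G \<iota> x) x)" for \<iota>
      unfolding iter_snoc by (simp add: pderivative_mult sm smooth_differentiable iter_add smooth_mult smooth_pderivative)
    show ?case
    proof
      fix k
      have "?b (\<lambda>\<iota> x. F \<iota> x * pderivative i (G \<iota>) x) k js" "?b (\<lambda>\<iota> x. pderivative i (F \<iota>) x * G \<iota> x) k js"
        using snoc by (auto intro!: snoc.IH[rule_format] schwf_pderivative modf_pderivative)
      from polyb_add[OF this P] show "?b (\<lambda>\<iota> x. F \<iota> x * G \<iota> x) k (js @ [i])"
      proof (rule polyb_mono)
        fix z :: "'i \<times> (real^'n)"
        show "norm ((1 + norm (snd z)) ^ k * cmod (iter_pderivative (js @ [i]) (\<lambda>x. F (fst z) x * G (fst z) x) (snd z)))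
          \<le> norm ((1 + norm (snd z)) ^ k * cmod (iter_pderivative js (\<lambda>x. F (fst z) x * pderivative i (G (fst z)) x) (snd z)) +
               (1 + norm (snd z)) ^ k * cmod (iter_pderivative js (\<lambda>x. pderivative i (F (fst z)) x * G (fst z) x) (snd z)))"
          unfolding eq distrib_left[symmetric] norm_mult
          by (intro mult_left_mono) (auto intro: norm_triangle_ineq)
      qed
    qed
  qed
  from this[OF assms(1,2)] show ?thesis
    unfolding schwf_def using assms(1,2) by (simp add: schwf_smooth modf_smooth smooth_mult)
qed

lemma schwf_modf:
  assumes "schwf P F" "\<And>i. P i \<ge> 1" shows "modf P F"
proof -
  have "polyb (\<lambda>z. P (fst z) * (1 + norm (snd z))) (\<lambda>z. iter_pderivative js (F (fst z)) (snd z))" for js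
  proof -
    have "polyb (\<lambda>z. P (fst z)) (\<lambda>z. (1 + norm (snd z)) ^ 0 * cmod (iter_pderivative js (F (fst z)) (snd z)))"
      using assms(1) unfolding schwf_def by blast
    then have "polyb (\<lambda>z. P (fst z)) (\<lambda>z. iter_pderivative js (F (fst z)) (snd z))"
      by (simp add: polyb_norm)
    then show ?thesis
      by (rule polyb_weaken)
        (use assms(2) order_trans[OF zero_le_one assms(2)] in \<open>simp_all add: algebra_simps\<close>)
  qed
  with assms(1) show ?thesis by (auto simp: modf_def schwf_def)
qed

lemma modf_const:
  fixes P :: "'i \<Rightarrow> real"
  assumes "polyb P c" "\<And>i. P i \<ge> 1" shows "modf P (\<lambda>\<iota> (_::real^'n). c \<iota>)"
proof -
  have i: "iter_pderivative js (\<lambda>_. a :: complex) = (\<lambda>_::real^'n. if js = [] then a else 0)" for js a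
    by (induction js) (auto simp: iter_Cons pderivative_const)
  show ?thesis
    unfolding modf_def i
  proof safe
    fix js :: "'n list"
    have "polyb (\<lambda>z. P (fst z) * (1 + norm (snd z))) (\<lambda>z::'i \<times> (real^'n). c (fst z))"
      by (rule polyb_weaken[OF polyb_reindex[OF assms(1), of fst]])
        (use assms(2) order_trans[OF zero_le_one assms(2)] in \<open>simp_all add: algebra_simps\<close>)
    then show "polyb (\<lambda>z. P (fst z) * (1 + norm (snd z))) (\<lambda>z::'i \<times> (real^'n). if js = [] then c (fst z) else 0)"
      by (rule polyb_mono) auto
  qed (rule smooth_const)
qed

lemma schwf_cmult:
  "schwf P F \<Longrightarrow> polyb P c \<Longrightarrow> (\<And>i. P i \<ge> 1) \<Longrightarrow> schwf P (\<lambda>\<iota> x. c \<iota> * F \<iota> x)"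
  by (intro schwf_mult modf_const)

lemma schwf_sum:
  fixes F :: "'j \<Rightarrow> 'i \<Rightarrow> real^'n \<Rightarrow> complex"
  assumes "\<And>j. j \<in> J \<Longrightarrow> schwf P (F j)" "\<And>i. P i \<ge> 1" "finite J"
  shows "schwf P (\<lambda>\<iota> x. \<Sum>j\<in>J. F j \<iota> x)"
  using assms(3,1)
proof (induction J rule: finite_induct)
  case empty
  have "schwf P (\<lambda>\<iota> x::real^'n. 0 * 0)"
    by (rule schwf_cmult[OF schwartz_schwf])
       (auto intro!: polyb_const assms test_function_schwartz test_functionI[of _ 0] smooth_const)
  then show ?case by simp
next
  case (insert j J)
  then show ?case by (simp add: schwf_add assms(2))
qed

lemma modf_coord:
  fixes P :: "'i \<Rightarrow> real"
  assumes "\<And>i. P i \<ge> 1" shows "modf P (\<lambda>_ (x::real^'n). of_real (x $ j))"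
proof -
  have i: "iter_pderivative js (\<lambda>x::real^'n. of_real (x $ j) :: complex) =
     (\<lambda>x. if js = [] then of_real (x $ j) else if js = [j] then 1 else 0)" for js
  proof (induction js)
    case (Cons a js)
    show ?case unfolding iter_Cons Cons.IH
      by (cases "js = []"; cases "js = [j]") (simp_all add: pderivative_const pderivative_coord)
  qed simp
  have "polyb (\<lambda>z. P (fst z) * (1 + norm (snd z))) (\<lambda>z. if js = [] then of_real (snd z $ j) else if js = [j] then 1 else (0::complex))" for js
  proof (rule polybI[of _ 1 _ 1])
    fix z :: "'i \<times> (real^'n)"
    have "\<bar>snd z $ j\<bar> \<le> 1 * (1 + norm (snd z))" using component_le_norm_cart[of "snd z" j] by simp
    also have "\<dots> \<le> P (fst z) * (1 + norm (snd z))" by (intro mult_right_mono assms) auto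
    finally show "cmod (if js = [] then of_real (snd z $ j) else if js = [j] then 1 else 0)
         \<le> 1 * (P (fst z) * (1 + norm (snd z))) ^ 1"
      using one_le_mult_one_plus_norm[OF assms, of "fst z" "snd z"] by auto
  qed
  then show ?thesis by (simp add: modf_def i smooth_coord)
qed

lemma schwf_harmonic_osc:
  assumes F: "schwf P F" and P: "\<And>i. P i \<ge> 1" shows "schwf P (\<lambda>\<iota>. harmonic_osc (F \<iota>))"
proof -
  have eq: "harmonic_osc (F \<iota>) x = (\<Sum>i\<in>UNIV. of_real (x $ i) * (of_real (x $ i) * F \<iota> x)) +
     (-1) * (\<Sum>i\<in>UNIV. pderivative i (pderivative i (F \<iota>)) x)" for \<iota> x
    unfolding harmonic_osc_def laplacian_def norm_sq_coords
    by (simp add: sum_distrib_right power2_eq_square mult.assoc)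
  show ?thesis unfolding eq[abs_def]
    by (intro schwf_add schwf_sum schwf_mult[OF modf_coord] schwf_cmult schwf_pderivative polyb_const F P) auto
qed

lemma schwf_harmonic_osc_funpow:
  "schwf P F \<Longrightarrow> (\<And>i. P i \<ge> 1) \<Longrightarrow> schwf P (\<lambda>\<iota>. (harmonic_osc ^^ N) (F \<iota>))"
  by (induction N) (auto intro: schwf_harmonic_osc)

section \<open>Translates, modulations and cutoffs as families\<close>

lemma one_plus_norm_translate: "(1 + norm x) ^ k \<le> (1 + norm y) ^ k * (1 + norm (x - y)) ^ k"
proof -
  have "1 + norm x \<le> (1 + norm y) * (1 + norm (x - y))"
  proof -
    have "norm x \<le> norm y + norm (x - y)" using norm_triangle_ineq[of y "x - y"] by simp
    moreover have "0 \<le> norm y * norm (x - y)" by simp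
    ultimately show ?thesis unfolding distrib_left distrib_right mult_1 mult_1_right by linarith
  qed
  then show ?thesis unfolding power_mult_distrib[symmetric] by (intro power_mono) auto
qed

text \<open>Peetre's inequality gives (1 + |s|)^k <= (1 + |y|)^k (1 + |y - s|)^k; the last factor is
  absorbed by the decay of \<phi>, the first is mere growth in y. The bound is thus uniform in s,
  which later produces decay of the short-time Fourier transform in the space variable.\<close>

lemma modf_weighted_translate:
  fixes s :: "'i \<Rightarrow> real^'n"
  assumes "\<phi> \<in> schwartz" "\<And>i. P i \<ge> 1"
  shows "modf P (\<lambda>\<iota> y. of_real ((1 + norm (s \<iota>)) ^ k) * \<phi> (y - s \<iota>))"
proof -
  have sm: "smooth \<phi>" using assms by (simp add: schwartz_def)
  have tr: "iter_pderivative js (\<lambda>y. \<phi> (y - a)) = (\<lambda>y. iter_pderivative js \<phi> (y - a))" "smooth (\<lambda>y. \<phi> (y - a))" for js a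
    using iter_affine[OF sm, of js "- a" 1] smooth_affine[OF sm, of "- a" 1] by (simp_all add: add.commute)
  have "polyb (\<lambda>z. P (fst z) * (1 + norm (snd z))) (\<lambda>z. of_real ((1 + norm (s (fst z))) ^ k) * iter_pderivative js \<phi> (snd z - s (fst z)))" for js
  proof -
    obtain C where C: "\<And>x. norm ((1 + norm x) ^ k * cmod (iter_pderivative js \<phi> x)) \<le> C"
      using assms(1) unfolding schwartz_def bounded_iff by blast
    have C0: "C \<ge> 0" using order_trans[OF norm_ge_zero C[of 0]] .
    show ?thesis
    proof (rule polybI[of _ C _ k])
      fix z :: "'i \<times> (real^'n)"
      define x y where "x = s (fst z)" and "y = snd z"
      have "cmod (of_real ((1 + norm x) ^ k) * iter_pderivative js \<phi> (y - x)) = (1 + norm x) ^ k * cmod (iter_pderivative js \<phi> (y - x))"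
        unfolding norm_mult norm_of_real by simp
      also have "\<dots> \<le> ((1 + norm y) ^ k * (1 + norm (y - x)) ^ k) * cmod (iter_pderivative js \<phi> (y - x))"
        using one_plus_norm_translate[of x k y] unfolding norm_minus_commute[of y x]
        by (rule mult_right_mono) simp
      also have "\<dots> \<le> (1 + norm y) ^ k * C"
        using C[of "y - x"] by (simp add: mult.assoc mult_left_mono)
      also have "\<dots> \<le> (P (fst z) * (1 + norm y)) ^ k * C"
        using mult_right_mono[OF assms(2), of "1 + norm y" "fst z"] by (intro mult_right_mono power_mono C0) simp_all
      finally show "cmod (of_real ((1 + norm (s (fst z))) ^ k) * iter_pderivative js \<phi> (snd z - s (fst z)))
         \<le> C * (P (fst z) * (1 + norm (snd z))) ^ k"
        by (simp add: x_def y_def mult.commute)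
    qed
  qed
  then show ?thesis
    unfolding modf_def using tr iter_cmult[OF tr(2)] by (simp add: smooth_cmult)
qed

lemma schwf_translate:
  fixes \<phi> :: "real^'b \<Rightarrow> complex"
  assumes "\<phi> \<in> schwartz" shows "schwf (\<lambda>x. 1 + norm x) (\<lambda>x y. \<phi> (y - x))"
proof -
  have sm: "smooth \<phi>" using assms by (simp add: schwartz_def)
  have tr: "iter_pderivative js (\<lambda>y. \<phi> (y - a)) = (\<lambda>y. iter_pderivative js \<phi> (y - a))" "smooth (\<lambda>y. \<phi> (y - a))" for js a
    using iter_affine[OF sm, of js "- a" 1] smooth_affine[OF sm, of "- a" 1] by (simp_all add: add.commute)
  have "polyb (\<lambda>z. 1 + norm (fst z)) (\<lambda>z. (1 + norm (snd z)) ^ k * cmod (iter_pderivative js \<phi> (snd z - fst z)))" for k js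
  proof -
    obtain C where C: "\<And>x. norm ((1 + norm x) ^ k * cmod (iter_pderivative js \<phi> x)) \<le> C"
      using assms(1) unfolding schwartz_def bounded_iff by blast
    show ?thesis
    proof (rule polybI[of _ C _ k])
      fix z :: "(real^'b) \<times> (real^'b)"
      define x y where "x = fst z" and "y = snd z"
      have "norm ((1 + norm y) ^ k * cmod (iter_pderivative js \<phi> (y - x)))
        \<le> ((1 + norm x) ^ k * (1 + norm (y - x)) ^ k) * cmod (iter_pderivative js \<phi> (y - x))"
        using one_plus_norm_translate[of y k x] unfolding norm_mult
        by (auto intro!: mult_right_mono)
      also have "\<dots> \<le> (1 + norm x) ^ k * C"
        using C[of "y - x"] by (simp add: mult.assoc mult_left_mono)
      finally show "norm ((1 + norm (snd z)) ^ k * cmod (iter_pderivative js \<phi> (snd z - fst z))) \<le> C * (1 + norm (fst z)) ^ k"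
        by (simp add: x_def y_def mult.commute)
    qed
  qed
  with tr show ?thesis by (simp add: schwf_def)
qed

lemma has_derivative_cis:
  "((\<lambda>y. exp (\<i> * of_real (y \<bullet> \<xi>))) has_derivative (\<lambda>h. exp (\<i> * of_real (y \<bullet> \<xi>)) * (\<i> * of_real (h \<bullet> \<xi>)))) (at y)"
proof -
  have "((\<lambda>y. \<i> * of_real (y \<bullet> \<xi>)) has_derivative (\<lambda>h. \<i> * of_real (h \<bullet> \<xi>))) (at y)"
    by (auto intro!: derivative_eq_intros)
  from has_derivative_compose[OF this DERIV_exp[unfolded has_field_derivative_def]] show ?thesis by simp
qed

lemma modf_cis: "modf (\<lambda>\<xi>. 1 + norm \<xi>) (\<lambda>\<xi> y. exp (\<i> * of_real (y \<bullet> \<xi>)))"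
proof -
  let ?e = "\<lambda>\<xi> y. exp (\<i> * of_real (y \<bullet> \<xi>))"
  have p: "pderivative i (\<lambda>y. c * ?e \<xi> y) = (\<lambda>y. (c * (\<i> * of_real (\<xi> $ i))) * ?e \<xi> y)" for i \<xi> c
    by (rule ext, rule trans[OF pderivative_eqI[OF has_derivative_mult_right[OF has_derivative_cis]]])
       (simp add: inner_commute inner_axis)
  have it: "iter_pderivative js (?e \<xi>) = (\<lambda>y. (\<Prod>i\<leftarrow>js. \<i> * of_real (\<xi> $ i)) * ?e \<xi> y)" for js \<xi>
  proof (induction js)
    case (Cons i js)
    show ?case unfolding iter_Cons Cons.IH p by (simp add: mult_ac)
  qed simp
  have "cmod (\<Prod>i\<leftarrow>js. \<i> * of_real (\<xi> $ i)) \<le> (1 + norm \<xi>) ^ length js" for js and \<xi> :: "real^'a"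
  proof (induction js)
    case (Cons i js)
    have "\<bar>\<xi> $ i\<bar> \<le> 1 + norm \<xi>" using component_le_norm_cart[of \<xi> i] by simp
    with Cons show ?case by (simp add: norm_mult mult_mono)
  qed simp
  then have "cmod (iter_pderivative js (?e \<xi>) y) \<le> 1 * ((1 + norm \<xi>) * (1 + norm y)) ^ length js" for js \<xi> and y :: "real^'a"
    unfolding it norm_mult norm_exp_i_times power_mult_distrib
    using mult_mono[of "cmod (\<Prod>i\<leftarrow>js. \<i> * of_real (\<xi> $ i))" "(1 + norm \<xi>) ^ length js" 1 "(1 + norm y) ^ length js"]
    by auto
  then have "polyb (\<lambda>z. (1 + norm (fst z)) * (1 + norm (snd z))) (\<lambda>z::(real^'a)\<times>(real^'a). iter_pderivative js (?e (fst z)) (snd z))" for js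
    by (intro polybI[of _ 1 _ "length js"]) auto
  moreover have "smooth (?e \<xi>)" for \<xi> :: "real^'a"
    unfolding smooth_def it using has_derivative_mult_right[OF has_derivative_cis]
    by (auto simp: differentiable_def)
  ultimately show ?thesis by (simp add: modf_def)
qed

lemma schwartz_cnj: assumes "\<phi> \<in> schwartz" shows "(\<lambda>x. cnj (\<phi> x)) \<in> schwartz"
  using assms by (simp add: schwartz_def smooth_cnj iter_cnj)

lemma schwartz_bump: "bump \<in> schwartz"
  using bump_affine_test[of 1 0] by (intro test_function_schwartz) simp

text \<open>The factor n is compensated in the function itself by its quadratic vanishing at the
  origin, and in its derivatives because each of them brings out a factor 1 / n. Hence truncating a
  Schwartz function at radius n causes an error of size 1 / n in every seminorm.\<close>

lemma cutoff_modf: "modf (\<lambda>_. 1) (\<lambda>n x. of_nat (Suc n) * (1 - bump (inverse (real (Suc n)) *\<^sub>R x)))"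
proof -
  let ?c = "\<lambda>n. inverse (real (Suc n))"
  have sm: "smooth (\<lambda>x::real^'a. bump (?c n *\<^sub>R x))" for n
    using smooth_affine[OF smooth_bump, of 0 "?c n"] by simp
  have sm': "smooth (\<lambda>x::real^'a. 1 + (- 1) * bump (?c n *\<^sub>R x))" for n
    by (intro smooth_add smooth_const smooth_cmult sm)
  have eq: "(\<lambda>x::real^'a. of_nat (Suc n) * (1 - bump (?c n *\<^sub>R x))) = (\<lambda>x. of_nat (Suc n) * (1 + (- 1) * bump (?c n *\<^sub>R x)))" for n
    by (simp add: algebra_simps)
  have it: "iter_pderivative js (\<lambda>x::real^'a. of_nat (Suc n) * (1 - bump (?c n *\<^sub>R x))) =
     (\<lambda>x. of_nat (Suc n) * (iter_pderivative js (\<lambda>_. 1) x - ?c n ^ length js *\<^sub>R iter_pderivative js bump (?c n *\<^sub>R x)))" for n js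
    unfolding eq iter_cmult[OF sm'] iter_add[OF smooth_const smooth_cmult[OF sm]] iter_cmult[OF sm]
    using iter_affine[OF smooth_bump, of js 0 "?c n"] by simp
  have i1: "iter_pderivative js (\<lambda>_. 1 :: complex) = (\<lambda>_::real^'a. if js = [] then 1 else 0)" for js
    by (induction js) (auto simp: iter_Cons pderivative_const)
  have "polyb (\<lambda>z. 1 * (1 + norm (snd z))) (\<lambda>z. iter_pderivative js (\<lambda>x::real^'a. of_nat (Suc (fst z)) * (1 - bump (?c (fst z) *\<^sub>R x))) (snd z))" for js
  proof (cases "js = []")
    case True
    have "cmod (of_nat (Suc n) * (1 - bump (?c n *\<^sub>R x))) \<le> 2 * (1 + norm x)\<^sup>2" for n and x :: "real^'a"
    proof -
      have "cmod (of_nat (Suc n) * (1 - bump (?c n *\<^sub>R x))) \<le> real (Suc n) * (2 * (norm (?c n *\<^sub>R x))\<^sup>2)"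
        unfolding norm_mult norm_of_nat by (intro mult_left_mono one_minus_bump) auto
      also have "\<dots> = 2 * (norm x)\<^sup>2 * ?c n" by (simp add: power2_eq_square)
      also have "\<dots> \<le> 2 * (norm x)\<^sup>2 * 1" by (intro mult_left_mono) (auto simp: field_simps)
      also have "\<dots> \<le> 2 * (1 + norm x)\<^sup>2" by (simp add: power_mono)
      finally show ?thesis .
    qed
    then show ?thesis by (intro polybI[of _ 2 _ 2]) (simp add: True)
  next
    case False
    obtain C where C: "\<And>x::real^'a. norm ((1 + norm x) ^ 0 * cmod (iter_pderivative js bump x)) \<le> C"
      using schwartz_bump unfolding schwartz_def bounded_iff by blast
    have "cmod (iter_pderivative js (\<lambda>x::real^'a. of_nat (Suc n) * (1 - bump (?c n *\<^sub>R x))) x) \<le> C" for n x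
    proof -
      have "cmod (iter_pderivative js (\<lambda>x::real^'a. of_nat (Suc n) * (1 - bump (?c n *\<^sub>R x))) x)
         = (real (Suc n) * ?c n) * ?c n ^ (length js - 1) * cmod (iter_pderivative js bump (?c n *\<^sub>R x))"
        unfolding it i1 using False by (cases js) (simp_all add: norm_mult norm_power norm_inverse del: of_nat_Suc)
      also have "\<dots> = ?c n ^ (length js - 1) * cmod (iter_pderivative js bump (?c n *\<^sub>R x))" by simp
      also have "\<dots> \<le> 1 * cmod (iter_pderivative js bump (?c n *\<^sub>R x))"
        by (intro mult_right_mono power_le_one) (auto simp: field_simps)
      also have "\<dots> \<le> C" using C[of "?c n *\<^sub>R x"] by simp
      finally show ?thesis .
    qed
    then show ?thesis by (intro polybI[of _ C _ 0]) simp
  qed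
  moreover have "smooth (\<lambda>x::real^'a. of_nat (Suc n) * (1 - bump (?c n *\<^sub>R x)))" for n
    unfolding eq by (intro smooth_cmult sm')
  ultimately show ?thesis by (simp add: modf_def)
qed


section \<open>Integration of Schwartz functions\<close>

definition wt :: "'a::euclidean_space \<Rightarrow> real" where
  "wt x = inverse ((1 + norm x) ^ (2 * DIM('a)))"

lemma wt_pos: "wt x > 0"
  by (simp add: wt_def zero_less_power add_pos_nonneg)

lemma wt_le_1: "wt x \<le> 1"
  unfolding wt_def by (intro inverse_le_1_iff[THEN iffD2] disjI2 one_le_power) simp

lemma continuous_wt: "continuous_on S wt"
  unfolding wt_def[abs_def]
  by (intro continuous_intros) (auto simp: add_nonneg_eq_0_iff)

lemma measurable_wt [measurable]: "wt \<in> borel_measurable borel"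
  by (intro borel_measurable_continuous_onI continuous_wt)

text \<open>The exponent of \<open>wt\<close> allows (1 + |x|)^2 to be spent on each coordinate, and
  1 / (1 + t^2) is integrable on the line.\<close>

lemma integrable_wt: "integrable lborel (wt :: 'a::euclidean_space \<Rightarrow> real)"
proof (rule integrableI_bounded)
  have "(\<integral>\<^sup>+ x. ennreal (norm (wt (x::'a))) \<partial>lborel) \<le> (\<integral>\<^sup>+ x. (\<Prod>b\<in>Basis. ennreal (inverse (1 + ((x::'a) \<bullet> b)\<^sup>2))) \<partial>lborel)"
  proof (rule nn_integral_mono)
    fix x :: 'a
    have le: "1 + (x \<bullet> b)\<^sup>2 \<le> (1 + norm x)\<^sup>2" if "b \<in> Basis" for b
    proof -
      have "(x \<bullet> b)\<^sup>2 \<le> (norm x)\<^sup>2"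
        using Basis_le_norm[OF that, of x] by (metis abs_le_square_iff abs_norm_cancel)
      then show ?thesis using norm_ge_zero[of x] unfolding power2_sum by (simp add: add_increasing2)
    qed
    have "norm (wt x) = (\<Prod>b\<in>(Basis::'a set). inverse ((1 + norm x)\<^sup>2))"
      using wt_pos[of x] by (simp add: wt_def power_mult power_inverse)
    also have "\<dots> \<le> (\<Prod>b\<in>Basis. inverse (1 + (x \<bullet> b)\<^sup>2))"
      by (intro prod_mono conjI le_imp_inverse_le le) (auto intro: add_pos_nonneg)
    finally show "ennreal (norm (wt x)) \<le> (\<Prod>b\<in>Basis. ennreal (inverse (1 + (x \<bullet> b)\<^sup>2)))"
      by (subst prod_ennreal) (auto intro: ennreal_leI)
  qed
  also have "\<dots> = (\<Prod>b\<in>(Basis::'a set). \<integral>\<^sup>+ t. ennreal (inverse (1 + t\<^sup>2)) \<partial>lborel)"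
    by (rule nn_integral_lborel_prod) auto
  also have "\<dots> < \<infinity>"
  proof -
    have "integrable lborel (\<lambda>t::real. inverse (1 + t\<^sup>2))"
      using integrable_inverse_1_plus_square by (simp add: set_integrable_def einterval_def)
    then have "(\<integral>\<^sup>+ t. ennreal (inverse (1 + t\<^sup>2)) \<partial>lborel) < \<infinity>"
      by (simp add: integrable_iff_bounded)
    then show ?thesis by (simp add: power_less_top_ennreal)
  qed
  finally show "(\<integral>\<^sup>+ x. ennreal (norm (wt (x::'a))) \<partial>lborel) < \<infinity>" .
qed simp

lemma integral_wt_nonneg: "0 \<le> integral\<^sup>L lborel wt"
  by (intro Bochner_Integration.integral_nonneg) (simp add: less_imp_le[OF wt_pos])

lemma wt_bound_integrable:
  fixes f :: "'a::euclidean_space \<Rightarrow> 'b::{banach, second_countable_topology}"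
  assumes "f \<in> borel_measurable borel" "\<And>x. norm (f x) \<le> C * wt x"
  shows "integrable lborel f" "norm (integral\<^sup>L lborel f) \<le> C * integral\<^sup>L lborel (wt :: 'a \<Rightarrow> real)"
proof -
  have i: "integrable lborel (\<lambda>x::'a. C * wt x)" by (intro integrable_mult_right integrable_wt)
  show "integrable lborel f"
    by (rule Bochner_Integration.integrable_bound[OF i]) (use assms order_trans[OF norm_ge_zero assms(2)] in auto)
  then have "(LBINT x. norm (f x)) \<le> integral\<^sup>L lborel (\<lambda>x::'a. C * wt x)"
    by (intro integral_mono_AE integrable_norm i AE_I2 assms(2))
  then have "norm (integral\<^sup>L lborel f) \<le> integral\<^sup>L lborel (\<lambda>x::'a. C * wt x)"
    by (rule order_trans[OF integral_norm_bound])
  then show "norm (integral\<^sup>L lborel f) \<le> C * integral\<^sup>L lborel (wt :: 'a \<Rightarrow> real)" by simp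
qed

lemma smooth_measurable: "smooth f \<Longrightarrow> (f :: real^'n \<Rightarrow> complex) \<in> borel_measurable borel"
  by (intro borel_measurable_continuous_onI smooth_continuous)

lemma schwartz_measurable: "f \<in> schwartz \<Longrightarrow> f \<in> borel_measurable borel"
  by (intro smooth_measurable schwartz_smooth)

lemma schwf_wt_bound:
  fixes F :: "'i \<Rightarrow> real^'n \<Rightarrow> complex"
  assumes "schwf P F" "\<And>i. P i \<ge> 1"
  obtains C m where "C > 0" "\<And>\<iota> x. (1 + norm x) ^ k * cmod (iter_pderivative js (F \<iota>) x) \<le> C * P \<iota> ^ m * wt x"
proof -
  have "polyb (\<lambda>z. P (fst z)) (\<lambda>z. (1 + norm (snd z)) ^ (k + 2 * CARD('n)) * cmod (iter_pderivative js (F (fst z)) (snd z)))"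
    using assms(1) unfolding schwf_def by blast
  from polybE[OF this assms(2)] obtain C m where C: "C > 0"
    "\<And>i m'. m' \<ge> m \<Longrightarrow> norm ((1 + norm (snd i)) ^ (k + 2 * CARD('n)) * cmod (iter_pderivative js (F (fst i)) (snd i))) \<le> C * P (fst i) ^ m'"
    by metis
  have "(1 + norm x) ^ k * cmod (iter_pderivative js (F \<iota>) x) \<le> C * P \<iota> ^ m * wt x" for \<iota> x
  proof -
    have "(1 + norm x) ^ (2 * CARD('n)) * ((1 + norm x) ^ k * cmod (iter_pderivative js (F \<iota>) x)) \<le> C * P \<iota> ^ m"
      using C(2)[of m "(\<iota>, x)"] by (simp add: power_add mult_ac)
    moreover have "(1 + norm x) ^ (2 * CARD('n)) > 0" by (simp add: zero_less_power add_pos_nonneg)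
    ultimately show ?thesis by (simp add: wt_def field_simps)
  qed
  with C(1) that show ?thesis by blast
qed

lemma schwartz_wt_bound:
  fixes f :: "real^'n \<Rightarrow> complex"
  assumes "f \<in> schwartz"
  obtains C where "C > 0" "\<And>x. (1 + norm x) ^ k * cmod (iter_pderivative js f x) \<le> C * wt x"
  using schwf_wt_bound[OF schwartz_schwf[OF assms, of "\<lambda>_::unit. 1"], of k js] by auto

lemma schwartz_integrable:
  assumes "f \<in> schwartz" shows "integrable lborel f"
proof -
  obtain C where "\<And>x. (1 + norm x) ^ 0 * cmod (iter_pderivative [] f x) \<le> C * wt x"
    using schwartz_wt_bound[OF assms] by blast
  then show ?thesis
    by (intro wt_bound_integrable[of _ C] schwartz_measurable assms) auto
qed

lemma schwartz_pderivative: "f \<in> schwartz \<Longrightarrow> pderivative i f \<in> schwartz"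
  by (rule schwf_schwartz[OF schwf_pderivative[OF schwartz_schwf[of f "\<lambda>_. 1"]]]) auto

lemma schwartz_mult: "f \<in> schwartz \<Longrightarrow> g \<in> schwartz \<Longrightarrow> (\<lambda>x. f x * g x) \<in> schwartz"
  by (rule schwf_schwartz[OF schwf_mult[OF schwf_modf[OF schwartz_schwf[of f "\<lambda>_. 1"]] schwartz_schwf[of g "\<lambda>_. 1"]]]) auto

lemma schwartz_modf_mult:
  assumes "modf (\<lambda>_::unit. 1) (\<lambda>_. f)" "g \<in> schwartz" shows "(\<lambda>x. f x * g x) \<in> schwartz"
  by (rule schwf_schwartz[OF schwf_mult[OF assms(1) schwartz_schwf[OF assms(2), of "\<lambda>_. 1"]]]) auto

lemma schwartz_coord: "g \<in> schwartz \<Longrightarrow> (\<lambda>x. of_real (x $ i) * g x) \<in> schwartz"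
  by (rule schwartz_modf_mult[OF modf_coord]) auto

lemma schwartz_cis: "g \<in> schwartz \<Longrightarrow> (\<lambda>y. exp (\<i> * of_real (y \<bullet> \<xi>)) * g y) \<in> schwartz"
  by (rule schwf_schwartz[OF schwf_mult[OF modf_cis schwartz_schwf]]) auto

lemma schwartz_cmult: "f \<in> schwartz \<Longrightarrow> (\<lambda>x. c * f x) \<in> schwartz"
  by (rule schwf_schwartz[OF schwf_cmult[OF schwartz_schwf[of f "\<lambda>_. 1"] polyb_const[of _ c]]]) auto

lemma schwartz_harmonic_osc: "f \<in> schwartz \<Longrightarrow> harmonic_osc f \<in> schwartz"
  by (rule schwf_schwartz[OF schwf_harmonic_osc[OF schwartz_schwf[of f "\<lambda>_. 1"]]]) auto

lemma schwartz_harmonic_osc_funpow: "f \<in> schwartz \<Longrightarrow> (harmonic_osc ^^ N) f \<in> schwartz"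
  by (induction N) (auto intro: schwartz_harmonic_osc)

lemma schwartz_translate: "f \<in> schwartz \<Longrightarrow> (\<lambda>y. f (y - x)) \<in> schwartz"
  using schwf_schwartz[OF schwf_translate] .

section \<open>Change of variables and integration by parts\<close>

lemma lborel_integral_affine:
  fixes f :: "'a::euclidean_space \<Rightarrow> 'b::{banach, second_countable_topology}"
  assumes "c \<noteq> 0" "f \<in> borel_measurable borel"
  shows "(LBINT x. f x) = \<bar>c\<bar> ^ DIM('a) *\<^sub>R (LBINT x. f (t + c *\<^sub>R x))"
proof -
  have "(LBINT x. f x) = integral\<^sup>L (density (distr lborel borel (\<lambda>x. t + c *\<^sub>R x)) (\<lambda>_. \<bar>c\<bar> ^ DIM('a))) f"
    using lborel_affine[OF assms(1), of t] by simp
  also have "\<dots> = (\<integral>x. \<bar>c\<bar> ^ DIM('a) *\<^sub>R f x \<partial>distr lborel borel (\<lambda>x. t + c *\<^sub>R x))"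
    by (rule integral_density) (use assms in auto)
  also have "\<dots> = (LBINT x. \<bar>c\<bar> ^ DIM('a) *\<^sub>R f (t + c *\<^sub>R x))"
    by (rule integral_distr) (use assms in measurable)
  finally show ?thesis by simp
qed

lemma lborel_integral_translate:
  fixes f :: "'a::euclidean_space \<Rightarrow> 'b::{banach, second_countable_topology}"
  assumes "f \<in> borel_measurable borel"
  shows "(LBINT x. f (t + x)) = (LBINT x. f x)"
  using lborel_integral_affine[OF _ assms, of 1 t] by simp

lemma pderivative_line:
  assumes "smooth f"
  shows "((\<lambda>t. f (x + t *\<^sub>R axis i 1)) has_vector_derivative pderivative i f (x + t *\<^sub>R axis i 1)) (at t within S)"
proof -
  obtain f' where f': "(f has_derivative f') (at (x + t *\<^sub>R axis i 1))"
    using smooth_differentiable[OF assms] unfolding differentiable_def by blast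
  have "((\<lambda>t. x + t *\<^sub>R axis i 1) has_derivative (\<lambda>s. s *\<^sub>R axis i 1)) (at t within S)"
    by (auto intro!: derivative_eq_intros)
  from has_derivative_compose[OF this f'] show ?thesis
    unfolding has_vector_derivative_def pderivative_eqI[OF f']
    using linear_scale[OF has_derivative_linear[OF f']] by simp
qed

text \<open>Provides a common integrable majorant for the difference quotients of a Schwartz
  function with steps at most 1.\<close>

lemma wt_nearby: fixes x y :: "'a::euclidean_space"
  assumes "norm (x - y) \<le> 1" shows "wt y \<le> 2 ^ (2 * DIM('a)) * wt x"
proof -
  have "1 + norm x \<le> 2 * (1 + norm y)" using assms norm_triangle_ineq2[of x y] by (smt (verit) norm_ge_zero)
  then have "(1 + norm x) ^ (2 * DIM('a)) \<le> 2 ^ (2 * DIM('a)) * (1 + norm y) ^ (2 * DIM('a))"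
    unfolding power_mult_distrib[symmetric] by (intro power_mono) auto
  moreover have "(1 + norm x) ^ (2 * DIM('a)) > 0" "(1 + norm y) ^ (2 * DIM('a)) > 0"
    by (auto intro!: zero_less_power add_pos_nonneg)
  ultimately show ?thesis unfolding wt_def by (simp add: field_simps)
qed

text \<open>By translation invariance the difference quotients of \<open>f\<close> integrate to \<open>0\<close>.\<close>

lemma integral_pderivative_schwartz:
  fixes f :: "real^'n \<Rightarrow> complex"
  assumes "f \<in> schwartz" shows "(LBINT x. pderivative i f x) = 0"
proof -
  let ?e = "axis i 1 :: real^'n" and ?h = "\<lambda>n. inverse (real (Suc n))"
  have sm: "smooth f" using assms by (rule schwartz_smooth)
  have [measurable]: "f \<in> borel_measurable borel" "pderivative i f \<in> borel_measurable borel"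
    using sm by (auto intro: smooth_measurable smooth_pderivative)
  obtain C where C: "C > 0" "\<And>x. (1 + norm x) ^ 0 * cmod (iter_pderivative [i] f x) \<le> C * wt x"
    using schwartz_wt_bound[OF assms] by blast
  define D where "D = C * 2 ^ (2 * CARD('n))"
  define s where "s = (\<lambda>n x. (f (?h n *\<^sub>R ?e + x) - f x) /\<^sub>R ?h n)"
  have "(\<lambda>n. LBINT x. s n x) \<longlonglongrightarrow> (LBINT x. pderivative i f x)"
  proof (rule integral_dominated_convergence[where w="\<lambda>x. D * wt x"])
    show "integrable lborel (\<lambda>x::real^'n. D * wt x)" by (intro integrable_mult_right integrable_wt)
    show "AE x in lborel. (\<lambda>n. s n x) \<longlonglongrightarrow> pderivative i f x"
    proof (rule AE_I2)
      fix x :: "real^'n"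
      have "((\<lambda>t. f (x + t *\<^sub>R ?e)) has_vector_derivative pderivative i f (x + 0 *\<^sub>R ?e)) (at 0)"
        by (rule pderivative_line[OF sm])
      then have "((\<lambda>t. norm (f (x + t *\<^sub>R ?e) - f x - t *\<^sub>R pderivative i f x) / norm t) \<longlongrightarrow> 0) (at 0)"
        by (simp add: has_vector_derivative_def has_derivative_at)
      then have "((\<lambda>t. norm ((f (x + t *\<^sub>R ?e) - f x) /\<^sub>R t - pderivative i f x)) \<longlongrightarrow> 0) (at 0)"
      proof (rule Lim_transform_eventually)
        show "\<forall>\<^sub>F t in at 0. norm (f (x + t *\<^sub>R ?e) - f x - t *\<^sub>R pderivative i f x) / norm t
            = norm ((f (x + t *\<^sub>R ?e) - f x) /\<^sub>R t - pderivative i f x)"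
        proof (intro eventually_at_filter[THEN iffD2] always_eventually allI impI)
          fix t :: real assume "t \<noteq> 0"
          then have "(f (x + t *\<^sub>R ?e) - f x) /\<^sub>R t - pderivative i f x = (f (x + t *\<^sub>R ?e) - f x - t *\<^sub>R pderivative i f x) /\<^sub>R t"
            by (simp add: scaleR_diff_right)
          then show "norm (f (x + t *\<^sub>R ?e) - f x - t *\<^sub>R pderivative i f x) / norm t
            = norm ((f (x + t *\<^sub>R ?e) - f x) /\<^sub>R t - pderivative i f x)"
            by (simp add: divide_inverse mult.commute)
        qed
      qed
      then have "((\<lambda>t. (f (x + t *\<^sub>R ?e) - f x) /\<^sub>R t) \<longlongrightarrow> pderivative i f x) (at 0)"
        by (simp only: tendsto_norm_zero_iff LIM_zero_iff)
      moreover have "filterlim ?h (at 0) sequentially"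
        by (rule filterlim_atI[OF LIMSEQ_inverse_real_of_nat]) auto
      ultimately have "(\<lambda>n. (f (x + ?h n *\<^sub>R ?e) - f x) /\<^sub>R ?h n) \<longlonglongrightarrow> pderivative i f x"
        by (rule filterlim_compose)
      then show "(\<lambda>n. s n x) \<longlonglongrightarrow> pderivative i f x" by (simp add: s_def add.commute)
    qed
    show "AE x in lborel. norm (s n x) \<le> D * wt x" for n
    proof (rule AE_I2)
      fix x :: "real^'n"
      have "norm (f (x + ?h n *\<^sub>R ?e) - f (x + 0 *\<^sub>R ?e)) \<le> (D * wt x) * norm (?h n - 0)"
      proof (rule differentiable_bound[of "{0..1}" "\<lambda>t. f (x + t *\<^sub>R ?e)" "\<lambda>t s. s *\<^sub>R pderivative i f (x + t *\<^sub>R ?e)"])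
        fix t :: real assume t: "t \<in> {0..1}"
        show "((\<lambda>t. f (x + t *\<^sub>R ?e)) has_derivative (\<lambda>s. s *\<^sub>R pderivative i f (x + t *\<^sub>R ?e))) (at t within {0..1})"
          using pderivative_line[OF sm] by (simp add: has_vector_derivative_def)
        have "cmod (pderivative i f (x + t *\<^sub>R ?e)) \<le> C * wt (x + t *\<^sub>R ?e)"
          using C(2)[of "x + t *\<^sub>R ?e"] by (simp add: iter_Cons)
        also have "\<dots> \<le> C * (2 ^ (2 * CARD('n)) * wt x)"
          using wt_nearby[of x "x + t *\<^sub>R ?e"] t C(1) by (intro mult_left_mono) (auto simp: norm_axis_1)
        finally have "cmod (pderivative i f (x + t *\<^sub>R ?e)) \<le> D * wt x" by (simp add: D_def)
        then show "onorm (\<lambda>s. s *\<^sub>R pderivative i f (x + t *\<^sub>R ?e)) \<le> D * wt x"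
          by (intro onorm_le) (simp add: mult.commute mult_left_mono)
      qed (auto simp: field_simps)
      moreover have "norm (s n x) = norm (f (x + ?h n *\<^sub>R ?e) - f (x + 0 *\<^sub>R ?e)) * real (Suc n)"
        by (simp add: s_def add.commute del: of_nat_Suc)
      ultimately show "norm (s n x) \<le> D * wt x" by (simp add: field_simps)
    qed
  qed (simp_all add: s_def)
  moreover have "(LBINT x. s n x) = 0" for n
  proof -
    have i: "integrable lborel f" by (rule schwartz_integrable[OF assms])
    have "integrable lborel (\<lambda>x. f (?h n *\<^sub>R ?e + x))"
      using schwartz_integrable[OF schwartz_translate[OF assms, of "- (?h n *\<^sub>R ?e)"]] by (simp add: add.commute)
    then show ?thesis
      using i lborel_integral_translate[of f "?h n *\<^sub>R ?e"] by (simp add: s_def)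
  qed
  ultimately show ?thesis by (simp add: LIMSEQ_const_iff)
qed

text \<open>The two situations in which integration by parts has no boundary term: an arbitrary
  smooth function against a test function, as needed for f and \<open>H^N f\<close>, and two
  Schwartz functions, as needed for Hermite functions.\<close>

definition spair :: "(real^'n \<Rightarrow> complex) \<Rightarrow> (real^'n \<Rightarrow> complex) \<Rightarrow> bool" where
  "spair f g \<longleftrightarrow> smooth f \<and> g \<in> test_function \<or> f \<in> schwartz \<and> g \<in> schwartz"

lemma spair_smooth: "spair f g \<Longrightarrow> smooth f" "spair f g \<Longrightarrow> smooth g"
  by (auto simp: spair_def schwartz_smooth test_function_def)

lemma spair_schwartz: "spair f g \<Longrightarrow> (\<lambda>x. f x * g x) \<in> schwartz"
  by (auto simp: spair_def intro: schwartz_mult test_function_schwartz test_function_mult)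

lemma spair_integrable: "spair f g \<Longrightarrow> integrable lborel (\<lambda>x. f x * g x)"
  by (intro schwartz_integrable spair_schwartz)

lemma spair_pderivative: "spair f g \<Longrightarrow> spair (pderivative i f) g" "spair f g \<Longrightarrow> spair f (pderivative i g)"
  by (auto simp: spair_def schwartz_pderivative smooth_pderivative test_function_pderivative)

lemma integration_by_parts:
  assumes "spair f g"
  shows "(LBINT x. pderivative i f x * g x) = - (LBINT x. f x * pderivative i g x)"
proof -
  have "0 = (LBINT x. pderivative i (\<lambda>x. f x * g x) x)"
    using integral_pderivative_schwartz[OF spair_schwartz[OF assms]] by simp
  also have "pderivative i (\<lambda>x. f x * g x) = (\<lambda>x. f x * pderivative i g x + pderivative i f x * g x)"
    by (intro pderivative_mult smooth_differentiable spair_smooth[OF assms])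
  also have "(LBINT x. f x * pderivative i g x + pderivative i f x * g x)
     = (LBINT x. f x * pderivative i g x) + (LBINT x. pderivative i f x * g x)"
    by (intro Bochner_Integration.integral_add spair_integrable spair_pderivative assms)
  finally show ?thesis by (simp add: eq_neg_iff_add_eq_0 add.commute)
qed

lemma test_harmonic_osc:
  assumes "g \<in> test_function" shows "harmonic_osc g \<in> test_function"
proof -
  have "bounded (closure {x. g x \<noteq> 0})" using assms by (auto simp: test_function_def compact_imp_bounded)
  then obtain R where R: "\<And>x. x \<in> closure {x. g x \<noteq> 0} \<Longrightarrow> norm x \<le> R" by (auto simp: bounded_iff)
  have "smooth g" using assms by (auto simp: test_function_def)
  moreover have "harmonic_osc g x = 0" if "norm x > R" for x
    using iter_outside_support[of x g] iter_outside_support[of x g "[i,i]" for i] R[of x] that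
    by (force simp: iter_Cons harmonic_osc_def laplacian_def dest: iter_outside_support[of x g "[]"])
  ultimately show ?thesis
    by (intro test_functionI[of _ R] smooth_harmonic_osc)
qed

lemma spair_harmonic_osc: "spair f g \<Longrightarrow> spair (harmonic_osc f) g" "spair f g \<Longrightarrow> spair f (harmonic_osc g)"
  by (auto simp: spair_def smooth_harmonic_osc schwartz_harmonic_osc test_harmonic_osc)

lemma harmonic_osc_symmetric:
  assumes "spair f g"
  shows "(LBINT x. harmonic_osc f x * g x) = (LBINT x. f x * harmonic_osc g x)"
proof -
  have i1: "integrable lborel (\<lambda>x. pderivative i (pderivative i f) x * g x)"
    "integrable lborel (\<lambda>x. f x * pderivative i (pderivative i g) x)" for i
    by (intro spair_integrable spair_pderivative assms)+
  have p: "(LBINT x. pderivative i (pderivative i f) x * g x) = (LBINT x. f x * pderivative i (pderivative i g) x)" for i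
    using integration_by_parts[OF spair_pderivative(1)[OF assms, of i], of i]
      integration_by_parts[OF spair_pderivative(2)[OF assms, of i], of i] by simp
  have s: "(\<lambda>x. of_real (x $ i) * (of_real (x $ i) * (f x * g x))) \<in> schwartz" for i
    by (intro schwartz_coord spair_schwartz assms)
  have "(\<lambda>x. of_real ((norm x)\<^sup>2) * (f x * g x)) = (\<lambda>x. \<Sum>i\<in>UNIV. of_real (x $ i) * (of_real (x $ i) * (f x * g x)))"
    unfolding norm_sq_coords by (simp add: sum_distrib_right power2_eq_square mult.assoc)
  then have i2: "integrable lborel (\<lambda>x. of_real ((norm x)\<^sup>2) * (f x * g x))"
    by (simp add: schwartz_integrable[OF s])
  have "(LBINT x. harmonic_osc f x * g x) =
     (LBINT x. of_real ((norm x)\<^sup>2) * (f x * g x) - (\<Sum>i\<in>UNIV. pderivative i (pderivative i f) x * g x))"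
    by (simp add: harmonic_osc_def laplacian_def left_diff_distrib sum_distrib_right mult.assoc)
  also have "\<dots> = (LBINT x. of_real ((norm x)\<^sup>2) * (f x * g x) - (\<Sum>i\<in>UNIV. f x * pderivative i (pderivative i g) x))"
    using i1 i2 p by simp
  also have "\<dots> = (LBINT x. f x * harmonic_osc g x)"
    by (simp add: harmonic_osc_def laplacian_def right_diff_distrib sum_distrib_left mult_ac)
  finally show ?thesis .
qed

lemma harmonic_osc_funpow_symmetric:
  assumes "spair f g"
  shows "(LBINT x. (harmonic_osc ^^ N) f x * g x) = (LBINT x. f x * (harmonic_osc ^^ N) g x)"
  using assms
proof (induction N arbitrary: f g)
  case (Suc N)
  have s: "spair ((harmonic_osc ^^ N) f) g"
    using Suc.prems by (induction N) (auto intro: spair_harmonic_osc)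
  show ?case
    using harmonic_osc_symmetric[OF s] Suc.IH[OF spair_harmonic_osc(2)[OF Suc.prems]]
    by (simp add: funpow_swap1)
qed simp

section \<open>Pointwise bounds obtained by testing\<close>

lemma integral_positive_at:
  fixes q :: "'a::euclidean_space \<Rightarrow> real"
  assumes "integrable lborel q" "continuous_on UNIV q" "\<And>x. q x \<ge> 0" "q a > 0"
  shows "integral\<^sup>L lborel q > 0"
proof (rule ccontr)
  assume "\<not> ?thesis"
  moreover have "integral\<^sup>L lborel q \<ge> 0" using assms(3) by simp
  ultimately have "integral\<^sup>L lborel q = 0" by simp
  then have ae: "AE x in lborel. q x = 0"
    using integral_nonneg_eq_0_iff_AE[OF assms(1)] assms(3) by simp
  have "open (q -` {0<..})" using assms(2) by (intro open_vimage) auto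
  then obtain e where e: "e > 0" "ball a e \<subseteq> q -` {0<..}" using assms(4) openE[of "q -` {0<..}" a] by auto
  have "AE x in lborel. x \<notin> ball a e" using ae by eventually_elim (use e in fastforce)
  then have "emeasure lborel (ball a e) = 0"
    by (subst (asm) AE_iff_measurable[of "ball a e"]) auto
  moreover have "emeasure lborel (ball a e) > 0"
    using e(1) by (simp add: emeasure_ball content_ball_pos unit_ball_vol_pos)
  ultimately show False by simp
qed

text \<open>If |G a| > w a, a unimodular \<theta> rotates G so that Re (\<theta> G) > w near a by
  continuity; testing against \<theta> times a nonnegative bump supported in that neighbourhood
  contradicts the hypothesis. This is how an estimate of a distribution becomes an estimate of the
  function representing it.\<close>

lemma pointwise_bound_from_test_functions:
  fixes G :: "real^'n \<Rightarrow> complex" and w :: "real^'n \<Rightarrow> real"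
  assumes G: "continuous_on UNIV G" and w: "continuous_on UNIV w"
    and b: "\<And>\<psi>. \<psi> \<in> test_function \<Longrightarrow> cmod (LBINT x. G x * \<psi> x) \<le> (LBINT x. w x * cmod (\<psi> x))"
  shows "cmod (G a) \<le> w a"
proof (rule ccontr)
  assume "\<not> ?thesis"
  then have gt: "cmod (G a) > w a" by simp
  \<comment> \<open>G a = 0 is possible here, since w a may be negative; any unimodular value serves
    in that case.\<close>
  define \<theta> where "\<theta> = (if G a = 0 then 1 else cnj (sgn (G a)))"
  have \<theta>: "cmod \<theta> = 1" "\<theta> * G a = of_real (cmod (G a))"
  proof -
    show "cmod \<theta> = 1" by (simp add: \<theta>_def norm_sgn)
    have "cnj (G a) * G a = of_real (cmod (G a)) * of_real (cmod (G a))"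
      using complex_norm_square[of "G a"] by (simp add: power2_eq_square mult.commute)
    then show "\<theta> * G a = of_real (cmod (G a))" by (simp add: \<theta>_def sgn_eq field_simps)
  qed
  define q where "q = (\<lambda>x. Re (\<theta> * G x) - w x)"
  have qc: "continuous_on UNIV q" unfolding q_def by (intro continuous_intros G w)
  have "q a > 0" using gt by (simp only: q_def \<theta>) simp
  then have "a \<in> q -` {0<..}" by simp
  moreover have "open (q -` {0<..})" using qc by (intro open_vimage) auto
  ultimately obtain e where e: "e > 0" "ball a e \<subseteq> q -` {0<..}" by (meson open_contains_ball)
  \<comment> \<open>With this dilation the bump is supported in the ball of radius e about
    a.\<close>
  define c where "c = inverse e"
  have c: "c > 0" using e by (simp add: c_def)
  define B where "B = (\<lambda>x. bump (- (c *\<^sub>R a) + c *\<^sub>R x))"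
  have Bt: "B \<in> test_function" unfolding B_def by (rule bump_affine_test) (use c in auto)
  have Bn: "B x = of_real (cmod (B x))" for x unfolding B_def by (rule bump_nonneg)
  have Bo: "B x = 0" if "x \<notin> ball a e" for x
  proof -
    have "norm (- (c *\<^sub>R a) + c *\<^sub>R x) = c * dist a x"
      using c by (simp add: dist_norm norm_minus_commute flip: scaleR_diff_right)
    also have "\<dots> \<ge> 1" using that e by (simp add: c_def field_simps)
    finally show ?thesis unfolding B_def by (rule bump_outside)
  qed
  have Bs: "smooth B" using Bt by (simp add: test_function_def)
  have cB: "continuous_on UNIV (\<lambda>x. cmod (B x))" by (intro continuous_intros smooth_continuous Bs)
  have cont_int: "integrable lborel (\<lambda>x. h x * cmod (B x))" if "continuous_on UNIV h" for h :: "real^'n \<Rightarrow> real"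
  proof -
    have "compact (cball a e)" by simp
    then have "bounded (h ` cball a e)"
      using that by (meson compact_continuous_image compact_imp_bounded continuous_on_subset subset_UNIV)
    then obtain M where M: "\<And>x. x \<in> cball a e \<Longrightarrow> \<bar>h x\<bar> \<le> M" unfolding bounded_iff real_norm_def by blast
    have M0: "M \<ge> 0" using M[of a] e by auto
    have [measurable]: "h \<in> borel_measurable borel" "(\<lambda>x. cmod (B x)) \<in> borel_measurable borel"
      using that cB by (auto intro: borel_measurable_continuous_onI)
    have i: "integrable lborel (\<lambda>x. M * cmod (B x))"
      by (intro integrable_mult_right integrable_norm schwartz_integrable test_function_schwartz Bt)
    show ?thesis
    proof (rule Bochner_Integration.integrable_bound[OF i])
      show "AE x in lborel. norm (h x * cmod (B x)) \<le> norm (M * cmod (B x))"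
      proof (rule AE_I2)
        fix x show "norm (h x * cmod (B x)) \<le> norm (M * cmod (B x))"
        proof (cases "x \<in> ball a e")
          case True
          then have "\<bar>h x\<bar> \<le> M" using M[of x] by (simp add: less_imp_le)
          then show ?thesis using M0 by (simp add: abs_mult mult_right_mono)
        qed (simp add: Bo)
      qed
    qed simp
  qed
  have "(\<lambda>x. \<theta> * B x) \<in> test_function"
    by (rule test_function_mult[OF smooth_const Bt])
  from b[OF this] have le: "cmod (LBINT x. G x * (\<theta> * B x)) \<le> (LBINT x. w x * cmod (B x))"
    using \<theta> by (simp add: norm_mult)
  have "integrable lborel (\<lambda>x. Re (\<theta> * G x) * cmod (B x))" "integrable lborel (\<lambda>x. Im (\<theta> * G x) * cmod (B x))"
    by (intro cont_int continuous_intros G)+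
  then have "integrable lborel (\<lambda>x. of_real (Re (\<theta> * G x) * cmod (B x)) + \<i> * of_real (Im (\<theta> * G x) * cmod (B x)))"
    by (intro Bochner_Integration.integrable_add integrable_mult_right integrable_of_real)
  moreover have eq: "of_real (Re (\<theta> * G x) * cmod (B x)) + \<i> * of_real (Im (\<theta> * G x) * cmod (B x)) = G x * (\<theta> * B x)" for x
  proof -
    have "G x * (\<theta> * B x) = (\<theta> * G x) * of_real (cmod (B x))" using Bn[of x] by simp
    also have "\<dots> = (of_real (Re (\<theta> * G x)) + \<i> * of_real (Im (\<theta> * G x))) * of_real (cmod (B x))"
      using complex_eq by metis
    finally show ?thesis by (simp add: algebra_simps)
  qed
  ultimately have gi: "integrable lborel (\<lambda>x. G x * (\<theta> * B x))" by simp
  have "(LBINT x. Re (\<theta> * G x) * cmod (B x)) = (LBINT x. Re (G x * (\<theta> * B x)))"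
    by (rule Bochner_Integration.integral_cong) (auto simp flip: eq)
  also have "\<dots> = Re (LBINT x. G x * (\<theta> * B x))" using gi by (rule integral_Re)
  also have "\<dots> \<le> (LBINT x. w x * cmod (B x))" using le complex_Re_le_cmod order_trans by blast
  finally have "(LBINT x. q x * cmod (B x)) \<le> 0"
    using cont_int[OF w] \<open>integrable lborel (\<lambda>x. Re (\<theta> * G x) * cmod (B x))\<close>
    by (simp add: q_def left_diff_distrib)
  moreover have "(LBINT x. q x * cmod (B x)) > 0"
  proof (rule integral_positive_at)
    show "integrable lborel (\<lambda>x. q x * cmod (B x))" by (rule cont_int[OF qc])
    show "continuous_on UNIV (\<lambda>x. q x * cmod (B x))" by (intro continuous_intros qc cB)
    show "q x * cmod (B x) \<ge> 0" for x
    proof (cases "x \<in> ball a e")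
      case True
      then have "q x > 0" using e(2) by blast
      then show ?thesis by simp
    qed (simp add: Bo)
    show "q a * cmod (B a) > 0" using \<open>q a > 0\<close> bump_zero[where 'a='n] by (simp add: B_def)
  qed
  ultimately show False by simp
qed

lemma LINT_lebesgue: "f \<in> borel_measurable borel \<Longrightarrow> (LINT x|lebesgue. f x) = (LBINT x. f x)"
  for f :: "'a::euclidean_space \<Rightarrow> 'b::{banach, second_countable_topology}"
  by (intro integral_completion) simp

section \<open>Tempered distributions\<close>

lemma tempered_add: "tempered_distribution u \<Longrightarrow> \<phi> \<in> schwartz \<Longrightarrow> \<psi> \<in> schwartz \<Longrightarrow> u (\<lambda>x. \<phi> x + \<psi> x) = u \<phi> + u \<psi>"
  and tempered_cmult: "tempered_distribution u \<Longrightarrow> \<phi> \<in> schwartz \<Longrightarrow> u (\<lambda>x. a * \<phi> x) = a * u \<phi>"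
  unfolding tempered_distribution_def by blast+

lemma finite_length_le: "finite {js :: 'n::finite list. length js \<le> k}"
  using finite_lists_length_le[of "UNIV :: 'n set" k] by simp

lemma schwartz_bdd_above:
  assumes "\<phi> \<in> schwartz" shows "bdd_above (range (\<lambda>x. (1 + norm x) ^ k * cmod (iter_pderivative js \<phi> x)))"
  using assms by (auto simp: schwartz_def intro: bounded_imp_bdd_above)

lemma schwartz_SUP_ge:
  assumes "\<phi> \<in> schwartz"
  shows "(1 + norm x) ^ k * cmod (iter_pderivative js \<phi> x) \<le> (SUP x. (1 + norm x) ^ k * cmod (iter_pderivative js \<phi> x))"
  by (rule cSUP_upper[OF _ schwartz_bdd_above[OF assms]]) simp

lemma schwartz_SUP_nonneg:
  assumes "\<phi> \<in> schwartz"
  shows "0 \<le> (SUP x. (1 + norm x) ^ k * cmod (iter_pderivative js \<phi> x))"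
  by (rule order_trans[OF _ schwartz_SUP_ge[OF assms, of 0]]) simp

text \<open>The continuity estimate of u involves finitely many seminorms, and each of them is
  polynomially bounded along the family.\<close>

lemma tempered_schwf:
  fixes F :: "'i \<Rightarrow> real^'n \<Rightarrow> complex"
  assumes u: "tempered_distribution u" and F: "schwf P F" and P: "\<And>i. P i \<ge> 1"
  shows "polyb P (\<lambda>\<iota>. u (F \<iota>))"
proof -
  obtain C k where C: "\<And>\<phi>. \<phi> \<in> schwartz \<Longrightarrow> cmod (u \<phi>) \<le>
        C * (\<Sum>js | length js \<le> k. SUP x. (1 + norm x) ^ k * cmod (iter_pderivative js \<phi> x))"
    using u unfolding tempered_distribution_def by blast
  have "polyb P (\<lambda>\<iota>. SUP x. (1 + norm x) ^ k * cmod (iter_pderivative js (F \<iota>) x))" for js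
  proof -
    have "polyb (\<lambda>z. P (fst z)) (\<lambda>z. (1 + norm (snd z)) ^ k * cmod (iter_pderivative js (F (fst z)) (snd z)))"
      using F unfolding schwf_def by blast
    then obtain D m where D: "\<And>z m'. m' \<ge> m \<Longrightarrow> norm ((1 + norm (snd z)) ^ k * cmod (iter_pderivative js (F (fst z)) (snd z))) \<le> D * P (fst z) ^ m'"
      by (rule polybE) (use P in auto)
    show ?thesis
    proof (rule polybI)
      fix \<iota>
      have "(SUP x. (1 + norm x) ^ k * cmod (iter_pderivative js (F \<iota>) x)) \<le> D * P \<iota> ^ m"
        by (rule cSUP_least) (use D[of m "(\<iota>, _)"] in auto)
      then show "norm (SUP x. (1 + norm x) ^ k * cmod (iter_pderivative js (F \<iota>) x)) \<le> D * P \<iota> ^ m"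
        using schwartz_SUP_nonneg[OF schwf_schwartz[OF F]] by simp
    qed
  qed
  then have "polyb P (\<lambda>\<iota>. C * (\<Sum>js | length js \<le> k. SUP x. (1 + norm x) ^ k * cmod (iter_pderivative js (F \<iota>) x)))"
    by (intro polyb_mult polyb_const polyb_sum P)
  then show ?thesis
    by (rule polyb_mono) (use C[OF schwf_schwartz[OF F]] in \<open>auto intro: order_trans abs_ge_self\<close>)
qed

text \<open>A sequential form of continuity. If no seminorm estimate holds, there are
  \<open>\<phi> n\<close> on which |u| exceeds n times the n-th seminorm; after normalization they
  are bounded in every seminorm, although u is unbounded along them.\<close>

lemma tempered_distributionI:
  fixes u :: "(real^'n \<Rightarrow> complex) \<Rightarrow> complex"
  assumes add: "\<And>\<phi> \<psi>. \<phi> \<in> schwartz \<Longrightarrow> \<psi> \<in> schwartz \<Longrightarrow> u (\<lambda>x. \<phi> x + \<psi> x) = u \<phi> + u \<psi>"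
    and cmult: "\<And>a \<phi>. \<phi> \<in> schwartz \<Longrightarrow> u (\<lambda>x. a * \<phi> x) = a * u \<phi>"
    and bdd: "\<And>F. schwf (\<lambda>_::nat. 1) F \<Longrightarrow> polyb (\<lambda>_. 1) (\<lambda>n. u (F n))"
  shows "tempered_distribution u"
proof (rule ccontr)
  define N :: "nat \<Rightarrow> (real^'n \<Rightarrow> complex) \<Rightarrow> real" where
    "N k \<phi> = (\<Sum>js | length js \<le> k. SUP x. (1 + norm x) ^ k * cmod (iter_pderivative js \<phi> x))" for k \<phi>
  assume "\<not> ?thesis"
  then have un: "\<not> (\<exists>C k. \<forall>\<phi>\<in>schwartz. cmod (u \<phi>) \<le> C * N k \<phi>)"
    using add cmult unfolding tempered_distribution_def N_def by blast
  have "\<exists>\<phi>. \<phi> \<in> schwartz \<and> cmod (u \<phi>) > real n * N n \<phi>" for n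
  proof (rule ccontr)
    assume "\<not> ?thesis"
    then have "\<forall>\<phi>\<in>schwartz. cmod (u \<phi>) \<le> real n * N n \<phi>"
      by (intro ballI leI notI) blast
    with un show False by blast
  qed
  then obtain \<phi> where \<phi>: "\<And>n. \<phi> n \<in> schwartz" "\<And>n. cmod (u (\<phi> n)) > real n * N n (\<phi> n)" by metis
  have sup_le: "(1 + norm x) ^ n * cmod (iter_pderivative js (\<phi> n) x) \<le> N n (\<phi> n)" if "length js \<le> n" for n js x
  proof -
    have "(1 + norm x) ^ n * cmod (iter_pderivative js (\<phi> n) x) \<le> (SUP x. (1 + norm x) ^ n * cmod (iter_pderivative js (\<phi> n) x))"
      by (rule schwartz_SUP_ge[OF \<phi>(1)])
    also have "\<dots> \<le> N n (\<phi> n)" unfolding N_def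
      by (rule member_le_sum) (use that finite_length_le in \<open>auto intro: schwartz_SUP_nonneg[OF \<phi>(1)]\<close>)
    finally show ?thesis .
  qed
  \<comment> \<open>A vanishing seminorm would force \<open>\<phi> n\<close> = 0, where u vanishes
    by homogeneity, against the choice of \<open>\<phi> n\<close>.\<close>
  have Npos: "N n (\<phi> n) > 0" for n
  proof (rule ccontr)
    assume "\<not> ?thesis"
    then have "(1 + norm x) ^ n * cmod (\<phi> n x) \<le> 0" for x using sup_le[of "[]" n x] by simp
    moreover have "(1 + norm x) ^ n > 0" for x :: "real^'n" by (simp add: zero_less_power add_pos_nonneg)
    ultimately have "\<phi> n x = 0" for x by (simp add: mult_le_0_iff not_le[symmetric])
    then have "\<phi> n = (\<lambda>x. 0 * \<phi> n x)" by auto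
    then have u0: "u (\<phi> n) = 0" using cmult[OF \<phi>(1), of 0 n] by simp
    have "N n (\<phi> n) \<ge> 0" unfolding N_def by (intro sum_nonneg schwartz_SUP_nonneg \<phi>)
    then have "real n * N n (\<phi> n) \<ge> 0" by (intro mult_nonneg_nonneg) auto
    with \<phi>(2)[of n] u0 show False by simp
  qed
  define \<psi> where "\<psi> = (\<lambda>n x. of_real (inverse (N n (\<phi> n))) * \<phi> n x)"
  have it: "iter_pderivative js (\<psi> n) x = of_real (inverse (N n (\<phi> n))) * iter_pderivative js (\<phi> n) x" for js n x
    unfolding \<psi>_def using iter_cmult[OF schwartz_smooth[OF \<phi>(1)]] by simp
  have "schwf (\<lambda>_. 1) \<psi>"
    unfolding schwf_def
  proof safe
    show "smooth (\<psi> n)" for n unfolding \<psi>_def by (intro smooth_cmult schwartz_smooth \<phi>)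
    fix k js
    \<comment> \<open>From this index on the n-th seminorm dominates the one under consideration;
      the finitely many earlier functions are bounded by the sum of their own seminorms.\<close>
    define n0 where "n0 = max k (length (js :: 'n list))"
    define b where "b n = (SUP x. (1 + norm x) ^ k * cmod (iter_pderivative js (\<psi> n) x))" for n
    have \<psi>s: "\<psi> n \<in> schwartz" for n unfolding \<psi>_def by (intro schwartz_cmult \<phi>)
    have "(1 + norm x) ^ k * cmod (iter_pderivative js (\<psi> n) x) \<le> 1 + (\<Sum>n<n0. b n)" for n x
    proof (cases "n < n0")
      case True
      have "(1 + norm x) ^ k * cmod (iter_pderivative js (\<psi> n) x) \<le> b n"
        unfolding b_def by (rule schwartz_SUP_ge[OF \<psi>s])
      also have "\<dots> \<le> (\<Sum>n<n0. b n)"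
        by (rule member_le_sum) (use True in \<open>auto simp: b_def intro: schwartz_SUP_nonneg[OF \<psi>s]\<close>)
      finally show ?thesis by simp
    next
      case False
      then have n: "k \<le> n" "length js \<le> n" by (auto simp: n0_def)
      have "(1 + norm x) ^ k * cmod (iter_pderivative js (\<psi> n) x) \<le> (1 + norm x) ^ n * cmod (iter_pderivative js (\<psi> n) x)"
        by (intro mult_right_mono power_increasing n) auto
      also have "\<dots> = ((1 + norm x) ^ n * cmod (iter_pderivative js (\<phi> n) x)) / N n (\<phi> n)"
        unfolding it norm_mult norm_of_real using Npos[of n] by (simp add: divide_inverse mult_ac)
      also have "\<dots> \<le> 1" using sup_le[OF n(2)] Npos[of n] by (subst divide_le_eq_1_pos) auto
      also have "\<dots> \<le> 1 + (\<Sum>n<n0. b n)"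
        by (simp add: sum_nonneg b_def schwartz_SUP_nonneg[OF \<psi>s])
      finally show ?thesis .
    qed
    then show "polyb (\<lambda>z. 1) (\<lambda>z. (1 + norm (snd z)) ^ k * cmod (iter_pderivative js (\<psi> (fst z)) (snd z)))"
      by (intro polybI[of _ "1 + (\<Sum>n<n0. b n)" _ 0]) auto
  qed
  from bdd[OF this] obtain C where C: "\<And>n. cmod (u (\<psi> n)) \<le> C" unfolding polyb_def by auto
  have "real n < C" for n
  proof -
    have "real n < cmod (u (\<phi> n)) / N n (\<phi> n)" using \<phi>(2)[of n] Npos[of n] by (simp add: field_simps)
    also have "\<dots> = cmod (u (\<psi> n))"
      unfolding \<psi>_def cmult[OF \<phi>(1)] norm_mult norm_of_real using Npos[of n] by (simp add: divide_inverse mult.commute)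
    also have "\<dots> \<le> C" by (rule C)
    finally show ?thesis .
  qed
  then show False using reals_Archimedean2[of C] less_asym by blast
qed

section \<open>Uniqueness and the harmonic oscillator on tempered distributions\<close>

lemma harmonic_osc_linear:
  assumes "smooth f" "smooth g"
  shows "harmonic_osc (\<lambda>x. f x + g x) = (\<lambda>x. harmonic_osc f x + harmonic_osc g x)"
    "harmonic_osc (\<lambda>x. a * f x) = (\<lambda>x. a * harmonic_osc f x)"
  using iter_add[OF assms, of "[i, i]" for i] iter_cmult[OF assms(1), of "[i, i]" a for i]
  by (auto simp: harmonic_osc_def laplacian_def iter_Cons sum.distrib algebra_simps sum_distrib_left)

lemma tempered_harmonic_osc:
  assumes u: "tempered_distribution u" shows "tempered_distribution (\<lambda>\<phi>. u (harmonic_osc \<phi>))"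
proof (rule tempered_distributionI)
  show "u (harmonic_osc (\<lambda>x. \<phi> x + \<psi> x)) = u (harmonic_osc \<phi>) + u (harmonic_osc \<psi>)"
    if "\<phi> \<in> schwartz" "\<psi> \<in> schwartz" for \<phi> \<psi>
    using that by (simp add: harmonic_osc_linear schwartz_smooth tempered_add[OF u] schwartz_harmonic_osc)
  show "u (harmonic_osc (\<lambda>x. a * \<phi> x)) = a * u (harmonic_osc \<phi>)" if "\<phi> \<in> schwartz" for a \<phi>
    using that by (simp add: harmonic_osc_linear(2)[of _ \<phi>] schwartz_smooth tempered_cmult[OF u] schwartz_harmonic_osc)
  show "polyb (\<lambda>_. 1) (\<lambda>n. u (harmonic_osc (F n)))" if "schwf (\<lambda>_::nat. 1) F" for F
    by (intro tempered_schwf[OF u] schwf_harmonic_osc that) auto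
qed

text \<open>Density of test functions with a rate: for each n, \<phi> is a test function plus 1 / n
  times a member of a bounded family. As u and v agree on the former, their difference at \<phi> is
  of order 1 / n.\<close>

lemma tempered_unique:
  assumes u: "tempered_distribution u" and v: "tempered_distribution v"
    and eq: "\<And>\<psi>. \<psi> \<in> test_function \<Longrightarrow> u \<psi> = v \<psi>" and \<phi>: "\<phi> \<in> schwartz"
  shows "u \<phi> = v \<phi>"
proof -
  let ?c = "\<lambda>n. inverse (real (Suc n))"
  define R where "R = (\<lambda>n x. (of_nat (Suc n) * (1 - bump (?c n *\<^sub>R x))) * \<phi> x)"
  define T where "T = (\<lambda>n x. \<phi> x * bump (?c n *\<^sub>R x))"
  have R: "schwf (\<lambda>_. 1) R" unfolding R_def by (intro schwf_mult cutoff_modf schwartz_schwf \<phi>) auto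
  have T: "T n \<in> test_function" for n
    unfolding T_def using bump_affine_test[of "?c n" 0] by (intro test_function_mult schwartz_smooth \<phi>) simp
  have dec: "\<phi> = (\<lambda>x. T n x + of_real (?c n) * R n x)" for n
  proof
    fix x :: "real^'a"
    have "of_real (?c n) * (of_nat (Suc n) * (1 - bump (?c n *\<^sub>R x))) = 1 - bump (?c n *\<^sub>R x)"
    proof -
      have "of_real (?c n) * of_nat (Suc n) = (1::complex)" by (simp del: of_nat_Suc)
      then show ?thesis by (metis mult.assoc mult_1)
    qed
    then have "of_real (?c n) * R n x = (1 - bump (?c n *\<^sub>R x)) * \<phi> x"
      unfolding R_def by (metis mult.assoc)
    then show "\<phi> x = T n x + of_real (?c n) * R n x"
      unfolding T_def by (simp add: algebra_simps)
  qed
  have dw: "w \<phi> = w (T n) + of_real (?c n) * w (R n)" if "tempered_distribution w" for w n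
    by (subst dec[of n], subst tempered_add[OF that])
      (auto intro: test_function_schwartz T schwartz_cmult schwf_schwartz[OF R] simp: tempered_cmult[OF that] schwf_schwartz[OF R])
  have "polyb (\<lambda>_. 1) (\<lambda>n. u (R n) + (-1) * v (R n))"
    by (intro polyb_add polyb_mult polyb_const tempered_schwf[OF u R] tempered_schwf[OF v R]) auto
  then obtain C where C: "\<And>n. cmod (u (R n) - v (R n)) \<le> C" unfolding polyb_def by auto
  have "cmod (u \<phi> - v \<phi>) \<le> ?c n * C" for n
  proof -
    have "u \<phi> - v \<phi> = of_real (?c n) * (u (R n) - v (R n))"
      unfolding dw[OF u, of n] dw[OF v, of n] eq[OF T] by (simp add: algebra_simps)
    then have "cmod (u \<phi> - v \<phi>) = ?c n * cmod (u (R n) - v (R n))" by (simp add: norm_mult norm_inverse del: of_nat_Suc)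
    also have "\<dots> \<le> ?c n * C" by (intro mult_left_mono C) auto
    finally show ?thesis .
  qed
  moreover have "(\<lambda>n. ?c n * C) \<longlonglongrightarrow> 0 * C" by (intro tendsto_mult LIMSEQ_inverse_real_of_nat tendsto_const)
  ultimately have "cmod (u \<phi> - v \<phi>) \<le> 0 * C" by (intro LIMSEQ_le_const) auto
  then show ?thesis by simp
qed

lemma representsI:
  assumes "tempered_distribution u" "smooth f" "\<And>\<psi>. \<psi> \<in> test_function \<Longrightarrow> u \<psi> = (LBINT x. f x * \<psi> x)"
  shows "represents f u"
  unfolding represents_def
proof (intro conjI ballI assms(1))
  fix \<psi> assume t: "\<psi> \<in> (test_function :: (real^'a \<Rightarrow> complex) set)"
  have m: "(\<lambda>x. f x * \<psi> x) \<in> borel_measurable borel"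
    using t assms(2) by (intro smooth_measurable smooth_mult) (auto simp: test_function_def)
  show "integrable lebesgue (\<lambda>x. f x * \<psi> x)"
    using spair_integrable[of f \<psi>] t assms(2) m by (simp add: integrable_completion spair_def)
  show "u \<psi> = (LINT x|lebesgue. f x * \<psi> x)" using LINT_lebesgue[OF m] assms(3)[OF t] by simp
qed

lemma represents_test:
  assumes "represents f u" "smooth f" "\<psi> \<in> test_function"
  shows "u \<psi> = (LBINT x. f x * \<psi> x)"
proof -
  have m: "(\<lambda>x. f x * \<psi> x) \<in> borel_measurable borel"
    using assms(2,3) by (intro smooth_measurable smooth_mult) (auto simp: test_function_def)
  show ?thesis using assms(1,3) LINT_lebesgue[OF m] by (simp add: represents_def)
qed

lemma represents_harmonic_osc:
  assumes "represents f u" "smooth f"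
  shows "represents (harmonic_osc f) (\<lambda>\<phi>. u (harmonic_osc \<phi>))"
proof (rule representsI)
  show "tempered_distribution (\<lambda>\<phi>. u (harmonic_osc \<phi>))"
    using assms by (intro tempered_harmonic_osc) (simp add: represents_def)
  show "smooth (harmonic_osc f)" by (rule smooth_harmonic_osc[OF assms(2)])
  show "u (harmonic_osc \<psi>) = (LBINT x. harmonic_osc f x * \<psi> x)" if "\<psi> \<in> test_function" for \<psi>
    using represents_test[OF assms test_harmonic_osc[OF that]] harmonic_osc_symmetric[of f \<psi>] that assms(2)
    by (simp add: spair_def)
qed

lemma smooth_harmonic_osc_funpow: "smooth f \<Longrightarrow> smooth ((harmonic_osc ^^ N) f)"
  by (induction N) (auto intro: smooth_harmonic_osc)

lemma represents_harmonic_osc_funpow: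
  assumes "represents f u" "smooth f"
  shows "represents ((harmonic_osc ^^ N) f) (\<lambda>\<phi>. u ((harmonic_osc ^^ N) \<phi>))"
proof (induction N)
  case (Suc N)
  from represents_harmonic_osc[OF this smooth_harmonic_osc_funpow[OF assms(2)]]
  show ?case by (simp add: funpow_swap1)
qed (use assms in simp)

lemma represents_distribution_of: "tempered_function f \<Longrightarrow> represents f (distribution_of f)"
  unfolding tempered_function_def distribution_of_def by (erule someI_ex)

text \<open>\<open>distribution_of\<close> picks an arbitrary representing functional, so the two
  choices can be compared on Schwartz functions only. There they agree by uniqueness, since both
  represent the same smooth function.\<close>

lemma distribution_of_harmonic_osc:
  assumes "smooth f" "tempered_function f"
  shows "represents ((harmonic_osc ^^ N) f) (distribution_of ((harmonic_osc ^^ N) f))"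
    and "\<phi> \<in> schwartz \<Longrightarrow> distribution_of ((harmonic_osc ^^ N) f) \<phi> = distribution_of f ((harmonic_osc ^^ N) \<phi>)"
proof -
  let ?u = "\<lambda>\<phi>. distribution_of f ((harmonic_osc ^^ N) \<phi>)"
  have r: "represents ((harmonic_osc ^^ N) f) ?u"
    by (intro represents_harmonic_osc_funpow represents_distribution_of assms)
  then show r': "represents ((harmonic_osc ^^ N) f) (distribution_of ((harmonic_osc ^^ N) f))"
    by (intro represents_distribution_of) (auto simp: tempered_function_def)
  show "distribution_of ((harmonic_osc ^^ N) f) \<phi> = ?u \<phi>" if "\<phi> \<in> schwartz"
    by (rule tempered_unique[OF _ _ _ that]) (use r r' in \<open>auto simp: represents_def\<close>)
qed


section \<open>Hermite functions\<close>

text \<open>\<open>gd n\<close> is the \<open>n\<close>-th derivative of \<open>exp (- z\<^sup>2)\<close>. It is polymorphic so that the real function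
  inherits Cauchy's inequality from the complex one.\<close>

fun gd :: "nat \<Rightarrow> 'a::{real_normed_field,banach} \<Rightarrow> 'a" where
  "gd 0 z = exp (- (z ^ 2))"
| "gd (Suc 0) z = - 2 * z * exp (- (z ^ 2))"
| "gd (Suc (Suc n)) z = - 2 * z * gd (Suc n) z - 2 * of_nat (Suc n) * gd n z"

lemma gd_Suc: "gd (Suc n) z = - 2 * z * gd n z - 2 * of_nat n * gd (n - 1) z"
  by (cases n) auto

lemma gd_deriv: "(gd n has_field_derivative gd (Suc n) z) (at z)"
proof (induction n z rule: gd.induct)
  case (1 z)
  show ?case unfolding gd.simps(1)[abs_def]
    by (auto intro!: derivative_eq_intros simp: power2_eq_square)
next
  case (2 z)
  show ?case unfolding gd.simps(2)[abs_def]
    by (auto intro!: derivative_eq_intros simp: power2_eq_square algebra_simps)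
next
  case (3 n z)
  note [derivative_intros] = 3
  show ?case unfolding gd.simps(3)[of n, abs_def]
    by (auto intro!: derivative_eq_intros simp del: gd.simps simp: gd.simps(3)[of "Suc n"] gd.simps(3)[of n]) (simp add: algebra_simps)
qed

lemma gd_of_real: "gd n (of_real t :: complex) = of_real (gd n t)"
  by (induction n t rule: gd.induct) (simp_all add: exp_of_real[symmetric])

lemma deriv_gd: "(deriv ^^ n) (\<lambda>z. exp (- (z ^ 2))) = (gd n :: complex \<Rightarrow> complex)"
  by (induction n) (auto intro!: ext DERIV_imp_deriv gd_deriv)

text \<open>Cauchy's inequality on the circle of radius \<rho> about x: completing the square shows
  that the real part of -z^2 is at most \<rho>^2 - x^2 / 2 there. The remaining decay exp (- x^2 /
  2) is exactly what the factor exp (x^2 / 2) of a Hermite function consumes.\<close>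

lemma gd_bound:
  fixes x :: real
  assumes "\<rho> > 0"
  shows "\<bar>gd n x\<bar> \<le> fact n * exp (- x\<^sup>2 / 2 + \<rho>\<^sup>2) / \<rho> ^ n"
proof -
  let ?f = "\<lambda>z::complex. exp (- (z ^ 2))"
  have h: "?f holomorphic_on S" for S by (intro holomorphic_intros)
  have "norm ((deriv ^^ n) ?f (of_real x)) \<le> fact n * exp (- x\<^sup>2 / 2 + \<rho>\<^sup>2) / \<rho> ^ n"
  proof (rule Cauchy_inequality[OF h holomorphic_on_imp_continuous_on[OF h] assms])
    fix z :: complex assume "norm (of_real x - z) = \<rho>"
    then have r: "(x - Re z)\<^sup>2 + (Im z)\<^sup>2 = \<rho>\<^sup>2" by (auto simp: cmod_def)
    have "Re (- (z\<^sup>2)) = (Im z)\<^sup>2 - (Re z)\<^sup>2" by (simp add: power2_eq_square)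
    also have "\<dots> = - x\<^sup>2 / 2 + \<rho>\<^sup>2 - (1/2) * (x - 2 * (x - Re z))\<^sup>2"
      unfolding r[symmetric] by (simp add: power2_eq_square field_simps)
    also have "\<dots> \<le> - x\<^sup>2 / 2 + \<rho>\<^sup>2" by simp
    finally show "norm (?f z) \<le> exp (- x\<^sup>2 / 2 + \<rho>\<^sup>2)" by (simp add: norm_exp_eq_Re)
  qed
  then show ?thesis by (simp add: deriv_gd gd_of_real)
qed

text \<open>Stirling's upper bound n! <= e n (n / e)^n; the induction step rests on (1 - 1 / (n +
  1))^(n + 1) <= 1 / e.\<close>

lemma fact_exp_le: "n \<ge> 1 \<Longrightarrow> fact n * exp (real n) \<le> exp 1 * real n * real n ^ n"
proof (induction n rule: nat_induct_at_least)
  case (Suc n)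
  have "1 - inverse (real (Suc n)) \<le> exp (- inverse (real (Suc n)))"
    using exp_ge_add_one_self[of "- inverse (real (Suc n))"] by simp
  then have "(1 - inverse (real (Suc n))) ^ Suc n \<le> exp (- inverse (real (Suc n))) ^ Suc n"
    by (intro power_mono) (auto simp: field_simps)
  also have "\<dots> = exp (- 1)" by (simp del: power_Suc of_nat_Suc flip: exp_of_nat_mult)
  also have "1 - inverse (real (Suc n)) = real n / real (Suc n)" by (simp add: field_simps)
  finally have "real n ^ Suc n * exp 1 \<le> real (Suc n) ^ Suc n"
    by (simp add: power_divide exp_minus field_simps del: power_Suc of_nat_Suc)
  have "fact (Suc n) * exp (real (Suc n)) = real (Suc n) * exp 1 * (fact n * exp (real n))"
    by (simp add: exp_add)
  also have "\<dots> \<le> real (Suc n) * exp 1 * (exp 1 * real n * real n ^ n)"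
    by (intro mult_left_mono Suc.IH) auto
  also have "\<dots> = real (Suc n) * exp 1 * (real n ^ Suc n * exp 1)" by simp
  also have "\<dots> \<le> real (Suc n) * exp 1 * real (Suc n) ^ Suc n"
    by (intro mult_left_mono) (use \<open>real n ^ Suc n * exp 1 \<le> real (Suc n) ^ Suc n\<close> in auto)
  finally show ?case by (simp add: mult_ac)
qed simp

section \<open>Hermite functions of one variable\<close>

definition h1 :: "nat \<Rightarrow> real \<Rightarrow> real" where
  "h1 n t = (-1) ^ n * pi powr (- 1 / 4) * (2 ^ n * fact n) powr (- 1 / 2) * exp (t\<^sup>2 / 2) * gd n t"

text \<open>Any bound that is polynomial in n and uniform in t will do, because powers of the index
  are harmless later. It comes from Cauchy's inequality with the best radius, followed by Stirling's
  bound.\<close>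

lemma h1_bound: "\<bar>h1 n t\<bar> \<le> 2 * (1 + real n)"
proof -
  have pi: "pi powr (- 1 / 4) \<le> 1" using powr_mono[of "- 1 / 4" 0 pi] pi_ge_two by simp
  have "\<bar>h1 n t\<bar> = pi powr (- 1 / 4) * ((2 ^ n * fact n) powr (- 1 / 2) * (exp (t\<^sup>2 / 2) * \<bar>gd n t\<bar>))"
    by (simp add: h1_def abs_mult power_abs mult.assoc)
  also have "\<dots> \<le> 1 * ((2 ^ n * fact n) powr (- 1 / 2) * (exp (t\<^sup>2 / 2) * \<bar>gd n t\<bar>))"
    by (intro mult_right_mono pi) auto
  also have "\<dots> \<le> 2 * (1 + real n)"
  proof (cases "n = 0")
    case True
    have "exp (- (t\<^sup>2 / 2)) \<le> 1" by simp
    then have "exp (- (t\<^sup>2 / 2)) \<le> 2" by linarith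
    with True show ?thesis by (simp flip: exp_add)
  next
    case False
    \<comment> \<open>This radius minimizes exp (\<rho>^2) / \<rho>^n. It degenerates for n = 0,
      hence the separate case.\<close>
    define \<rho> where "\<rho> = sqrt (real n / 2)"
    have \<rho>: "\<rho> > 0" "\<rho>\<^sup>2 = real n / 2" using False by (auto simp: \<rho>_def)
    let ?p = "(2 ^ n * fact n) powr (- 1 / 2) :: real"
    have p2: "?p ^ 2 = inverse (2 ^ n * fact n)"
    proof -
      have "?p ^ 2 = (2 ^ n * fact n) powr (real 2 * (- 1 / 2))" by (rule powr_power) simp
      then show ?thesis by (simp add: powr_minus)
    qed
    have "exp (t\<^sup>2 / 2) * \<bar>gd n t\<bar> \<le> exp (t\<^sup>2 / 2) * (fact n * exp (- t\<^sup>2 / 2 + \<rho>\<^sup>2) / \<rho> ^ n)"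
      by (intro mult_left_mono gd_bound \<rho>) auto
    also have "\<dots> = fact n * exp (\<rho>\<^sup>2) / \<rho> ^ n" 
    proof -
      have "exp (- t\<^sup>2 / 2 + \<rho>\<^sup>2) = exp (- (t\<^sup>2 / 2)) * exp (\<rho>\<^sup>2)" by (simp add: exp_add[symmetric])
      moreover have "exp (t\<^sup>2 / 2) * exp (- (t\<^sup>2 / 2)) = 1" by (simp add: exp_add[symmetric])
      ultimately show ?thesis by (simp add: mult_ac)
    qed
    finally have "?p * (exp (t\<^sup>2 / 2) * \<bar>gd n t\<bar>) \<le> ?p * (fact n * exp (\<rho>\<^sup>2) / \<rho> ^ n)" by (intro mult_left_mono) auto
    moreover have "(?p * (fact n * exp (\<rho>\<^sup>2) / \<rho> ^ n)) ^ 2 \<le> (2 * (1 + real n)) ^ 2"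
    proof -
      have e: "(exp (\<rho>\<^sup>2)) ^ 2 = exp (real n)" by (simp add: \<rho>(2) flip: exp_of_nat_mult)
      have r: "(\<rho> ^ n) ^ 2 = (real n / 2) ^ n" by (metis \<rho>(2) power_mult mult.commute)
      have "(?p * (fact n * exp (\<rho>\<^sup>2) / \<rho> ^ n)) ^ 2 = inverse (2 ^ n * fact n) * (fact n ^ 2 * exp (real n) / (real n / 2) ^ n)"
        by (simp only: power_mult_distrib power_divide p2 e r)
      also have "\<dots> = fact n * exp (real n) / real n ^ n"
        using False by (simp add: power_divide power2_eq_square field_simps)
      also have "\<dots> \<le> exp 1 * real n"
        using fact_exp_le[of n] False by (simp add: field_simps)
      also have "\<dots> \<le> 3 * real n" using exp_le by (intro mult_right_mono) auto
      also have "\<dots> \<le> (2 * (1 + real n)) ^ 2" by (simp add: power2_eq_square algebra_simps)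
      finally show ?thesis .
    qed
    then have "?p * (fact n * exp (\<rho>\<^sup>2) / \<rho> ^ n) \<le> 2 * (1 + real n)" by (rule power2_le_imp_le) auto
    ultimately show ?thesis by simp
  qed
  finally show ?thesis .
qed

lemma h1_coeff_Suc:
  "(-1) ^ Suc n * pi powr (- 1 / 4) * (2 ^ Suc n * fact (Suc n)) powr (- 1 / 2) * sqrt (2 * real (Suc n))
     = - ((-1) ^ n * pi powr (- 1 / 4) * (2 ^ n * fact n) powr (- 1 / 2))"
proof -
  have "(2 ^ Suc n * fact (Suc n)) powr (- 1 / 2) = (2 ^ n * fact n) powr (- 1 / 2) * (2 * real (Suc n)) powr (- 1 / 2)"
    by (subst powr_mult[symmetric]) (auto simp: algebra_simps)
  moreover have "(2 * real (Suc n)) powr (- 1 / 2) * sqrt (2 * real (Suc n)) = 1"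
    by (simp add: powr_half_sqrt[symmetric] powr_minus del: of_nat_Suc real_sqrt_mult)
  ultimately show ?thesis by (simp add: mult_ac del: of_nat_Suc fact_Suc real_sqrt_mult)
qed

lemma sqrt_2_mult_sqrt_half: "sqrt (2 * x) = 2 * sqrt (x / 2)"
proof -
  have "sqrt (2 * x) = sqrt (4 * (x / 2))" by simp
  also have "\<dots> = 2 * sqrt (x / 2)" unfolding real_sqrt_mult by simp
  finally show ?thesis .
qed

text \<open>The recurrence of the Gaussian derivatives in normalized form. For n = 0 the truncated
  index n - 1 is harmless, as its coefficient vanishes.\<close>

lemma h1_times: "t * h1 n t = sqrt (real (Suc n) / 2) * h1 (Suc n) t + sqrt (real n / 2) * h1 (n - 1) t"
proof -
  define c where "c n = (-1) ^ n * pi powr (- 1 / 4) * (2 ^ n * fact n) powr (- 1 / 2)" for n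
  have c: "c (Suc n) * sqrt (2 * real (Suc n)) = - c n" for n using h1_coeff_Suc[of n] by (simp add: c_def)
  have h: "h1 n t = c n * exp (t\<^sup>2 / 2) * gd n t" for n by (simp add: h1_def c_def)
  have 1: "sqrt (2 * real (Suc n)) * h1 (Suc n) t = - c n * exp (t\<^sup>2 / 2) * gd (Suc n) t"
  proof -
    have "sqrt (2 * real (Suc n)) * h1 (Suc n) t = (c (Suc n) * sqrt (2 * real (Suc n))) * exp (t\<^sup>2 / 2) * gd (Suc n) t"
      by (simp only: h mult_ac)
    then show ?thesis by (simp only: c)
  qed
  have 2: "sqrt (2 * real n) * h1 (n - 1) t = - 2 * real n * c n * exp (t\<^sup>2 / 2) * gd (n - 1) t"
  proof (cases n)
    case (Suc m)
    have "sqrt (2 * real n) * sqrt (2 * real n) = 2 * real n" by simp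
    then have "- 2 * real n * c n * exp (t\<^sup>2 / 2) * gd m t = - sqrt (2 * real n) * (c (Suc m) * sqrt (2 * real (Suc m))) * exp (t\<^sup>2 / 2) * gd m t"
      unfolding Suc by (simp add: mult_ac del: of_nat_Suc real_sqrt_mult)
    also have "\<dots> = sqrt (2 * real n) * h1 m t" unfolding c h by simp
    finally show ?thesis by (simp add: Suc)
  qed simp
  have "sqrt (2 * real (Suc n)) * h1 (Suc n) t + sqrt (2 * real n) * h1 (n - 1) t = 2 * (t * h1 n t)"
    unfolding 1 2 gd_Suc[of n] h[of n] by (simp add: algebra_simps)
  then show ?thesis by (simp only: sqrt_2_mult_sqrt_half)
qed

text \<open>The exponential factor contributes t times \<open>h1 n\<close>, which the multiplication
  recurrence expands; combined with the next Gaussian derivative only the two neighbours of n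
  remain.\<close>

lemma h1_deriv: "(h1 n has_real_derivative (sqrt (real n / 2) * h1 (n - 1) t - sqrt (real (Suc n) / 2) * h1 (Suc n) t)) (at t)"
proof -
  define c where "c n = (-1) ^ n * pi powr (- 1 / 4) * (2 ^ n * fact n) powr (- 1 / 2)" for n
  have c: "c (Suc n) * sqrt (2 * real (Suc n)) = - c n" for n using h1_coeff_Suc[of n] by (simp add: c_def)
  have h: "h1 n t = c n * exp (t\<^sup>2 / 2) * gd n t" for n t by (simp add: h1_def c_def)
  have 1: "sqrt (2 * real (Suc n)) * h1 (Suc n) t = - c n * exp (t\<^sup>2 / 2) * gd (Suc n) t"
  proof -
    have "sqrt (2 * real (Suc n)) * h1 (Suc n) t = (c (Suc n) * sqrt (2 * real (Suc n))) * exp (t\<^sup>2 / 2) * gd (Suc n) t"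
      by (simp only: h mult_ac)
    then show ?thesis by (simp only: c)
  qed
  have "((\<lambda>t. c n * exp (t\<^sup>2 / 2) * gd n t) has_real_derivative (t * h1 n t + c n * exp (t\<^sup>2 / 2) * gd (Suc n) t)) (at t)"
    by (auto intro!: derivative_eq_intros gd_deriv simp: h simp del: gd.simps)
  moreover have "t * h1 n t + c n * exp (t\<^sup>2 / 2) * gd (Suc n) t = sqrt (real n / 2) * h1 (n - 1) t - sqrt (real (Suc n) / 2) * h1 (Suc n) t"
    using 1 h1_times[of t n] by (simp only: sqrt_2_mult_sqrt_half)
  ultimately show ?thesis by (simp add: h[abs_def])
qed

section \<open>Hermite functions of several variables\<close>

lemma exists_list_with_counts: "\<exists>js. \<forall>i. count_list js i = (\<alpha> :: 'n::finite \<Rightarrow> nat) i"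
proof -
  have rep: "count_list (replicate n j) i = (if i = j then n else 0)" for n and i j :: 'n
    by (induction n) auto
  have "\<exists>js. \<forall>i. count_list js i = (if i \<in> S then \<alpha> i else 0)" if "finite S" for S
    using that
  proof (induction S)
    case empty
    show ?case by (intro exI[of _ "[]"]) simp
  next
    case (insert j S)
    then obtain js where "\<forall>i. count_list js i = (if i \<in> S then \<alpha> i else 0)" by blast
    with insert(2) show ?case by (intro exI[of _ "replicate (\<alpha> j) j @ js"]) (auto simp: count_list_append rep)
  qed
  from this[of UNIV] show ?thesis by simp
qed

lemma pderivative_prod_coords:
  fixes g g' :: "'n::finite \<Rightarrow> real \<Rightarrow> real"
  assumes "\<And>i t. (g i has_real_derivative g' i t) (at t)"
  shows "((\<lambda>x::real^'n. \<Prod>i\<in>UNIV. g i (x $ i)) has_derivative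
     (\<lambda>h. \<Sum>i\<in>UNIV. (h $ i * g' i (x $ i)) * (\<Prod>j\<in>UNIV - {i}. g j (x $ j)))) (at x)"
    and "pderivative j (\<lambda>x::real^'n. \<Prod>i\<in>UNIV. g i (x $ i)) x = g' j (x $ j) * (\<Prod>k\<in>UNIV - {j}. g k (x $ k))"
proof -
  have "((\<lambda>x::real^'n. g i (x $ i)) has_derivative (\<lambda>h. h $ i * g' i (x $ i))) (at x)" for i
    using DERIV_compose_FDERIV[OF assms bounded_linear.has_derivative[OF bounded_linear_vec_nth has_derivative_ident], of i i] .
  then show *: "((\<lambda>x::real^'n. \<Prod>i\<in>UNIV. g i (x $ i)) has_derivative
     (\<lambda>h. \<Sum>i\<in>UNIV. (h $ i * g' i (x $ i)) * (\<Prod>j\<in>UNIV - {i}. g j (x $ j)))) (at x)"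
    by (intro has_derivative_prod) auto
  have "pderivative j (\<lambda>x::real^'n. \<Prod>i\<in>UNIV. g i (x $ i)) x =
     (\<Sum>i\<in>UNIV. if i = j then g' i (x $ i) * (\<Prod>j\<in>UNIV - {i}. g j (x $ j)) else 0)"
    unfolding pderivative_eqI[OF *] by (intro sum.cong) (auto simp: axis_def)
  then show "pderivative j (\<lambda>x::real^'n. \<Prod>i\<in>UNIV. g i (x $ i)) x = g' j (x $ j) * (\<Prod>k\<in>UNIV - {j}. g k (x $ k))"
    by simp
qed

lemma prod_fun_upd:
  fixes g :: "'n::finite \<Rightarrow> nat \<Rightarrow> 'b::comm_monoid_mult"
  shows "(\<Prod>i\<in>UNIV. g i ((\<alpha>(j := k)) i)) = g j k * (\<Prod>i\<in>UNIV - {j}. g i (\<alpha> i))"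
proof -
  have "(\<Prod>i\<in>UNIV - {j}. g i ((\<alpha>(j := k)) i)) = (\<Prod>i\<in>UNIV - {j}. g i (\<alpha> i))"
    by (intro prod.cong) auto
  then show ?thesis using prod.remove[of UNIV j "\<lambda>i. g i ((\<alpha>(j := k)) i)"] by simp
qed

text \<open>The Gaussian separates into coordinates, so an iterated derivative of it depends only on
  how often each coordinate occurs in the list. The arbitrary list chosen in
  \<open>mderivative\<close> is therefore immaterial, as soon as one with the right counts
  exists.\<close>

lemma mderivative_gaussian:
  "mderivative \<alpha> (\<lambda>y::real^'n. exp (- (norm y)\<^sup>2)) x = (\<Prod>i\<in>UNIV. gd (\<alpha> i) (x $ i))"
proof -
  have it: "iter_pderivative js (\<lambda>y::real^'n. exp (- (norm y)\<^sup>2)) = (\<lambda>x. \<Prod>i\<in>UNIV. gd (count_list js i) (x $ i))" for js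
  proof (induction js)
    case Nil
    show ?case by (simp add: norm_sq_coords exp_sum flip: sum_negf)
  next
    case (Cons j js)
    have eq: "count_list (j # js) = (count_list js)(j := Suc (count_list js j))" by auto
    show ?case
    proof
      fix x :: "real^'n"
      show "iter_pderivative (j # js) (\<lambda>y. exp (- (norm y)\<^sup>2)) x = (\<Prod>i\<in>UNIV. gd (count_list (j # js) i) (x $ i))"
        unfolding iter_Cons Cons.IH eq prod_fun_upd[where g="\<lambda>i k. gd k (x $ i)"]
        by (rule pderivative_prod_coords(2)) (rule gd_deriv)
    qed
  qed
  have "\<forall>i. count_list (SOME js. \<forall>i. count_list js i = \<alpha> i) i = \<alpha> i"
    by (rule someI_ex[OF exists_list_with_counts])
  then show ?thesis by (simp add: mderivative_def it)
qed

lemma hermite_function_prod: "hermite_function \<alpha> x = of_real (\<Prod>i\<in>UNIV. h1 (\<alpha> i) (x $ i))"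
proof -
  have "pi powr (- real CARD('a) / 4) = (\<Prod>i\<in>(UNIV::'a set). pi powr (- 1 / 4))"
    by (simp add: powr_power)
  moreover have "(-1::real) ^ mabs \<alpha> = (\<Prod>i\<in>UNIV. (-1) ^ \<alpha> i)" by (simp add: mabs_def power_sum)
  moreover have "(2 ^ mabs \<alpha> * real (mfact \<alpha>)) powr (- 1 / 2) = (\<Prod>i\<in>UNIV. (2 ^ \<alpha> i * fact (\<alpha> i)) powr (- 1 / 2))"
    by (subst prod_powr_distrib[symmetric]) (auto simp: mabs_def mfact_def power_sum prod.distrib)
  moreover have "exp ((norm x)\<^sup>2 / 2) = (\<Prod>i\<in>UNIV. exp ((x $ i)\<^sup>2 / 2))"
    by (simp add: norm_sq_coords sum_divide_distrib exp_sum)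
  ultimately show ?thesis
    unfolding hermite_function_def mderivative_gaussian h1_def by (simp only: prod.distrib mult_ac)
qed

lemma hermite_upd:
  "hermite_function (\<alpha>(j := k)) x = of_real (h1 k (x $ j) * (\<Prod>i\<in>UNIV - {j}. h1 (\<alpha> i) (x $ i)))"
  unfolding hermite_function_prod prod_fun_upd[where g="\<lambda>i k. h1 k (x $ i)"] ..

lemma hermite_split: "hermite_function \<alpha> x = of_real (h1 (\<alpha> j) (x $ j) * (\<Prod>i\<in>UNIV - {j}. h1 (\<alpha> i) (x $ i)))"
  using hermite_upd[of \<alpha> j "\<alpha> j" x] by simp

lemma hermite_coord:
  "of_real (x $ j) * hermite_function \<alpha> x =
     of_real (sqrt (real (Suc (\<alpha> j)) / 2)) * hermite_function (\<alpha>(j := Suc (\<alpha> j))) x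
     + of_real (sqrt (real (\<alpha> j) / 2)) * hermite_function (\<alpha>(j := \<alpha> j - 1)) x"
proof -
  define R where "R = (\<Prod>i\<in>UNIV - {j}. h1 (\<alpha> i) (x $ i))"
  have "x $ j * (h1 (\<alpha> j) (x $ j) * R) = sqrt (real (Suc (\<alpha> j)) / 2) * (h1 (Suc (\<alpha> j)) (x $ j) * R) + sqrt (real (\<alpha> j) / 2) * (h1 (\<alpha> j - 1) (x $ j) * R)"
    using arg_cong[OF h1_times[of "x $ j" "\<alpha> j"], of "\<lambda>t. t * R"] by (simp only: distrib_right mult.assoc)
  then show ?thesis
    unfolding hermite_split[of \<alpha> x j] hermite_upd R_def[symmetric] of_real_mult[symmetric] of_real_add[symmetric]
    by (simp only:)
qed

lemma hermite_has_derivative: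
  "hermite_function \<alpha> differentiable (at x)"
  "pderivative j (hermite_function \<alpha>) x =
     of_real (sqrt (real (\<alpha> j) / 2)) * hermite_function (\<alpha>(j := \<alpha> j - 1)) x
     + (- of_real (sqrt (real (Suc (\<alpha> j)) / 2))) * hermite_function (\<alpha>(j := Suc (\<alpha> j))) x"
proof -
  let ?g = "\<lambda>i. h1 (\<alpha> i)" and ?g' = "\<lambda>i t. sqrt (real (\<alpha> i) / 2) * h1 (\<alpha> i - 1) t - sqrt (real (Suc (\<alpha> i)) / 2) * h1 (Suc (\<alpha> i)) t"
  have f: "hermite_function \<alpha> = (\<lambda>x. of_real (\<Prod>i\<in>UNIV. ?g i (x $ i)))" by (auto simp: hermite_function_prod)
  note d = pderivative_prod_coords[of ?g ?g', OF h1_deriv]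
  have dd: "(\<lambda>x. \<Prod>i\<in>UNIV. ?g i (x $ i)) differentiable (at x)" for x :: "real^'a"
    using d(1) by (rule differentiableI)
  show "hermite_function \<alpha> differentiable (at x)"
    unfolding f using has_derivative_of_real[OF d(1), where 'a=complex] by (rule differentiableI)
  define R where "R = (\<Prod>i\<in>UNIV - {j}. h1 (\<alpha> i) (x $ i))"
  have "pderivative j (hermite_function \<alpha>) x = of_real (?g' j (x $ j) * R)"
    unfolding f pderivative_bounded_linear[OF bounded_linear_of_real dd] d(2) R_def ..
  also have "?g' j (x $ j) * R = sqrt (real (\<alpha> j) / 2) * (h1 (\<alpha> j - 1) (x $ j) * R) + (- sqrt (real (Suc (\<alpha> j)) / 2)) * (h1 (Suc (\<alpha> j)) (x $ j) * R)"
    by (simp add: algebra_simps)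
  finally show "pderivative j (hermite_function \<alpha>) x =
     of_real (sqrt (real (\<alpha> j) / 2)) * hermite_function (\<alpha>(j := \<alpha> j - 1)) x
     + (- of_real (sqrt (real (Suc (\<alpha> j)) / 2))) * hermite_function (\<alpha>(j := Suc (\<alpha> j))) x"
    unfolding hermite_upd R_def[symmetric] by (simp only: of_real_add of_real_mult of_real_minus)
qed

lemma pderivative_hermite:
  "pderivative j (hermite_function \<alpha>) = (\<lambda>x.
     of_real (sqrt (real (\<alpha> j) / 2)) * hermite_function (\<alpha>(j := \<alpha> j - 1)) x
     + (- of_real (sqrt (real (Suc (\<alpha> j)) / 2))) * hermite_function (\<alpha>(j := Suc (\<alpha> j))) x)"
  by (rule ext) (rule hermite_has_derivative)

lemma smooth_hermite: "smooth (hermite_function \<alpha>)"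
proof (rule alg_smooth[of "range hermite_function"])
  show "pderivative i g \<in> alg (range hermite_function)" if "g \<in> range hermite_function" for g and i :: 'a
  proof -
    from that obtain \<beta> where g: "g = hermite_function \<beta>" by blast
    show ?thesis unfolding g pderivative_hermite by (intro alg.add alg.mult alg.const alg.gen rangeI)
  qed
qed (auto intro: hermite_has_derivative alg.gen)

lemma harmonic_osc_hermite:
  "harmonic_osc (hermite_function \<alpha>) x = of_real (2 * real (mabs \<alpha>) + real CARD('n)) * hermite_function \<alpha> (x::real^'n)"
proof -
  \<comment> \<open>The ladder operators in coordinate j: x plus derivative lowers the j-th index, x
    minus derivative raises it.\<close>
  have low: "of_real (x $ j) * hermite_function \<beta> x + pderivative j (hermite_function \<beta>) x
      = 2 * of_real (sqrt (real (\<beta> j) / 2)) * hermite_function (\<beta>(j := \<beta> j - 1)) x"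
   and up: "of_real (x $ j) * hermite_function \<beta> x - pderivative j (hermite_function \<beta>) x
      = 2 * of_real (sqrt (real (Suc (\<beta> j)) / 2)) * hermite_function (\<beta>(j := Suc (\<beta> j))) x" for j \<beta>
    unfolding hermite_coord pderivative_hermite by simp_all
  have "of_real ((x $ j)\<^sup>2) * hermite_function \<alpha> x - pderivative j (pderivative j (hermite_function \<alpha>)) x
     = of_real (2 * real (\<alpha> j) + 1) * hermite_function \<alpha> x" for j
  proof -
    define A where "A = \<alpha>(j := Suc (\<alpha> j))"
    define B where "B = \<alpha>(j := \<alpha> j - 1)"
    define a where "a = sqrt (real (Suc (\<alpha> j)) / 2)"
    define b where "b = sqrt (real (\<alpha> j) / 2)"
    have a2: "a * a = real (Suc (\<alpha> j)) / 2" and b2: "b * b = real (\<alpha> j) / 2" by (simp_all add: a_def b_def)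
    have "pderivative j (hermite_function \<alpha>) = (\<lambda>x. of_real b * hermite_function B x + (- of_real a) * hermite_function A x)"
      unfolding pderivative_hermite a_def b_def A_def B_def ..
    then have "pderivative j (pderivative j (hermite_function \<alpha>)) =
      pderivative j (\<lambda>x. of_real b * hermite_function B x + (- of_real a) * hermite_function A x)" by simp
    also have "\<dots> = (\<lambda>x. of_real b * pderivative j (hermite_function B) x + (- of_real a) * pderivative j (hermite_function A) x)"
      using iter_add[OF smooth_cmult[OF smooth_hermite] smooth_cmult[OF smooth_hermite], of "[j]"]
        iter_cmult[OF smooth_hermite, of "[j]"] by (simp only: iter_Cons iter_Nil)
    finally have pp: "pderivative j (pderivative j (hermite_function \<alpha>)) x
      = of_real b * pderivative j (hermite_function B) x - of_real a * pderivative j (hermite_function A) x" by simp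
    have xx: "of_real ((x $ j)\<^sup>2) * hermite_function \<alpha> x
       = of_real a * (of_real (x $ j) * hermite_function A x) + of_real b * (of_real (x $ j) * hermite_function B x)"
      using arg_cong[OF hermite_coord[of x j \<alpha>], of "\<lambda>t. of_real (x $ j) * t"]
      unfolding a_def b_def A_def B_def by (simp add: power2_eq_square algebra_simps)
    \<comment> \<open>Regrouped so that the lowering operator acts on the raised function A and the
      raising operator on the lowered function B; the squares of the coefficients then add up to the
      eigenvalue.\<close>
    have "of_real ((x $ j)\<^sup>2) * hermite_function \<alpha> x - pderivative j (pderivative j (hermite_function \<alpha>)) x
       = of_real a * (of_real (x $ j) * hermite_function A x + pderivative j (hermite_function A) x)
       + of_real b * (of_real (x $ j) * hermite_function B x - pderivative j (hermite_function B) x)"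
      unfolding xx pp by (simp add: algebra_simps)
    also have "of_real (x $ j) * hermite_function A x + pderivative j (hermite_function A) x = 2 * of_real a * hermite_function \<alpha> x"
      unfolding low by (simp add: A_def a_def)
    also have "of_real b * (of_real (x $ j) * hermite_function B x - pderivative j (hermite_function B) x) = of_real b * (2 * of_real b * hermite_function \<alpha> x)"
    \<comment> \<open>For \<alpha> j = 0 the truncated predecessor makes B equal to \<alpha>, and
      the coefficient b is 0.\<close>
    proof (cases "\<alpha> j")
      case (Suc n)
      then have "B(j := Suc (B j)) = \<alpha>" by (auto simp: B_def)
      then show ?thesis unfolding up by (simp add: B_def b_def Suc)
    qed (simp add: b_def)
    also have "of_real a * (2 * of_real a * hermite_function \<alpha> x) + of_real b * (2 * of_real b * hermite_function \<alpha> x)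
       = of_real (2 * (a * a) + 2 * (b * b)) * hermite_function \<alpha> x" by (simp add: algebra_simps)
    also have "2 * (a * a) + 2 * (b * b) = 2 * real (\<alpha> j) + 1" unfolding a2 b2 by simp
    finally show ?thesis .
  qed
  then have "(\<Sum>j\<in>UNIV. of_real ((x $ j)\<^sup>2) * hermite_function \<alpha> x - pderivative j (pderivative j (hermite_function \<alpha>)) x)
     = (\<Sum>j\<in>UNIV. of_real (2 * real (\<alpha> j) + 1) * hermite_function \<alpha> x)" by simp
  also have "\<dots> = of_real (2 * real (mabs \<alpha>) + real CARD('n)) * hermite_function \<alpha> x"
    unfolding sum_distrib_right[symmetric] of_real_sum[symmetric] by (simp add: mabs_def sum.distrib sum_distrib_left)
  finally show ?thesis
    unfolding harmonic_osc_def laplacian_def norm_sq_coords by (simp add: sum_subtractf sum_distrib_right)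
qed

lemma harmonic_osc_funpow_hermite:
  "(harmonic_osc ^^ N) (hermite_function \<alpha>) = (\<lambda>x::real^'n. of_real ((2 * real (mabs \<alpha>) + real CARD('n)) ^ N) * hermite_function \<alpha> x)"
proof (induction N)
  case (Suc N)
  let ?l = "2 * real (mabs \<alpha>) + real CARD('n)"
  have "(harmonic_osc ^^ Suc N) (hermite_function \<alpha>) = harmonic_osc (\<lambda>x. of_real (?l ^ N) * hermite_function \<alpha> x)"
    by (simp only: funpow.simps o_apply Suc.IH)
  also have "\<dots> = (\<lambda>x. of_real (?l ^ N) * harmonic_osc (hermite_function \<alpha>) x)"
    by (rule harmonic_osc_linear(2)[OF smooth_hermite smooth_hermite])
  also have "\<dots> = (\<lambda>x. of_real (?l ^ Suc N) * hermite_function \<alpha> x)"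
    unfolding harmonic_osc_hermite by (simp only: power_Suc of_real_mult mult_ac)
  finally show ?case .
qed simp

subsection \<open>Polynomial bounds in the multi-index\<close>

abbreviation Pm :: "('n::finite \<Rightarrow> nat) \<Rightarrow> real" where
  "Pm \<alpha> \<equiv> 1 + real (mabs \<alpha>)"

lemma Pm_ge: "Pm \<alpha> \<ge> 1" by simp

lemma le_mabs: "\<alpha> i \<le> mabs (\<alpha> :: 'n::finite \<Rightarrow> nat)"
  unfolding mabs_def by (rule member_le_sum) auto

lemma mabs_upd: "mabs (\<alpha>(j := k)) + \<alpha> j = mabs (\<alpha> :: 'n::finite \<Rightarrow> nat) + k"
  unfolding mabs_def using sum.remove[of UNIV j \<alpha>] sum.remove[of UNIV j "\<alpha>(j := k)"] by simp

lemma hermite_bound: "cmod (hermite_function \<alpha> (x::real^'n)) \<le> 2 ^ CARD('n) * Pm \<alpha> ^ CARD('n)"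
proof -
  have "cmod (hermite_function \<alpha> x) = (\<Prod>i\<in>UNIV. \<bar>h1 (\<alpha> i) (x $ i)\<bar>)"
    unfolding hermite_function_prod norm_of_real abs_prod ..
  also have "\<dots> \<le> (\<Prod>i\<in>(UNIV::'n set). 2 * Pm \<alpha>)"
  proof (rule prod_mono, safe)
    fix i
    have "\<bar>h1 (\<alpha> i) (x $ i)\<bar> \<le> 2 * (1 + real (\<alpha> i))" by (rule h1_bound)
    also have "\<dots> \<le> 2 * Pm \<alpha>" using le_mabs[of \<alpha> i] by simp
    finally show "\<bar>h1 (\<alpha> i) (x $ i)\<bar> \<le> 2 * Pm \<alpha>" .
  qed simp
  finally show ?thesis by (simp only: prod_constant power_mult_distrib)
qed

text \<open>Multiplication by a coordinate and differentiation send a Hermite function to its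
  neighbours, with coefficients of the size of a square root of the index. This class is stable
  under both operations, so every Schwartz seminorm of the Hermite functions reduces to their sup
  norm; m bounds the accumulated shift of the index.\<close>

inductive hfam :: "(('n::finite \<Rightarrow> nat) \<Rightarrow> real^'n \<Rightarrow> complex) \<Rightarrow> bool" where
  base: "polyb Pm a \<Longrightarrow> (\<And>\<alpha>. mabs (\<sigma> \<alpha>) \<le> mabs \<alpha> + m) \<Longrightarrow> hfam (\<lambda>\<alpha> x. a \<alpha> * hermite_function (\<sigma> \<alpha>) x)"
| add: "hfam F \<Longrightarrow> hfam G \<Longrightarrow> hfam (\<lambda>\<alpha> x. F \<alpha> x + G \<alpha> x)"

lemma hfam_smooth: "hfam F \<Longrightarrow> smooth (F \<alpha>)"
  by (induction rule: hfam.induct) (auto intro: smooth_add smooth_cmult smooth_hermite)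

lemma Pm_shift: assumes "mabs \<beta> \<le> mabs \<alpha> + m" shows "Pm \<beta> \<le> real (Suc m) * Pm \<alpha>"
proof -
  have "real (mabs \<beta>) \<le> real (mabs \<alpha>) + real m" using assms by (simp flip: of_nat_add)
  moreover have "0 \<le> real m * real (mabs \<alpha>)" by simp
  moreover have "real (Suc m) * Pm \<alpha> = 1 + real m + real (mabs \<alpha>) + real m * real (mabs \<alpha>)"
    by (simp add: algebra_simps)
  ultimately show ?thesis by linarith
qed

lemma polyb_sqrt:
  assumes "\<And>\<alpha>. mabs (\<sigma> \<alpha>) \<le> mabs \<alpha> + m"
  shows "polyb Pm (\<lambda>\<alpha>. of_real (sqrt (real (\<sigma> \<alpha> j) / 2)) :: complex)" "polyb Pm (\<lambda>\<alpha>. of_real (sqrt (real (Suc (\<sigma> \<alpha> j)) / 2)) :: complex)"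
proof -
  have s: "sqrt (y / 2) \<le> 1 + y" if "y \<ge> 0" for y :: real
    by (rule real_le_lsqrt) (use that in \<open>auto simp: power2_eq_square algebra_simps\<close>)
  have b: "1 + real (Suc (\<sigma> \<alpha> j)) \<le> 2 * real (Suc m) * Pm \<alpha> ^ 1" for \<alpha>
  proof -
    have "real (\<sigma> \<alpha> j) \<le> real (mabs (\<sigma> \<alpha>))" using le_mabs[of "\<sigma> \<alpha>" j] by simp
    moreover have "1 \<le> Pm (\<sigma> \<alpha>)" "Pm (\<sigma> \<alpha>) \<le> real (Suc m) * Pm \<alpha>" using Pm_shift[OF assms[of \<alpha>]] by simp_all
    ultimately have "1 + real (Suc (\<sigma> \<alpha> j)) \<le> 2 * (real (Suc m) * Pm \<alpha>)" by linarith
    then show ?thesis by (simp only: mult.assoc power_one_right)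
  qed
  show "polyb Pm (\<lambda>\<alpha>. of_real (sqrt (real (\<sigma> \<alpha> j) / 2)) :: complex)"
  proof (rule polybI)
    show "norm (of_real (sqrt (real (\<sigma> \<alpha> j) / 2)) :: complex) \<le> 2 * real (Suc m) * Pm \<alpha> ^ 1" for \<alpha>
      using s[of "real (\<sigma> \<alpha> j)"] b[of \<alpha>] by (simp del: power_one_right)
  qed
  show "polyb Pm (\<lambda>\<alpha>. of_real (sqrt (real (Suc (\<sigma> \<alpha> j)) / 2)) :: complex)"
  proof (rule polybI)
    show "norm (of_real (sqrt (real (Suc (\<sigma> \<alpha> j)) / 2)) :: complex) \<le> 2 * real (Suc m) * Pm \<alpha> ^ 1" for \<alpha>
      using s[of "real (Suc (\<sigma> \<alpha> j))"] b[of \<alpha>] by (simp del: power_one_right)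
  qed
qed

lemma mabs_shift:
  assumes "mabs (\<beta> :: 'n::finite \<Rightarrow> nat) \<le> mabs \<alpha> + m"
  shows "mabs (\<beta>(j := \<beta> j - 1)) \<le> mabs \<alpha> + Suc m" "mabs (\<beta>(j := Suc (\<beta> j))) \<le> mabs \<alpha> + Suc m"
  using mabs_upd[of \<beta> j "\<beta> j - 1"] mabs_upd[of \<beta> j "Suc (\<beta> j)"] assms by auto

lemma hfam_coord: "hfam F \<Longrightarrow> hfam (\<lambda>\<alpha> x. of_real (x $ j) * F \<alpha> x)"
proof (induction rule: hfam.induct)
  case (base a \<sigma> m)
  have "hfam (\<lambda>\<alpha> x. (a \<alpha> * of_real (sqrt (real (Suc (\<sigma> \<alpha> j)) / 2))) * hermite_function ((\<sigma> \<alpha>)(j := Suc (\<sigma> \<alpha> j))) x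
     + (a \<alpha> * of_real (sqrt (real (\<sigma> \<alpha> j) / 2))) * hermite_function ((\<sigma> \<alpha>)(j := \<sigma> \<alpha> j - 1)) x)"
    by (rule hfam.add; rule hfam.base[where m="Suc m"])
      (intro polyb_mult base(1) polyb_sqrt[OF base(2)] Pm_ge mabs_shift[OF base(2)])+
  moreover have "of_real (x $ j) * (a \<alpha> * hermite_function (\<sigma> \<alpha>) x) =
     (a \<alpha> * of_real (sqrt (real (Suc (\<sigma> \<alpha> j)) / 2))) * hermite_function ((\<sigma> \<alpha>)(j := Suc (\<sigma> \<alpha> j))) x
     + (a \<alpha> * of_real (sqrt (real (\<sigma> \<alpha> j) / 2))) * hermite_function ((\<sigma> \<alpha>)(j := \<sigma> \<alpha> j - 1)) x" for \<alpha> x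
    using arg_cong[OF hermite_coord[of x j "\<sigma> \<alpha>"], of "\<lambda>t. a \<alpha> * t"] by (simp only: distrib_left mult_ac)
  ultimately show ?case by simp
next
  case (add F G)
  then show ?case by (simp add: distrib_left hfam.add)
qed

lemma hfam_pderivative: "hfam F \<Longrightarrow> hfam (\<lambda>\<alpha>. pderivative j (F \<alpha>))"
proof (induction rule: hfam.induct)
  case (base a \<sigma> m)
  have "hfam (\<lambda>\<alpha> x. (a \<alpha> * of_real (sqrt (real (\<sigma> \<alpha> j) / 2))) * hermite_function ((\<sigma> \<alpha>)(j := \<sigma> \<alpha> j - 1)) x
     + ((- 1) * (a \<alpha> * of_real (sqrt (real (Suc (\<sigma> \<alpha> j)) / 2)))) * hermite_function ((\<sigma> \<alpha>)(j := Suc (\<sigma> \<alpha> j))) x)"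
    by (rule hfam.add; rule hfam.base[where m="Suc m"])
      (intro polyb_mult polyb_const base(1) polyb_sqrt[OF base(2)] Pm_ge mabs_shift[OF base(2)])+
  moreover have "pderivative j (\<lambda>x. a \<alpha> * hermite_function (\<sigma> \<alpha>) x) =
     (\<lambda>x. (a \<alpha> * of_real (sqrt (real (\<sigma> \<alpha> j) / 2))) * hermite_function ((\<sigma> \<alpha>)(j := \<sigma> \<alpha> j - 1)) x
     + ((- 1) * (a \<alpha> * of_real (sqrt (real (Suc (\<sigma> \<alpha> j)) / 2)))) * hermite_function ((\<sigma> \<alpha>)(j := Suc (\<sigma> \<alpha> j))) x)" for \<alpha>
    using iter_cmult[OF smooth_hermite, of "[j]" "a \<alpha>" "\<sigma> \<alpha>"]
    by (auto simp: iter_Cons pderivative_hermite algebra_simps)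
  ultimately show ?case by simp
next
  case (add F G)
  then show ?case
    by (simp add: pderivative_add smooth_differentiable hfam_smooth hfam.add)
qed

lemma hfam_iter: "hfam F \<Longrightarrow> hfam (\<lambda>\<alpha>. iter_pderivative js (F \<alpha>))"
  by (induction js) (auto simp: iter_Cons intro: hfam_pderivative)

lemma hfam_bound: "hfam F \<Longrightarrow> polyb (\<lambda>z. Pm (fst z)) (\<lambda>z. F (fst z) (snd z :: real^'n))"
proof (induction rule: hfam.induct)
  case (base a \<sigma> m)
  have "polyb (\<lambda>z. Pm (fst z)) (\<lambda>z. hermite_function (\<sigma> (fst z)) (snd z :: real^'n))"
  proof (rule polybI)
    fix z :: "('n \<Rightarrow> nat) \<times> (real^'n)"
    have "cmod (hermite_function (\<sigma> (fst z)) (snd z)) \<le> 2 ^ CARD('n) * Pm (\<sigma> (fst z)) ^ CARD('n)"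
      by (rule hermite_bound)
    also have "\<dots> \<le> 2 ^ CARD('n) * (real (Suc m) * Pm (fst z)) ^ CARD('n)"
      by (intro mult_left_mono power_mono Pm_shift base(2)) auto
    finally show "cmod (hermite_function (\<sigma> (fst z)) (snd z)) \<le> (2 ^ CARD('n) * real (Suc m) ^ CARD('n)) * Pm (fst z) ^ CARD('n)"
      by (simp only: power_mult_distrib mult.assoc)
  qed
  then show ?case by (intro polyb_mult polyb_reindex[OF base(1), of fst]) auto
qed (auto intro: polyb_add)

text \<open>A factor 1 + |x| is dominated by 1 plus the sum of the |x_j|, and multiplication by x_j
  does not leave the class.\<close>

lemma hfam_weighted_bound:
  "hfam F \<Longrightarrow> polyb (\<lambda>z. Pm (fst z)) (\<lambda>z. (1 + norm (snd z)) ^ k * cmod (F (fst z) (snd z :: real^'n)))"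
proof (induction k arbitrary: F)
  case 0
  then show ?case using hfam_bound[of F] by (simp add: polyb_norm)
next
  case (Suc k)
  have "polyb (\<lambda>z. Pm (fst z)) (\<lambda>z. (1 + norm (snd z)) ^ k * cmod (F (fst z) (snd z))
     + (\<Sum>j\<in>UNIV. (1 + norm (snd z)) ^ k * cmod (of_real (snd z $ j) * F (fst z) (snd z))))"
    by (intro polyb_add polyb_sum Suc hfam_coord) auto
  then show ?case
  proof (rule polyb_mono)
    fix z :: "('n \<Rightarrow> nat) \<times> (real^'n)"
    have "1 + norm (snd z) \<le> 1 + (\<Sum>j\<in>UNIV. \<bar>snd z $ j\<bar>)" using norm_le_l1_cart[of "snd z"] by simp
    then have "(1 + norm (snd z)) * ((1 + norm (snd z)) ^ k * cmod (F (fst z) (snd z)))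
       \<le> (1 + (\<Sum>j\<in>UNIV. \<bar>snd z $ j\<bar>)) * ((1 + norm (snd z)) ^ k * cmod (F (fst z) (snd z)))"
      by (rule mult_right_mono) simp
    also have "\<dots> = (1 + norm (snd z)) ^ k * cmod (F (fst z) (snd z))
     + (\<Sum>j\<in>UNIV. (1 + norm (snd z)) ^ k * cmod (of_real (snd z $ j) * F (fst z) (snd z)))"
      by (simp add: distrib_left distrib_right sum_distrib_left sum_distrib_right norm_mult mult_ac)
    finally show "norm ((1 + norm (snd z)) ^ Suc k * cmod (F (fst z) (snd z))) \<le> norm ((1 + norm (snd z)) ^ k * cmod (F (fst z) (snd z))
     + (\<Sum>j\<in>UNIV. (1 + norm (snd z)) ^ k * cmod (of_real (snd z $ j) * F (fst z) (snd z))))"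
      by (simp add: mult.assoc)
  qed
qed

lemma schwf_hermite: "schwf Pm (hermite_function :: ('n::finite \<Rightarrow> nat) \<Rightarrow> real^'n \<Rightarrow> complex)"
proof -
  have "hfam (\<lambda>\<alpha> x. 1 * hermite_function ((\<lambda>\<alpha>. \<alpha>) \<alpha>) x :: complex)" for dummy :: 'n
    by (rule hfam.base[of _ _ 0]) (auto intro: polyb_const)
  then have h: "hfam (hermite_function :: ('n \<Rightarrow> nat) \<Rightarrow> real^'n \<Rightarrow> complex)" by simp
  show ?thesis unfolding schwf_def
    by (auto intro!: smooth_hermite hfam_weighted_bound hfam_iter h)
qed

lemma schwartz_hermite: "hermite_function \<alpha> \<in> schwartz"
  by (rule schwf_schwartz[OF schwf_hermite])

text \<open>The eigenvalue relation and the symmetry of H turn N powers of 2|\<alpha>| + d into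
  \<open>H^N\<close> acting on F, which is again a family of the same kind. The power d of
  \<open>Pm \<alpha>\<close> on the right is the bound for the sup norm of the Hermite
  function.\<close>

lemma hermite_pairing_decay:
  fixes F :: "'i \<Rightarrow> real^'n \<Rightarrow> complex"
  assumes F: "schwf P F" and P: "\<And>i. P i \<ge> 1"
  obtains C m where "C > 0"
    "\<And>\<alpha> \<iota>. Pm \<alpha> ^ N * cmod (LBINT x. hermite_function \<alpha> x * F \<iota> x) \<le> C * Pm \<alpha> ^ CARD('n) * P \<iota> ^ m"
proof -
  obtain C m where C: "C > 0" "\<And>\<iota> x. (1 + norm x) ^ 0 * cmod (iter_pderivative [] ((harmonic_osc ^^ N) (F \<iota>)) x) \<le> C * P \<iota> ^ m * wt x"
    using schwf_wt_bound[OF schwf_harmonic_osc_funpow[OF F P] P] by blast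
  define W where "W = integral\<^sup>L lborel (wt :: real^'n \<Rightarrow> real)"
  have W: "W \<ge> 0" unfolding W_def by (rule integral_wt_nonneg)
  have "Pm \<alpha> ^ N * cmod (LBINT x. hermite_function \<alpha> x * F \<iota> x) \<le> (C * 2 ^ CARD('n) * W + 1) * Pm \<alpha> ^ CARD('n) * P \<iota> ^ m" for \<alpha> \<iota>
  proof -
    let ?l = "2 * real (mabs \<alpha>) + real CARD('n)"
    have s: "spair (hermite_function \<alpha>) (F \<iota>)" by (simp add: spair_def schwartz_hermite schwf_schwartz[OF F])
    have "Pm \<alpha> \<le> ?l" using zero_less_card_finite[where 'a='n] by linarith
    then have "Pm \<alpha> ^ N * cmod (LBINT x. hermite_function \<alpha> x * F \<iota> x) \<le> ?l ^ N * cmod (LBINT x. hermite_function \<alpha> x * F \<iota> x)"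
      by (intro mult_right_mono power_mono) auto
    also have "\<dots> = cmod (of_real (?l ^ N) * (LBINT x. hermite_function \<alpha> x * F \<iota> x))"
      unfolding norm_mult norm_of_real by simp
    also have "of_real (?l ^ N) * (LBINT x. hermite_function \<alpha> x * F \<iota> x) = (LBINT x. (harmonic_osc ^^ N) (hermite_function \<alpha>) x * F \<iota> x)"
      unfolding harmonic_osc_funpow_hermite by (simp add: mult.assoc)
    also have "\<dots> = (LBINT x. hermite_function \<alpha> x * (harmonic_osc ^^ N) (F \<iota>) x)"
      by (rule harmonic_osc_funpow_symmetric[OF s])
    also have "cmod \<dots> \<le> (2 ^ CARD('n) * Pm \<alpha> ^ CARD('n) * (C * P \<iota> ^ m)) * W"
      unfolding W_def
    proof (rule wt_bound_integrable)
      show "(\<lambda>x. hermite_function \<alpha> x * (harmonic_osc ^^ N) (F \<iota>) x) \<in> borel_measurable borel"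
        by (intro schwartz_measurable schwartz_mult schwartz_hermite schwartz_harmonic_osc_funpow schwf_schwartz[OF F])
      fix x
      have "cmod (hermite_function \<alpha> x) * cmod ((harmonic_osc ^^ N) (F \<iota>) x) \<le> (2 ^ CARD('n) * Pm \<alpha> ^ CARD('n)) * (C * P \<iota> ^ m * wt x)"
        by (intro mult_mono hermite_bound) (use C(2)[of x \<iota>] in auto)
      then show "cmod (hermite_function \<alpha> x * (harmonic_osc ^^ N) (F \<iota>) x) \<le> 2 ^ CARD('n) * Pm \<alpha> ^ CARD('n) * (C * P \<iota> ^ m) * wt x"
        by (simp add: norm_mult mult_ac)
    qed
    also have "\<dots> = (C * 2 ^ CARD('n) * W) * (Pm \<alpha> ^ CARD('n) * P \<iota> ^ m)" by (simp add: mult_ac)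
    also have "\<dots> \<le> (C * 2 ^ CARD('n) * W + 1) * (Pm \<alpha> ^ CARD('n) * P \<iota> ^ m)"
      using order_trans[OF zero_le_one P[of \<iota>]] by (intro mult_right_mono) auto
    finally show ?thesis by (simp add: mult.assoc)
  qed
  moreover have "C * 2 ^ CARD('n) * W + 1 > 0" using C(1) W by (simp add: add_nonneg_pos)
  ultimately show ?thesis using that by blast
qed

text \<open>The power 2 d leaves a factor (1 + \<alpha>_i)^(-2) for each coordinate, and the series
  of their products converges.\<close>

lemma summable_Pm: "integrable (count_space UNIV) (\<lambda>\<alpha> :: 'n::finite \<Rightarrow> nat. inverse (Pm \<alpha> ^ (2 * CARD('n))))"
proof -
  have s: "summable (\<lambda>n. norm (inverse ((1 + real n) ^ 2)))"
  proof -
    have "summable (\<lambda>n. inverse (real (Suc n) ^ 2))"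
      using inverse_power_summable[of 2, where 'a=real] by (subst summable_Suc_iff[of "\<lambda>n. inverse (real n ^ 2)"]) simp
    then show ?thesis by (simp add: norm_inverse norm_power)
  qed
  have "Infinite_Set_Sum.abs_summable_on (\<lambda>g. \<Prod>x\<in>UNIV. (\<lambda>_ n. inverse ((1 + real n) ^ 2)) x (g x)) (PiE (UNIV :: 'n set) (\<lambda>_. UNIV))"
    by (rule abs_summable_on_prod_PiE) (use s in \<open>auto simp: abs_summable_on_nat_iff'\<close>)
  then have i: "integrable (count_space UNIV) (\<lambda>\<alpha>::'n \<Rightarrow> nat. \<Prod>x\<in>UNIV. inverse ((1 + real (\<alpha> x)) ^ 2))"
    by (simp add: abs_summable_on_def)
  show ?thesis
  proof (rule Bochner_Integration.integrable_bound[OF i])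
    have "inverse (Pm \<alpha> ^ (2 * CARD('n))) \<le> (\<Prod>x\<in>UNIV. inverse ((1 + real (\<alpha> x)) ^ 2))" for \<alpha> :: "'n \<Rightarrow> nat"
    proof -
      have "inverse (Pm \<alpha> ^ (2 * CARD('n))) = (\<Prod>x\<in>(UNIV::'n set). inverse (Pm \<alpha> ^ 2))"
        by (simp add: power_mult power_inverse)
      also have "\<dots> \<le> (\<Prod>x\<in>UNIV. inverse ((1 + real (\<alpha> x)) ^ 2))"
        using le_mabs[of \<alpha>] by (intro prod_mono conjI le_imp_inverse_le power_mono) auto
      finally show ?thesis .
    qed
    then show "AE \<alpha> :: 'n \<Rightarrow> nat in count_space UNIV. norm (inverse (Pm \<alpha> ^ (2 * CARD('n)))) \<le> norm (\<Prod>x\<in>UNIV. inverse ((1 + real (\<alpha> x)) ^ 2))"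
      by (intro AE_I2) (auto simp: norm_inverse norm_power abs_prod)
  qed simp
qed

text \<open>Series over multi-indices are handled as integrals over counting measure, so that
  dominated bounds and Fubini's theorem apply to them.\<close>

lemma has_sum_eq_integral_count_space:
  fixes g :: "'a \<Rightarrow> 'b::{banach, second_countable_topology}"
  assumes "integrable (count_space UNIV) g" "(g has_sum s) UNIV"
  shows "s = integral\<^sup>L (count_space UNIV) g"
proof -
  have "infsetsum g UNIV = infsum g UNIV"
    by (rule infsetsum_infsum) (use assms(1) in \<open>simp add: abs_summable_on_def\<close>)
  then show ?thesis using infsumI[OF assms(2)] by (simp add: infsetsum_def)
qed


section \<open>The growth function\<close>

text \<open>Since N / l = t / (2 \<sigma>), the parameter r enters with the exponent t / (2
  \<sigma>). This is the origin of the powers 2 \<sigma> and 1 / (2 \<sigma>) that relate the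
  parameters of the growth function and of the coefficient bound.\<close>

lemma ln_growth_bound:
  assumes "\<sigma> > 0" "real N * \<sigma> > 1" "r > 0"
  defines "l \<equiv> ln (real N * \<sigma>)"
  defines "t \<equiv> 2 * real N * \<sigma> / l"
  shows "growth_bound \<sigma> r N > 0" "l > 0" "t > 0" "real N = t * l / (2 * \<sigma>)"
    "ln (growth_bound \<sigma> r N) = real N * ln 2 + t / (2 * \<sigma>) * (ln r + (l - 1) * ln t)"
proof -
  show l: "l > 0" using assms by (simp add: l_def)
  have N: "real N > 0" using assms by (metis less_trans mult_eq_0_iff not_gr_zero of_nat_0_less_iff zero_less_one less_irrefl of_nat_0)
  then show t: "t > 0" using l assms by (simp add: t_def)
  show Nt: "real N = t * l / (2 * \<sigma>)" using l assms by (simp add: t_def)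
  have g: "growth_bound \<sigma> r N = 2 ^ N * r powr (real N / l) * t powr (real N * (1 - 1 / l))"
    by (simp add: growth_bound_def l_def t_def)
  show "growth_bound \<sigma> r N > 0" unfolding g
    by (intro mult_pos_pos) (use t \<open>r > 0\<close> in simp_all)
  have "ln (growth_bound \<sigma> r N) = real N * ln 2 + real N / l * ln r + real N * (1 - 1 / l) * ln t"
    unfolding g using t \<open>r > 0\<close> by (simp add: ln_mult ln_powr ln_realpow)
  also have "\<dots> = real N * ln 2 + t / (2 * \<sigma>) * (ln r + (l - 1) * ln t)"
    unfolding Nt[symmetric] using l assms(1) by (subst (2 3) Nt) (simp add: field_simps)
  finally show "ln (growth_bound \<sigma> r N) = real N * ln 2 + t / (2 * \<sigma>) * (ln r + (l - 1) * ln t)" .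
qed

lemma ln_ratio: "(n::real) > 1 \<Longrightarrow> ln (2 * n / ln n) = ln 2 + ln n - ln (ln n)"
  by (simp add: ln_div ln_mult)

text \<open>With \<open>t = 2 N \<sigma> / ln (N \<sigma>)\<close> and \<open>\<tau> = x t\<close> the logarithm of the left-hand side is, up to the
  factor \<open>t / (2 \<sigma>)\<close>, a concave function of \<open>x\<close> that concentrates at \<open>x = 1\<close> as \<open>N\<close> grows.\<close>

lemma growth_upper_eventually:
  fixes \<sigma> \<rho> :: real
  assumes "\<sigma> > 0"
  shows "\<forall>\<^sub>F N in sequentially. \<forall>\<tau>>0. (2 * \<tau>) ^ N * exp (- \<tau> * ln \<tau> / (2 * \<sigma>) + \<rho> * \<tau>) \<le> growth_bound \<sigma> (exp (2 * \<sigma> * \<rho> + 1)) N"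
proof -
  \<comment> \<open>By ln t = ln 2 + l - ln l this choice makes l - ln l + c equal to 1 + ln t - 2
    \<sigma> \<rho>.\<close>
  define c where "c = 1 + ln 2 - 2 * \<sigma> * \<rho>"
  \<comment> \<open>The logarithmic term equals ln l - c up to an error tending to 0. That the total
    is eventually below 1 accounts for the summand 1 in exp (2 \<sigma> \<rho> + 1).\<close>
  have "((\<lambda>l. l * ln (l / (l - ln l + c)) - ln l + c) \<longlongrightarrow> 0) at_top" by real_asymp
  then have e1: "\<forall>\<^sub>F l in at_top. l * ln (l / (l - ln l + c)) - ln l + c < 1" by (rule order_tendstoD) simp
  have "filterlim (\<lambda>l::real. l - ln l + c) at_top at_top" by real_asymp
  then have e2: "\<forall>\<^sub>F l in at_top. l - ln l + c > 0" by (simp add: filterlim_at_top_dense)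
  have lim: "filterlim (\<lambda>N. ln (real N * \<sigma>)) at_top sequentially" using assms by real_asymp
  have "filterlim (\<lambda>N. real N * \<sigma>) at_top sequentially" using assms by real_asymp
  then have e3: "\<forall>\<^sub>F N in sequentially. real N * \<sigma> > 1" by (simp add: filterlim_at_top_dense)
  show ?thesis
    using e3 eventually_compose_filterlim[OF e1 lim] eventually_compose_filterlim[OF e2 lim]
  proof eventually_elim
    case (elim N)
    define l where "l = ln (real N * \<sigma>)"
    define t where "t = 2 * real N * \<sigma> / l"
    note g = ln_growth_bound[OF assms elim(1) exp_gt_zero, folded l_def, folded t_def]
    have lt: "ln t = ln 2 + l - ln l"
      using ln_ratio[OF elim(1)] by (simp only: t_def l_def mult.assoc)
    define K where "K = l - ln l + c"
    have K: "K > 0" "l * ln (l / K) - ln l + c < 1" using elim by (auto simp: K_def l_def)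
    have K': "K = 1 + ln t - 2 * \<sigma> * \<rho>" by (simp add: K_def c_def lt)
    show ?case
    proof (intro allI impI)
      fix \<tau> :: real assume \<tau>: "\<tau> > 0"
      define x where "x = \<tau> / t"
      have x: "x > 0" "\<tau> = x * t" using \<tau> g(3) by (auto simp: x_def)
      have l\<tau>: "ln \<tau> = ln x + ln t" using x g(3) by (simp add: ln_mult)
      \<comment> \<open>Tangent line of the logarithm at l / K, the point where l ln x - K x is
        maximal.\<close>
      have "ln (x * K / l) \<le> x * K / l - 1" using x K g(2) by (intro ln_le_minus_one) auto
      moreover have "ln (x * K / l) = ln x - ln (l / K)" using x K g(2) by (simp add: ln_mult ln_div)
      ultimately have "l * (ln x - ln (l / K)) \<le> l * (x * K / l - 1)" using g(2) by (intro mult_left_mono) auto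
      then have "l * ln x \<le> l * ln (l / K) + x * K - l" using g(2) by (simp add: right_diff_distrib)
      then have 1: "l * ln x - (x - 1) * K \<le> 1" using K(2) by (simp add: left_diff_distrib) (simp add: K_def)
      \<comment> \<open>This gives the tangent line of x ln x at x = 1.\<close>
      have "ln (1 / x) \<le> 1 / x - 1" using x by (intro ln_le_minus_one) auto
      then have "x * (- ln x) \<le> x * (1 / x - 1)" using x by (intro mult_left_mono) (auto simp: ln_div)
      then have 2: "x - 1 \<le> x * ln x" using x by (simp add: right_diff_distrib)
      have "l * ln x - x * ln \<tau> + 2 * \<sigma> * \<rho> * x \<le> 2 * \<sigma> * \<rho> + 1 - ln t"
        using 1 2 unfolding K' l\<tau> by (simp add: algebra_simps)
      then have "t / (2 * \<sigma>) * (l * ln x - x * ln \<tau> + 2 * \<sigma> * \<rho> * x) \<le> t / (2 * \<sigma>) * (2 * \<sigma> * \<rho> + 1 - ln t)"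
        using g(3) assms by (intro mult_left_mono) auto
      moreover have "t / (2 * \<sigma>) * (l * ln x - x * ln \<tau> + 2 * \<sigma> * \<rho> * x) = real N * ln x - \<tau> * ln \<tau> / (2 * \<sigma>) + \<rho> * \<tau>"
        unfolding g(4) using assms x(2) by (simp add: field_simps)
      moreover have "t / (2 * \<sigma>) * (2 * \<sigma> * \<rho> + 1 - ln t) + real N * ln t = t / (2 * \<sigma>) * (2 * \<sigma> * \<rho> + 1 + (l - 1) * ln t)"
        unfolding g(4) using assms by (simp add: field_simps)
      moreover have "real N * ln \<tau> = real N * ln x + real N * ln t" unfolding l\<tau> by (simp only: distrib_left)
      ultimately have "real N * ln \<tau> - \<tau> * ln \<tau> / (2 * \<sigma>) + \<rho> * \<tau> \<le> t / (2 * \<sigma>) * (2 * \<sigma> * \<rho> + 1 + (l - 1) * ln t)"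
        by linarith
      then have "ln ((2 * \<tau>) ^ N * exp (- \<tau> * ln \<tau> / (2 * \<sigma>) + \<rho> * \<tau>)) \<le> ln (growth_bound \<sigma> (exp (2 * \<sigma> * \<rho> + 1)) N)"
        unfolding g(5) using \<tau> by (simp add: ln_mult ln_realpow distrib_left)
      then show "(2 * \<tau>) ^ N * exp (- \<tau> * ln \<tau> / (2 * \<sigma>) + \<rho> * \<tau>) \<le> growth_bound \<sigma> (exp (2 * \<sigma> * \<rho> + 1)) N"
        using g(1) \<tau> by (subst (asm) ln_le_cancel_iff) auto
    qed
  qed
qed

text \<open>The choice \<open>N = \<lceil>\<tau> ln \<tau> / (2 \<sigma>)\<rceil>\<close> makes \<open>2 N \<sigma> / ln (N \<sigma>)\<close> asymptotically equal to \<open>\<tau>\<close>,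
  with an error that is negligible at the exponential scale.\<close>

lemma growth_lower_eventually:
  fixes \<sigma> r :: real
  assumes "\<sigma> > 0" "r > 0"
  shows "\<forall>\<^sub>F \<tau> in at_top. \<exists>N\<ge>N\<^sub>0. growth_bound \<sigma> r N \<le> (2 * \<tau>) ^ N * exp (- \<tau> * ln \<tau> / (2 * \<sigma>) + (ln r + 1) / (2 * \<sigma>) * \<tau>)"
proof -
  define R where "R = \<bar>ln r\<bar> + 1"
  \<comment> \<open>\<open>zl\<close> and \<open>zh\<close> will bracket z = \<tau> / t - 1: N
    \<sigma> lies between \<tau> ln \<tau> / 2 and that number plus \<sigma>, and ln u / u decreases
    for u >= e.\<close>
  define zh where "zh = (\<lambda>\<tau>::real. \<tau> * ln (\<tau> * ln \<tau> / 2) / (\<tau> * ln \<tau>) - 1)"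
  define zl where "zl = (\<lambda>\<tau>::real. \<tau> * ln (\<tau> * ln \<tau> / 2 + \<sigma>) / (\<tau> * ln \<tau> + 2 * \<sigma>) - 1)"
  define L where "L = (\<lambda>\<tau>::real. ln (\<tau> * ln \<tau> / 2 + \<sigma>))"
  have zh0: "(zh \<longlongrightarrow> 0) at_top" unfolding zh_def by real_asymp
  have zl0: "(zl \<longlongrightarrow> 0) at_top" unfolding zl_def by real_asymp
  \<comment> \<open>The error terms of the final estimate. Both bracketing functions are of order ln
    ln \<tau> / ln \<tau> while L is of order ln \<tau>, so even the square times L and the first
    power times ln L tend to 0.\<close>
  have "((\<lambda>\<tau>. ((zl \<tau>)\<^sup>2 + (zh \<tau>)\<^sup>2) * (1 + 2 * L \<tau>) + (\<bar>zl \<tau>\<bar> + \<bar>zh \<tau>\<bar>) * (ln (L \<tau>) + R)) \<longlongrightarrow> 0) at_top"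
  proof -
    have a: "((\<lambda>\<tau>. (zl \<tau>)\<^sup>2 * (1 + 2 * L \<tau>)) \<longlongrightarrow> 0) at_top" "((\<lambda>\<tau>. (zh \<tau>)\<^sup>2 * (1 + 2 * L \<tau>)) \<longlongrightarrow> 0) at_top"
      "((\<lambda>\<tau>. zl \<tau> * (ln (L \<tau>) + R)) \<longlongrightarrow> 0) at_top" "((\<lambda>\<tau>. zh \<tau> * (ln (L \<tau>) + R)) \<longlongrightarrow> 0) at_top"
      unfolding zl_def zh_def L_def by real_asymp+
    have "filterlim (\<lambda>\<tau>. ln (L \<tau>) + R) at_top at_top" unfolding L_def by real_asymp
    then have pos: "\<forall>\<^sub>F \<tau> in at_top. ln (L \<tau>) + R > 0" by (simp add: filterlim_at_top_dense)
    have "((\<lambda>\<tau>. (zl \<tau>)\<^sup>2 * (1 + 2 * L \<tau>) + (zh \<tau>)\<^sup>2 * (1 + 2 * L \<tau>) + \<bar>zl \<tau> * (ln (L \<tau>) + R)\<bar> + \<bar>zh \<tau> * (ln (L \<tau>) + R)\<bar>) \<longlongrightarrow> 0 + 0 + \<bar>0\<bar> + \<bar>0\<bar>) at_top"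
      by (intro tendsto_add tendsto_rabs a)
    then have "((\<lambda>\<tau>. (zl \<tau>)\<^sup>2 * (1 + 2 * L \<tau>) + (zh \<tau>)\<^sup>2 * (1 + 2 * L \<tau>) + \<bar>zl \<tau> * (ln (L \<tau>) + R)\<bar> + \<bar>zh \<tau> * (ln (L \<tau>) + R)\<bar>) \<longlongrightarrow> 0) at_top"
      by simp
    then show ?thesis
    proof (rule Lim_transform_eventually)
      show "\<forall>\<^sub>F \<tau> in at_top. (zl \<tau>)\<^sup>2 * (1 + 2 * L \<tau>) + (zh \<tau>)\<^sup>2 * (1 + 2 * L \<tau>) + \<bar>zl \<tau> * (ln (L \<tau>) + R)\<bar> + \<bar>zh \<tau> * (ln (L \<tau>) + R)\<bar>
        = ((zl \<tau>)\<^sup>2 + (zh \<tau>)\<^sup>2) * (1 + 2 * L \<tau>) + (\<bar>zl \<tau>\<bar> + \<bar>zh \<tau>\<bar>) * (ln (L \<tau>) + R)"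
        using pos by eventually_elim (simp only: abs_mult abs_of_pos distrib_right add.assoc)
    qed
  qed
  then have e1: "\<forall>\<^sub>F \<tau> in at_top. ((zl \<tau>)\<^sup>2 + (zh \<tau>)\<^sup>2) * (1 + 2 * L \<tau>) + (\<bar>zl \<tau>\<bar> + \<bar>zh \<tau>\<bar>) * (ln (L \<tau>) + R) < 1"
    by (rule order_tendstoD) simp
  have e2: "\<forall>\<^sub>F \<tau> in at_top. \<bar>zh \<tau>\<bar> < 1/2" using tendsto_rabs_zero[OF zh0] by (rule order_tendstoD) simp
  have e3: "\<forall>\<^sub>F \<tau> in at_top. \<bar>zl \<tau>\<bar> < 1/2" using tendsto_rabs_zero[OF zl0] by (rule order_tendstoD) simp
  have "filterlim (\<lambda>\<tau>::real. \<tau> * ln \<tau> / 2) at_top at_top" by real_asymp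
  then have e4: "\<forall>\<^sub>F \<tau> in at_top. \<tau> * ln \<tau> / 2 > max (exp 1) (\<sigma> * real N\<^sub>0)" by (simp add: filterlim_at_top_dense)
  have e5: "\<forall>\<^sub>F \<tau> in at_top. \<tau> > (1::real)" by (rule eventually_gt_at_top)
  show ?thesis using e1 e2 e3 e4 e5
  proof eventually_elim
    case (elim \<tau>)
    define a where "a = \<tau> * ln \<tau> / (2 * \<sigma>)"
    define N where "N = nat \<lceil>a\<rceil>"
    have a0: "a > 0" using elim assms by (simp add: a_def)
    have aN: "a \<le> real N" "real N < a + 1" using a0 unfolding N_def by linarith+
    have as: "a * \<sigma> = \<tau> * ln \<tau> / 2" using assms by (simp add: a_def)
    have n1: "\<tau> * ln \<tau> / 2 \<le> real N * \<sigma>" using mult_right_mono[OF aN(1), of \<sigma>] assms as by simp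
    have n2: "real N * \<sigma> \<le> \<tau> * ln \<tau> / 2 + \<sigma>"
      using mult_right_mono[OF less_imp_le[OF aN(2)], of \<sigma>] assms as by (simp add: distrib_right)
    have gt: "exp 1 < real N * \<sigma>" using elim(4) n1 by simp
    have gt1: "1 < real N * \<sigma>" using gt exp_gt_one[of "1::real"] by linarith
    have "\<sigma> * real N\<^sub>0 < real N * \<sigma>" using elim(4) n1 by simp
    then have N0: "N\<^sub>0 \<le> N" using assms(1) by (simp add: mult.commute)
    define l where "l = ln (real N * \<sigma>)"
    define t where "t = 2 * real N * \<sigma> / l"
    note g = ln_growth_bound[OF assms(1) gt1 assms(2), folded l_def, folded t_def]
    have l1: "l \<ge> 1" using gt by (metis gt1 ln_exp ln_le_cancel_iff exp_gt_zero l_def less_imp_le less_trans zero_less_one)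
    have lL: "l \<le> L \<tau>" unfolding l_def L_def using n2 gt1 by (subst ln_le_cancel_iff) auto
    have lt: "ln t = ln 2 + l - ln l"
      using ln_ratio[OF gt1] by (simp only: t_def l_def mult.assoc)
    define x where "x = \<tau> / t"
    define z where "z = x - 1"
    have x: "x > 0" "\<tau> = x * t" using elim(5) g(3) by (auto simp: x_def)
    have l\<tau>: "ln \<tau> = ln x + ln t" using x g(3) by (simp add: ln_mult)
    have mono: "ln v / v \<le> ln u / u" if "exp 1 \<le> u" "u \<le> v" for u v :: real
    proof -
      have u: "u > 0" using that(1) exp_gt_zero[of "1::real"] by linarith
      have "ln (v / u) \<le> v / u - 1" using u that by (intro ln_le_minus_one) auto
      then have "ln v \<le> ln u + (v / u - 1)" using u that by (simp add: ln_div)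
      moreover have "(v / u - 1) * 1 \<le> (v / u - 1) * ln u"
        using u that by (intro mult_left_mono) (auto simp: ln_ge_iff)
      ultimately have "ln v \<le> v / u * ln u" by (simp add: algebra_simps)
      then show ?thesis using u that by (simp add: field_simps)
    qed
    have xe: "x = \<tau> / 2 * (ln (real N * \<sigma>) / (real N * \<sigma>))" using g(2) by (simp add: x_def t_def l_def)
    have zhi: "z \<le> zh \<tau>"
    proof -
      have "x \<le> \<tau> / 2 * (ln (\<tau> * ln \<tau> / 2) / (\<tau> * ln \<tau> / 2))"
        unfolding xe using elim(4,5) n1 by (intro mult_left_mono mono) auto
      then show ?thesis by (simp add: z_def zh_def)
    qed
    have zlo: "zl \<tau> \<le> z"
    proof -
      have "\<tau> / 2 * (ln (\<tau> * ln \<tau> / 2 + \<sigma>) / (\<tau> * ln \<tau> / 2 + \<sigma>)) \<le> x"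
        unfolding xe using elim(5) n2 gt by (intro mult_left_mono mono) auto
      moreover have "\<tau> / 2 * (ln (\<tau> * ln \<tau> / 2 + \<sigma>) / (\<tau> * ln \<tau> / 2 + \<sigma>)) = zl \<tau> + 1"
      proof -
        have "\<tau> / 2 * (ln (\<tau> * ln \<tau> / 2 + \<sigma>) / (\<tau> * ln \<tau> / 2 + \<sigma>)) = \<tau> * ln (\<tau> * ln \<tau> / 2 + \<sigma>) / (2 * (\<tau> * ln \<tau> / 2 + \<sigma>))" by simp
        also have "2 * (\<tau> * ln \<tau> / 2 + \<sigma>) = \<tau> * ln \<tau> + 2 * \<sigma>" by simp
        finally show ?thesis by (simp add: zl_def)
      qed
      ultimately show ?thesis by (simp add: z_def)
    qed
    have zabs: "\<bar>z\<bar> \<le> \<bar>zl \<tau>\<bar> + \<bar>zh \<tau>\<bar>" "\<bar>z\<bar> \<le> 1/2" using zhi zlo elim(2,3) by linarith+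
    have zsq: "z\<^sup>2 \<le> (zl \<tau>)\<^sup>2 + (zh \<tau>)\<^sup>2"
    proof -
      have "\<bar>z\<bar> \<le> \<bar>zl \<tau>\<bar> \<or> \<bar>z\<bar> \<le> \<bar>zh \<tau>\<bar>" using zhi zlo by linarith
      then have "z\<^sup>2 \<le> (zl \<tau>)\<^sup>2 \<or> z\<^sup>2 \<le> (zh \<tau>)\<^sup>2" by (simp add: abs_le_square_iff)
      then show ?thesis using zero_le_power2[of "zl \<tau>"] zero_le_power2[of "zh \<tau>"] by linarith
    qed
    have err: "z\<^sup>2 * (1 + 2 * l) + \<bar>z\<bar> * (ln l + R) \<le> 1"
    proof -
      have "z\<^sup>2 * (1 + 2 * l) \<le> ((zl \<tau>)\<^sup>2 + (zh \<tau>)\<^sup>2) * (1 + 2 * L \<tau>)"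
        using zsq lL l1 by (intro mult_mono) auto
      moreover have "\<bar>z\<bar> * (ln l + R) \<le> (\<bar>zl \<tau>\<bar> + \<bar>zh \<tau>\<bar>) * (ln (L \<tau>) + R)"
        using zabs lL l1 by (intro mult_mono add_mono) (auto simp: R_def)
      ultimately show ?thesis using elim(1) by linarith
    qed
    \<comment> \<open>Second-order lower bound for ln (1 + z), available since |z| <= 1/2. The first
      order alone would not suffice because it is multiplied by l.\<close>
    have lnx: "z - 2 * z\<^sup>2 \<le> ln x" using abs_ln_one_plus_x_minus_x_bound[OF zabs(2)] by (simp add: z_def abs_le_iff)
    \<comment> \<open>After inserting ln t = ln 2 + l - ln l the terms l z cancel, and x - x z = 1 -
      z^2 leaves room 1 for all errors. This room is the summand 1 in the exponent (ln r + 1) / (2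
      \<sigma>).\<close>
    have "0 \<le> l * ln x - x * ln x - (x - 1) * ln t + ln r * (x - 1) + x"
    proof -
      have 1: "l * (z - 2 * z\<^sup>2) \<le> l * ln x" using lnx l1 by (intro mult_left_mono) auto
      have 2: "x * ln x \<le> x * z" using ln_le_minus_one[OF x(1)] x(1) unfolding z_def by (intro mult_left_mono) auto
      have 3: "- (z * (ln l - ln 2 + ln r)) \<le> \<bar>z\<bar> * (ln l + R)"
      proof -
        have "- (z * (ln l - ln 2 + ln r)) \<le> \<bar>z\<bar> * \<bar>ln l - ln 2 + ln r\<bar>" by (metis abs_ge_minus_self abs_mult)
        also have "\<dots> \<le> \<bar>z\<bar> * (ln l + R)"
        proof (rule mult_left_mono)
          have "ln l \<ge> 0" "0 \<le> ln (2::real)" using l1 by auto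
          then show "\<bar>ln l - ln 2 + ln r\<bar> \<le> ln l + R" using ln_2_less_1 unfolding R_def by linarith
        qed simp
        finally show ?thesis .
      qed
      have "l * ln x - x * ln x - z * ln t + ln r * z + x \<ge> l * (z - 2 * z\<^sup>2) - x * z - z * ln t + ln r * z + x"
        using 1 2 by linarith
      also have "l * (z - 2 * z\<^sup>2) - x * z - z * ln t + ln r * z + x = 1 - z\<^sup>2 * (1 + 2 * l) + z * (ln l - ln 2 + ln r)"
        unfolding lt z_def by (simp add: power2_eq_square algebra_simps)
      finally show ?thesis using 3 err unfolding z_def by linarith
    qed
    then have "ln r + (l - 1) * ln t \<le> l * ln \<tau> - x * ln \<tau> + (ln r + 1) * x"
      unfolding l\<tau> by (simp add: algebra_simps)
    then have "t / (2 * \<sigma>) * (ln r + (l - 1) * ln t) \<le> t / (2 * \<sigma>) * (l * ln \<tau> - x * ln \<tau> + (ln r + 1) * x)"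
      using g(3) assms by (intro mult_left_mono) auto
    also have "\<dots> = real N * ln \<tau> - \<tau> * ln \<tau> / (2 * \<sigma>) + (ln r + 1) / (2 * \<sigma>) * \<tau>"
      unfolding g(4) using x(2) assms by (simp add: field_simps)
    finally have "ln (growth_bound \<sigma> r N) \<le> ln ((2 * \<tau>) ^ N * exp (- \<tau> * ln \<tau> / (2 * \<sigma>) + (ln r + 1) / (2 * \<sigma>) * \<tau>))"
      unfolding g(5) using elim(5) by (simp add: ln_mult ln_realpow distrib_left)
    then have "growth_bound \<sigma> r N \<le> (2 * \<tau>) ^ N * exp (- \<tau> * ln \<tau> / (2 * \<sigma>) + (ln r + 1) / (2 * \<sigma>) * \<tau>)"
      using g(1) elim(5) by (subst (asm) ln_le_cancel_iff) auto
    with N0 show ?case by blast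
  qed
qed

section \<open>Factorials of multi-indices\<close>

lemma mfact_pos: "mfact \<alpha> > 0"
  by (simp add: mfact_def prod_pos)

lemma mfact_le: "mfact \<alpha> \<le> fact (mabs (\<alpha> :: 'n::finite \<Rightarrow> nat))"
proof -
  have "(\<Prod>i\<in>S. fact (\<alpha> i) :: nat) \<le> fact (\<Sum>i\<in>S. \<alpha> i)" if "finite S" for S
    using that
  proof (induction S)
    case (insert j S)
    have "fact (\<alpha> j) * (\<Prod>i\<in>S. fact (\<alpha> i) :: nat) \<le> fact (\<alpha> j) * fact (\<Sum>i\<in>S. \<alpha> i)" using insert by (intro mult_left_mono) auto
    also have "\<dots> \<le> fact (\<alpha> j + (\<Sum>i\<in>S. \<alpha> i))" by (intro dvd_imp_le fact_fact_dvd_fact) auto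
    finally show ?case using insert by simp
  qed simp
  then show ?thesis by (simp add: mfact_def mabs_def)
qed

text \<open>The multinomial coefficient is a product of binomial coefficients, one for each
  coordinate, and each of them is at most 2^|\<alpha>|.\<close>

lemma fact_mabs_le: "fact (mabs \<alpha>) \<le> 2 ^ (CARD('n) * mabs \<alpha>) * mfact (\<alpha> :: 'n::finite \<Rightarrow> nat)"
proof -
  have "fact (\<Sum>i\<in>S. \<alpha> i) \<le> 2 ^ (card S * (\<Sum>i\<in>S. \<alpha> i)) * (\<Prod>i\<in>S. fact (\<alpha> i) :: nat)" if "finite S" for S
    using that
  proof (induction S)
    case (insert j S)
    define s where "s = (\<Sum>i\<in>S. \<alpha> i)"
    have "fact (\<alpha> j + s) = fact (\<alpha> j) * fact s * ((\<alpha> j + s) choose \<alpha> j)"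
      using binomial_fact_lemma[of "\<alpha> j" "\<alpha> j + s"] by simp
    also have "\<dots> \<le> fact (\<alpha> j) * fact s * 2 ^ (\<alpha> j + s)"
      by (intro mult_left_mono binomial_le_pow2) auto
    also have "\<dots> \<le> fact (\<alpha> j) * (2 ^ (card S * s) * (\<Prod>i\<in>S. fact (\<alpha> i))) * 2 ^ (\<alpha> j + s)"
      using insert.IH unfolding s_def by (intro mult_right_mono mult_left_mono) auto
    also have "\<dots> = 2 ^ (card S * s + (\<alpha> j + s)) * (\<Prod>i\<in>insert j S. fact (\<alpha> i))"
      using insert(1,2) by (simp add: power_add mult_ac)
    also have "\<dots> \<le> 2 ^ (card (insert j S) * (\<alpha> j + s)) * (\<Prod>i\<in>insert j S. fact (\<alpha> i))"
      using insert(1,2) by (intro mult_right_mono power_increasing) (auto simp: algebra_simps)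
    finally show ?case using insert(1,2) by (simp add: s_def)
  qed simp
  from this[of UNIV] show ?thesis by (simp add: mfact_def mabs_def)
qed

text \<open>The constant 1 covers \<alpha> = 0, where \<tau> = d / 2 may be below 1 and \<tau> ln
  \<tau> negative, though never below -1. For other \<alpha> the inequality n! <= n^n is
  enough.\<close>

lemma ln_mfact_upper:
  fixes \<alpha> :: "'n::finite \<Rightarrow> nat"
  defines "\<tau> \<equiv> real (mabs \<alpha>) + real CARD('n) / 2"
  shows "ln (real (mfact \<alpha>)) \<le> 1 + \<tau> * ln \<tau>"
proof -
  have "ln (real (mfact \<alpha>)) \<le> ln (fact (mabs \<alpha>))"
    using mfact_le[of \<alpha>] mfact_pos[of \<alpha>] by (subst ln_le_cancel_iff) (auto, metis of_nat_fact of_nat_le_iff)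
  also have "\<dots> \<le> 1 + \<tau> * ln \<tau>"
  proof (cases "mabs \<alpha> = 0")
    case True
    have "\<tau> > 0" by (simp add: \<tau>_def add_nonneg_pos)
    then have "ln (1 / \<tau>) \<le> 1 / \<tau> - 1" by (intro ln_le_minus_one) auto
    then have "\<tau> * (- ln \<tau>) \<le> \<tau> * (1 / \<tau> - 1)" using \<open>\<tau> > 0\<close> by (intro mult_left_mono) (auto simp: ln_div)
    then have "- (\<tau> * ln \<tau>) \<le> 1 - \<tau>" using \<open>\<tau> > 0\<close> by (simp add: right_diff_distrib)
    then show ?thesis using True \<open>\<tau> > 0\<close> by simp
  next
    case False
    then have m: "real (mabs \<alpha>) \<ge> 1" by simp
    have "fact (mabs \<alpha>) \<le> real (mabs \<alpha>) ^ mabs \<alpha>" using fact_le_power[of "mabs \<alpha>", where 'a=real] by simp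
    then have "ln (fact (mabs \<alpha>)) \<le> ln (real (mabs \<alpha>) ^ mabs \<alpha>)" using m by (subst ln_le_cancel_iff) auto
    also have "\<dots> = real (mabs \<alpha>) * ln (real (mabs \<alpha>))" using m by (simp add: ln_realpow)
    also have "\<dots> \<le> \<tau> * ln \<tau>" using m by (intro mult_mono) (auto simp: \<tau>_def)
    finally show ?thesis by simp
  qed
  finally show ?thesis .
qed

text \<open>t^t / t! is a single term of the series of exp t. Passing from t = |\<alpha>| to \<tau>
  = t + d / 2 costs only terms linear in \<tau>, which amount to a change of r.\<close>

lemma ln_mfact_lower:
  fixes \<alpha> :: "'n::finite \<Rightarrow> nat"
  defines "d \<equiv> real CARD('n)"
  defines "\<tau> \<equiv> real (mabs \<alpha>) + d / 2"
  shows "\<tau> * ln \<tau> \<le> ln (real (mfact \<alpha>)) + (1 + 2 * d) * \<tau> + d"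
proof -
  define t where "t = mabs \<alpha>"
  have d: "d \<ge> 1" by (simp add: d_def)
  have \<tau>: "\<tau> > 0" "\<tau> = real t + d / 2" using d by (auto simp: \<tau>_def t_def)
  have "fact t \<le> (2 ^ (CARD('n) * t) * real (mfact \<alpha>))"
  proof -
    have "real (fact t) \<le> real (2 ^ (CARD('n) * t) * mfact \<alpha>)"
      using fact_mabs_le[of \<alpha>] unfolding t_def of_nat_le_iff .
    then show ?thesis by simp
  qed
  then have "ln (fact t) \<le> ln (2 ^ (CARD('n) * t) * real (mfact \<alpha>))"
    using mfact_pos[of \<alpha>] by (subst ln_le_cancel_iff) auto
  also have "\<dots> = d * real t * ln 2 + ln (real (mfact \<alpha>))"
    using mfact_pos[of \<alpha>] by (simp add: ln_mult ln_realpow d_def)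
  also have "\<dots> \<le> d * real t * 1 + ln (real (mfact \<alpha>))"
    using d ln_2_less_1 by (intro add_right_mono mult_left_mono) auto
  finally have 1: "ln (fact t) \<le> d * real t + ln (real (mfact \<alpha>))" by simp
  have "\<tau> * ln \<tau> \<le> ln (fact t) + real t + d / 2 + d / 2 * \<tau>"
  proof (cases "t = 0")
    case True
    have "ln \<tau> \<le> \<tau>" using ln_le_minus_one[OF \<tau>(1)] by linarith
    then have "\<tau> * ln \<tau> \<le> \<tau> * \<tau>" using \<tau>(1) by (intro mult_left_mono) auto
    moreover have "\<tau> * \<tau> = d / 2 * \<tau>" using True \<tau>(2) by simp
    ultimately show ?thesis using True d by simp
  next
    case False
    then have t: "real t \<ge> 1" by simp
    have "real t ^ t / fact t \<le> exp (real t)"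
    proof -
      have "(\<Sum>n\<in>{t}. real t ^ n /\<^sub>R fact n) \<le> (\<Sum>n. real t ^ n /\<^sub>R fact n)"
        by (rule sum_le_suminf) (auto simp: summable_exp)
      then show ?thesis by (simp add: exp_def divide_inverse mult.commute)
    qed
    then have "ln (real t ^ t / fact t) \<le> ln (exp (real t))" using t by (subst ln_le_cancel_iff) auto
    then have f: "real t * ln (real t) - ln (fact t) \<le> real t" using t by (simp add: ln_div ln_realpow)
    have "ln (\<tau> / real t) \<le> \<tau> / real t - 1" using t \<tau> by (intro ln_le_minus_one) auto
    then have "real t * (ln \<tau> - ln (real t)) \<le> real t * (\<tau> / real t - 1)" using t \<tau> by (intro mult_left_mono) (auto simp: ln_div)
    then have "real t * ln \<tau> \<le> real t * ln (real t) + d / 2" using t \<tau> by (simp add: right_diff_distrib)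
    moreover have "d / 2 * ln \<tau> \<le> d / 2 * \<tau>" using ln_le_minus_one[OF \<tau>(1)] d by (intro mult_left_mono) auto
    moreover have "\<tau> * ln \<tau> = real t * ln \<tau> + d / 2 * ln \<tau>" unfolding \<tau>(2) by (simp only: distrib_right)
    ultimately show ?thesis using f by linarith
  qed
  moreover have "d * real t + real t + d / 2 + d / 2 * \<tau> \<le> (1 + 2 * d) * \<tau> + d"
  proof -
    have "(1 + 2 * d) * \<tau> + d = (d * real t + real t + d / 2 + d / 2 * \<tau>) + (d * real t / 2 + 3 / 4 * (d * d) + d)"
      unfolding \<tau>(2) by (simp add: field_simps)
    moreover have "0 \<le> d * real t" "0 \<le> d * d" using d by auto
    ultimately show ?thesis using d by linarith
  qed
  ultimately show ?thesis using 1 by linarith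
qed

text \<open>A single term of the exponential series. It trades polynomial factors in |\<alpha>| for
  a factor e in the base r.\<close>

lemma poly_le_exp: "\<exists>C>0. \<forall>t::nat. (1 + real t) ^ m \<le> C * exp (real t)"
proof -
  have "(1 + real t) ^ m \<le> fact m * exp 1 * exp (real t)" for t
  proof -
    have "(\<Sum>n\<in>{m}. (1 + real t) ^ n /\<^sub>R fact n) \<le> (\<Sum>n. (1 + real t) ^ n /\<^sub>R fact n)"
      by (rule sum_le_suminf) (auto simp: summable_exp)
    then have "(1 + real t) ^ m / fact m \<le> exp (1 + real t)" by (simp add: exp_def divide_inverse mult.commute)
    then show ?thesis by (simp add: field_simps exp_add)
  qed
  then show ?thesis by (intro exI[of _ "fact m * exp 1"]) auto
qed

section \<open>Coefficient weights against the growth function\<close>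

definition coeff_weight :: "real \<Rightarrow> real \<Rightarrow> ('n::finite \<Rightarrow> nat) \<Rightarrow> real" where
  "coeff_weight \<sigma> r \<alpha> = r ^ mabs \<alpha> * real (mfact \<alpha>) powr (- 1 / (2 * \<sigma>))"

lemma coeff_weight_pos: "r > 0 \<Longrightarrow> coeff_weight \<sigma> r \<alpha> > 0"
  using mfact_pos[of \<alpha>] by (simp add: coeff_weight_def)

text \<open>\<kappa> depends on \<sigma> and the dimension only, while C may depend on r; the
  version for every r relies on this order of quantifiers. The asymptotic estimate covers all large
  N, and the finitely many other orders are covered by the ratio of a supremum over \<tau> to the
  growth function.\<close>

lemma weight_le_growth:
  fixes \<sigma> :: real
  assumes \<sigma>: "\<sigma> > 0" and N\<^sub>0: "real N\<^sub>0 * \<sigma> > 1"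
  shows "\<exists>\<kappa>>0. \<forall>r>0. \<exists>C>0. \<forall>N\<ge>N\<^sub>0. \<forall>\<alpha> :: 'n::finite \<Rightarrow> nat.
     (2 * real (mabs \<alpha>) + real CARD('n)) ^ N * coeff_weight \<sigma> r \<alpha> \<le> C * growth_bound \<sigma> (\<kappa> * r powr (2 * \<sigma>)) N"
proof -
  define d where "d = real CARD('n)"
  have d: "d \<ge> 1" by (simp add: d_def)
  \<comment> \<open>Cost per unit of \<tau> of replacing ln \<alpha>! by \<tau> ln \<tau>, divided
    by 2 \<sigma>. It does not involve r and can therefore go into \<kappa>.\<close>
  define q where "q = (1 + 2 * d) / (2 * \<sigma>)"
  define \<kappa> where "\<kappa> = exp (2 * \<sigma> * q + 1)"
  have "\<exists>C>0. \<forall>N\<ge>N\<^sub>0. \<forall>\<alpha> :: 'n \<Rightarrow> nat.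
     (2 * real (mabs \<alpha>) + d) ^ N * coeff_weight \<sigma> r \<alpha> \<le> C * growth_bound \<sigma> (\<kappa> * r powr (2 * \<sigma>)) N" if r: "r > 0" for r
  proof -
    define \<rho> where "\<rho> = ln r + q"
    define G where "G = (\<lambda>N. growth_bound \<sigma> (\<kappa> * r powr (2 * \<sigma>)) N)"
    have \<kappa>r: "\<kappa> * r powr (2 * \<sigma>) = exp (2 * \<sigma> * \<rho> + 1)"
      using r by (simp add: \<kappa>_def \<rho>_def powr_def exp_add[symmetric] algebra_simps)
    define D where "D = exp (\<bar>ln r\<bar> * d / 2 + d / (2 * \<sigma>))"
    define E where "E = (\<lambda>\<tau>. exp (- \<tau> * ln \<tau> / (2 * \<sigma>) + \<rho> * \<tau>))"
    have w: "coeff_weight \<sigma> r \<alpha> \<le> D * E (real (mabs \<alpha>) + d / 2)" for \<alpha> :: "'n \<Rightarrow> nat"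
    proof -
      define \<tau> where "\<tau> = real (mabs \<alpha>) + d / 2"
      have "- ln (real (mfact \<alpha>)) \<le> - (\<tau> * ln \<tau>) + (1 + 2 * d) * \<tau> + d"
        using ln_mfact_lower[of \<alpha>] by (simp add: \<tau>_def d_def)
      then have "(- ln (real (mfact \<alpha>))) / (2 * \<sigma>) \<le> (- (\<tau> * ln \<tau>) + (1 + 2 * d) * \<tau> + d) / (2 * \<sigma>)"
        using \<sigma> by (intro divide_right_mono) auto
      also have "\<dots> = - \<tau> * ln \<tau> / (2 * \<sigma>) + q * \<tau> + d / (2 * \<sigma>)" using \<sigma> by (simp add: q_def field_simps)
      finally have 1: "- ln (real (mfact \<alpha>)) / (2 * \<sigma>) \<le> - \<tau> * ln \<tau> / (2 * \<sigma>) + q * \<tau> + d / (2 * \<sigma>)" .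
      have "- ln r * (d / 2) \<le> \<bar>ln r\<bar> * (d / 2)" using d by (intro mult_right_mono) auto
      then have 2: "real (mabs \<alpha>) * ln r \<le> ln r * \<tau> + \<bar>ln r\<bar> * d / 2" by (simp add: \<tau>_def algebra_simps)
      have "coeff_weight \<sigma> r \<alpha> = exp (real (mabs \<alpha>) * ln r + - ln (real (mfact \<alpha>)) / (2 * \<sigma>))"
      proof -
        have "r ^ mabs \<alpha> = exp (real (mabs \<alpha>) * ln r)" using r by (simp add: exp_of_nat_mult)
        moreover have "real (mfact \<alpha>) powr (- 1 / (2 * \<sigma>)) = exp (- ln (real (mfact \<alpha>)) / (2 * \<sigma>))"
          using mfact_pos[of \<alpha>] by (simp add: powr_def)
        ultimately show ?thesis by (simp only: coeff_weight_def exp_add)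
      qed
      also have "\<dots> \<le> exp ((\<bar>ln r\<bar> * d / 2 + d / (2 * \<sigma>)) + (- \<tau> * ln \<tau> / (2 * \<sigma>) + \<rho> * \<tau>))"
        using 1 2 by (simp add: \<rho>_def algebra_simps)
      also have "\<dots> = D * E \<tau>" by (simp only: exp_add D_def E_def)
      finally show ?thesis by (simp add: \<tau>_def)
    qed
    have Gpos: "G N > 0" if "N \<ge> N\<^sub>0" for N
    proof -
      have "real N\<^sub>0 * \<sigma> \<le> real N * \<sigma>" using that \<sigma> by (intro mult_right_mono) auto
      then have "real N * \<sigma> > 1" using N\<^sub>0 by linarith
      then show ?thesis unfolding G_def \<kappa>r by (intro ln_growth_bound(1) \<sigma> exp_gt_zero)
    qed
    obtain N1 where N1: "\<And>N \<tau>. N \<ge> N1 \<Longrightarrow> \<tau> > 0 \<Longrightarrow> (2 * \<tau>) ^ N * E \<tau> \<le> G N"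
      using growth_upper_eventually[OF \<sigma>, of \<rho>] unfolding eventually_sequentially E_def G_def \<kappa>r by blast
    have "\<exists>M\<ge>0. \<forall>\<tau>>0. (2 * \<tau>) ^ N * E \<tau> \<le> M" for N
    proof -
      define b where "b = 2 * \<sigma> * (2 * real N + \<rho>)"
      have "(2 * \<tau>) ^ N * E \<tau> \<le> exp (exp (b - 1) / (2 * \<sigma>))" if \<tau>: "\<tau> > 0" for \<tau>
      proof -
        have "(2 * \<tau>) ^ N \<le> exp (2 * \<tau>) ^ N"
        proof (rule power_mono)
          show "2 * \<tau> \<le> exp (2 * \<tau>)" using exp_ge_add_one_self[of "2 * \<tau>"] by linarith
        qed (use \<tau> in simp)
        then have "(2 * \<tau>) ^ N * E \<tau> \<le> exp (2 * \<tau>) ^ N * E \<tau>" by (intro mult_right_mono) (auto simp: E_def)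
        also have "\<dots> = exp ((b * \<tau> - \<tau> * ln \<tau>) / (2 * \<sigma>))"
          using \<sigma> by (simp add: E_def exp_of_nat_mult[symmetric] exp_add[symmetric] b_def field_simps)
        also have "\<dots> \<le> exp (exp (b - 1) / (2 * \<sigma>))"
        proof -
          \<comment> \<open>The maximum of b \<tau> - \<tau> ln \<tau> is exp (b - 1), attained at
            \<tau> = exp (b - 1).\<close>
          have "ln (exp (b - 1) / \<tau>) \<le> exp (b - 1) / \<tau> - 1" using \<tau> by (intro ln_le_minus_one) auto
          then have "b - ln \<tau> \<le> exp (b - 1) / \<tau>" using \<tau> by (simp add: ln_div)
          then have "\<tau> * (b - ln \<tau>) \<le> \<tau> * (exp (b - 1) / \<tau>)" using \<tau> by (intro mult_left_mono) auto
          then have "b * \<tau> - \<tau> * ln \<tau> \<le> exp (b - 1)" using \<tau> by (simp add: algebra_simps)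
          then show ?thesis using \<sigma> by (simp add: divide_right_mono)
        qed
        finally show ?thesis .
      qed
      then show ?thesis by (intro exI[of _ "exp (exp (b - 1) / (2 * \<sigma>))"]) auto
    qed
    then obtain M where M: "\<And>N. M N \<ge> 0" "\<And>N \<tau>. \<tau> > 0 \<Longrightarrow> (2 * \<tau>) ^ N * E \<tau> \<le> M N" by metis
    define C where "C = 1 + (\<Sum>N\<in>{N\<^sub>0..<N1}. M N / G N)"
    have MG: "M N / G N \<ge> 0" if "N \<ge> N\<^sub>0" for N using M(1) Gpos[OF that] by (intro divide_nonneg_pos)
    have C: "C \<ge> 1" unfolding C_def using MG by (auto intro!: sum_nonneg)
    have main: "(2 * \<tau>) ^ N * E \<tau> \<le> C * G N" if N: "N \<ge> N\<^sub>0" and \<tau>: "\<tau> > 0" for N \<tau>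
    proof (cases "N \<ge> N1")
      case True
      have "1 * G N \<le> C * G N" using C Gpos[OF N] by (intro mult_right_mono) auto
      then show ?thesis using N1[OF True \<tau>] by simp
    next
      case False
      have "M N / G N \<le> (\<Sum>N\<in>{N\<^sub>0..<N1}. M N / G N)"
        by (rule member_le_sum) (use False N MG in auto)
      then have "M N / G N \<le> C" by (simp add: C_def)
      then have "M N \<le> C * G N" using Gpos[OF N] by (simp add: field_simps)
      then show ?thesis using M(2)[OF \<tau>, of N] by simp
    qed
    have "(2 * real (mabs \<alpha>) + d) ^ N * coeff_weight \<sigma> r \<alpha> \<le> (D * C) * G N" if "N \<ge> N\<^sub>0" for N and \<alpha> :: "'n \<Rightarrow> nat"
    proof -
      define \<tau> where "\<tau> = real (mabs \<alpha>) + d / 2"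
      have \<tau>: "\<tau> > 0" "2 * real (mabs \<alpha>) + d = 2 * \<tau>" using d by (auto simp: \<tau>_def)
      have "(2 * \<tau>) ^ N * coeff_weight \<sigma> r \<alpha> \<le> (2 * \<tau>) ^ N * (D * E \<tau>)"
        using w[of \<alpha>] \<tau> by (intro mult_left_mono) (auto simp: \<tau>_def)
      also have "\<dots> = D * ((2 * \<tau>) ^ N * E \<tau>)" by simp
      also have "\<dots> \<le> D * (C * G N)" by (intro mult_left_mono main that \<tau>) (simp add: D_def)
      finally show ?thesis by (simp add: \<tau>(2) mult.assoc)
    qed
    moreover have "D * C > 0" using C by (simp add: D_def)
    ultimately show ?thesis unfolding G_def by blast
  qed
  then show ?thesis unfolding d_def by (intro exI[of _ \<kappa>]) (auto simp: \<kappa>_def)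
qed

lemma finite_mabs_le: "finite {\<alpha> :: 'n::finite \<Rightarrow> nat. mabs \<alpha> \<le> k}"
proof (rule finite_subset)
  show "{\<alpha> :: 'n \<Rightarrow> nat. mabs \<alpha> \<le> k} \<subseteq> PiE UNIV (\<lambda>_. {..k})"
    by (auto simp: PiE_def Pi_def intro: order_trans[OF le_mabs])
qed (intro finite_PiE; simp)

text \<open>For a large index a suitable order N is supplied by the lower estimate of the growth
  function; the finitely many small indices only enlarge C. A polynomial factor in |\<alpha>| is
  tolerated because it costs just a factor e per unit of |\<alpha>|.\<close>

lemma growth_le_weight:
  fixes \<sigma> :: real
  assumes \<sigma>: "\<sigma> > 0" and N\<^sub>0: "real N\<^sub>0 * \<sigma> > 1"
  shows "\<exists>\<kappa>>0. \<forall>r>0. \<forall>m. \<forall>c. \<forall>a :: ('n::finite \<Rightarrow> nat) \<Rightarrow> real.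
     (\<forall>\<alpha>. a \<alpha> \<ge> 0) \<longrightarrow> (\<forall>N\<ge>N\<^sub>0. \<forall>\<alpha>. (2 * real (mabs \<alpha>) + real CARD('n)) ^ N * a \<alpha> \<le> c * Pm \<alpha> ^ m * growth_bound \<sigma> r N)
     \<longrightarrow> (\<exists>C>0. \<forall>\<alpha>. a \<alpha> \<le> C * coeff_weight \<sigma> (\<kappa> * r powr (1 / (2 * \<sigma>))) \<alpha>)"
proof -
  define d where "d = real CARD('n)"
  have d: "d \<ge> 1" by (simp add: d_def)
  \<comment> \<open>exp (1 / (2 \<sigma>)) stems from the exponent (ln r + 1) / (2 \<sigma>) of the
    lower estimate, the further factor e from the polynomial in |\<alpha>|.\<close>
  define \<kappa> where "\<kappa> = exp (1 / (2 * \<sigma>) + 1)"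
  have "\<exists>C>0. \<forall>\<alpha>. a \<alpha> \<le> C * coeff_weight \<sigma> (\<kappa> * r powr (1 / (2 * \<sigma>))) \<alpha>"
    if r: "r > 0" and a0: "\<forall>\<alpha>. a \<alpha> \<ge> 0"
     and a: "\<forall>N\<ge>N\<^sub>0. \<forall>\<alpha>. (2 * real (mabs \<alpha>) + d) ^ N * a \<alpha> \<le> c * Pm \<alpha> ^ m * growth_bound \<sigma> r N"
   for r m c and a :: "('n \<Rightarrow> nat) \<Rightarrow> real"
  proof -
    define s where "s = (ln r + 1) / (2 * \<sigma>)"
    \<comment> \<open>c is an arbitrary real number, whereas the products below need a nonnegative
      factor.\<close>
    define c' where "c' = max c 0"
    have a': "(2 * real (mabs \<alpha>) + d) ^ N * a \<alpha> \<le> c' * Pm \<alpha> ^ m * growth_bound \<sigma> r N" if "N \<ge> N\<^sub>0" for N \<alpha>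
    proof -
      have "real N\<^sub>0 * \<sigma> \<le> real N * \<sigma>" using that \<sigma> by (intro mult_right_mono) auto
      then have "real N * \<sigma> > 1" using N\<^sub>0 by linarith
      then have "growth_bound \<sigma> r N > 0" by (intro ln_growth_bound(1) \<sigma> r)
      then have "c * Pm \<alpha> ^ m * growth_bound \<sigma> r N \<le> c' * Pm \<alpha> ^ m * growth_bound \<sigma> r N"
        unfolding c'_def by (intro mult_right_mono) auto
      then show ?thesis using a that by (meson order_trans)
    qed
    have \<kappa>r: "ln (\<kappa> * r powr (1 / (2 * \<sigma>))) = s + 1" "\<kappa> * r powr (1 / (2 * \<sigma>)) > 0"
      using r by (simp_all add: \<kappa>_def s_def ln_mult ln_powr add_divide_distrib)
    obtain T where T: "\<And>\<tau>. \<tau> \<ge> T \<Longrightarrow> \<exists>N\<ge>N\<^sub>0. growth_bound \<sigma> r N \<le> (2 * \<tau>) ^ N * exp (- \<tau> * ln \<tau> / (2 * \<sigma>) + s * \<tau>)"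
      using growth_lower_eventually[OF \<sigma> r, of N\<^sub>0] unfolding eventually_at_top_linorder s_def by blast
    obtain Cm where Cm: "Cm > 0" "\<And>t::nat. (1 + real t) ^ m \<le> Cm * exp (real t)" using poly_le_exp by blast
    define D where "D = c' * Cm * exp (1 / (2 * \<sigma>) + \<bar>s\<bar> * d / 2)"
    have D: "D \<ge> 0" using Cm by (simp add: D_def c'_def)
    have big: "a \<alpha> \<le> D * coeff_weight \<sigma> (\<kappa> * r powr (1 / (2 * \<sigma>))) \<alpha>" if "real (mabs \<alpha>) \<ge> T" for \<alpha>
    proof -
      define \<tau> where "\<tau> = real (mabs \<alpha>) + d / 2"
      have \<tau>: "\<tau> > 0" "2 * real (mabs \<alpha>) + d = 2 * \<tau>" "\<tau> \<ge> T" using d that by (auto simp: \<tau>_def)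
      obtain N where N: "N \<ge> N\<^sub>0" "growth_bound \<sigma> r N \<le> (2 * \<tau>) ^ N * exp (- \<tau> * ln \<tau> / (2 * \<sigma>) + s * \<tau>)"
        using T[OF \<tau>(3)] by blast
      have "(2 * \<tau>) ^ N * a \<alpha> \<le> c' * Pm \<alpha> ^ m * growth_bound \<sigma> r N" using a'[OF N(1), of \<alpha>] by (simp add: \<tau>(2))
      also have "\<dots> \<le> c' * (Cm * exp (real (mabs \<alpha>))) * ((2 * \<tau>) ^ N * exp (- \<tau> * ln \<tau> / (2 * \<sigma>) + s * \<tau>))"
      proof (intro mult_mono N(2) Cm(2))
        have "real N\<^sub>0 * \<sigma> \<le> real N * \<sigma>" using N(1) \<sigma> by (intro mult_right_mono) auto
        then have "real N * \<sigma> > 1" using N\<^sub>0 by linarith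
        then show "growth_bound \<sigma> r N \<ge> 0" by (intro less_imp_le ln_growth_bound(1) \<sigma> r)
      qed (use Cm(1) in \<open>auto simp: c'_def\<close>)
      finally have "(2 * \<tau>) ^ N * a \<alpha> \<le> (2 * \<tau>) ^ N * (c' * Cm * exp (real (mabs \<alpha>)) * exp (- \<tau> * ln \<tau> / (2 * \<sigma>) + s * \<tau>))"
        by (simp add: mult_ac)
      then have "a \<alpha> \<le> c' * Cm * exp (real (mabs \<alpha>)) * exp (- \<tau> * ln \<tau> / (2 * \<sigma>) + s * \<tau>)"
        by (rule mult_left_le_imp_le) (use \<tau>(1) in simp)
      also have "\<dots> = c' * Cm * exp (real (mabs \<alpha>) + (- \<tau> * ln \<tau> / (2 * \<sigma>) + s * \<tau>))"
        by (simp add: exp_add mult.assoc)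
      also have "\<dots> \<le> c' * Cm * exp ((1 / (2 * \<sigma>) + \<bar>s\<bar> * d / 2) + (real (mabs \<alpha>) * (s + 1) + - ln (real (mfact \<alpha>)) / (2 * \<sigma>)))"
      proof -
        have "- (\<tau> * ln \<tau>) \<le> 1 - ln (real (mfact \<alpha>))" using ln_mfact_upper[of \<alpha>] by (simp add: \<tau>_def d_def)
        then have "- (\<tau> * ln \<tau>) / (2 * \<sigma>) \<le> (1 - ln (real (mfact \<alpha>))) / (2 * \<sigma>)" using \<sigma> by (intro divide_right_mono) auto
        then have 1: "- \<tau> * ln \<tau> / (2 * \<sigma>) \<le> 1 / (2 * \<sigma>) + - ln (real (mfact \<alpha>)) / (2 * \<sigma>)" by (simp add: diff_divide_distrib)
        have "s * (d / 2) \<le> \<bar>s\<bar> * (d / 2)" using d by (intro mult_right_mono) auto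
        then have "s * \<tau> \<le> real (mabs \<alpha>) * s + \<bar>s\<bar> * d / 2" by (simp add: \<tau>_def algebra_simps)
        with 1 have "real (mabs \<alpha>) + (- \<tau> * ln \<tau> / (2 * \<sigma>) + s * \<tau>) \<le> (1 / (2 * \<sigma>) + \<bar>s\<bar> * d / 2) + (real (mabs \<alpha>) * (s + 1) + - ln (real (mfact \<alpha>)) / (2 * \<sigma>))"
          unfolding distrib_left by linarith
        then show ?thesis using Cm(1) by (intro mult_left_mono) (auto simp: c'_def)
      qed
      also have "\<dots> = D * coeff_weight \<sigma> (\<kappa> * r powr (1 / (2 * \<sigma>))) \<alpha>"
      proof -
        have "(\<kappa> * r powr (1 / (2 * \<sigma>))) ^ mabs \<alpha> = exp (real (mabs \<alpha>) * (s + 1))"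
          using \<kappa>r by (metis exp_ln exp_of_nat_mult)
        moreover have "real (mfact \<alpha>) powr (- 1 / (2 * \<sigma>)) = exp (- ln (real (mfact \<alpha>)) / (2 * \<sigma>))"
          using mfact_pos[of \<alpha>] by (simp add: powr_def)
        ultimately show ?thesis by (simp only: D_def coeff_weight_def exp_add mult.assoc)
      qed
      finally show ?thesis .
    qed
    define S where "S = {\<alpha> :: 'n \<Rightarrow> nat. mabs \<alpha> \<le> nat \<lceil>T\<rceil>}"
    define W where "W = (\<lambda>\<alpha>. coeff_weight \<sigma> (\<kappa> * r powr (1 / (2 * \<sigma>))) (\<alpha> :: 'n \<Rightarrow> nat))"
    have W: "W \<alpha> > 0" for \<alpha> unfolding W_def by (rule coeff_weight_pos[OF \<kappa>r(2)])
    define C where "C = D + 1 + (\<Sum>\<alpha>\<in>S. a \<alpha> / W \<alpha>)"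
    have an: "a \<alpha> / W \<alpha> \<ge> 0" for \<alpha> using a0 W by (intro divide_nonneg_pos) auto
    have sn: "(\<Sum>\<alpha>\<in>S. a \<alpha> / W \<alpha>) \<ge> 0" by (intro sum_nonneg an)
    have "a \<alpha> \<le> C * W \<alpha>" for \<alpha>
    proof (cases "real (mabs \<alpha>) \<ge> T")
      case True
      have "D * W \<alpha> \<le> C * W \<alpha>" using sn W[of \<alpha>] by (intro mult_right_mono) (auto simp: C_def)
      then show ?thesis using big[OF True] by (simp add: W_def)
    next
      case False
      then have "\<alpha> \<in> S" unfolding S_def by simp linarith
      then have "a \<alpha> / W \<alpha> \<le> (\<Sum>\<alpha>\<in>S. a \<alpha> / W \<alpha>)"
        by (intro member_le_sum) (use an finite_mabs_le in \<open>auto simp: S_def\<close>)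
      then have "a \<alpha> / W \<alpha> \<le> C" using D by (simp add: C_def)
      then show ?thesis using W[of \<alpha>] by (simp add: field_simps)
    qed
    moreover have "C > 0" using D sn by (simp add: C_def)
    ultimately show ?thesis unfolding W_def by blast
  qed
  then show ?thesis unfolding d_def by (intro exI[of _ \<kappa>]) (auto simp: \<kappa>_def)
qed


section \<open>Fourier inversion\<close>

text \<open>Supplies the integrability hypothesis of Fubini's theorem in the exchanges of integrals
  below, where the integrand is always dominated by a product.\<close>

lemma integrable_pair_bound:
  fixes f :: "'a \<times> 'b \<Rightarrow> 'c::{banach, second_countable_topology}"
  assumes "sigma_finite_measure M" "sigma_finite_measure N"
    and f: "f \<in> borel_measurable (M \<Otimes>\<^sub>M N)"
    and a: "integrable M a" and b: "integrable N b"
    and le: "\<And>x y. norm (f (x, y)) \<le> a x * b y"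
  shows "integrable (M \<Otimes>\<^sub>M N) f"
proof -
  interpret pair_sigma_finite M N using assms(1,2) by (simp add: pair_sigma_finite_def)
  have fy: "(\<lambda>y. f (x, y)) \<in> borel_measurable N" if "x \<in> space M" for x
    using f that by measurable
  have ix: "integrable N (\<lambda>y. f (x, y))" if "x \<in> space M" for x
    by (rule Bochner_Integration.integrable_bound[OF integrable_mult_right[OF b, of "a x"] fy[OF that]])
       (use le order_trans[OF le abs_ge_self] in \<open>auto intro!: AE_I2\<close>)
  show ?thesis
  proof (rule Fubini_integrable[OF f])
    have "(\<lambda>x. \<integral>y. norm (f (x, y)) \<partial>N) \<in> borel_measurable M"
      using f by measurable
    then show "integrable M (\<lambda>x. \<integral>y. norm (f (x, y)) \<partial>N)"
    proof (rule Bochner_Integration.integrable_bound[OF integrable_mult_left[OF a, of "integral\<^sup>L N b"]])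
      show "AE x in M. norm (\<integral>y. norm (f (x, y)) \<partial>N) \<le> norm (a x * integral\<^sup>L N b)"
      proof (rule AE_I2)
        fix x assume x: "x \<in> space M"
        have "(\<integral>y. norm (f (x, y)) \<partial>N) \<le> (\<integral>y. a x * b y \<partial>N)"
          by (intro integral_mono_AE AE_I2 le integrable_norm ix[OF x] integrable_mult_right b)
        then show "norm (\<integral>y. norm (f (x, y)) \<partial>N) \<le> norm (a x * integral\<^sup>L N b)" by simp
      qed
    qed
    show "AE x in M. integrable N (\<lambda>y. f (x, y))" by (rule AE_I2) (rule ix)
  qed
qed

lemma measurable_pair_cong:
  "sets M = sets M' \<Longrightarrow> sets N = sets N' \<Longrightarrow> borel_measurable (M \<Otimes>\<^sub>M N) = borel_measurable (M' \<Otimes>\<^sub>M N')"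
  by (intro measurable_cong_sets sets_pair_measure_cong refl)

lemma gaussian_fourier_real:
  "(LBINT x::real. of_real (exp (- x\<^sup>2 / 2)) * exp (\<i> * of_real (x * t))) = of_real (sqrt (2 * pi) * exp (- t\<^sup>2 / 2))"
    and gaussian_fourier_real_integrable:
  "integrable lborel (\<lambda>x::real. of_real (exp (- x\<^sup>2 / 2)) * exp (\<i> * of_real (x * t)))"
proof -
  have "of_real (exp (- (t\<^sup>2) / 2)) = char std_normal_distribution t"
    by (simp add: char_std_normal_distribution)
  also have "\<dots> = (LBINT x. std_normal_density x *\<^sub>R exp (\<i> * of_real (t * x)))"
    unfolding char_def by (subst integral_density) auto
  also have "\<dots> = (LBINT x. of_real (1 / sqrt (2 * pi)) * (of_real (exp (- x\<^sup>2 / 2)) * exp (\<i> * of_real (x * t))))"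
    by (simp add: std_normal_density_def scaleR_conv_of_real mult_ac)
  also have "\<dots> = of_real (1 / sqrt (2 * pi)) * (LBINT x. of_real (exp (- x\<^sup>2 / 2)) * exp (\<i> * of_real (x * t)))"
    by simp
  finally have *: "of_real (exp (- (t\<^sup>2) / 2)) = of_real (1 / sqrt (2 * pi)) * (LBINT x. of_real (exp (- x\<^sup>2 / 2)) * exp (\<i> * of_real (x * t)))" .
  have "of_real (sqrt (2 * pi)) * of_real (1 / sqrt (2 * pi)) = (1::complex)"
    by (subst of_real_mult[symmetric]) simp
  then show "(LBINT x::real. of_real (exp (- x\<^sup>2 / 2)) * exp (\<i> * of_real (x * t))) = of_real (sqrt (2 * pi) * exp (- t\<^sup>2 / 2))"
    using arg_cong[OF *, of "\<lambda>z. of_real (sqrt (2 * pi)) * z"] by (simp only: mult.assoc[symmetric] of_real_mult mult_1)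
  \<comment> \<open>A function that is not integrable has Bochner integral 0 by convention, so a
    nonzero integral proves integrability.\<close>
  then show "integrable lborel (\<lambda>x::real. of_real (exp (- x\<^sup>2 / 2)) * exp (\<i> * of_real (x * t)))"
    by (metis (no_types, lifting) exp_not_eq_zero mult_eq_0_iff not_integrable_integral_eq of_real_eq_0_iff pi_neq_zero real_sqrt_eq_zero_cancel_iff zero_neq_numeral)
qed

lemma gaussian_fourier:
  fixes w :: "'a::euclidean_space"
  shows "(LBINT x. of_real (exp (- (norm x)\<^sup>2 / 2)) * exp (\<i> * of_real (x \<bullet> w))) = of_real (sqrt (2 * pi) ^ DIM('a) * exp (- (norm w)\<^sup>2 / 2))"
    and gaussian_fourier_integrable: "integrable lborel (\<lambda>x::'a. of_real (exp (- (norm x)\<^sup>2 / 2)) * exp (\<i> * of_real (x \<bullet> w)))"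
proof -
  let ?g = "\<lambda>x::'a. of_real (exp (- (norm x)\<^sup>2 / 2)) * exp (\<i> * of_real (x \<bullet> w))"
  interpret product_sigma_finite "\<lambda>_::'a. lborel :: real measure" ..
  have nrm: "(norm x)\<^sup>2 = (\<Sum>b\<in>Basis. (x \<bullet> b)\<^sup>2)" for x :: 'a
    unfolding power2_norm_eq_inner euclidean_inner[of x x] by (simp add: power2_eq_square)
  have m: "?g \<in> borel_measurable borel" by measurable
  have "(LBINT x. ?g x) = (\<integral>f. ?g (\<Sum>b\<in>Basis. f b *\<^sub>R b) \<partial>(\<Pi>\<^sub>M b\<in>Basis. lborel))"
    unfolding lborel_eq[where 'a='a] by (rule integral_distr) (use m in measurable)
  also have "\<dots> = (\<integral>f. (\<Prod>b\<in>Basis. of_real (exp (- (f b)\<^sup>2 / 2)) * exp (\<i> * of_real (f b * (w \<bullet> b)))) \<partial>(\<Pi>\<^sub>M b\<in>Basis. lborel))"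
  proof (rule Bochner_Integration.integral_cong[OF refl])
    fix f :: "'a \<Rightarrow> real"
    have "(\<Sum>b\<in>Basis. f b *\<^sub>R b) \<bullet> w = (\<Sum>b\<in>Basis. f b * (w \<bullet> b))"
      unfolding inner_sum_left inner_scaleR_left inner_commute[of w] ..
    then show "?g (\<Sum>b\<in>Basis. f b *\<^sub>R b) = (\<Prod>b\<in>Basis. of_real (exp (- (f b)\<^sup>2 / 2)) * exp (\<i> * of_real (f b * (w \<bullet> b))))"
      by (simp add: nrm exp_sum prod.distrib sum_negf[symmetric] sum_divide_distrib sum_distrib_left)
  qed
  also have "\<dots> = (\<Prod>b\<in>Basis. LBINT x. of_real (exp (- x\<^sup>2 / 2)) * exp (\<i> * of_real (x * (w \<bullet> b))))"
    by (rule product_integral_prod[OF finite_Basis gaussian_fourier_real_integrable])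
  also have "\<dots> = of_real (sqrt (2 * pi) ^ DIM('a) * exp (- (norm w)\<^sup>2 / 2))"
    unfolding gaussian_fourier_real by (simp add: nrm exp_sum prod.distrib sum_negf[symmetric] sum_divide_distrib)
  finally show eq: "(LBINT x. ?g x) = of_real (sqrt (2 * pi) ^ DIM('a) * exp (- (norm w)\<^sup>2 / 2))" .
  show "integrable lborel ?g"
  proof (rule ccontr)
    assume "\<not> ?thesis"
    then have "(LBINT x. ?g x) = 0" by (rule not_integrable_integral_eq)
    with eq show False by simp
  qed
qed

text \<open>Positive sign in the exponent and no normalization; the inverse transform accordingly
  carries the negative sign and the factor (2 pi)^d.\<close>

definition fourier :: "(real^'n \<Rightarrow> complex) \<Rightarrow> real^'n \<Rightarrow> complex" where
  "fourier f \<xi> = (LBINT y. f y * exp (\<i> * of_real (y \<bullet> \<xi>)))"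

lemma fourier_measurable:
  assumes [measurable]: "f \<in> borel_measurable borel" shows "fourier f \<in> borel_measurable borel"
  unfolding fourier_def[abs_def] by measurable

lemma fourier_coord:
  fixes f :: "real^'n \<Rightarrow> complex"
  assumes "f \<in> schwartz" shows "cmod (of_real (\<xi> $ i) * fourier f \<xi>) = cmod (fourier (pderivative i f) \<xi>)"
proof -
  let ?e = "\<lambda>y. exp (\<i> * of_real (y \<bullet> \<xi>))"
  have s: "(\<lambda>y. ?e y * f y) \<in> schwartz" "(\<lambda>y. ?e y * pderivative i f y) \<in> schwartz"
    by (intro schwartz_cis schwartz_pderivative assms)+
  have pe: "pderivative i ?e y = ?e y * (\<i> * of_real (\<xi> $ i))" for y
    by (rule trans[OF pderivative_eqI[OF has_derivative_cis]]) (simp add: inner_commute inner_axis)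
  have "0 = (LBINT y. pderivative i (\<lambda>y. ?e y * f y) y)"
    using integral_pderivative_schwartz[OF s(1)] by simp
  also have "pderivative i (\<lambda>y. ?e y * f y) = (\<lambda>y. ?e y * pderivative i f y + (\<i> * of_real (\<xi> $ i)) * (?e y * f y))"
    by (subst pderivative_mult)
       (auto simp: pe mult_ac intro: smooth_differentiable schwartz_smooth[OF assms] differentiableI[OF has_derivative_cis])
  also have "(LBINT y. ?e y * pderivative i f y + (\<i> * of_real (\<xi> $ i)) * (?e y * f y))
     = (LBINT y. ?e y * pderivative i f y) + (\<i> * of_real (\<xi> $ i)) * (LBINT y. ?e y * f y)"
    by (subst Bochner_Integration.integral_add) (auto intro!: schwartz_integrable s integrable_mult_right)
  finally have "fourier (pderivative i f) \<xi> = - (\<i> * (of_real (\<xi> $ i) * fourier f \<xi>))"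
    by (simp add: fourier_def mult_ac eq_neg_iff_add_eq_0)
  then show ?thesis by (simp add: norm_mult)
qed

text \<open>Each factor 1 + |\<xi>| is exchanged for first derivatives of the family, which is again
  of the same kind.\<close>

lemma fourier_decay:
  fixes F :: "'i \<Rightarrow> real^'n \<Rightarrow> complex"
  assumes "schwf P F" and P: "\<And>i. P i \<ge> 1"
  shows "polyb (\<lambda>z. P (fst z)) (\<lambda>z. (1 + norm (snd z)) ^ k * cmod (fourier (F (fst z)) (snd z)))"
  using assms(1)
proof (induction k arbitrary: F)
  case 0
  obtain C m where C: "C > 0" "\<And>\<iota> x. (1 + norm x) ^ 0 * cmod (iter_pderivative [] (F \<iota>) x) \<le> C * P \<iota> ^ m * wt x"
    using schwf_wt_bound[OF 0 P] by blast
  show ?case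
  proof (rule polybI)
    fix z :: "'i \<times> (real^'n)"
    have "cmod (fourier (F (fst z)) (snd z)) \<le> (C * P (fst z) ^ m) * integral\<^sup>L lborel (wt :: real^'n \<Rightarrow> real)"
      unfolding fourier_def
    proof (rule wt_bound_integrable)
      have [measurable]: "F (fst z) \<in> borel_measurable borel" by (intro schwartz_measurable schwf_schwartz[OF 0])
      show "(\<lambda>y. F (fst z) y * exp (\<i> * of_real (y \<bullet> snd z))) \<in> borel_measurable borel" by measurable
      show "norm (F (fst z) y * exp (\<i> * of_real (y \<bullet> snd z))) \<le> C * P (fst z) ^ m * wt y" for y
        using C(2)[of y "fst z"] by (simp add: norm_mult)
    qed
    then show "norm ((1 + norm (snd z)) ^ 0 * cmod (fourier (F (fst z)) (snd z))) \<le> (C * integral\<^sup>L lborel (wt :: real^'n \<Rightarrow> real)) * P (fst z) ^ m"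
      by (simp add: mult_ac)
  qed
next
  case (Suc k)
  have "polyb (\<lambda>z. P (fst z)) (\<lambda>z. (1 + norm (snd z)) ^ k * cmod (fourier (F (fst z)) (snd z))
     + (\<Sum>j\<in>UNIV. (1 + norm (snd z)) ^ k * cmod (fourier (pderivative j (F (fst z))) (snd z))))"
    by (intro polyb_add polyb_sum Suc.IH Suc.prems schwf_pderivative P)
  then show ?case
  proof (rule polyb_mono)
    fix z :: "'i \<times> (real^'n)"
    have sF: "F (fst z) \<in> schwartz" by (rule schwf_schwartz[OF Suc.prems])
    have "1 + norm (snd z) \<le> 1 + (\<Sum>j\<in>UNIV. \<bar>snd z $ j\<bar>)" using norm_le_l1_cart[of "snd z"] by simp
    then have "(1 + norm (snd z)) * ((1 + norm (snd z)) ^ k * cmod (fourier (F (fst z)) (snd z)))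
       \<le> (1 + (\<Sum>j\<in>UNIV. \<bar>snd z $ j\<bar>)) * ((1 + norm (snd z)) ^ k * cmod (fourier (F (fst z)) (snd z)))"
      by (rule mult_right_mono) simp
    also have "\<dots> = (1 + norm (snd z)) ^ k * cmod (fourier (F (fst z)) (snd z))
     + (\<Sum>j\<in>UNIV. (1 + norm (snd z)) ^ k * cmod (fourier (pderivative j (F (fst z))) (snd z)))"
      by (simp add: fourier_coord[OF sF, symmetric] distrib_left distrib_right sum_distrib_left sum_distrib_right norm_mult mult_ac)
    finally show "norm ((1 + norm (snd z)) ^ Suc k * cmod (fourier (F (fst z)) (snd z))) \<le> norm ((1 + norm (snd z)) ^ k * cmod (fourier (F (fst z)) (snd z))
     + (\<Sum>j\<in>UNIV. (1 + norm (snd z)) ^ k * cmod (fourier (pderivative j (F (fst z))) (snd z))))"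
      by (simp add: mult.assoc)
  qed
qed

lemma polyb_wt_bound:
  fixes g :: "'i \<Rightarrow> 'a::euclidean_space \<Rightarrow> complex"
  assumes "polyb (\<lambda>z. P (fst z)) (\<lambda>z. (1 + norm (snd z)) ^ (k + 2 * DIM('a)) * cmod (g (fst z) (snd z)))" "\<And>i. P i \<ge> 1"
  obtains C m where "C > 0" "\<And>\<iota> x. (1 + norm x) ^ k * cmod (g \<iota> x) \<le> C * P \<iota> ^ m * wt x"
proof -
  from polybE[OF assms(1,2)] obtain C m where C: "C > 0"
    "\<And>i m'. m' \<ge> m \<Longrightarrow> norm ((1 + norm (snd i)) ^ (k + 2 * DIM('a)) * cmod (g (fst i) (snd i))) \<le> C * P (fst i) ^ m'"
    by metis
  have "(1 + norm x) ^ k * cmod (g \<iota> x) \<le> C * P \<iota> ^ m * wt x" for \<iota> x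
  proof -
    have "(1 + norm x) ^ (2 * DIM('a)) * ((1 + norm x) ^ k * cmod (g \<iota> x)) \<le> C * P \<iota> ^ m"
      using C(2)[of m "(\<iota>, x)"] by (simp add: power_add mult_ac)
    moreover have "(1 + norm x) ^ (2 * DIM('a)) > 0" by (simp add: zero_less_power add_pos_nonneg)
    ultimately show ?thesis by (simp add: wt_def field_simps)
  qed
  with C(1) that show ?thesis by blast
qed

lemma fourier_integrable:
  fixes f :: "real^'n \<Rightarrow> complex"
  assumes "f \<in> schwartz"
  obtains C where "C > 0" "\<And>\<xi>. cmod (fourier f \<xi>) \<le> C * wt \<xi>" "integrable lborel (fourier f)"
proof -
  obtain C where C: "C > 0" "\<And>\<xi>. (1 + norm \<xi>) ^ 0 * cmod (fourier f \<xi>) \<le> C * 1 ^ m * wt \<xi>" for m :: nat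
    using polyb_wt_bound[OF fourier_decay[OF schwartz_schwf[OF assms, of "\<lambda>_::unit. 1"], of "0 + 2 * DIM(real^'n)"]] by auto
  then have "integrable lborel (fourier f)"
    by (intro wt_bound_integrable[of _ C] fourier_measurable schwartz_measurable assms) auto
  with C that show ?thesis by auto
qed

text \<open>Gaussian regularization: a dilated Gaussian is inserted, the integrals are exchanged,
  the Gaussian is its own transform up to a constant, and a rescaling moves the small parameter into
  f. Both limits follow by dominated convergence; other points are reached by translation.\<close>

lemma fourier_inversion_zero:
  fixes f :: "real^'n \<Rightarrow> complex"
  assumes f: "f \<in> schwartz"
  shows "(LBINT \<xi>. fourier f \<xi>) = of_real ((2 * pi) ^ CARD('n)) * f 0"
proof -
  define \<gamma> where "\<gamma> = (\<lambda>x::real^'n. exp (- (norm x)\<^sup>2 / 2))"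
  define s where "s = sqrt (2 * pi) ^ CARD('n)"
  define e where "e = (\<lambda>n. inverse (real (Suc n)))"
  have e: "e n > 0" for n by (simp add: e_def)
  have elim: "e \<longlonglongrightarrow> 0" unfolding e_def by (rule LIMSEQ_inverse_real_of_nat)
  note [measurable] = schwartz_measurable[OF f] fourier_measurable[OF schwartz_measurable[OF f]]
  have [measurable]: "\<gamma> \<in> borel_measurable borel" unfolding \<gamma>_def by measurable
  have \<gamma>le: "0 \<le> \<gamma> x" "\<gamma> x \<le> 1" for x by (simp_all add: \<gamma>_def)
  have \<gamma>0: "\<gamma> 0 = 1" by (simp add: \<gamma>_def)
  have \<gamma>c: "continuous_on UNIV \<gamma>" unfolding \<gamma>_def by (intro continuous_intros) auto
  have gf: "(LBINT x. of_real (\<gamma> x) * exp (\<i> * of_real (x \<bullet> w))) = of_real (s * \<gamma> w)" for w :: "real^'n"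
    using gaussian_fourier[of w] by (simp add: \<gamma>_def s_def)
  have \<gamma>i: "integrable lborel (\<lambda>x. of_real (\<gamma> x) :: complex)"
    using gaussian_fourier_integrable[of "0 :: real^'n"] by (simp add: \<gamma>_def)
  then have \<gamma>ir: "integrable lborel \<gamma>" using integrable_Re[OF \<gamma>i] by simp
  have f0: "(\<lambda>n. f (e n *\<^sub>R w)) \<longlonglongrightarrow> f 0" for w
  proof -
    have "(\<lambda>n. e n *\<^sub>R w) \<longlonglongrightarrow> 0" using tendsto_scaleR[OF elim tendsto_const[of w]] by simp
    then show ?thesis
      using smooth_continuous[OF schwartz_smooth[OF f], of UNIV] by (auto simp: continuous_on_eq_continuous_within intro: isCont_tendsto_compose)
  qed
  have \<gamma>lim: "(\<lambda>n. \<gamma> (e n *\<^sub>R \<xi>)) \<longlonglongrightarrow> 1" for \<xi>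
  proof -
    have "(\<lambda>n. e n *\<^sub>R \<xi>) \<longlonglongrightarrow> 0" using tendsto_scaleR[OF elim tendsto_const[of \<xi>]] by simp
    then show ?thesis
      using \<gamma>c \<gamma>0 by (metis continuous_on_eq_continuous_at isCont_tendsto_compose open_UNIV UNIV_I)
  qed
  define I where "I = (\<lambda>n. LBINT \<xi>. fourier f \<xi> * of_real (\<gamma> (e n *\<^sub>R \<xi>)))"
  obtain C where C: "C > 0" "\<And>\<xi>. cmod (fourier f \<xi>) \<le> C * wt \<xi>" "integrable lborel (fourier f)"
    using fourier_integrable[OF f] by blast
  have l1: "I \<longlonglongrightarrow> (LBINT \<xi>. fourier f \<xi>)"
    unfolding I_def
  proof (rule integral_dominated_convergence[where w="\<lambda>\<xi>. C * wt \<xi>"])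
    show "integrable lborel (\<lambda>\<xi>::real^'n. C * wt \<xi>)" by (intro integrable_mult_right integrable_wt)
    show "AE \<xi> in lborel. (\<lambda>n. fourier f \<xi> * of_real (\<gamma> (e n *\<^sub>R \<xi>))) \<longlonglongrightarrow> fourier f \<xi>"
    proof (rule AE_I2)
      fix \<xi> :: "real^'n"
      have "(\<lambda>n. fourier f \<xi> * of_real (\<gamma> (e n *\<^sub>R \<xi>))) \<longlonglongrightarrow> fourier f \<xi> * of_real 1"
        by (intro tendsto_intros \<gamma>lim)
      then show "(\<lambda>n. fourier f \<xi> * of_real (\<gamma> (e n *\<^sub>R \<xi>))) \<longlonglongrightarrow> fourier f \<xi>" by simp
    qed
    show "AE \<xi> in lborel. norm (fourier f \<xi> * of_real (\<gamma> (e n *\<^sub>R \<xi>))) \<le> C * wt \<xi>" for n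
    proof (rule AE_I2)
      fix \<xi> :: "real^'n"
      have "cmod (fourier f \<xi>) * \<gamma> (e n *\<^sub>R \<xi>) \<le> cmod (fourier f \<xi>) * 1" by (intro mult_left_mono \<gamma>le) auto
      then show "norm (fourier f \<xi> * of_real (\<gamma> (e n *\<^sub>R \<xi>))) \<le> C * wt \<xi>"
        using C(2)[of \<xi>] \<gamma>le by (simp add: norm_mult)
    qed
  qed simp_all
  have I_eq: "I n = of_real s * (LBINT w. f (e n *\<^sub>R w) * of_real (\<gamma> w))" for n
  proof -
    have en: "e n \<noteq> 0" "\<bar>e n\<bar> = e n" using e[of n] by auto
    \<comment> \<open>If the dilated Gaussian were not integrable, its integral would be 0 by
      convention, against the scaling formula.\<close>
    have \<gamma>ni: "integrable lborel (\<lambda>\<xi>. \<gamma> (e n *\<^sub>R \<xi>))"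
    proof (rule ccontr)
      assume "\<not> ?thesis"
      then have "(LBINT \<xi>. \<gamma> (e n *\<^sub>R \<xi>)) = 0" by (rule not_integrable_integral_eq)
      then have "(LBINT \<xi>. \<gamma> \<xi>) = 0" using lborel_integral_affine[of "e n" \<gamma> 0] en by simp
      moreover have "(LBINT \<xi>. \<gamma> \<xi>) > 0"
        by (rule integral_positive_at[OF \<gamma>ir \<gamma>c \<gamma>le(1), of 0]) (simp add: \<gamma>0)
      ultimately show False by simp
    qed
    have inner: "(LBINT \<xi>. exp (\<i> * of_real (z \<bullet> \<xi>)) * of_real (\<gamma> (e n *\<^sub>R \<xi>))) = of_real (s * \<gamma> (z /\<^sub>R e n) / e n ^ CARD('n))" for z
    proof -
      let ?G = "\<lambda>\<eta>. of_real (\<gamma> \<eta>) * exp (\<i> * of_real (\<eta> \<bullet> (z /\<^sub>R e n))) :: complex"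
      have "of_real (s * \<gamma> (z /\<^sub>R e n)) = (LBINT \<eta>. ?G \<eta>)" by (rule gf[symmetric])
      also have "\<dots> = e n ^ CARD('n) *\<^sub>R (LBINT \<xi>. ?G (0 + e n *\<^sub>R \<xi>))"
        using lborel_integral_affine[OF en(1), of ?G 0] en(2) by simp
      also have "(\<lambda>\<xi>. ?G (0 + e n *\<^sub>R \<xi>)) = (\<lambda>\<xi>. exp (\<i> * of_real (z \<bullet> \<xi>)) * of_real (\<gamma> (e n *\<^sub>R \<xi>)))"
      proof
        fix \<xi> :: "real^'n"
        have "(0 + e n *\<^sub>R \<xi>) \<bullet> (z /\<^sub>R e n) = z \<bullet> \<xi>" using en by (simp add: inner_commute)
        then show "?G (0 + e n *\<^sub>R \<xi>) = exp (\<i> * of_real (z \<bullet> \<xi>)) * of_real (\<gamma> (e n *\<^sub>R \<xi>))"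
          by (simp only: add_0 mult.commute)
      qed
      finally have "of_real (s * \<gamma> (z /\<^sub>R e n)) = of_real (e n ^ CARD('n)) * (LBINT \<xi>. exp (\<i> * of_real (z \<bullet> \<xi>)) * of_real (\<gamma> (e n *\<^sub>R \<xi>)))"
        by (simp only: scaleR_conv_of_real)
      moreover have "(of_real (e n ^ CARD('n)) :: complex) \<noteq> 0" using en by simp
      ultimately show ?thesis by (simp add: field_simps)
    qed
    let ?f = "\<lambda>(z::real^'n, \<xi>::real^'n). f z * exp (\<i> * of_real (z \<bullet> \<xi>)) * of_real (\<gamma> (e n *\<^sub>R \<xi>))"
    have int: "integrable (lborel \<Otimes>\<^sub>M lborel) ?f"
    proof (rule integrable_pair_bound)
      show "?f \<in> borel_measurable (lborel \<Otimes>\<^sub>M lborel)" by measurable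
      show "integrable lborel (\<lambda>z. cmod (f z))" by (intro integrable_norm schwartz_integrable f)
      show "integrable lborel (\<lambda>\<xi>. \<gamma> (e n *\<^sub>R \<xi>))" by (rule \<gamma>ni)
      show "norm (?f (z, \<xi>)) \<le> cmod (f z) * \<gamma> (e n *\<^sub>R \<xi>)" for z \<xi>
        using \<gamma>le by (simp add: norm_mult)
    qed (simp_all add: lborel.sigma_finite_measure_axioms)
    have "I n = (LBINT \<xi>. LBINT z. f z * exp (\<i> * of_real (z \<bullet> \<xi>)) * of_real (\<gamma> (e n *\<^sub>R \<xi>)))"
      unfolding I_def fourier_def by simp
    also have "\<dots> = (LBINT z. LBINT \<xi>. f z * exp (\<i> * of_real (z \<bullet> \<xi>)) * of_real (\<gamma> (e n *\<^sub>R \<xi>)))"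
      by (rule lborel_pair.Fubini_integral[OF int])
    also have "\<dots> = (LBINT z. f z * of_real (s * \<gamma> (z /\<^sub>R e n) / e n ^ CARD('n)))"
      by (simp only: mult.assoc integral_mult_right_zero inner)
    also have "\<dots> = e n ^ CARD('n) *\<^sub>R (LBINT w. f (0 + e n *\<^sub>R w) * of_real (s * \<gamma> ((0 + e n *\<^sub>R w) /\<^sub>R e n) / e n ^ CARD('n)))"
      using lborel_integral_affine[OF en(1), of "\<lambda>z. f z * of_real (s * \<gamma> (z /\<^sub>R e n) / e n ^ CARD('n))" 0] en(2) by simp
    also have "\<dots> = (LBINT w. of_real (e n ^ CARD('n)) * (f (0 + e n *\<^sub>R w) * of_real (s * \<gamma> ((0 + e n *\<^sub>R w) /\<^sub>R e n) / e n ^ CARD('n))))"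
      by (simp only: scaleR_conv_of_real integral_mult_right_zero)
    also have "\<dots> = (LBINT w. of_real s * (f (e n *\<^sub>R w) * of_real (\<gamma> w)))"
    proof (rule Bochner_Integration.integral_cong[OF refl])
      fix w :: "real^'n"
      have "(0 + e n *\<^sub>R w) /\<^sub>R e n = w" using en by simp
      moreover have "of_real (e n ^ CARD('n)) * (a * of_real (s * b / e n ^ CARD('n))) = of_real s * (a * of_real b)" for a :: complex and b
        using en by simp
      ultimately show "of_real (e n ^ CARD('n)) * (f (0 + e n *\<^sub>R w) * of_real (s * \<gamma> ((0 + e n *\<^sub>R w) /\<^sub>R e n) / e n ^ CARD('n)))
         = of_real s * (f (e n *\<^sub>R w) * of_real (\<gamma> w))" by (simp only: add_0)
    qed
    finally show ?thesis by simp
  qed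
  obtain D where D: "\<And>x. cmod (f x) \<le> D"
  proof -
    obtain D where "\<And>x. norm ((1 + norm x) ^ 0 * cmod (iter_pderivative [] f x)) \<le> D"
      using f unfolding schwartz_def bounded_iff by blast
    then show ?thesis using that by auto
  qed
  have "(\<lambda>n. LBINT w. f (e n *\<^sub>R w) * of_real (\<gamma> w)) \<longlonglongrightarrow> (LBINT w. f 0 * of_real (\<gamma> w))"
  proof (rule integral_dominated_convergence[where w="\<lambda>w. D * \<gamma> w"])
    show "integrable lborel (\<lambda>w. D * \<gamma> w)" by (intro integrable_mult_right \<gamma>ir)
    show "AE w in lborel. (\<lambda>n. f (e n *\<^sub>R w) * of_real (\<gamma> w)) \<longlonglongrightarrow> f 0 * of_real (\<gamma> w)"
      by (rule AE_I2) (intro tendsto_intros f0)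
    show "AE w in lborel. norm (f (e n *\<^sub>R w) * of_real (\<gamma> w)) \<le> D * \<gamma> w" for n
      using \<gamma>le D by (intro AE_I2) (simp add: norm_mult mult_right_mono)
  qed simp_all
  then have "(\<lambda>n. of_real s * (LBINT w. f (e n *\<^sub>R w) * of_real (\<gamma> w))) \<longlonglongrightarrow> of_real s * (LBINT w. f 0 * of_real (\<gamma> w))"
    by (intro tendsto_intros)
  then have "I \<longlonglongrightarrow> of_real s * (LBINT w. f 0 * of_real (\<gamma> w))" by (simp only: I_eq[abs_def])
  with l1 have "(LBINT \<xi>. fourier f \<xi>) = of_real s * (LBINT w. f 0 * of_real (\<gamma> w))" by (rule LIMSEQ_unique)
  also have "(LBINT w. f 0 * of_real (\<gamma> w)) = f 0 * of_real s" using gf[of 0] by (simp add: \<gamma>0)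
  also have "of_real s * (f 0 * of_real s) = of_real (s * s) * f 0" by simp
  also have "s * s = (2 * pi) ^ CARD('n)"
    unfolding s_def power_mult_distrib[symmetric] by simp
  finally show ?thesis .
qed

lemma fourier_inversion:
  fixes f :: "real^'n \<Rightarrow> complex"
  assumes f: "f \<in> schwartz"
  shows "(LBINT \<xi>. fourier f \<xi> * exp (- (\<i> * of_real (y \<bullet> \<xi>)))) = of_real ((2 * pi) ^ CARD('n)) * f y"
proof -
  have s: "(\<lambda>z. f (z - (- y))) \<in> schwartz" by (rule schwartz_translate[OF f])
  note [measurable] = schwartz_measurable[OF f]
  have "fourier (\<lambda>z. f (z - (- y))) \<xi> = fourier f \<xi> * exp (- (\<i> * of_real (y \<bullet> \<xi>)))" for \<xi>
  proof -
    have "fourier f \<xi> = (LBINT z. f (y + z) * exp (\<i> * of_real ((y + z) \<bullet> \<xi>)))"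
      unfolding fourier_def using lborel_integral_translate[of "\<lambda>z. f z * exp (\<i> * of_real (z \<bullet> \<xi>))" y] by simp
    also have "\<dots> = (LBINT z. exp (\<i> * of_real (y \<bullet> \<xi>)) * (f (z - (- y)) * exp (\<i> * of_real (z \<bullet> \<xi>))))"
      by (simp add: inner_add_left distrib_left exp_add mult_ac add.commute)
    finally have "fourier f \<xi> = exp (\<i> * of_real (y \<bullet> \<xi>)) * fourier (\<lambda>z. f (z - (- y))) \<xi>"
      by (simp add: fourier_def)
    then show ?thesis by (simp add: exp_minus field_simps)
  qed
  then show ?thesis using fourier_inversion_zero[OF s] by simp
qed

section \<open>The short-time Fourier transform\<close>

text \<open>Pairing u with this function gives the short-time Fourier transform at X up to the
  factor (2 pi)^(-d/2). The pairing is bilinear, so the conjugations are part of the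
  function.\<close>

definition atom :: "(real^'n \<Rightarrow> complex) \<Rightarrow> (real^'n) \<times> (real^'n) \<Rightarrow> real^'n \<Rightarrow> complex" where
  "atom \<phi> X y = cnj (\<phi> (y - fst X)) * exp (- (\<i> * of_real (y \<bullet> snd X)))"

text \<open>The coefficient function of the inversion formula, with window and exponential conjugate
  to those of \<open>atom\<close>: integrated against \<open>atom \<phi>\<close> over phase space it
  reproduces \<psi> up to a constant.\<close>

definition cross :: "(real^'n \<Rightarrow> complex) \<Rightarrow> (real^'n \<Rightarrow> complex) \<Rightarrow> (real^'n) \<times> (real^'n) \<Rightarrow> complex" where
  "cross \<psi> \<phi> X = fourier (\<lambda>y. \<psi> y * \<phi> (y - fst X)) (snd X)"

lemma one_plus_norm_pair:
  fixes X :: "(real^'n) \<times> (real^'n)"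
  shows "1 + norm X \<le> (1 + norm (fst X)) * (1 + norm (snd X))"
    "1 + norm (fst X) \<le> 1 + norm X" "1 + norm (snd X) \<le> 1 + norm X"
proof -
  have "norm X \<le> norm (fst X) + norm (snd X)" using norm_Pair_le[of "fst X" "snd X"] by simp
  moreover have "0 \<le> norm (fst X) * norm (snd X)" by simp
  ultimately show "1 + norm X \<le> (1 + norm (fst X)) * (1 + norm (snd X))" by (simp only: distrib_left distrib_right mult_1 mult_1_right)
qed (use norm_fst_le[of "fst X" "snd X"] norm_snd_le[of "snd X" "fst X"] in simp_all)

text \<open>Translation costs powers of 1 + |x| and modulation powers of 1 + |\<xi>|; each of these
  is at most 1 + |X|, whence the square.\<close>

lemma schwf_atom:
  assumes "\<phi> \<in> schwartz"
  shows "schwf (\<lambda>X. (1 + norm X)\<^sup>2) (atom \<phi>)"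
proof -
  let ?P = "\<lambda>X::(real^'a)\<times>(real^'a). (1 + norm (fst X)) * (1 + norm (snd X))"
  have 1: "schwf (\<lambda>X. 1 + norm (fst X)) (\<lambda>X y. cnj (\<phi> (y - fst X)))"
    by (rule schwf_reindex[OF schwf_translate[OF schwartz_cnj[OF assms]]])
  have 2: "modf (\<lambda>X. 1 + norm (- snd X)) (\<lambda>X y. exp (\<i> * of_real (y \<bullet> (- snd X))))"
    by (rule modf_reindex[OF modf_cis])
  have p: "?P X \<ge> 1" "1 + norm (fst X) \<le> ?P X" "1 + norm (- snd X) \<le> ?P X" "?P X \<le> (1 + norm X)\<^sup>2" for X
  proof -
    show "?P X \<ge> 1" "1 + norm (fst X) \<le> ?P X" "1 + norm (- snd X) \<le> ?P X" by (simp_all add: algebra_simps)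
    show "?P X \<le> (1 + norm X)\<^sup>2" unfolding power2_eq_square by (intro mult_mono one_plus_norm_pair) auto
  qed
  have "schwf ?P (\<lambda>X y. exp (\<i> * of_real (y \<bullet> (- snd X))) * cnj (\<phi> (y - fst X)))"
    by (intro schwf_mult modf_weaken[OF 2 _ p(3)] schwf_weaken[OF 1 _ p(2)] p(1)) simp_all
  then have 3: "schwf ?P (atom \<phi>)" by (simp add: atom_def[abs_def] mult.commute)
  show ?thesis by (rule schwf_weaken[OF 3 p(1) p(4)])
qed

lemma schwartz_atom: "\<phi> \<in> schwartz \<Longrightarrow> atom \<phi> X \<in> schwartz"
  by (rule schwf_schwartz[OF schwf_atom])

lemma atom_measurable:
  assumes "\<phi> \<in> schwartz" shows "(\<lambda>z. atom \<phi> (fst z) (snd z)) \<in> borel_measurable (borel \<Otimes>\<^sub>M borel)"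
proof -
  note [measurable] = schwartz_measurable[OF assms]
  have "(\<lambda>z::((real^'a)\<times>(real^'a))\<times>(real^'a). cnj (\<phi> (snd z - fst (fst z)))) \<in> borel_measurable borel"
    "(\<lambda>z::((real^'a)\<times>(real^'a))\<times>(real^'a). exp (- (\<i> * complex_of_real (snd z \<bullet> snd (fst z))))) \<in> borel_measurable borel"
    by (intro borel_measurable_continuous_onI continuous_intros continuous_on_compose2[OF smooth_continuous[OF schwartz_smooth[OF assms], of UNIV]]; simp)+
  then show ?thesis unfolding atom_def borel_prod by (rule borel_measurable_times)
qed

lemma cross_measurable:
  assumes "\<phi> \<in> schwartz" "\<psi> \<in> schwartz" shows "cross \<psi> \<phi> \<in> borel_measurable borel"
proof -
  have "(\<lambda>z::((real^'a)\<times>(real^'a))\<times>(real^'a). \<psi> (snd z) * \<phi> (snd z - fst (fst z)) * exp (\<i> * of_real (snd z \<bullet> snd (fst z)))) \<in> borel_measurable (borel \<Otimes>\<^sub>M borel)"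
    unfolding borel_prod
    by (intro borel_measurable_continuous_onI continuous_intros continuous_on_compose2[OF smooth_continuous[OF schwartz_smooth[OF assms(1)], of UNIV]]
         continuous_on_compose2[OF smooth_continuous[OF schwartz_smooth[OF assms(2)], of UNIV]]; simp)
  then have "(\<lambda>z::((real^'a)\<times>(real^'a))\<times>(real^'a). \<psi> (snd z) * \<phi> (snd z - fst (fst z)) * exp (\<i> * of_real (snd z \<bullet> snd (fst z)))) \<in> borel_measurable (borel \<Otimes>\<^sub>M lborel)"
    unfolding measurable_pair_cong[OF refl sets_lborel] .
  then show ?thesis
    unfolding cross_def[abs_def] fourier_def
    by (intro lborel.borel_measurable_lebesgue_integral) (simp add: case_prod_beta')
qed

text \<open>Decay in the frequency variable comes from the Fourier transform of a family, decay in
  the space variable from weighted translates of the window, and (1 + |x|) (1 + |\<xi>|) dominates 1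
  + |X|.\<close>

lemma cross_decay:
  fixes F :: "'i \<Rightarrow> real^'n \<Rightarrow> complex"
  assumes "schwf P F" and P: "\<And>i. P i \<ge> 1" and \<phi>: "\<phi> \<in> schwartz"
  shows "polyb (\<lambda>z. P (fst z)) (\<lambda>z. (1 + norm (snd z)) ^ k * cmod (cross (F (fst z)) \<phi> (snd z)))"
proof -
  let ?\<Psi> = "\<lambda>z y. (of_real ((1 + norm (snd z)) ^ k) * \<phi> (y - snd z)) * F (fst z) y"
  have "schwf (\<lambda>z::'i \<times> (real^'n). P (fst z)) ?\<Psi>"
    by (intro schwf_mult modf_weighted_translate \<phi> P schwf_reindex[OF assms(1), of fst])
  from fourier_decay[OF this P, of k]
  have "polyb (\<lambda>z. P (fst (fst z))) (\<lambda>z::('i \<times> (real^'n)) \<times> (real^'n). (1 + norm (snd z)) ^ k * cmod (fourier (?\<Psi> (fst z)) (snd z)))" .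
  from polyb_reindex[OF this, of "\<lambda>z::'i \<times> (real^'n) \<times> (real^'n). ((fst z, fst (snd z)), snd (snd z))"]
  have "polyb (\<lambda>z. P (fst z)) (\<lambda>z::'i \<times> (real^'n) \<times> (real^'n). (1 + norm (snd (snd z))) ^ k * cmod (fourier (?\<Psi> (fst z, fst (snd z))) (snd (snd z))))"
    by simp
  then show ?thesis
  proof (rule polyb_mono)
    fix z :: "'i \<times> (real^'n) \<times> (real^'n)"
    have "fourier (?\<Psi> (fst z, fst (snd z))) (snd (snd z)) = of_real ((1 + norm (fst (snd z))) ^ k) * cross (F (fst z)) \<phi> (snd z)"
      unfolding fourier_def cross_def integral_mult_right_zero[symmetric] by (simp add: mult_ac)
    then have "(1 + norm (snd (snd z))) ^ k * cmod (fourier (?\<Psi> (fst z, fst (snd z))) (snd (snd z)))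
      = ((1 + norm (fst (snd z))) * (1 + norm (snd (snd z)))) ^ k * cmod (cross (F (fst z)) \<phi> (snd z))"
      by (simp only: norm_mult norm_of_real power_mult_distrib) simp
    also have "\<dots> \<ge> (1 + norm (snd z)) ^ k * cmod (cross (F (fst z)) \<phi> (snd z))"
      by (intro mult_right_mono power_mono one_plus_norm_pair) auto
    finally show "norm ((1 + norm (snd z)) ^ k * cmod (cross (F (fst z)) \<phi> (snd z))) \<le>
      norm ((1 + norm (snd (snd z))) ^ k * cmod (fourier (?\<Psi> (fst z, fst (snd z))) (snd (snd z))))"
      by simp
  qed
qed

lemma cross_wt_bound:
  fixes \<psi> :: "real^'n \<Rightarrow> complex"
  assumes "\<psi> \<in> schwartz" "\<phi> \<in> schwartz"
  obtains C where "C > 0" "\<And>X. (1 + norm X) ^ k * cmod (cross \<psi> \<phi> X) \<le> C * wt X"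
proof -
  have "polyb (\<lambda>z. 1) (\<lambda>z :: unit \<times> (real^'n) \<times> (real^'n). (1 + norm (snd z)) ^ (k + 2 * DIM((real^'n) \<times> (real^'n))) * cmod (cross \<psi> \<phi> (snd z)))"
    by (rule cross_decay[OF schwartz_schwf[OF assms(1), of "\<lambda>_. 1"] _ assms(2)]) auto
  from polyb_wt_bound[OF this] show ?thesis using that by auto
qed

lemma atom_bound:
  assumes "\<phi> \<in> schwartz" obtains D where "D > 0" "\<And>X y. cmod (atom \<phi> X y) \<le> D"
proof -
  obtain D where "\<And>x. norm ((1 + norm x) ^ 0 * cmod (iter_pderivative [] \<phi> x)) \<le> D"
    using assms unfolding schwartz_def bounded_iff by blast
  then have D: "cmod (\<phi> x) \<le> D" for x by simp
  have "cmod (atom \<phi> X y) = cmod (\<phi> (y - fst X))" for X y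
    using norm_exp_i_times[of "- (y \<bullet> snd X)"] by (simp add: atom_def norm_mult)
  then have "cmod (atom \<phi> X y) \<le> D + 1" for X y using D[of "y - fst X"] by simp
  moreover have "D + 1 > 0" using order_trans[OF norm_ge_zero D[of 0]] by simp
  ultimately show ?thesis using that by blast
qed

definition stft_const :: "(real^'n \<Rightarrow> complex) \<Rightarrow> real" where
  "stft_const \<phi> = (2 * pi) ^ CARD('n) * (LBINT x. (cmod (\<phi> x))\<^sup>2)"

lemma stft_const_pos:
  fixes \<phi> :: "real^'n \<Rightarrow> complex"
  assumes "\<phi> \<in> schwartz" "\<phi> \<noteq> (\<lambda>_. 0)" shows "stft_const \<phi> > 0"
proof -
  obtain a where a: "\<phi> a \<noteq> 0" using assms(2) by auto
  have "integrable lborel (\<lambda>x. \<phi> x * cnj (\<phi> x))"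
    by (intro schwartz_integrable schwartz_mult schwartz_cnj assms)
  then have "integrable lborel (\<lambda>x. Re (\<phi> x * cnj (\<phi> x)))" by (rule integrable_Re)
  moreover have "Re (\<phi> x * cnj (\<phi> x)) = (cmod (\<phi> x))\<^sup>2" for x
    unfolding complex_norm_square[symmetric] by simp
  ultimately have i: "integrable lborel (\<lambda>x. (cmod (\<phi> x))\<^sup>2)" by simp
  have "continuous_on UNIV \<phi>" by (intro smooth_continuous schwartz_smooth assms)
  then have "continuous_on UNIV (\<lambda>x. (cmod (\<phi> x))\<^sup>2)" by (intro continuous_intros)
  then have "(LBINT x. (cmod (\<phi> x))\<^sup>2) > 0"
    by (rule integral_positive_at[OF i, of a]) (use a in auto)
  then show ?thesis by (simp add: stft_const_def)
qed

text \<open>For fixed y the frequency integral is Fourier inversion and yields \<psi> y times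
  |\<phi> (y - x)|^2 up to a constant; integration in x then gives the squared norm of the window.
  Fubini's theorem brings the pairing with h outside.\<close>

lemma stft_inversion_schwartz:
  fixes \<psi> \<phi> h :: "real^'n \<Rightarrow> complex"
  assumes \<psi>: "\<psi> \<in> schwartz" and \<phi>: "\<phi> \<in> schwartz" and h: "h \<in> schwartz"
  shows "(LBINT X. cross \<psi> \<phi> X * (LBINT y. h y * atom \<phi> X y)) = of_real (stft_const \<phi>) * (LBINT y. h y * \<psi> y)"
proof -
  note [measurable] = schwartz_measurable[OF \<psi>] schwartz_measurable[OF \<phi>] schwartz_measurable[OF h] cross_measurable[OF \<phi> \<psi>]
  obtain C where C: "C > 0" "\<And>X. (1 + norm X) ^ 0 * cmod (cross \<psi> \<phi> X) \<le> C * wt X"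
    using cross_wt_bound[OF \<psi> \<phi>] by blast
  obtain D where D: "D > 0" "\<And>X y. cmod (atom \<phi> X y) \<le> D" using atom_bound[OF \<phi>] by blast
  have am: "(\<lambda>z. atom \<phi> (fst z) (snd z)) \<in> borel_measurable (lborel \<Otimes>\<^sub>M lborel)"
    unfolding measurable_pair_cong[OF sets_lborel sets_lborel] by (rule atom_measurable[OF \<phi>])
  have ay: "(\<lambda>X. atom \<phi> X y) \<in> borel_measurable borel" for y
  proof -
    have "(\<lambda>X. (X, y)) \<in> borel \<rightarrow>\<^sub>M borel \<Otimes>\<^sub>M borel" by measurable
    from measurable_compose[OF this atom_measurable[OF \<phi>]] show ?thesis by simp
  qed
  let ?f = "\<lambda>(X, y). cross \<psi> \<phi> X * (h y * atom \<phi> X y)"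
  have int: "integrable (lborel \<Otimes>\<^sub>M lborel) ?f"
  proof (rule integrable_pair_bound)
    have 1: "(\<lambda>z. cross \<psi> \<phi> (fst z)) \<in> borel_measurable (lborel \<Otimes>\<^sub>M (lborel :: (real^'n) measure))" by measurable
    have 2: "(\<lambda>z. h (snd z)) \<in> borel_measurable ((lborel :: ((real^'n)\<times>(real^'n)) measure) \<Otimes>\<^sub>M lborel)" by measurable
    show "?f \<in> borel_measurable (lborel \<Otimes>\<^sub>M lborel)"
      using borel_measurable_times[OF 1 borel_measurable_times[OF 2 am]] by (simp add: case_prod_beta')
    show "integrable lborel (\<lambda>X::(real^'n)\<times>(real^'n). C * D * wt X)" by (intro integrable_mult_right integrable_wt)
    show "integrable lborel (\<lambda>y. cmod (h y))" by (intro integrable_norm schwartz_integrable h)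
    show "norm (?f (X, y)) \<le> (C * D * wt X) * cmod (h y)" for X y
    proof -
      have "cmod (cross \<psi> \<phi> X) * cmod (atom \<phi> X y) \<le> (C * wt X) * D"
        by (intro mult_mono D(2)) (use C(2)[of X] C(1) wt_pos[of X] in auto)
      then have "(cmod (cross \<psi> \<phi> X) * cmod (atom \<phi> X y)) * cmod (h y) \<le> ((C * wt X) * D) * cmod (h y)"
        by (rule mult_right_mono) simp
      then show ?thesis by (simp add: norm_mult mult_ac)
    qed
  qed (simp_all add: lborel.sigma_finite_measure_axioms)
  have inner: "(LBINT X. cross \<psi> \<phi> X * atom \<phi> X y) = of_real (stft_const \<phi>) * \<psi> y" for y
  proof -
    have "integrable lborel (\<lambda>X. cross \<psi> \<phi> X * atom \<phi> X y)"
    proof (rule wt_bound_integrable)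
      show "(\<lambda>X. cross \<psi> \<phi> X * atom \<phi> X y) \<in> borel_measurable borel" using ay by measurable
      show "norm (cross \<psi> \<phi> X * atom \<phi> X y) \<le> (C * D) * wt X" for X
      proof -
        have "cmod (cross \<psi> \<phi> X) * cmod (atom \<phi> X y) \<le> (C * wt X) * D"
          by (intro mult_mono D(2)) (use C(2)[of X] C(1) wt_pos[of X] in auto)
        then show ?thesis by (simp add: norm_mult mult_ac)
      qed
    qed
    then have i2: "integrable (lborel \<Otimes>\<^sub>M lborel) (\<lambda>X. cross \<psi> \<phi> X * atom \<phi> X y)" by (simp add: lborel_prod)
    have "(LBINT X. cross \<psi> \<phi> X * atom \<phi> X y) = (LBINT x. LBINT \<xi>. cross \<psi> \<phi> (x, \<xi>) * atom \<phi> (x, \<xi>) y)"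
      using lborel_pair.integral_fst'[OF i2] by (simp add: lborel_prod)
    also have "\<dots> = (LBINT x. of_real ((2 * pi) ^ CARD('n)) * \<psi> y * of_real ((cmod (\<phi> (y - x)))\<^sup>2))"
    proof (rule Bochner_Integration.integral_cong[OF refl])
      fix x
      have s: "(\<lambda>z. \<psi> z * \<phi> (z - x)) \<in> schwartz" by (intro schwartz_mult \<psi> schwartz_translate \<phi>)
      have "(LBINT \<xi>. cross \<psi> \<phi> (x, \<xi>) * atom \<phi> (x, \<xi>) y)
         = cnj (\<phi> (y - x)) * (LBINT \<xi>. fourier (\<lambda>z. \<psi> z * \<phi> (z - x)) \<xi> * exp (- (\<i> * of_real (y \<bullet> \<xi>))))"
        by (simp add: cross_def atom_def mult_ac flip: integral_mult_right_zero)
      also have "\<dots> = cnj (\<phi> (y - x)) * (of_real ((2 * pi) ^ CARD('n)) * (\<psi> y * \<phi> (y - x)))"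
        unfolding fourier_inversion[OF s] ..
      also have "\<dots> = of_real ((2 * pi) ^ CARD('n)) * \<psi> y * (\<phi> (y - x) * cnj (\<phi> (y - x)))" by (simp only: mult_ac)
      finally show "(LBINT \<xi>. cross \<psi> \<phi> (x, \<xi>) * atom \<phi> (x, \<xi>) y) = of_real ((2 * pi) ^ CARD('n)) * \<psi> y * of_real ((cmod (\<phi> (y - x)))\<^sup>2)"
        unfolding complex_norm_square .
    qed
    also have "\<dots> = of_real ((2 * pi) ^ CARD('n)) * \<psi> y * of_real (LBINT x. (cmod (\<phi> (y - x)))\<^sup>2)"
      by (simp only: integral_mult_right_zero integral_complex_of_real)
    also have "(LBINT x. (cmod (\<phi> (y - x)))\<^sup>2) = (LBINT x. (cmod (\<phi> x))\<^sup>2)"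
      using lborel_integral_affine[of "-1" "\<lambda>x. (cmod (\<phi> x))\<^sup>2" y] by simp
    finally show ?thesis by (simp add: stft_const_def mult_ac)
  qed
  have "(LBINT X. cross \<psi> \<phi> X * (LBINT y. h y * atom \<phi> X y)) = (LBINT X. LBINT y. cross \<psi> \<phi> X * (h y * atom \<phi> X y))"
    by simp
  also have "\<dots> = (LBINT y. LBINT X. cross \<psi> \<phi> X * (h y * atom \<phi> X y))"
    by (rule lborel_pair.Fubini_integral[OF int, symmetric])
  also have "\<dots> = (LBINT y. h y * (LBINT X. cross \<psi> \<phi> X * atom \<phi> X y))"
    unfolding integral_mult_right_zero[symmetric] by (simp only: mult_ac)
  also have "\<dots> = of_real (stft_const \<phi>) * (LBINT y. h y * \<psi> y)"
    unfolding inner integral_mult_right_zero[symmetric] by (simp only: mult_ac)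
  finally show ?thesis .
qed

section \<open>Hermite series of tempered distributions\<close>

lemma LINT_hermite_schwartz:
  "\<phi> \<in> schwartz \<Longrightarrow> (LINT x|lebesgue. hermite_function \<alpha> x * \<phi> x) = (LBINT x. hermite_function \<alpha> x * \<phi> x)"
  by (intro LINT_lebesgue schwartz_measurable schwartz_mult schwartz_hermite)

lemma hermite_coeff_polyb:
  assumes "tempered_distribution u" shows "polyb Pm (hermite_coeff u)"
  unfolding hermite_coeff_def[abs_def] by (intro tempered_schwf assms schwf_hermite Pm_ge)

lemma hermite_series_bound:
  fixes F :: "'i \<Rightarrow> real^'n \<Rightarrow> complex"
  assumes "polyb Pm c" "schwf P F" and P: "\<And>i. P i \<ge> 1"
  obtains C m where "C > 0"
    "\<And>\<alpha> \<iota>. cmod (c \<alpha> * (LBINT x. hermite_function \<alpha> x * F \<iota> x)) \<le> inverse (Pm \<alpha> ^ (2 * CARD('n))) * (C * P \<iota> ^ m)"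
proof -
  obtain C1 m1 where C1: "C1 > 0" "\<And>\<alpha> m'. m' \<ge> m1 \<Longrightarrow> norm (c \<alpha>) \<le> C1 * Pm \<alpha> ^ m'" using polybE[OF assms(1) Pm_ge] by blast
  \<comment> \<open>How the power of \<open>Pm \<alpha>\<close> is spent: m1 on the growth of the
    coefficients, d on the factor in the pairing estimate, and 2 d remain for summability.\<close>
  obtain C m where C: "C > 0"
    "\<And>\<alpha> \<iota>. Pm \<alpha> ^ (2 * CARD('n) + (m1 + CARD('n))) * cmod (LBINT x. hermite_function \<alpha> x * F \<iota> x) \<le> C * Pm \<alpha> ^ CARD('n) * P \<iota> ^ m"
    using hermite_pairing_decay[OF assms(2) P, of "2 * CARD('n) + (m1 + CARD('n))"] by blast
  have "cmod (c \<alpha> * (LBINT x. hermite_function \<alpha> x * F \<iota> x)) \<le> inverse (Pm \<alpha> ^ (2 * CARD('n))) * (C1 * C * P \<iota> ^ m)" for \<alpha> \<iota>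
  proof -
    define I where "I = cmod (LBINT x. hermite_function \<alpha> x * F \<iota> x)"
    have p: "Pm \<alpha> ^ k > 0" for k by simp
    have e: "A * (M * B) * I = B * (A * (M * I))" "C * B * Q = B * (C * Q)" for A M B Q :: real by (simp_all only: mult_ac)
    have "Pm \<alpha> ^ CARD('n) * (Pm \<alpha> ^ (2 * CARD('n)) * (Pm \<alpha> ^ m1 * I)) \<le> Pm \<alpha> ^ CARD('n) * (C * P \<iota> ^ m)"
      using C(2)[of \<alpha> \<iota>] unfolding power_add[of _ "2 * CARD('n)"] power_add[of _ m1] I_def[symmetric] e .
    then have "Pm \<alpha> ^ (2 * CARD('n)) * (Pm \<alpha> ^ m1 * I) \<le> C * P \<iota> ^ m" by (rule mult_left_le_imp_le) (rule p)
    moreover have "cmod (c \<alpha>) * I \<le> C1 * Pm \<alpha> ^ m1 * I" by (intro mult_right_mono C1(2)) (auto simp: I_def)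
    ultimately have "Pm \<alpha> ^ (2 * CARD('n)) * (cmod (c \<alpha>) * I) \<le> C1 * (C * P \<iota> ^ m)"
    proof -
      assume a: "Pm \<alpha> ^ (2 * CARD('n)) * (Pm \<alpha> ^ m1 * I) \<le> C * P \<iota> ^ m" and b: "cmod (c \<alpha>) * I \<le> C1 * Pm \<alpha> ^ m1 * I"
      have "Pm \<alpha> ^ (2 * CARD('n)) * (cmod (c \<alpha>) * I) \<le> Pm \<alpha> ^ (2 * CARD('n)) * (C1 * Pm \<alpha> ^ m1 * I)"
        by (intro mult_left_mono b less_imp_le[OF p])
      also have "\<dots> = C1 * (Pm \<alpha> ^ (2 * CARD('n)) * (Pm \<alpha> ^ m1 * I))" by (simp only: mult_ac)
      also have "\<dots> \<le> C1 * (C * P \<iota> ^ m)" by (intro mult_left_mono a less_imp_le[OF C1(1)])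
      finally show ?thesis .
    qed
    then show ?thesis using p[of "2 * CARD('n)"] unfolding norm_mult I_def[symmetric] by (simp add: field_simps)
  qed
  moreover have "C1 * C > 0" using C1 C by simp
  ultimately show ?thesis using that by blast
qed

lemma hermite_series_integral:
  fixes \<psi> :: "real^'n \<Rightarrow> complex"
  assumes "tempered_distribution u" "hermite_series u" "\<psi> \<in> schwartz"
  shows "u \<psi> = (\<integral>\<alpha>. hermite_coeff u \<alpha> * (LBINT x. hermite_function \<alpha> x * \<psi> x) \<partial>count_space UNIV)"
proof (rule has_sum_eq_integral_count_space)
  obtain C m where C: "C > 0"
    "\<And>\<alpha> \<iota>. cmod (hermite_coeff u \<alpha> * (LBINT x. hermite_function \<alpha> x * \<psi> x)) \<le> inverse (Pm \<alpha> ^ (2 * CARD('n))) * (C * 1 ^ m)" for \<iota> :: unit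
    using hermite_series_bound[OF hermite_coeff_polyb[OF assms(1)] schwartz_schwf[OF assms(3), of "\<lambda>_::unit. 1"]] by auto
  show "integrable (count_space UNIV) (\<lambda>\<alpha>. hermite_coeff u \<alpha> * (LBINT x. hermite_function \<alpha> x * \<psi> x))"
    by (rule Bochner_Integration.integrable_bound[OF integrable_mult_left[OF summable_Pm[where 'n='n], of C]])
       (use C in \<open>auto intro!: AE_I2\<close>)
  show "((\<lambda>\<alpha>. hermite_coeff u \<alpha> * (LBINT x. hermite_function \<alpha> x * \<psi> x)) has_sum u \<psi>) UNIV"
    using assms(2,3) unfolding hermite_series_def by (auto simp: LINT_hermite_schwartz)
qed

lemma tempered_atom_bound:
  assumes "tempered_distribution u" "\<phi> \<in> schwartz"
  obtains C k where "C > 0" "\<And>X. cmod (u (atom \<phi> X)) \<le> C * (1 + norm X) ^ k"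
proof -
  have "polyb (\<lambda>X. (1 + norm X)\<^sup>2) (\<lambda>X. u (atom \<phi> X))"
    by (intro tempered_schwf assms schwf_atom) (simp add: one_le_power)
  then obtain C m where "C > 0" "\<And>X m'. m' \<ge> m \<Longrightarrow> norm (u (atom \<phi> X)) \<le> C * ((1 + norm X)\<^sup>2) ^ m'"
    by (rule polybE) (auto simp: one_le_power)
  then show ?thesis using that[of C "2 * m"] by (simp add: power_mult)
qed

text \<open>The formula for Hermite functions is carried over term by term, by Fubini's theorem for
  Lebesgue times counting measure. The same series shows that the transform is a measurable function
  of X.\<close>

lemma stft_inversion:
  fixes \<psi> \<phi> :: "real^'n \<Rightarrow> complex"
  assumes u: "tempered_distribution u" "hermite_series u" and \<psi>: "\<psi> \<in> schwartz" and \<phi>: "\<phi> \<in> schwartz"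
  shows "(\<lambda>X. u (atom \<phi> X)) \<in> borel_measurable borel"
    and "(LBINT X. cross \<psi> \<phi> X * u (atom \<phi> X)) = of_real (stft_const \<phi>) * u \<psi>"
proof -
  let ?A = "\<lambda>X \<alpha>. hermite_coeff u \<alpha> * (LBINT y. hermite_function \<alpha> y * atom \<phi> X y)"
  have eq: "u (atom \<phi> X) = (\<integral>\<alpha>. ?A X \<alpha> \<partial>count_space UNIV)" for X
    by (rule hermite_series_integral[OF u schwartz_atom[OF \<phi>]])
  interpret c: sigma_finite_measure "count_space (UNIV :: ('n \<Rightarrow> nat) set)"
    by (rule sigma_finite_measure_count_space_countable) simp
  interpret pc: pair_sigma_finite "lborel :: ((real^'n)\<times>(real^'n)) measure" "count_space (UNIV :: ('n \<Rightarrow> nat) set)" ..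
  have AX: "(\<lambda>X. ?A X \<alpha>) \<in> borel_measurable borel" for \<alpha>
  proof -
    note [measurable] = schwartz_measurable[OF schwartz_hermite[of \<alpha>]]
    have 2: "(\<lambda>z. hermite_function \<alpha> (snd z)) \<in> borel_measurable ((borel :: ((real^'n)\<times>(real^'n)) measure) \<Otimes>\<^sub>M borel)" by measurable
    have "(\<lambda>z. hermite_function \<alpha> (snd z) * atom \<phi> (fst z) (snd z)) \<in> borel_measurable (borel \<Otimes>\<^sub>M lborel)"
      unfolding measurable_pair_cong[OF refl sets_lborel] by (rule borel_measurable_times[OF 2 atom_measurable[OF \<phi>]])
    then have "(\<lambda>X. LBINT y. hermite_function \<alpha> y * atom \<phi> X y) \<in> borel_measurable borel"
      by (intro lborel.borel_measurable_lebesgue_integral) (simp add: case_prod_beta')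
    then show ?thesis by measurable
  qed
  have Am: "(\<lambda>z. ?A (fst z) (snd z)) \<in> borel_measurable (borel \<Otimes>\<^sub>M count_space UNIV)"
  proof -
    have "(\<lambda>z. ?A (snd z) (fst z)) \<in> borel_measurable (count_space UNIV \<Otimes>\<^sub>M borel)"
      by (rule measurable_pair_measure_countable1) (use AX in auto)
    from measurable_pair_swap[OF this] show ?thesis by (simp add: case_prod_beta')
  qed
  show m: "(\<lambda>X. u (atom \<phi> X)) \<in> borel_measurable borel"
    unfolding eq by (intro c.borel_measurable_lebesgue_integral) (use Am in \<open>simp add: case_prod_beta'\<close>)
  obtain C m where C: "C > 0"
    "\<And>\<alpha> X. cmod (?A X \<alpha>) \<le> inverse (Pm \<alpha> ^ (2 * CARD('n))) * (C * ((1 + norm X)\<^sup>2) ^ m)"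
    using hermite_series_bound[OF hermite_coeff_polyb[OF u(1)] schwf_atom[OF \<phi>]] by (auto simp: one_le_power)
  obtain D where D: "D > 0" "\<And>X. (1 + norm X) ^ (2 * m) * cmod (cross \<psi> \<phi> X) \<le> D * wt X"
    using cross_wt_bound[OF \<psi> \<phi>] by blast
  have int: "integrable (lborel \<Otimes>\<^sub>M count_space UNIV) (\<lambda>(X, \<alpha>). cross \<psi> \<phi> X * ?A X \<alpha>)"
  proof (rule integrable_pair_bound)
    note [measurable] = cross_measurable[OF \<phi> \<psi>]
    have 1: "(\<lambda>z. cross \<psi> \<phi> (fst z)) \<in> borel_measurable (borel \<Otimes>\<^sub>M count_space (UNIV :: ('n \<Rightarrow> nat) set))" by measurable
    show "(\<lambda>(X, \<alpha>). cross \<psi> \<phi> X * ?A X \<alpha>) \<in> borel_measurable (lborel \<Otimes>\<^sub>M count_space UNIV)"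
      unfolding measurable_pair_cong[OF sets_lborel refl] using borel_measurable_times[OF 1 Am] by (simp add: case_prod_beta')
    show "integrable lborel (\<lambda>X::(real^'n)\<times>(real^'n). C * D * wt X)" by (intro integrable_mult_right integrable_wt)
    show "integrable (count_space UNIV) (\<lambda>\<alpha> :: 'n \<Rightarrow> nat. inverse (Pm \<alpha> ^ (2 * CARD('n))))" by (rule summable_Pm)
    show "norm (case (X, \<alpha>) of (X, \<alpha>) \<Rightarrow> cross \<psi> \<phi> X * ?A X \<alpha>) \<le> C * D * wt X * inverse (Pm \<alpha> ^ (2 * CARD('n)))" for X \<alpha>
    proof -
      have "cmod (cross \<psi> \<phi> X) * cmod (?A X \<alpha>) \<le> cmod (cross \<psi> \<phi> X) * (inverse (Pm \<alpha> ^ (2 * CARD('n))) * (C * ((1 + norm X)\<^sup>2) ^ m))"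
        by (intro mult_left_mono C(2)) simp
      also have "\<dots> = inverse (Pm \<alpha> ^ (2 * CARD('n))) * C * ((1 + norm X) ^ (2 * m) * cmod (cross \<psi> \<phi> X))"
        unfolding power_mult[of "1 + norm X" 2 m] by (simp only: mult_ac)
      also have "\<dots> \<le> inverse (Pm \<alpha> ^ (2 * CARD('n))) * C * (D * wt X)"
        using C(1) by (intro mult_left_mono D(2)) auto
      finally show ?thesis by (simp add: norm_mult mult_ac)
    qed
  qed (simp_all add: lborel.sigma_finite_measure_axioms c.sigma_finite_measure_axioms)
  have "(LBINT X. cross \<psi> \<phi> X * u (atom \<phi> X)) = (LBINT X. \<integral>\<alpha>. cross \<psi> \<phi> X * ?A X \<alpha> \<partial>count_space UNIV)"
    unfolding eq by simp
  also have "\<dots> = (\<integral>\<alpha>. (LBINT X. cross \<psi> \<phi> X * ?A X \<alpha>) \<partial>count_space UNIV)"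
    by (rule pc.Fubini_integral[OF int, symmetric])
  also have "\<dots> = (\<integral>\<alpha>. hermite_coeff u \<alpha> * (LBINT X. cross \<psi> \<phi> X * (LBINT y. hermite_function \<alpha> y * atom \<phi> X y)) \<partial>count_space UNIV)"
  proof (rule Bochner_Integration.integral_cong[OF refl])
    fix \<alpha> :: "'n \<Rightarrow> nat"
    have "(\<lambda>X. cross \<psi> \<phi> X * ?A X \<alpha>) = (\<lambda>X. hermite_coeff u \<alpha> * (cross \<psi> \<phi> X * (LBINT y. hermite_function \<alpha> y * atom \<phi> X y)))"
      by (simp only: mult_ac)
    then show "(LBINT X. cross \<psi> \<phi> X * ?A X \<alpha>) = hermite_coeff u \<alpha> * (LBINT X. cross \<psi> \<phi> X * (LBINT y. hermite_function \<alpha> y * atom \<phi> X y))"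
      by simp
  qed
  also have "\<dots> = (\<integral>\<alpha>. of_real (stft_const \<phi>) * (hermite_coeff u \<alpha> * (LBINT y. hermite_function \<alpha> y * \<psi> y)) \<partial>count_space UNIV)"
    unfolding stft_inversion_schwartz[OF \<psi> \<phi> schwartz_hermite] by (simp only: mult_ac)
  also have "\<dots> = of_real (stft_const \<phi>) * u \<psi>"
    using hermite_series_integral[OF u \<psi>] by simp
  finally show "(LBINT X. cross \<psi> \<phi> X * u (atom \<phi> X)) = of_real (stft_const \<phi>) * u \<psi>" .
qed

text \<open>Time-frequency covariance: a shift by X only costs a phase. In modulus the reproducing
  kernel is therefore a convolution kernel, as the self-improving estimate requires.\<close>

lemma cross_atom:
  fixes \<phi> :: "real^'n \<Rightarrow> complex"
  assumes "\<phi> \<in> schwartz"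
  shows "cmod (cross (atom \<phi> X) \<phi> Y) = cmod (cross (\<lambda>y. cnj (\<phi> y)) \<phi> (Y - X))"
proof -
  note [measurable] = schwartz_measurable[OF assms]
  obtain x \<xi> where X: "X = (x, \<xi>)" by (cases X)
  obtain x' \<xi>' where Y: "Y = (x', \<xi>')" by (cases Y)
  let ?g = "\<lambda>y. cnj (\<phi> (y - x)) * exp (- (\<i> * of_real (y \<bullet> \<xi>))) * \<phi> (y - x') * exp (\<i> * of_real (y \<bullet> \<xi>'))"
  have "cross (atom \<phi> X) \<phi> Y = (LBINT y. ?g y)" by (simp add: cross_def fourier_def atom_def X Y)
  also have "\<dots> = (LBINT y. ?g (x + y))"
  proof (rule lborel_integral_translate[symmetric])
    show "?g \<in> borel_measurable borel"
      by (intro borel_measurable_continuous_onI continuous_intros continuous_on_compose2[OF smooth_continuous[OF schwartz_smooth[OF assms], of UNIV]]; simp)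
  qed
  also have "\<dots> = (LBINT y. exp (\<i> * of_real (x \<bullet> (\<xi>' - \<xi>))) * (cnj (\<phi> y) * \<phi> (y - (x' - x)) * exp (\<i> * of_real (y \<bullet> (\<xi>' - \<xi>)))))"
  proof (rule Bochner_Integration.integral_cong[OF refl])
    fix y
    have "exp (- (\<i> * of_real ((x + y) \<bullet> \<xi>))) * exp (\<i> * of_real ((x + y) \<bullet> \<xi>'))
      = exp (\<i> * of_real (x \<bullet> (\<xi>' - \<xi>))) * exp (\<i> * of_real (y \<bullet> (\<xi>' - \<xi>)))"
      unfolding exp_add[symmetric] by (simp add: algebra_simps)
    moreover have "x + y - x' = y - (x' - x)" by simp
    ultimately show "?g (x + y) = exp (\<i> * of_real (x \<bullet> (\<xi>' - \<xi>))) * (cnj (\<phi> y) * \<phi> (y - (x' - x)) * exp (\<i> * of_real (y \<bullet> (\<xi>' - \<xi>))))"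
      by (simp only: add_diff_cancel_left' mult_ac)
  qed
  also have "\<dots> = exp (\<i> * of_real (x \<bullet> (\<xi>' - \<xi>))) * cross (\<lambda>y. cnj (\<phi> y)) \<phi> (Y - X)"
    by (simp add: cross_def fourier_def X Y)
  finally show ?thesis by (simp add: norm_mult)
qed


section \<open>Lebesgue quasi-norms\<close>

lemma ennreal_powr_ennreal: "x \<ge> 0 \<Longrightarrow> ennreal_powr (ennreal x) a = ennreal (x powr a)"
  by (simp add: ennreal_powr_def)

lemma ennreal_powr_top: "ennreal_powr top a = top"
  by (simp add: ennreal_powr_def)

lemma ennreal_powr_mono: "x \<le> y \<Longrightarrow> a \<ge> 0 \<Longrightarrow> ennreal_powr x a \<le> ennreal_powr y a"
  by (cases x; cases y) (auto simp: ennreal_powr_def ennreal_le_iff top_unique intro: powr_mono2)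

lemma measurable_ennreal_powr [measurable]: "(\<lambda>x. ennreal_powr x a) \<in> borel_measurable borel"
  unfolding ennreal_powr_def by measurable

lemma Lp_enorm_mono_AE:
  assumes "f \<in> borel_measurable M" "AE x in M. f x \<le> g x"
  shows "Lp_enorm p M f \<le> Lp_enorm p M g"
proof (cases "p = top")
  case True
  then show ?thesis using assms by (auto simp: Lp_enorm_def intro: esssup_AE_mono)
next
  case False
  have "(\<integral>\<^sup>+x. ennreal_powr (f x) (enn2real p) \<partial>M) \<le> (\<integral>\<^sup>+x. ennreal_powr (g x) (enn2real p) \<partial>M)"
    using assms(2) by (intro nn_integral_mono_AE) (auto elim!: eventually_mono intro: ennreal_powr_mono)
  then show ?thesis using False by (simp add: Lp_enorm_def ennreal_powr_mono)
qed

lemma Lp_enorm_cong_AE: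
  assumes "f \<in> borel_measurable M" "g \<in> borel_measurable M" "AE x in M. f x = g x"
  shows "Lp_enorm p M f = Lp_enorm p M g"
  using assms by (intro antisym Lp_enorm_mono_AE) (auto elim: eventually_mono)

lemma enn2real_exponent: "p > 0 \<Longrightarrow> p \<noteq> top \<Longrightarrow> enn2real p > 0"
  by (metis enn2real_positive_iff top.not_eq_extremum)

text \<open>Since \<open>t\<^sup>s \<le> 1 + t\<^sup>p\<close> for \<open>s \<le> p\<close>, no Hoelder inequality is needed.\<close>

lemma weighted_integral_le_Lp:
  fixes g :: "'a \<Rightarrow> ennreal" and w :: "'a \<Rightarrow> real"
  assumes g[measurable]: "g \<in> borel_measurable M" and w[measurable]: "w \<in> borel_measurable M"
    and w01: "\<And>x. 0 \<le> w x" "\<And>x. w x \<le> 1"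
    and s: "s > 0" "ennreal s \<le> p"
  shows "(\<integral>\<^sup>+x. ennreal_powr (g x) s * ennreal (w x) \<partial>M) \<le> (1 + (\<integral>\<^sup>+x. ennreal (w x) \<partial>M)) * ennreal_powr (Lp_enorm p M g) s"
proof -
  define W where "W = (\<integral>\<^sup>+x. ennreal (w x) \<partial>M)"
  have W1: "c \<le> (1 + W) * c" for c :: ennreal
    using mult_right_mono[of 1 "1 + W" c] by simp
  have W2: "W * c \<le> (1 + W) * c" for c :: ennreal by (intro mult_right_mono) auto
  consider (inf) "p = top" | (norm) "p \<noteq> top" "Lp_enorm p M g = top" | (fin) "p \<noteq> top" "Lp_enorm p M g \<noteq> top" by blast
  then show ?thesis
  proof cases
    case inf
    then have L: "Lp_enorm p M g = esssup M g" by (simp add: Lp_enorm_def)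
    have "(\<integral>\<^sup>+x. ennreal_powr (g x) s * ennreal (w x) \<partial>M) \<le> (\<integral>\<^sup>+x. ennreal_powr (esssup M g) s * ennreal (w x) \<partial>M)"
    proof (rule nn_integral_mono_AE)
      show "AE x in M. ennreal_powr (g x) s * ennreal (w x) \<le> ennreal_powr (esssup M g) s * ennreal (w x)"
        using esssup_AE[of g M] by eventually_elim (intro mult_right_mono ennreal_powr_mono; use s in simp)
    qed
    also have "\<dots> = W * ennreal_powr (esssup M g) s" by (subst nn_integral_cmult) (auto simp: W_def mult.commute)
    finally show ?thesis using W2 unfolding L W_def[symmetric] by (meson order_trans)
  next
    case norm
    show ?thesis unfolding norm(2) ennreal_powr_top W_def[symmetric] using W1[of top] by (simp add: top_unique)
  next
    case fin
    define P where "P = enn2real p"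
    have p: "p = ennreal P" using fin(1) by (simp add: P_def top.not_eq_extremum)
    have P: "P > 0" "s \<le> P" using s unfolding p by (auto simp: ennreal_le_iff2)
    define I where "I = (\<integral>\<^sup>+x. ennreal_powr (g x) P \<partial>M)"
    have L: "Lp_enorm p M g = ennreal_powr I (1 / P)" using fin(1) by (simp add: Lp_enorm_def I_def P_def)
    have "I \<noteq> top" using fin(2) unfolding L by (auto simp: ennreal_powr_top)
    then obtain i where i: "I = ennreal i" "i \<ge> 0" by (cases I) auto
    show ?thesis
    proof (cases "i = 0")
      case True
      then have "AE x in M. ennreal_powr (g x) P = 0" using i nn_integral_0_iff_AE[of "\<lambda>x. ennreal_powr (g x) P" M] unfolding I_def by simp
      then have "AE x in M. ennreal_powr (g x) s * ennreal (w x) = 0"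
      proof eventually_elim
        case (elim x)
        then have "g x = 0" by (cases "g x") (auto simp: ennreal_powr_def split: if_splits)
        then show ?case by (simp add: ennreal_powr_def)
      qed
      then have "(\<integral>\<^sup>+x. ennreal_powr (g x) s * ennreal (w x) \<partial>M) = 0" by (subst nn_integral_0_iff_AE) auto
      then show ?thesis by simp
    next
      case False
      then have ip: "i > 0" using i by simp
      \<comment> \<open>l is the norm itself. Dividing g by l makes the integral of its p-th power
        equal to 1, the summand 1 in the constant, and lets the result scale like the power s of the
        norm.\<close>
      define l where "l = i powr (1 / P)"
      have l: "l > 0" "l powr P = i" using ip P by (simp_all add: l_def powr_powr)
      have pt: "ennreal_powr t s * ennreal c \<le> ennreal (l powr s) * (ennreal c + ennreal (1 / i) * ennreal_powr t P)"
        if c: "0 \<le> c" "c \<le> 1" for t c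
      proof (cases t)
        case (real r)
        have "(r / l) powr s \<le> 1 + (r / l) powr P"
        proof (cases "r \<le> l")
          case True
          then have "(r / l) powr s \<le> 1 powr s" using real l s by (intro powr_mono2) auto
          then show ?thesis by (simp add: add_increasing2)
        next
          case False
          then have "(r / l) powr s \<le> (r / l) powr P" using real l P by (intro powr_mono) auto
          then show ?thesis by simp
        qed
        moreover have "(r / l) powr a = r powr a / l powr a" for a using real l by (simp add: powr_divide)
        ultimately have "r powr s \<le> l powr s * (1 + r powr P / i)"
          using l by (simp add: field_simps)
        then have "r powr s * c \<le> (l powr s * (1 + r powr P / i)) * c" using c by (intro mult_right_mono)
        also have "\<dots> = l powr s * (c + (r powr P / i) * c)" by (simp add: algebra_simps)
        also have "\<dots> \<le> l powr s * (c + (r powr P / i) * 1)"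
          using c ip by (intro mult_left_mono add_left_mono) auto
        finally have "r powr s * c \<le> l powr s * (c + 1 / i * r powr P)" by simp
        then show ?thesis using real c ip
          by (simp add: ennreal_powr_ennreal ennreal_mult[symmetric] ennreal_plus[symmetric] ennreal_leI del: ennreal_plus)
      next
        case top
        then show ?thesis using ip l
          by (simp add: ennreal_powr_top ennreal_mult_top ennreal_mult_eq_top_iff)
      qed
      have "(\<integral>\<^sup>+x. ennreal_powr (g x) s * ennreal (w x) \<partial>M) \<le> (\<integral>\<^sup>+x. ennreal (l powr s) * (ennreal (w x) + ennreal (1 / i) * ennreal_powr (g x) P) \<partial>M)"
        by (intro nn_integral_mono pt w01)
      also have "\<dots> = ennreal (l powr s) * (W + ennreal (1 / i) * I)"
        by (subst nn_integral_cmult, simp, subst nn_integral_add, simp, simp, subst nn_integral_cmult) (auto simp: W_def I_def)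
      also have "ennreal (1 / i) * I = 1" using ip unfolding i(1) by (subst ennreal_mult[symmetric]) auto
      also have "ennreal (l powr s) = ennreal_powr (Lp_enorm p M g) s"
        unfolding L i(1) using ip l by (simp add: ennreal_powr_ennreal l_def)
      finally show ?thesis by (simp add: W_def mult.commute add.commute)
    qed
  qed
qed

text \<open>K and the threshold depend on p and the dimension only. The estimate can thus be applied
  twice in a mixed norm, where S for the inner norm carries the decay in the frequency
  variable.\<close>

lemma Lp_enorm_decay_bound:
  fixes p :: ennreal
  assumes "p > 0"
  shows "\<exists>K\<ge>0. \<exists>k0. \<forall>k\<ge>k0. \<forall>S\<ge>0. \<forall>g :: 'a::euclidean_space \<Rightarrow> ennreal. g \<in> borel_measurable lebesgue \<longrightarrow>
     (AE x in lebesgue. g x \<le> ennreal (S * inverse ((1 + norm x) ^ k))) \<longrightarrow> Lp_enorm p lebesgue g \<le> ennreal (K * S)"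
proof (cases "p = top")
  case True
  have "Lp_enorm p lebesgue g \<le> ennreal (1 * S)" if S: "S \<ge> 0" and g: "g \<in> borel_measurable lebesgue"
    and b: "AE x in lebesgue. g x \<le> ennreal (S * inverse ((1 + norm x) ^ k))" for k S and g :: "'a \<Rightarrow> ennreal"
  proof -
    have "AE x in lebesgue. g x \<le> ennreal (1 * S)"
      using b
    proof eventually_elim
      case (elim x)
      have "S * inverse ((1 + norm x) ^ k) \<le> S * 1"
        using S by (intro mult_left_mono) (auto simp: inverse_le_1_iff one_le_power)
      then show ?case using elim by (simp add: order_trans[OF _ ennreal_leI])
    qed
    then show ?thesis unfolding True Lp_enorm_def using g by (simp add: esssup_I)
  qed
  then show ?thesis by (intro exI[of _ "1::real"] conjI exI[of _ "0::nat"]) auto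
next
  case False
  define P where "P = enn2real p"
  have P: "P > 0" using enn2real_exponent[OF assms False] by (simp add: P_def)
  define W where "W = integral\<^sup>L lborel (wt :: 'a \<Rightarrow> real)"
  have W: "W \<ge> 0" unfolding W_def by (rule integral_wt_nonneg)
  have nnW: "(\<integral>\<^sup>+x. ennreal (wt (x::'a)) \<partial>lborel) = ennreal W"
    unfolding W_def by (rule nn_integral_eq_integral[OF integrable_wt]) (simp add: less_imp_le[OF wt_pos])
  \<comment> \<open>Ensures k p >= 2 dim, so that the p-th power is dominated by
    \<open>wt\<close>.\<close>
  define k0 where "k0 = nat \<lceil>real (2 * DIM('a)) / P\<rceil>"
  have "Lp_enorm p lebesgue g \<le> ennreal (W powr (1 / P) * S)" if k: "k \<ge> k0" and S: "S \<ge> 0"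
    and b: "AE x in lebesgue. g x \<le> ennreal (S * inverse ((1 + norm x) ^ k))" for k S and g :: "'a \<Rightarrow> ennreal"
  proof -
    have kP: "real (2 * DIM('a)) \<le> real k * P"
    proof -
      have "real (2 * DIM('a)) / P \<le> real k0" unfolding k0_def by (rule real_nat_ceiling_ge)
      also have "\<dots> \<le> real k" using k by simp
      finally show ?thesis using P by (simp add: field_simps)
    qed
    have "(\<integral>\<^sup>+x. ennreal_powr (g x) P \<partial>lebesgue) \<le> (\<integral>\<^sup>+x. ennreal (S powr P) * ennreal (wt (x::'a)) \<partial>lebesgue)"
    proof (rule nn_integral_mono_AE)
      show "AE x in lebesgue. ennreal_powr (g x) P \<le> ennreal (S powr P) * ennreal (wt x)"
        using b
      proof eventually_elim
        case (elim x)
        have n: "1 + norm x \<ge> 1" by simp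
        then have n0: "1 + norm x > 0" by linarith
        have "(inverse ((1 + norm x) ^ k)) powr P = (1 + norm x) powr (- (real k * P))"
        proof -
          have "inverse ((1 + norm x) ^ k) = (1 + norm x) powr (- real k)"
            by (simp only: powr_minus powr_realpow[OF n0])
          then show ?thesis by (simp add: powr_powr)
        qed
        also have "\<dots> \<le> (1 + norm x) powr (- real (2 * DIM('a)))" using kP n by (intro powr_mono) auto
        also have "\<dots> = wt x" by (simp only: wt_def powr_minus powr_realpow[OF n0])
        finally have 1: "(inverse ((1 + norm x) ^ k)) powr P \<le> wt x" .
        have "ennreal_powr (g x) P \<le> ennreal_powr (ennreal (S * inverse ((1 + norm x) ^ k))) P"
          using elim P by (intro ennreal_powr_mono) auto
        also have "\<dots> = ennreal (S powr P * (inverse ((1 + norm x) ^ k)) powr P)"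
          using S by (subst ennreal_powr_ennreal) (auto simp: powr_mult)
        also have "\<dots> \<le> ennreal (S powr P * wt x)" using 1 by (intro ennreal_leI mult_left_mono) auto
        finally show ?case using wt_pos[of x] by (simp add: ennreal_mult less_imp_le)
      qed
    qed
    also have "\<dots> = ennreal (S powr P) * ennreal W"
      unfolding nn_integral_completion by (subst nn_integral_cmult) (auto simp: nnW)
    also have "\<dots> = ennreal (S powr P * W)" using W by (simp add: ennreal_mult)
    finally have "Lp_enorm p lebesgue g \<le> ennreal_powr (ennreal (S powr P * W)) (1 / P)"
      unfolding Lp_enorm_def using False P by (simp add: P_def[symmetric] ennreal_powr_mono)
    also have "\<dots> = ennreal (W powr (1 / P) * S)"
      using W S P by (subst ennreal_powr_ennreal) (auto simp: powr_mult powr_powr mult.commute)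
    finally show ?thesis .
  qed
  then show ?thesis by (intro exI[of _ "W powr (1 / P)"] conjI exI[of _ k0]) auto
qed

section \<open>Measurability of mixed norms\<close>

lemma borel_measurable_completion_AE:
  assumes g: "g \<in> borel_measurable M" and ae: "AE x in M. f x = g x"
  shows "f \<in> borel_measurable (completion M)"
proof (rule measurableI)
  obtain N where N: "N \<in> null_sets M" "{x \<in> space M. f x \<noteq> g x} \<subseteq> N"
    using ae unfolding eventually_ae_filter by auto
  fix A :: "'b set" assume A: "A \<in> sets borel"
  have "f -` A \<inter> space M = (g -` A \<inter> space M - N) \<union> (f -` A \<inter> space M \<inter> N)" using N(2) by auto
  moreover have "g -` A \<inter> space M - N \<in> sets (completion M)"
    using measurable_sets[OF g A] N(1) by auto
  moreover have "f -` A \<inter> space M \<inter> N \<in> sets (completion M)"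
    using null_sets_completion[OF N(1)] by auto
  ultimately show "f -` A \<inter> space (completion M) \<in> sets (completion M)"
    unfolding space_completion by (metis sets.Un)
qed simp

text \<open>For finite p this is Tonelli's theorem. For p = \<infinity>, the essential supremum of a
  slice is at most a exactly when the slice of {g > a} is a null set, and the measure of the slices
  of a measurable set is a measurable function.\<close>

lemma Lp_enorm_slice_measurable:
  fixes g :: "'a::euclidean_space \<times> 'b::euclidean_space \<Rightarrow> ennreal"
  assumes g: "g \<in> borel_measurable borel"
  shows "(\<lambda>\<xi>. Lp_enorm p lebesgue (\<lambda>x. g (x, \<xi>))) \<in> borel_measurable borel"
proof -
  have [measurable]: "(\<lambda>x. g (x, \<xi>)) \<in> borel_measurable borel" for \<xi>
  proof -
    have "(\<lambda>x. (x, \<xi>)) \<in> borel \<rightarrow>\<^sub>M (borel :: ('a \<times> 'b) measure)"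
      by (intro borel_measurable_continuous_onI continuous_intros)
    from measurable_compose[OF this g] show ?thesis .
  qed
  have g': "(\<lambda>z. g (snd z, fst z)) \<in> borel_measurable (borel \<Otimes>\<^sub>M lborel)"
  proof -
    have "(\<lambda>z. (snd z, fst z)) \<in> (borel :: ('b \<times> 'a) measure) \<rightarrow>\<^sub>M (borel :: ('a \<times> 'b) measure)"
      by (intro borel_measurable_continuous_onI continuous_intros)
    from measurable_compose[OF this g] show ?thesis
      unfolding measurable_pair_cong[OF refl sets_lborel] borel_prod .
  qed
  show ?thesis
  proof (cases "p = top")
    case False
    have "(\<lambda>z. ennreal_powr (g (snd z, fst z)) (enn2real p)) \<in> borel_measurable (borel \<Otimes>\<^sub>M lborel)"
      using g' by measurable
    then have "(\<lambda>\<xi>. \<integral>\<^sup>+x. ennreal_powr (g (x, \<xi>)) (enn2real p) \<partial>lborel) \<in> borel_measurable borel"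
      by (intro lborel.borel_measurable_nn_integral) (simp add: case_prod_beta')
    then show ?thesis unfolding Lp_enorm_def using False by (simp add: nn_integral_completion)
  next
    case True
    have "{\<xi>. esssup lebesgue (\<lambda>x. g (x, \<xi>)) \<le> a} \<in> sets borel" for a
    proof -
      have m: "(\<lambda>x. g (x, \<xi>)) \<in> borel_measurable lebesgue" for \<xi> by (intro measurable_completion) simp
      have iff: "esssup lebesgue (\<lambda>x. g (x, \<xi>)) \<le> a \<longleftrightarrow> emeasure lborel {x. g (x, \<xi>) > a} = 0" for \<xi>
      proof -
        have "esssup lebesgue (\<lambda>x. g (x, \<xi>)) \<le> a \<longleftrightarrow> (AE x in lebesgue. g (x, \<xi>) \<le> a)"
          using esssup_I[OF m] esssup_AE[of "\<lambda>x. g (x, \<xi>)" lebesgue] by (auto elim: eventually_mono)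
        also have "\<dots> \<longleftrightarrow> (AE x in lborel. g (x, \<xi>) \<le> a)" by (rule AE_completion_iff)
        also have "\<dots> \<longleftrightarrow> emeasure lborel {x. g (x, \<xi>) > a} = 0"
          by (rule AE_iff_measurable) (auto simp: not_le)
        finally show ?thesis .
      qed
      have Q: "{z. g (snd z, fst z) > a} \<in> sets (borel \<Otimes>\<^sub>M lborel)"
      proof -
        have "{z \<in> space (borel \<Otimes>\<^sub>M lborel). g (snd z, fst z) > a} \<in> sets (borel \<Otimes>\<^sub>M lborel)"
          using g' by measurable
        then show ?thesis by (simp add: space_pair_measure)
      qed
      have "(\<lambda>\<xi>. emeasure lborel (Pair \<xi> -` {z. g (snd z, fst z) > a})) \<in> borel_measurable borel"
        by (rule lborel.measurable_emeasure_Pair[OF Q])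
      then have [measurable]: "(\<lambda>\<xi>. emeasure lborel {x. g (x, \<xi>) > a}) \<in> borel_measurable borel"
        by (simp add: vimage_def)
      have "{\<xi> \<in> space borel. emeasure lborel {x. g (x, \<xi>) > a} = 0} \<in> sets borel" by measurable
      then show ?thesis by (simp add: iff)
    qed
    then show ?thesis unfolding Lp_enorm_def True by (simp add: borel_measurableI_le)
  qed
qed

text \<open>The weight is only Lebesgue measurable, so the slices of the integrand are known to be
  measurable merely for almost every \<xi>. A Borel version of the function repairs this: by
  Fubini's theorem for null sets almost all of its slices agree almost everywhere with those of
  h.\<close>

lemma lebesgue_slices:
  fixes h :: "'a::euclidean_space \<times> 'b::euclidean_space \<Rightarrow> ennreal"
  assumes "h \<in> borel_measurable lebesgue"
  shows "AE \<xi> in lebesgue. (\<lambda>x. h (x, \<xi>)) \<in> borel_measurable lebesgue"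
    and "(\<lambda>\<xi>. Lp_enorm p lebesgue (\<lambda>x. h (x, \<xi>))) \<in> borel_measurable lebesgue"
proof -
  obtain h' where h': "h' \<in> borel_measurable lborel" "AE X in lborel. h X = h' X"
    using completion_ex_borel_measurable[OF assms] by blast
  obtain N where N: "N \<in> null_sets lborel" "{X \<in> space lborel. h X \<noteq> h' X} \<subseteq> N"
    using h'(2) unfolding eventually_ae_filter by auto
  have "N \<in> sets lborel" using N(1) by auto
  then have Ns: "N \<in> sets (lborel \<Otimes>\<^sub>M lborel)" unfolding lborel_prod .
  have "AE X in lborel \<Otimes>\<^sub>M lborel. X \<notin> N" unfolding lborel_prod by (rule AE_not_in[OF N(1)])
  from lborel_pair.AE_pair[OF this] have "AE x in lborel. AE \<xi> in lborel. (x, \<xi>) \<notin> N" .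
  moreover have "{z \<in> space (lborel \<Otimes>\<^sub>M lborel). (fst z, snd z) \<notin> N} \<in> sets (lborel \<Otimes>\<^sub>M lborel)"
  proof -
    have "{z \<in> space (lborel \<Otimes>\<^sub>M lborel). (fst z, snd z) \<notin> N} = space (lborel \<Otimes>\<^sub>M lborel) - N" by auto
    then show ?thesis using sets.compl_sets[OF Ns] by (simp only:)
  qed
  ultimately have "AE \<xi> in lborel. AE x in lborel. (x, \<xi>) \<notin> N"
    using lborel_pair.AE_commute[of "\<lambda>x \<xi>. (x, \<xi>) \<notin> N"] by blast
  then have ae: "AE \<xi> in lborel. AE x in lborel. h (x, \<xi>) = h' (x, \<xi>)"
    by eventually_elim (use N(2) in \<open>auto elim!: eventually_mono\<close>)
  have sl: "(\<lambda>x. h' (x, \<xi>)) \<in> borel_measurable lborel" for \<xi>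
  proof -
    have "(\<lambda>x. (x, \<xi>)) \<in> borel \<rightarrow>\<^sub>M (borel :: ('a \<times> 'b) measure)"
      by (intro borel_measurable_continuous_onI continuous_intros)
    from measurable_compose[OF this, of h' borel] h'(1) show ?thesis by simp
  qed
  have ae2: "AE \<xi> in lborel. (\<lambda>x. h (x, \<xi>)) \<in> borel_measurable lebesgue"
    using ae by eventually_elim (rule borel_measurable_completion_AE[OF sl])
  then show "AE \<xi> in lebesgue. (\<lambda>x. h (x, \<xi>)) \<in> borel_measurable lebesgue" by (rule AE_completion)
  have "AE \<xi> in lborel. Lp_enorm p lebesgue (\<lambda>x. h (x, \<xi>)) = Lp_enorm p lebesgue (\<lambda>x. h' (x, \<xi>))"
    using ae ae2
  proof eventually_elim
    case (elim \<xi>)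
    show ?case by (rule Lp_enorm_cong_AE) (use elim sl in \<open>auto intro: AE_completion measurable_completion\<close>)
  qed
  moreover have "(\<lambda>\<xi>. Lp_enorm p lebesgue (\<lambda>x. h' (x, \<xi>))) \<in> borel_measurable lborel"
    using Lp_enorm_slice_measurable[of h' p] h'(1) by simp
  ultimately show "(\<lambda>\<xi>. Lp_enorm p lebesgue (\<lambda>x. h (x, \<xi>))) \<in> borel_measurable lebesgue"
    by (intro borel_measurable_completion_AE)
qed

section \<open>A self-improving estimate\<close>

text \<open>If \<open>F\<close> is dominated by its average against a rapidly decreasing kernel, then already a weighted
  \<open>L\<^sup>s\<close> bound with small \<open>s\<close> controls \<open>F\<close> pointwise, with constants that do not depend on the a priori
  polynomial growth of \<open>F\<close>: writing \<open>F = F\<^sup>s F\<^sup>1\<^sup>-\<^sup>s\<close> under the integral turns a growth exponent \<open>k\<close> into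
  \<open>k (1 - s) + L\<close>.\<close>

lemma bootstrap_step:
  fixes F G :: "'a::euclidean_space \<Rightarrow> real"
  assumes s: "0 < s" "s \<le> 1" and L: "L \<ge> 0" and k: "k \<ge> 0"
    and F: "F \<in> borel_measurable borel" "\<And>X. F X \<ge> 0" and G: "\<And>Z. G Z \<ge> 0"
    and GD: "\<And>Z. (1 + norm Z) powr (k * (1 - s) + L) * G Z \<le> D" and D: "D > 0"
    and FG: "\<And>X. ennreal (F X) \<le> (\<integral>\<^sup>+Y. ennreal (F Y * G (Y - X)) \<partial>lborel)"
    and T: "(\<integral>\<^sup>+Y. ennreal (F Y powr s * (1 + norm Y) powr (- L)) \<partial>lborel) \<le> ennreal \<tau>" "\<tau> \<ge> 0"
    and A: "A > 0" "\<And>X. F X \<le> A * (1 + norm X) powr k"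
  shows "F X \<le> D * A powr (1 - s) * \<tau> * (1 + norm X) powr (k * (1 - s) + L)"
proof -
  define j where "j = k * (1 - s) + L"
  have j: "j \<ge> 0" using s k L by (simp add: j_def)
  have pw: "F Y * G (Y - X) \<le> (D * A powr (1 - s) * (1 + norm X) powr j) * (F Y powr s * (1 + norm Y) powr (- L))" for Y
  proof (cases "F Y = 0")
    case False
    then have FY: "F Y > 0" using F(2)[of Y] by simp
    have n: "1 + norm Z > 0" for Z :: 'a by (simp add: add_pos_nonneg)
    have "F Y powr (1 - s) \<le> (A * (1 + norm Y) powr k) powr (1 - s)"
      using FY s A(2)[of Y] by (intro powr_mono2) auto
    also have "\<dots> = A powr (1 - s) * (1 + norm Y) powr (k * (1 - s))" using A(1) n by (simp add: powr_mult powr_powr)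
    also have "(1 + norm Y) powr (k * (1 - s)) = (1 + norm Y) powr j * (1 + norm Y) powr (- L)"
      by (simp add: j_def powr_add[symmetric])
    finally have 1: "F Y powr (1 - s) \<le> A powr (1 - s) * ((1 + norm Y) powr j * (1 + norm Y) powr (- L))" .
    have "1 + norm Y \<le> (1 + norm X) * (1 + norm (Y - X))"
      using one_plus_norm_translate[of Y 1 X] by simp
    then have "(1 + norm Y) powr j \<le> ((1 + norm X) * (1 + norm (Y - X))) powr j"
      using n[of Y] j by (intro powr_mono2) auto
    also have "\<dots> = (1 + norm X) powr j * (1 + norm (Y - X)) powr j" using n by (simp add: powr_mult)
    finally have "(1 + norm Y) powr j * G (Y - X) \<le> ((1 + norm X) powr j * (1 + norm (Y - X)) powr j) * G (Y - X)"
      by (intro mult_right_mono G)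
    also have "\<dots> \<le> (1 + norm X) powr j * D"
      using GD[of "Y - X"] by (simp only: j_def[symmetric] mult.assoc) (intro mult_left_mono; simp)
    finally have 2: "(1 + norm Y) powr j * G (Y - X) \<le> (1 + norm X) powr j * D" .
    have "F Y = F Y powr s * F Y powr (1 - s)" using FY by (simp add: powr_add[symmetric])
    then have "F Y * G (Y - X) = F Y powr s * F Y powr (1 - s) * G (Y - X)" by simp
    also have "\<dots> \<le> F Y powr s * (A powr (1 - s) * ((1 + norm Y) powr j * (1 + norm Y) powr (- L))) * G (Y - X)"
      by (intro mult_right_mono mult_left_mono 1 G) auto
    also have "\<dots> = (F Y powr s * A powr (1 - s) * (1 + norm Y) powr (- L)) * ((1 + norm Y) powr j * G (Y - X))" by (simp only: mult_ac)
    also have "\<dots> \<le> (F Y powr s * A powr (1 - s) * (1 + norm Y) powr (- L)) * ((1 + norm X) powr j * D)"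
      by (intro mult_left_mono 2) auto
    finally show ?thesis by (simp only: mult_ac)
  qed (use s in simp)
  define c where "c = D * A powr (1 - s) * (1 + norm X) powr j"
  have c: "c \<ge> 0" using D by (simp add: c_def)
  note [measurable] = F(1)
  have "ennreal (F X) \<le> (\<integral>\<^sup>+Y. ennreal (F Y * G (Y - X)) \<partial>lborel)" by (rule FG)
  also have "\<dots> \<le> (\<integral>\<^sup>+Y. ennreal c * ennreal (F Y powr s * (1 + norm Y) powr (- L)) \<partial>lborel)"
    using pw c by (intro nn_integral_mono) (auto simp: c_def ennreal_mult'[symmetric] intro!: ennreal_leI)
  also have "\<dots> = ennreal c * (\<integral>\<^sup>+Y. ennreal (F Y powr s * (1 + norm Y) powr (- L)) \<partial>lborel)"
    by (rule nn_integral_cmult) measurable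
  also have "\<dots> \<le> ennreal c * ennreal \<tau>" by (intro mult_left_mono T) simp
  also have "\<dots> = ennreal (c * \<tau>)" using c T(2) by (simp add: ennreal_mult)
  finally have "F X \<le> c * \<tau>" using c T(2) by (subst (asm) ennreal_le_iff) auto
  then show ?thesis by (simp add: c_def j_def mult_ac)
qed

text \<open>The step is used twice. From any polynomial growth the exponent is lowered by at least 1
  at a time until it reaches K. At K the bound reproduces itself, so the best constant satisfies a
  <= D a^(1 - s) \<tau>, hence a^s <= D \<tau>, and the a priori constant has disappeared.\<close>

lemma bootstrap:
  fixes G :: "'a::euclidean_space \<Rightarrow> real"
  assumes s: "0 < s" "s \<le> 1" and L: "L \<ge> 0" and G: "\<And>Z. G Z \<ge> 0"
    and GD: "\<And>k. \<exists>D. \<forall>Z. (1 + norm Z) ^ k * G Z \<le> D"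
  shows "\<exists>D>0. \<forall>F. F \<in> borel_measurable borel \<longrightarrow> (\<forall>X. F X \<ge> 0)
    \<longrightarrow> (\<forall>X. ennreal (F X) \<le> (\<integral>\<^sup>+Y. ennreal (F Y * G (Y - X)) \<partial>lborel))
    \<longrightarrow> (\<exists>A k. \<forall>X. F X \<le> A * (1 + norm X) ^ k)
    \<longrightarrow> (\<forall>\<tau>\<ge>0. (\<integral>\<^sup>+Y. ennreal (F Y powr s * (1 + norm Y) powr (- L)) \<partial>lborel) \<le> ennreal \<tau>
       \<longrightarrow> (\<forall>X. F X \<le> D * \<tau> powr (1 / s) * (1 + norm X) powr ((L + 1) / s)))"
proof -
  \<comment> \<open>Chosen so that K (1 - s) + L = K - 1: the exponent K is reproduced with one
    power to spare, which also lets larger exponents descend.\<close>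
  define K where "K = (L + 1) / s"
  have K: "K \<ge> 0" "K * s = L + 1" using s L by (auto simp: K_def)
  have n: "1 + norm Z \<ge> 1" for Z :: 'a by simp
  have GD': "\<exists>D>0. \<forall>Z. (1 + norm Z) powr j * G Z \<le> D" if "j \<ge> 0" for j
  proof -
    define k where "k = nat \<lceil>j\<rceil>"
    obtain D where D: "\<And>Z. (1 + norm Z) ^ k * G Z \<le> D" using GD by blast
    have "(1 + norm Z) powr j * G Z \<le> \<bar>D\<bar> + 1" for Z
    proof -
      have "(1 + norm Z) powr j \<le> (1 + norm Z) powr real k" using n[of Z] by (intro powr_mono) (auto simp: k_def real_nat_ceiling_ge)
      also have "\<dots> = (1 + norm Z) ^ k" using n[of Z] by (intro powr_realpow) linarith
      finally have "(1 + norm Z) powr j * G Z \<le> (1 + norm Z) ^ k * G Z" by (intro mult_right_mono G)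
      then show ?thesis using D[of Z] by linarith
    qed
    then show ?thesis by (intro exI[of _ "\<bar>D\<bar> + 1"]) auto
  qed
  define j where "j = K * (1 - s) + L"
  have jK: "j \<le> K" using K(2) by (simp add: j_def algebra_simps)
  have j0: "j \<ge> 0" using s K L by (simp add: j_def)
  obtain D where D: "D > 0" "\<And>Z. (1 + norm Z) powr j * G Z \<le> D" using GD'[OF j0] by blast
  have "F X \<le> D powr (1 / s) * \<tau> powr (1 / s) * (1 + norm X) powr K"
    if F: "F \<in> borel_measurable borel" "\<And>X. F X \<ge> 0"
     and FG: "\<And>X. ennreal (F X) \<le> (\<integral>\<^sup>+Y. ennreal (F Y * G (Y - X)) \<partial>lborel)"
     and gr: "\<exists>A k. \<forall>X. F X \<le> A * (1 + norm X) ^ k"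
     and T: "(\<integral>\<^sup>+Y. ennreal (F Y powr s * (1 + norm Y) powr (- L)) \<partial>lborel) \<le> ennreal \<tau>" "\<tau> \<ge> 0"
    for F \<tau> X
  proof -
    have step: "\<exists>A>0. \<forall>X. F X \<le> A * (1 + norm X) powr K" if "\<exists>A>0. \<forall>X. F X \<le> A * (1 + norm X) powr (K + real m)" for m
      using that
    proof (induction m)
      case (Suc m)
      then obtain A where A: "A > 0" "\<And>X. F X \<le> A * (1 + norm X) powr (K + real (Suc m))" by blast
      define k where "k = K + real (Suc m)"
      have k: "k \<ge> 0" using K by (simp add: k_def)
      have kk: "k * (1 - s) + L \<le> K + real m"
      proof -
        have "k * (1 - s) + L = K + real m + 1 - (K * s + real (Suc m) * s) + L" by (simp add: k_def algebra_simps)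
        also have "\<dots> = K + real m - real (Suc m) * s" unfolding K(2) by simp
        also have "\<dots> \<le> K + real m" using s by simp
        finally show ?thesis .
      qed
      have k0: "k * (1 - s) + L \<ge> 0" using k s L by simp
      obtain D' where D': "D' > 0" "\<And>Z. (1 + norm Z) powr (k * (1 - s) + L) * G Z \<le> D'" using GD'[OF k0] by blast
      have A': "\<And>X. F X \<le> A * (1 + norm X) powr k" using A(2) by (simp add: k_def)
      define B where "B = D' * A powr (1 - s) * \<tau> + 1"
      have B: "B > 0" using D' T by (simp add: B_def add_nonneg_pos)
      have "F X \<le> B * (1 + norm X) powr (K + real m)" for X
      proof -
        have "F X \<le> D' * A powr (1 - s) * \<tau> * (1 + norm X) powr (k * (1 - s) + L)"
          by (rule bootstrap_step[OF s L k F G D'(2) D'(1) FG T A(1) A'])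
        also have "\<dots> \<le> B * (1 + norm X) powr (K + real m)"
          using D' T n[of X] kk by (intro mult_mono powr_mono) (auto simp: B_def)
        finally show ?thesis .
      qed
      with B show ?case using Suc.IH by blast
    qed simp
    obtain A k where A: "\<And>X. F X \<le> A * (1 + norm X) ^ k" using gr by blast
    have "F X \<le> (\<bar>A\<bar> + 1) * (1 + norm X) powr (K + real k)" for X
    proof -
      have "(1 + norm X) ^ k = (1 + norm X) powr real k" using n[of X] by (intro powr_realpow[symmetric]) linarith
      also have "\<dots> \<le> (1 + norm X) powr (K + real k)" using n[of X] K by (intro powr_mono) auto
      finally have "A * (1 + norm X) ^ k \<le> (\<bar>A\<bar> + 1) * (1 + norm X) powr (K + real k)" by (intro mult_mono) auto
      then show ?thesis using A[of X] by linarith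
    qed
    then obtain A0 where A0: "A0 > 0" "\<And>X. F X \<le> A0 * (1 + norm X) powr K"
      using step[of k] by (metis abs_ge_zero add_nonneg_pos zero_less_one)
    have np: "(1 + norm X) powr K > 0" for X :: 'a
    proof -
      have "1 + norm X \<noteq> 0" using n[of X] by linarith
      then show ?thesis by simp
    qed
    \<comment> \<open>The best constant at exponent K. It is finite by the descent just completed,
      which is what permits the division by a^(1 - s) below.\<close>
    define a where "a = (SUP X. F X / (1 + norm X) powr K)"
    have bdd: "bdd_above (range (\<lambda>X. F X / (1 + norm X) powr K))"
      using A0(2) np by (intro bdd_aboveI[of _ A0]) (auto simp: divide_le_eq)
    have Fa: "F X \<le> a * (1 + norm X) powr K" for X
    proof -
      have "F X / (1 + norm X) powr K \<le> a" unfolding a_def by (rule cSUP_upper[OF _ bdd]) simp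
      then show ?thesis using np[of X] by (simp add: divide_le_eq)
    qed
    have "a \<le> (D * \<tau>) powr (1 / s)"
    proof (cases "a > 0")
      case True
      have "a \<le> D * a powr (1 - s) * \<tau>"
        unfolding a_def[symmetric]
      proof (subst a_def, rule cSUP_least)
        fix X
        have "F X \<le> D * a powr (1 - s) * \<tau> * (1 + norm X) powr (K * (1 - s) + L)"
          by (rule bootstrap_step[OF s L K(1) F G _ D(1) FG T True Fa]) (use D(2) in \<open>simp add: j_def\<close>)
        also have "\<dots> \<le> D * a powr (1 - s) * \<tau> * (1 + norm X) powr K"
          using D T n[of X] jK by (intro mult_left_mono powr_mono) (auto simp: j_def)
        finally show "F X / (1 + norm X) powr K \<le> D * a powr (1 - s) * \<tau>" using np[of X] by (simp add: divide_le_eq)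
      qed simp
      moreover have "a = a powr s * a powr (1 - s)" using True by (simp add: powr_add[symmetric])
      ultimately have "a powr s * a powr (1 - s) \<le> (D * \<tau>) * a powr (1 - s)" by (simp add: mult_ac)
      then have "a powr s \<le> D * \<tau>" using True by (simp add: mult_le_cancel_right)
      then have "(a powr s) powr (1 / s) \<le> (D * \<tau>) powr (1 / s)" using s by (intro powr_mono2) auto
      then show ?thesis using True s by (simp add: powr_powr)
    next
      case False
      then show ?thesis using powr_ge_zero[of "D * \<tau>" "1 / s"] by linarith
    qed
    also have "\<dots> = D powr (1 / s) * \<tau> powr (1 / s)" using D T by (simp add: powr_mult)
    finally have "a * (1 + norm X) powr K \<le> D powr (1 / s) * \<tau> powr (1 / s) * (1 + norm X) powr K"
      by (intro mult_right_mono) auto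
    then show ?thesis using Fa[of X] by linarith
  qed
  then show ?thesis unfolding K_def using D(1) by (intro exI[of _ "D powr (1 / s)"]) auto
qed


section \<open>Coefficient estimates\<close>

lemma stft_eq: "stft \<phi> u x \<xi> = of_real ((2 * pi) powr (- real CARD('n) / 2)) * u (atom \<phi> (x, \<xi> :: real^'n))"
  by (simp add: stft_def atom_def[abs_def])

lemma schwartz_integrable_against:
  fixes g :: "real^'n \<Rightarrow> complex"
  assumes "integrable lborel (\<lambda>x. cmod (g x) * wt x)" "smooth g"
    and F: "smooth F" "\<And>x. cmod (F x) \<le> C * wt x"
  shows "integrable lborel (\<lambda>x. g x * F x)"
    "cmod (LBINT x. g x * F x) \<le> C * (LBINT x. cmod (g x) * wt x)"
proof -
  have [measurable]: "g \<in> borel_measurable borel" "F \<in> borel_measurable borel"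
    by (intro smooth_measurable assms)+
  have le: "cmod (g x * F x) \<le> C * (cmod (g x) * wt x)" for x
    using mult_left_mono[OF F(2)[of x], of "cmod (g x)"] by (simp add: norm_mult mult_ac)
  have i: "integrable lborel (\<lambda>x. C * (cmod (g x) * wt x))" by (intro integrable_mult_right assms)
  show 1: "integrable lborel (\<lambda>x. g x * F x)"
  proof (rule Bochner_Integration.integrable_bound[OF i])
    show "AE x in lborel. norm (g x * F x) \<le> norm (C * (cmod (g x) * wt x))"
      using le order_trans[OF le abs_ge_self] by (intro AE_I2) simp
  qed simp
  have "(LBINT x. cmod (g x * F x)) \<le> (LBINT x. C * (cmod (g x) * wt x))"
    by (intro integral_mono_AE AE_I2 le integrable_norm 1 i)
  then show "cmod (LBINT x. g x * F x) \<le> C * (LBINT x. cmod (g x) * wt x)"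
    using order_trans[OF integral_norm_bound] by simp
qed

text \<open>A priori u is tied to g on test functions only. Weighted integrability makes integration
  against g a tempered distribution, and uniqueness identifies it with u on all Schwartz functions,
  in particular on Hermite functions.\<close>

lemma represents_integral:
  fixes g :: "real^'n \<Rightarrow> complex"
  assumes r: "represents g u" "smooth g" and i: "integrable lborel (\<lambda>x. cmod (g x) * wt x)"
    and \<phi>: "\<phi> \<in> schwartz"
  shows "u \<phi> = (LBINT x. g x * \<phi> x)"
proof (rule tempered_unique[of u "\<lambda>\<phi>. LBINT x. g x * \<phi> x", OF _ _ _ \<phi>])
  show "tempered_distribution u" using r by (simp add: represents_def)
  show "u \<psi> = (LBINT x. g x * \<psi> x)" if "\<psi> \<in> test_function" for \<psi> by (rule represents_test[OF r that])
  have ii: "integrable lborel (\<lambda>x. g x * \<psi> x)" if \<psi>: "\<psi> \<in> schwartz" for \<psi>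
  proof -
    obtain C where "\<And>x. (1 + norm x) ^ 0 * cmod (iter_pderivative [] \<psi> x) \<le> C * wt x" using schwartz_wt_bound[OF \<psi>] by blast
    then show ?thesis by (intro schwartz_integrable_against[OF i r(2), of _ C] schwartz_smooth \<psi>) simp
  qed
  show "tempered_distribution (\<lambda>\<phi>. LBINT x. g x * \<phi> x)"
  proof (rule tempered_distributionI)
    show "(LBINT x. g x * (\<phi> x + \<psi> x)) = (LBINT x. g x * \<phi> x) + (LBINT x. g x * \<psi> x)" if "\<phi> \<in> schwartz" "\<psi> \<in> schwartz" for \<phi> \<psi>
      using ii[OF that(1)] ii[OF that(2)] by (simp add: distrib_left)
    show "(LBINT x. g x * (a * \<phi> x)) = a * (LBINT x. g x * \<phi> x)" for a \<phi>
      by (simp add: mult.left_commute)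
    show "polyb (\<lambda>_. 1) (\<lambda>n. LBINT x. g x * F n x)" if F: "schwf (\<lambda>_::nat. 1) F" for F
    proof -
      obtain C m where C: "\<And>n x. (1 + norm x) ^ 0 * cmod (iter_pderivative [] (F n) x) \<le> C * 1 ^ m * wt x"
        by (rule schwf_wt_bound[OF F, of 0 "[]"]) (auto intro: that)
      show ?thesis
        by (rule polybI[of _ "C * (LBINT x. cmod (g x) * wt x)" _ 0])
           (use C in \<open>auto intro!: schwartz_integrable_against[OF i r(2)] schwf_smooth[OF F]\<close>)
    qed
  qed
qed

lemma hermite_wt_bound:
  obtains C m where "C > 0" "\<And>\<alpha> (x::real^'n). (1 + norm x) ^ k * cmod (hermite_function \<alpha> x) \<le> C * Pm \<alpha> ^ m * wt x"
  using schwf_wt_bound[OF schwf_hermite Pm_ge, of k "[]"] by auto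

text \<open>The constants precede g, u and B because one bound must serve every
  \<open>H^N f\<close>. With s = 1, admissible since p >= 1, the weighted estimate makes g
  integrable against \<open>wt\<close>, and \<open>wt\<close> dominates each Hermite function up to
  a power of \<open>Pm \<alpha>\<close>.\<close>

lemma coeff_le_Lp:
  fixes p :: ennreal
  assumes p: "p \<ge> 1"
  shows "\<exists>C>0. \<exists>m. \<forall>(g::real^'n \<Rightarrow> complex) u B. represents g u \<longrightarrow> smooth g \<longrightarrow> B \<ge> 0
    \<longrightarrow> Lp_enorm p lebesgue (\<lambda>x. ennreal (cmod (g x))) \<le> ennreal B
    \<longrightarrow> (\<forall>\<alpha>. cmod (hermite_coeff u \<alpha>) \<le> C * Pm \<alpha> ^ m * B)"
proof -
  define W where "W = integral\<^sup>L lborel (wt :: real^'n \<Rightarrow> real)"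
  have W: "W \<ge> 0" unfolding W_def by (rule integral_wt_nonneg)
  have nnW: "(\<integral>\<^sup>+x. ennreal (wt (x::real^'n)) \<partial>lebesgue) = ennreal W"
    unfolding W_def nn_integral_completion by (rule nn_integral_eq_integral[OF integrable_wt]) (simp add: less_imp_le[OF wt_pos])
  obtain C m where C: "C > 0" "\<And>\<alpha> (x::real^'n). (1 + norm x) ^ 0 * cmod (hermite_function \<alpha> x) \<le> C * Pm \<alpha> ^ m * wt x"
    using hermite_wt_bound[of 0, where 'n='n] by blast
  have "cmod (hermite_coeff u \<alpha>) \<le> C * (1 + W) * Pm \<alpha> ^ m * B"
    if r: "represents g u" "smooth g" and B: "B \<ge> 0" "Lp_enorm p lebesgue (\<lambda>x. ennreal (cmod (g x))) \<le> ennreal B"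
    for g :: "real^'n \<Rightarrow> complex" and u B \<alpha>
  proof -
    have [measurable]: "g \<in> borel_measurable borel" by (rule smooth_measurable[OF r(2)])
    have "(\<integral>\<^sup>+x. ennreal (cmod (g x) * wt x) \<partial>lebesgue) = (\<integral>\<^sup>+x. ennreal_powr (ennreal (cmod (g x))) 1 * ennreal (wt x) \<partial>lebesgue)"
      by (intro nn_integral_cong) (simp add: ennreal_powr_ennreal ennreal_mult' powr_one_gt_zero_iff)
    also have "\<dots> \<le> (1 + (\<integral>\<^sup>+x. ennreal (wt (x::real^'n)) \<partial>lebesgue)) * ennreal_powr (Lp_enorm p lebesgue (\<lambda>x. ennreal (cmod (g x)))) 1"
      by (rule weighted_integral_le_Lp)
         (use p wt_le_1 wt_pos in \<open>auto intro: measurable_completion less_imp_le\<close>)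
    also have "\<dots> \<le> (1 + ennreal W) * ennreal_powr (ennreal B) 1"
      unfolding nnW by (intro mult_left_mono ennreal_powr_mono B) auto
    also have "\<dots> = ennreal ((1 + W) * B)"
      using B W by (simp add: ennreal_powr_ennreal ennreal_mult ennreal_1[symmetric] ennreal_plus[symmetric] del: ennreal_1 ennreal_plus)
    finally have nb: "(\<integral>\<^sup>+x. ennreal (cmod (g x) * wt x) \<partial>lborel) \<le> ennreal ((1 + W) * B)" by (simp add: nn_integral_completion)
    have i: "integrable lborel (\<lambda>x. cmod (g x) * wt x)"
    proof (rule integrableI_bounded)
      show "(\<integral>\<^sup>+x. ennreal (norm (cmod (g x) * wt x)) \<partial>lborel) < \<infinity>"
        using le_less_trans[OF nb ennreal_less_top] by (simp add: abs_mult abs_of_nonneg[OF less_imp_le[OF wt_pos]])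
    qed simp
    have e: "ennreal (LBINT x. cmod (g x) * wt x) = (\<integral>\<^sup>+x. ennreal (cmod (g x) * wt x) \<partial>lborel)"
      by (rule nn_integral_eq_integral[symmetric, OF i]) (simp add: less_imp_le[OF wt_pos])
    have ib: "(LBINT x. cmod (g x) * wt x) \<le> (1 + W) * B"
      using nb B W unfolding e[symmetric] by (subst (asm) ennreal_le_iff) auto
    have "hermite_coeff u \<alpha> = (LBINT x. g x * hermite_function \<alpha> x)"
      unfolding hermite_coeff_def by (rule represents_integral[OF r i schwartz_hermite])
    also have "cmod \<dots> \<le> (C * Pm \<alpha> ^ m) * (LBINT x. cmod (g x) * wt x)"
      by (rule schwartz_integrable_against[OF i r(2) smooth_hermite]) (use C(2)[of _ \<alpha>] in simp)
    also have "\<dots> \<le> (C * Pm \<alpha> ^ m) * ((1 + W) * B)" using C(1) by (intro mult_left_mono ib) auto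
    finally show ?thesis by (simp add: mult_ac)
  qed
  then show ?thesis using C(1) W by (intro exI[of _ "C * (1 + W)"] conjI exI[of _ m]) (auto simp: add_pos_nonneg)
qed

section \<open>Modulation norms control the coefficients\<close>

lemma poly_moderate_bounds:
  fixes w :: "(real^'n) \<times> (real^'n) \<Rightarrow> real"
  assumes "poly_moderate_weight w"
  obtains c C M where "c > 0" "C > 0" "\<And>X. c * inverse ((1 + norm X) ^ M) \<le> w X" "\<And>X. w X \<le> C * (1 + norm X) ^ M"
    "w \<in> borel_measurable lebesgue"
proof -
  obtain M c where M: "c > 0" "\<And>X Y. w (X + Y) \<le> c * (w X * (1 + norm Y) ^ M)" and wp: "\<And>X. w X > 0"
    and wm: "w \<in> borel_measurable lebesgue"
    using assms unfolding poly_moderate_weight_def Linf_loc_def by blast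
  \<comment> \<open>Moderateness at the origin gives the upper bound; the lower one arises by moving
    from X back to the origin.\<close>
  have up: "w X \<le> (c * w 0) * (1 + norm X) ^ M" for X using M(2)[of 0 X] by (simp add: mult.assoc)
  have "w 0 / c * inverse ((1 + norm X) ^ M) \<le> w X" for X
  proof -
    have "(1 + norm X) ^ M > 0" by (simp add: zero_less_power add_pos_nonneg)
    then show ?thesis using M(2)[of X "- X"] M(1) by (simp add: field_simps)
  qed
  then show ?thesis using that[of "w 0 / c" "c * w 0" M] up M(1) wp[of 0] wm by simp
qed

lemma wt_pair: "inverse ((1 + norm (X::(real^'n)\<times>(real^'n))) ^ (2 * (2 * CARD('n)))) \<le> wt (fst X) * wt (snd X)"
proof -
  have "((1 + norm (fst X)) * (1 + norm (snd X))) ^ (2 * CARD('n)) \<le> ((1 + norm X) * (1 + norm X)) ^ (2 * CARD('n))"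
    by (intro power_mono mult_mono one_plus_norm_pair) auto
  also have "\<dots> = (1 + norm X) ^ (2 * (2 * CARD('n)))" by (simp only: power_mult_distrib power2_eq_square[symmetric] power_mult)
  finally have "inverse ((1 + norm X) ^ (2 * (2 * CARD('n)))) \<le> inverse (((1 + norm (fst X)) * (1 + norm (snd X))) ^ (2 * CARD('n)))"
    by (intro le_imp_inverse_le) (auto intro!: zero_less_power mult_pos_pos add_pos_nonneg)
  then show ?thesis by (simp add: wt_def power_mult_distrib)
qed

text \<open>Below exponent 1 the norm gives no direct control of integrals, so F = |u (atom X)| is
  first bounded pointwise. Inversion applied to the atoms dominates F by its convolution with a
  rapidly decreasing G, and the self-improving estimate bounds F by B times a power of 1 + |X|.
  Inversion applied to Hermite functions then yields the coefficients, the growth of F being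
  absorbed by the decay of \<open>cross\<close>. Temperedness of u enters only qualitatively,
  through some polynomial growth of F.\<close>

lemma coeff_le_modulation:
  fixes \<phi> :: "real^'n \<Rightarrow> complex" and p q :: ennreal
  assumes pq: "p > 0" "q > 0" and \<omega>: "poly_moderate_weight \<omega>" and \<phi>: "\<phi> \<in> schwartz" "\<phi> \<noteq> (\<lambda>_. 0)"
  shows "\<exists>C>0. \<exists>m. \<forall>u B. tempered_distribution u \<longrightarrow> hermite_series u \<longrightarrow> B \<ge> 0
    \<longrightarrow> modulation_enorm \<phi> p q \<omega> u \<le> ennreal B \<longrightarrow> (\<forall>\<alpha>. cmod (hermite_coeff u \<alpha>) \<le> C * Pm \<alpha> ^ m * B)"
proof -
  obtain c C0 M where c: "c > 0" "C0 > 0" "\<And>X. c * inverse ((1 + norm X) ^ M) \<le> \<omega> X"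
    "\<And>X. \<omega> X \<le> C0 * (1 + norm X) ^ M" "\<omega> \<in> borel_measurable lebesgue" by (rule poly_moderate_bounds[OF \<omega>]) (rule that)
  \<comment> \<open>A continuous minorant of the weight, so that the functions built from it below
    are Borel measurable.\<close>
  define v where "v = (\<lambda>X::(real^'n)\<times>(real^'n). c * inverse ((1 + norm X) ^ M))"
  have v: "v X > 0" "v X \<le> \<omega> X" for X using c by (auto simp: v_def add_pos_nonneg zero_less_power)
  have [measurable]: "v \<in> borel_measurable borel"
    unfolding v_def by (intro borel_measurable_continuous_onI continuous_intros) (auto simp: add_nonneg_eq_0_iff)
  \<comment> \<open>At most 1, p and q, so that the weighted estimate applies to the inner and to
    the outer norm; an infinite exponent imposes no restriction.\<close>
  define s where "s = min 1 (min (if p = top then 1 else enn2real p) (if q = top then 1 else enn2real q))"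
  have s: "0 < s" "s \<le> 1" using enn2real_exponent pq by (auto simp: s_def)
  have sp: "ennreal s \<le> p"
  proof (cases "p = top")
    case False
    then have "s \<le> enn2real p" by (simp add: s_def)
    then show ?thesis using False by (metis ennreal_enn2real ennreal_leI top.not_eq_extremum)
  qed simp
  have sq: "ennreal s \<le> q"
  proof (cases "q = top")
    case False
    then have "s \<le> enn2real q" by (simp add: s_def)
    then show ?thesis using False by (metis ennreal_enn2real ennreal_leI top.not_eq_extremum)
  qed simp
  define a where "a = (2 * pi) powr (- real CARD('n) / 2)"
  have a: "a > 0" by (simp add: a_def)
  \<comment> \<open>M s accounts for the weight raised to the power s, and 4 d buys the factor
    \<open>wt x * wt \<xi>\<close> needed to integrate in both variables.\<close>
  define L where "L = real M * s + real (2 * (2 * CARD('n)))"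
  have L: "L \<ge> 0" using s by (simp add: L_def)
  define K0 where "K0 = stft_const \<phi>"
  have K0: "K0 > 0" unfolding K0_def by (rule stft_const_pos[OF \<phi>])
  define G where "G = (\<lambda>Z. cmod (cross (\<lambda>y. cnj (\<phi> y)) \<phi> Z) / K0)"
  have G0: "G Z \<ge> 0" for Z using K0 by (simp add: G_def)
  have GD: "\<exists>D. \<forall>Z. (1 + norm Z) ^ k * G Z \<le> D" for k
  proof -
    obtain D where D: "D > 0" "\<And>X. (1 + norm X) ^ k * cmod (cross (\<lambda>y. cnj (\<phi> y)) \<phi> X) \<le> D * wt X"
      using cross_wt_bound[OF schwartz_cnj[OF \<phi>(1)] \<phi>(1)] by blast
    have "(1 + norm Z) ^ k * G Z \<le> D / K0" for Z
    proof -
      have "(1 + norm Z) ^ k * cmod (cross (\<lambda>y. cnj (\<phi> y)) \<phi> Z) \<le> D * 1"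
        using D(2)[of Z] mult_left_mono[OF wt_le_1[of Z], of D] D(1) by linarith
      then show ?thesis using K0 by (simp add: G_def divide_right_mono)
    qed
    then show ?thesis by blast
  qed
  obtain D where D: "D > 0" and boot: "\<And>F \<tau> X. F \<in> borel_measurable borel \<Longrightarrow> (\<And>X. F X \<ge> 0) \<Longrightarrow>
     (\<And>X. ennreal (F X) \<le> (\<integral>\<^sup>+Y. ennreal (F Y * G (Y - X)) \<partial>lborel)) \<Longrightarrow> (\<exists>A k. \<forall>X. F X \<le> A * (1 + norm X) ^ k) \<Longrightarrow>
     \<tau> \<ge> 0 \<Longrightarrow> (\<integral>\<^sup>+Y. ennreal (F Y powr s * (1 + norm Y) powr (- L)) \<partial>lborel) \<le> ennreal \<tau> \<Longrightarrow>
     F X \<le> D * \<tau> powr (1 / s) * (1 + norm X) powr ((L + 1) / s)"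
    using bootstrap[OF s L G0 GD] by blast
  define k where "k = nat \<lceil>(L + 1) / s\<rceil>"
  define W where "W = integral\<^sup>L lborel (wt :: real^'n \<Rightarrow> real)"
  have W: "W \<ge> 0" unfolding W_def by (rule integral_wt_nonneg)
  have nnW: "(\<integral>\<^sup>+x. ennreal (wt (x::real^'n)) \<partial>lebesgue) = ennreal W"
    unfolding W_def nn_integral_completion by (rule nn_integral_eq_integral[OF integrable_wt]) (simp add: less_imp_le[OF wt_pos])
  have "polyb (\<lambda>z. Pm (fst z)) (\<lambda>z. (1 + norm (snd z)) ^ (k + 2 * DIM((real^'n)\<times>(real^'n))) * cmod (cross (hermite_function (fst z)) \<phi> (snd z)))"
    by (rule cross_decay[OF schwf_hermite Pm_ge \<phi>(1)])
  from polyb_wt_bound[OF this Pm_ge] obtain E m where E: "E > 0"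
    "\<And>\<alpha> X. (1 + norm X) ^ k * cmod (cross (hermite_function \<alpha>) \<phi> X) \<le> E * Pm \<alpha> ^ m * wt X" by blast
  define V where "V = integral\<^sup>L lborel (wt :: (real^'n)\<times>(real^'n) \<Rightarrow> real)"
  have V: "V \<ge> 0" unfolding V_def by (rule integral_wt_nonneg)
  define Q where "Q = (1 + W) powr (2 / s) / (a * c)"
  have Q: "Q \<ge> 0" using a c(1) by (simp add: Q_def)
  have main: "cmod (hermite_coeff u \<alpha>) \<le> (D * Q * E * V / K0) * Pm \<alpha> ^ m * B"
    if u: "tempered_distribution u" "hermite_series u" and B: "B \<ge> 0" "modulation_enorm \<phi> p q \<omega> u \<le> ennreal B" for u B \<alpha>
  proof -
    define F where "F = (\<lambda>X. cmod (u (atom \<phi> X)))"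
    have Fm [measurable]: "F \<in> borel_measurable borel"
      unfolding F_def using stft_inversion(1)[OF u \<phi>(1) \<phi>(1)] by measurable
    have F0: "F X \<ge> 0" for X by (simp add: F_def)
    obtain A k1 where A: "A > 0" "\<And>X. F X \<le> A * (1 + norm X) ^ k1"
      unfolding F_def using tempered_atom_bound[OF u(1) \<phi>(1)] by blast
    have gr: "\<exists>A k. \<forall>X. F X \<le> A * (1 + norm X) ^ k" using A by blast
    have nn_le: "ennreal (cmod (u \<psi>) * K0) \<le> (\<integral>\<^sup>+Y. ennreal (F Y * cmod (cross \<psi> \<phi> Y)) \<partial>lborel)" if \<psi>: "\<psi> \<in> schwartz" for \<psi>
    proof -
      note [measurable] = cross_measurable[OF \<phi>(1) \<psi>] stft_inversion(1)[OF u \<psi> \<phi>(1)]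
      have i: "integrable lborel (\<lambda>X. cross \<psi> \<phi> X * u (atom \<phi> X))"
      proof -
        obtain C' where C': "C' > 0" "\<And>X. (1 + norm X) ^ k1 * cmod (cross \<psi> \<phi> X) \<le> C' * wt X" using cross_wt_bound[OF \<psi> \<phi>(1)] by blast
        have "cmod (cross \<psi> \<phi> X * u (atom \<phi> X)) \<le> (A * C') * wt X" for X
        proof -
          have "cmod (cross \<psi> \<phi> X * u (atom \<phi> X)) \<le> cmod (cross \<psi> \<phi> X) * (A * (1 + norm X) ^ k1)"
            using A(2)[of X] by (simp add: norm_mult F_def mult_left_mono)
          also have "\<dots> = A * ((1 + norm X) ^ k1 * cmod (cross \<psi> \<phi> X))" by (simp only: mult_ac)
          also have "\<dots> \<le> A * (C' * wt X)" using A(1) by (intro mult_left_mono C'(2)) auto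
          finally show ?thesis by (simp only: mult.assoc)
        qed
        then show ?thesis by (intro wt_bound_integrable) measurable
      qed
      have "cmod (u \<psi>) * K0 = cmod (of_real (stft_const \<phi>) * u \<psi>)" using K0 by (simp add: norm_mult K0_def)
      also have "\<dots> = norm (LBINT X. cross \<psi> \<phi> X * u (atom \<phi> X))" unfolding stft_inversion(2)[OF u \<psi> \<phi>(1)] ..
      finally have "ennreal (cmod (u \<psi>) * K0) \<le> (\<integral>\<^sup>+X. ennreal (norm (cross \<psi> \<phi> X * u (atom \<phi> X))) \<partial>lborel)"
        using integral_norm_bound_ennreal[OF i] by simp
      then show ?thesis by (simp add: F_def norm_mult mult.commute)
    qed
    have FG: "ennreal (F X) \<le> (\<integral>\<^sup>+Y. ennreal (F Y * G (Y - X)) \<partial>lborel)" for X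
    proof -
      have [measurable]: "cross (atom \<phi> X) \<phi> \<in> borel_measurable borel" by (rule cross_measurable[OF \<phi>(1) schwartz_atom[OF \<phi>(1)]])
      have "ennreal (F X) = ennreal (1 / K0) * ennreal (F X * K0)"
        using K0 F0[of X] by (simp add: ennreal_mult'[symmetric])
      also have "\<dots> \<le> ennreal (1 / K0) * (\<integral>\<^sup>+Y. ennreal (F Y * cmod (cross (atom \<phi> X) \<phi> Y)) \<partial>lborel)"
        using nn_le[OF schwartz_atom[OF \<phi>(1)], of X] by (intro mult_left_mono) (simp_all add: F_def)
      also have "\<dots> = (\<integral>\<^sup>+Y. ennreal (1 / K0) * ennreal (F Y * cmod (cross (atom \<phi> X) \<phi> Y)) \<partial>lborel)"
        by (rule nn_integral_cmult[symmetric]) measurable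
      also have "\<dots> = (\<integral>\<^sup>+Y. ennreal (F Y * G (Y - X)) \<partial>lborel)"
        using K0 by (intro nn_integral_cong) (simp add: ennreal_mult'[symmetric] cross_atom[OF \<phi>(1)] G_def)
      finally show ?thesis .
    qed
    define H where "H = (\<lambda>X. ennreal (a * F X * v X))"
    have Hm [measurable]: "H \<in> borel_measurable borel" unfolding H_def by measurable
    define I where "I = (\<lambda>\<xi>. Lp_enorm p lebesgue (\<lambda>x. H (x, \<xi>)))"
    have Im [measurable]: "I \<in> borel_measurable borel" unfolding I_def by (rule Lp_enorm_slice_measurable[OF Hm])
    have Hs: "(\<lambda>x. H (x, \<xi>)) \<in> borel_measurable borel" for \<xi>
    proof -
      have "(\<lambda>x. (x, \<xi>)) \<in> borel \<rightarrow>\<^sub>M (borel :: ((real^'n)\<times>(real^'n)) measure)"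
        by (intro borel_measurable_continuous_onI continuous_intros)
      from measurable_compose[OF this Hm] show ?thesis .
    qed
    have "Lp_enorm q lebesgue I \<le> modulation_enorm \<phi> p q \<omega> u"
      unfolding modulation_enorm_def I_def
    proof (intro Lp_enorm_mono_AE AE_I2)
      show "(\<lambda>\<xi>. Lp_enorm p lebesgue (\<lambda>x. H (x, \<xi>))) \<in> borel_measurable lebesgue"
        using Im unfolding I_def by (intro measurable_completion) simp
      show "(\<lambda>x. H (x, \<xi>)) \<in> borel_measurable lebesgue" for \<xi> using Hs by (intro measurable_completion) simp
      show "H (x, \<xi>) \<le> ennreal (cmod (stft \<phi> u x \<xi> * of_real (\<omega> (x, \<xi>))))" for x \<xi>
      proof -
        have "a * F (x, \<xi>) * v (x, \<xi>) \<le> a * F (x, \<xi>) * \<omega> (x, \<xi>)"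
          using a F0[of "(x, \<xi>)"] by (intro mult_left_mono v) auto
        also have "\<dots> = cmod (stft \<phi> u x \<xi> * of_real (\<omega> (x, \<xi>)))"
          using a less_le_trans[OF v(1) v(2), of "(x, \<xi>)"] by (simp add: stft_eq norm_mult F_def a_def)
        finally show ?thesis unfolding H_def by (rule ennreal_leI)
      qed
    qed
    then have LB: "Lp_enorm q lebesgue I \<le> ennreal B" using B(2) by (rule order_trans)
    \<comment> \<open>Each of the two norms contributes a factor 1 + W. B enters as B^s, so that
      \<tau>^(1/s) is linear in B with a constant independent of u.\<close>
    define \<tau> where "\<tau> = inverse ((a * c) powr s) * ((1 + W) * ((1 + W) * B powr s))"
    have \<tau>: "\<tau> \<ge> 0" using W by (simp add: \<tau>_def)
    have T: "(\<integral>\<^sup>+Y. ennreal (F Y powr s * (1 + norm Y) powr (- L)) \<partial>lborel) \<le> ennreal \<tau>"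
    proof -
      define ci where "ci = inverse ((a * c) powr s)"
      have ci: "ci \<ge> 0" by (simp add: ci_def)
      have pw: "ennreal (F X powr s * (1 + norm X) powr (- L)) \<le> ennreal ci * (ennreal_powr (H X) s * (ennreal (wt (fst X)) * ennreal (wt (snd X))))" for X
      proof -
        have n: "1 + norm X > 0" by (simp add: add_pos_nonneg)
        have "(a * F X * v X) powr s = (a * c) powr s * F X powr s * (1 + norm X) powr (- (real M * s))"
        proof -
          have "inverse ((1 + norm X) ^ M) = (1 + norm X) powr (- real M)"
            by (simp only: powr_minus powr_realpow[OF n])
          then have aFv: "a * F X * v X = (a * c) * F X * (1 + norm X) powr (- real M)" by (simp add: v_def mult_ac)
          show ?thesis unfolding aFv using a c(1) F0[of X] by (simp add: powr_mult powr_powr)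
        qed
        then have e: "F X powr s * (1 + norm X) powr (- (real M * s)) = ci * (a * F X * v X) powr s"
          using a c(1) by (simp add: ci_def field_simps)
        have "(1 + norm X) powr (- L) = (1 + norm X) powr (- (real M * s)) * (1 + norm X) powr (- real (2 * (2 * CARD('n))))"
          by (simp add: L_def powr_add[symmetric])
        also have "(1 + norm X) powr (- real (2 * (2 * CARD('n)))) = inverse ((1 + norm X) ^ (2 * (2 * CARD('n))))"
          by (simp only: powr_minus powr_realpow[OF n])
        finally have "F X powr s * (1 + norm X) powr (- L) = (F X powr s * (1 + norm X) powr (- (real M * s))) * inverse ((1 + norm X) ^ (2 * (2 * CARD('n))))"
          by (simp only: mult.assoc)
        also have "\<dots> \<le> (F X powr s * (1 + norm X) powr (- (real M * s))) * (wt (fst X) * wt (snd X))"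
          by (intro mult_left_mono wt_pair) auto
        also have "\<dots> = ci * ((a * F X * v X) powr s * (wt (fst X) * wt (snd X)))" unfolding e by (simp only: mult.assoc)
        finally have "ennreal (F X powr s * (1 + norm X) powr (- L)) \<le> ennreal (ci * ((a * F X * v X) powr s * (wt (fst X) * wt (snd X))))"
          by (rule ennreal_leI)
        also have "\<dots> = ennreal ci * (ennreal_powr (H X) s * (ennreal (wt (fst X)) * ennreal (wt (snd X))))"
        proof -
          have "0 \<le> a * F X * v X" using a F0[of X] v(1)[of X] by simp
          then have "ennreal_powr (H X) s = ennreal ((a * F X * v X) powr s)" by (simp only: H_def ennreal_powr_ennreal)
          then show ?thesis using ci wt_pos[of "fst X"] wt_pos[of "snd X"] by (simp add: ennreal_mult less_imp_le)
        qed
        finally show ?thesis .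
      qed
      have m2: "(\<lambda>X. ennreal_powr (H X) s * (ennreal (wt (fst X)) * ennreal (wt (snd X)))) \<in> borel_measurable (lborel \<Otimes>\<^sub>M lborel)"
      proof -
        have "(\<lambda>X. wt (fst X :: real^'n)) \<in> borel_measurable (borel :: ((real^'n)\<times>(real^'n)) measure)"
          "(\<lambda>X. wt (snd X :: real^'n)) \<in> borel_measurable (borel :: ((real^'n)\<times>(real^'n)) measure)"
          by (intro borel_measurable_continuous_onI continuous_on_compose2[OF continuous_wt[of UNIV]] continuous_intros; simp)+
        then show ?thesis unfolding lborel_prod by measurable
      qed
      have "(\<integral>\<^sup>+Y. ennreal (F Y powr s * (1 + norm Y) powr (- L)) \<partial>lborel)
        \<le> (\<integral>\<^sup>+X. ennreal ci * (ennreal_powr (H X) s * (ennreal (wt (fst X)) * ennreal (wt (snd X)))) \<partial>lborel)"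
        by (intro nn_integral_mono pw)
      also have "\<dots> = ennreal ci * (\<integral>\<^sup>+X. (ennreal_powr (H X) s * (ennreal (wt (fst X)) * ennreal (wt (snd X)))) \<partial>lborel)"
        by (rule nn_integral_cmult) (use m2 in \<open>simp add: lborel_prod\<close>)
      also have "(\<integral>\<^sup>+X. (ennreal_powr (H X) s * (ennreal (wt (fst X)) * ennreal (wt (snd X)))) \<partial>lborel)
         = (\<integral>\<^sup>+\<xi>. \<integral>\<^sup>+x. ennreal_powr (H (x, \<xi>)) s * (ennreal (wt x) * ennreal (wt \<xi>)) \<partial>lborel \<partial>lborel)"
        using lborel_pair.nn_integral_snd[OF m2] by (simp add: lborel_prod)
      also have "\<dots> \<le> (\<integral>\<^sup>+\<xi>. (1 + ennreal W) * ennreal_powr (I \<xi>) s * ennreal (wt \<xi>) \<partial>lborel)"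
      proof (rule nn_integral_mono)
        fix \<xi> :: "real^'n"
        note [measurable] = Hs[of \<xi>]
        have "(\<integral>\<^sup>+x. ennreal_powr (H (x, \<xi>)) s * (ennreal (wt x) * ennreal (wt \<xi>)) \<partial>lborel)
           = (\<integral>\<^sup>+x. (ennreal_powr (H (x, \<xi>)) s * ennreal (wt x)) * ennreal (wt \<xi>) \<partial>lborel)" by (simp only: mult.assoc)
        also have "\<dots> = (\<integral>\<^sup>+x. ennreal_powr (H (x, \<xi>)) s * ennreal (wt x) \<partial>lborel) * ennreal (wt \<xi>)"
          by (rule nn_integral_multc) measurable
        also have "(\<integral>\<^sup>+x. ennreal_powr (H (x, \<xi>)) s * ennreal (wt x) \<partial>lborel) = (\<integral>\<^sup>+x. ennreal_powr (H (x, \<xi>)) s * ennreal (wt x) \<partial>lebesgue)"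
          by (simp add: nn_integral_completion)
        also have "\<dots> \<le> (1 + (\<integral>\<^sup>+x. ennreal (wt (x::real^'n)) \<partial>lebesgue)) * ennreal_powr (Lp_enorm p lebesgue (\<lambda>x. H (x, \<xi>))) s"
          by (rule weighted_integral_le_Lp) (use Hs s sp wt_le_1 wt_pos in \<open>auto intro: measurable_completion less_imp_le\<close>)
        finally show "(\<integral>\<^sup>+x. ennreal_powr (H (x, \<xi>)) s * (ennreal (wt x) * ennreal (wt \<xi>)) \<partial>lborel) \<le> (1 + ennreal W) * ennreal_powr (I \<xi>) s * ennreal (wt \<xi>)"
          unfolding nnW I_def by (simp add: mult_right_mono)
      qed
      also have "\<dots> = (1 + ennreal W) * (\<integral>\<^sup>+\<xi>. ennreal_powr (I \<xi>) s * ennreal (wt \<xi>) \<partial>lebesgue)"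
        unfolding mult.assoc nn_integral_completion by (rule nn_integral_cmult) measurable
      also have "\<dots> \<le> (1 + ennreal W) * ((1 + (\<integral>\<^sup>+x. ennreal (wt (x::real^'n)) \<partial>lebesgue)) * ennreal_powr (Lp_enorm q lebesgue I) s)"
        by (intro mult_left_mono weighted_integral_le_Lp) (use Im s sq wt_le_1 wt_pos in \<open>auto intro: measurable_completion less_imp_le\<close>)
      also have "\<dots> \<le> (1 + ennreal W) * ((1 + ennreal W) * ennreal_powr (ennreal B) s)"
        unfolding nnW using s by (intro mult_left_mono ennreal_powr_mono LB) auto
      also have "\<dots> = ennreal ((1 + W) * ((1 + W) * B powr s))"
        using B W by (simp add: ennreal_powr_ennreal ennreal_mult ennreal_1[symmetric] ennreal_plus[symmetric] del: ennreal_1 ennreal_plus)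
      finally have "(\<integral>\<^sup>+Y. ennreal (F Y powr s * (1 + norm Y) powr (- L)) \<partial>lborel) \<le> ennreal ci * ennreal ((1 + W) * ((1 + W) * B powr s))"
        by (simp add: mult_left_mono)
      also have "\<dots> = ennreal \<tau>" using ci W by (simp add: \<tau>_def ci_def ennreal_mult)
      finally show ?thesis .
    qed
    have \<tau>s: "\<tau> powr (1 / s) = Q * B"
    proof -
      have cancel: "(y powr s) powr (1 / s) = y" if "y \<ge> 0" for y using that s by (simp add: powr_powr)
      have \<tau>': "\<tau> = (1 + W) powr 2 * inverse ((a * c) powr s) * B powr s" using W by (simp add: \<tau>_def power2_eq_square mult_ac)
      have "inverse ((a * c) powr s) powr (1 / s) = inverse (a * c)"
        using a c(1) by (simp only: inverse_powr cancel powr_ge_zero mult_nonneg_nonneg less_imp_le)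
      moreover have "((1 + W) powr 2) powr (1 / s) = (1 + W) powr (2 / s)" by (simp only: powr_powr times_divide_eq_right mult_1_right)
      moreover have "\<tau> powr (1 / s) = ((1 + W) powr 2) powr (1 / s) * inverse ((a * c) powr s) powr (1 / s) * (B powr s) powr (1 / s)"
        unfolding \<tau>' using W B by (subst powr_mult; simp)+
      ultimately have "\<tau> powr (1 / s) = (1 + W) powr (2 / s) * inverse ((a * c)) * B"
        using B by (simp only: cancel)
      then show ?thesis by (simp add: Q_def divide_inverse mult_ac)
    qed
    have Fk: "F X \<le> D * (Q * B) * (1 + norm X) ^ k" for X
    proof -
      have n: "1 + norm X \<ge> 1" "1 + norm X > 0" by (simp_all add: add_pos_nonneg)
      have "F X \<le> D * \<tau> powr (1 / s) * (1 + norm X) powr ((L + 1) / s)"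
        by (rule boot[OF Fm F0 FG gr \<tau> T])
      also have "\<dots> \<le> D * \<tau> powr (1 / s) * (1 + norm X) powr real k"
        using D n(1) by (intro mult_left_mono powr_mono) (auto simp: k_def real_nat_ceiling_ge)
      finally show ?thesis unfolding \<tau>s powr_realpow[OF n(2)] .
    qed
    have "ennreal (cmod (hermite_coeff u \<alpha>) * K0) \<le> (\<integral>\<^sup>+Y. ennreal (F Y * cmod (cross (hermite_function \<alpha>) \<phi> Y)) \<partial>lborel)"
      unfolding hermite_coeff_def by (rule nn_le[OF schwartz_hermite])
    also have "\<dots> \<le> (\<integral>\<^sup>+Y. ennreal ((D * (Q * B) * (E * Pm \<alpha> ^ m)) * wt (Y::(real^'n)\<times>(real^'n))) \<partial>lborel)"
    proof (intro nn_integral_mono ennreal_leI)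
      fix X
      have "F X * cmod (cross (hermite_function \<alpha>) \<phi> X) \<le> (D * (Q * B) * (1 + norm X) ^ k) * cmod (cross (hermite_function \<alpha>) \<phi> X)"
        by (intro mult_right_mono Fk) simp
      also have "\<dots> = (D * (Q * B)) * ((1 + norm X) ^ k * cmod (cross (hermite_function \<alpha>) \<phi> X))" by (simp only: mult.assoc)
      also have "\<dots> \<le> (D * (Q * B)) * (E * Pm \<alpha> ^ m * wt X)" using D Q B by (intro mult_left_mono E(2)) auto
      finally show "F X * cmod (cross (hermite_function \<alpha>) \<phi> X) \<le> (D * (Q * B) * (E * Pm \<alpha> ^ m)) * wt X" by (simp only: mult_ac)
    qed
    also have "\<dots> = ennreal ((D * (Q * B) * (E * Pm \<alpha> ^ m)) * V)"
    proof -
      have "(\<integral>\<^sup>+Y. ennreal ((D * (Q * B) * (E * Pm \<alpha> ^ m)) * wt (Y::(real^'n)\<times>(real^'n))) \<partial>lborel) = ennreal (LBINT Y. (D * (Q * B) * (E * Pm \<alpha> ^ m)) * wt (Y::(real^'n)\<times>(real^'n)))"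
        using D Q B E(1) by (intro nn_integral_eq_integral integrable_mult_right integrable_wt AE_I2) (auto simp: less_imp_le[OF wt_pos])
      then show ?thesis by (simp add: V_def)
    qed
    finally have "cmod (hermite_coeff u \<alpha>) * K0 \<le> (D * (Q * B) * (E * Pm \<alpha> ^ m)) * V"
      using D Q B E(1) V by (subst (asm) ennreal_le_iff) auto
    then show ?thesis using K0 by (simp add: field_simps)
  qed
  have "cmod (hermite_coeff u \<alpha>) \<le> (D * Q * E * V / K0 + 1) * Pm \<alpha> ^ m * B"
    if "tempered_distribution u" "hermite_series u" "B \<ge> 0" "modulation_enorm \<phi> p q \<omega> u \<le> ennreal B" for u B \<alpha>
  proof -
    have "(D * Q * E * V / K0) * Pm \<alpha> ^ m * B \<le> (D * Q * E * V / K0 + 1) * Pm \<alpha> ^ m * B"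
      using that(3) by (intro mult_right_mono) auto
    with main[OF that] show ?thesis by (rule order_trans)
  qed
  moreover have "D * Q * E * V / K0 + 1 > 0" using D Q E(1) V K0 by (simp add: add_nonneg_pos)
  ultimately show ?thesis by blast
qed

section \<open>Norm estimates from the coefficients\<close>

lemma integral_count_space_bound:
  fixes g :: "('n::finite \<Rightarrow> nat) \<Rightarrow> complex"
  assumes "\<And>\<alpha>. cmod (g \<alpha>) \<le> S * inverse (Pm \<alpha> ^ (2 * CARD('n)))"
  shows "cmod (\<integral>\<alpha>. g \<alpha> \<partial>count_space UNIV) \<le> S * (\<integral>\<alpha>. inverse (Pm \<alpha> ^ (2 * CARD('n))) \<partial>count_space (UNIV :: ('n \<Rightarrow> nat) set))"
proof -
  have i: "integrable (count_space UNIV) (\<lambda>\<alpha> :: 'n \<Rightarrow> nat. S * inverse (Pm \<alpha> ^ (2 * CARD('n))))"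
    by (intro integrable_mult_right summable_Pm)
  have "integrable (count_space UNIV) g"
    by (rule Bochner_Integration.integrable_bound[OF i]) (use order_trans[OF assms abs_ge_self] in \<open>auto intro!: AE_I2\<close>)
  then have "(\<integral>\<alpha>. cmod (g \<alpha>) \<partial>count_space UNIV) \<le> (\<integral>\<alpha>. S * inverse (Pm \<alpha> ^ (2 * CARD('n))) \<partial>count_space (UNIV :: ('n \<Rightarrow> nat) set))"
    by (intro integral_mono_AE AE_I2 assms integrable_norm i)
  then show ?thesis using order_trans[OF integral_norm_bound] by simp
qed

text \<open>The Hermite series may be summed only after pairing with a test function; the resulting
  bound by an integral of a continuous weight is then localized to points. Decay of order k is
  inherited from the Hermite functions at the price of m powers of \<open>Pm \<alpha>\<close>, with
  2 d further powers for summability.\<close>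

lemma series_pointwise_bound:
  "\<exists>C\<ge>0. \<exists>m. \<forall>(g::real^'n \<Rightarrow> complex) u S. represents g u \<longrightarrow> smooth g \<longrightarrow> hermite_series u \<longrightarrow> S \<ge> 0
    \<longrightarrow> (\<forall>\<alpha>. cmod (hermite_coeff u \<alpha>) * Pm \<alpha> ^ m \<le> S * inverse (Pm \<alpha> ^ (2 * CARD('n))))
    \<longrightarrow> (\<forall>x. cmod (g x) \<le> C * S * inverse ((1 + norm x) ^ k))"
proof -
  obtain C m where C: "C > 0" "\<And>\<alpha> (x::real^'n). (1 + norm x) ^ k * cmod (hermite_function \<alpha> x) \<le> C * Pm \<alpha> ^ m * wt x"
    using hermite_wt_bound[of k, where 'n='n] by blast
  define Z where "Z = (\<integral>\<alpha>. inverse (Pm \<alpha> ^ (2 * CARD('n))) \<partial>count_space (UNIV :: ('n \<Rightarrow> nat) set))"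
  have Z: "Z \<ge> 0" unfolding Z_def by (rule Bochner_Integration.integral_nonneg) simp
  have "cmod (g x) \<le> (C * Z) * S * inverse ((1 + norm x) ^ k)"
    if r: "represents g u" "smooth g" and h: "hermite_series u" and S: "S \<ge> 0"
      and b: "\<forall>\<alpha>. cmod (hermite_coeff u \<alpha>) * Pm \<alpha> ^ m \<le> S * inverse (Pm \<alpha> ^ (2 * CARD('n)))"
    for g :: "real^'n \<Rightarrow> complex" and u S x
  proof (rule pointwise_bound_from_test_functions)
    have u: "tempered_distribution u" using r by (simp add: represents_def)
    show "continuous_on UNIV g" by (rule smooth_continuous[OF r(2)])
    show "continuous_on UNIV (\<lambda>x. (C * Z) * S * inverse ((1 + norm x) ^ k))"
      by (intro continuous_intros) (auto simp: add_nonneg_eq_0_iff)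
    fix \<psi> :: "real^'n \<Rightarrow> complex" assume \<psi>t: "\<psi> \<in> test_function"
    then have \<psi>: "\<psi> \<in> schwartz" by (rule test_function_schwartz)
    note [measurable] = schwartz_measurable[OF \<psi>]
    define J where "J = (LBINT x. inverse ((1 + norm x) ^ k) * cmod (\<psi> x))"
    have nk: "(1 + norm y) ^ k \<ge> 1" "inverse ((1 + norm y) ^ k) \<le> 1" for y :: "real^'n"
      by (simp_all add: one_le_power inverse_le_1_iff)
    have cm: "(\<lambda>x::real^'n. inverse ((1 + norm x) ^ k)) \<in> borel_measurable borel"
      by (intro borel_measurable_continuous_onI continuous_intros) (auto simp: add_nonneg_eq_0_iff)
    have Ji: "integrable lborel (\<lambda>x. inverse ((1 + norm x) ^ k) * cmod (\<psi> x))"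
    proof (rule Bochner_Integration.integrable_bound[OF integrable_norm[OF schwartz_integrable[OF \<psi>]]])
      show "AE x in lborel. norm (inverse ((1 + norm x) ^ k) * cmod (\<psi> x)) \<le> norm (norm (\<psi> x))"
      proof (rule AE_I2)
        fix x show "norm (inverse ((1 + norm x) ^ k) * cmod (\<psi> x)) \<le> norm (norm (\<psi> x))"
          using mult_right_mono[OF nk(2)[of x], of "cmod (\<psi> x)"] nk(1)[of x] by (simp add: abs_mult)
      qed
    qed (use cm in measurable)
    have "cmod (LBINT x. g x * \<psi> x) = cmod (\<integral>\<alpha>. hermite_coeff u \<alpha> * (LBINT x. hermite_function \<alpha> x * \<psi> x) \<partial>count_space UNIV)"
      using represents_test[OF r \<psi>t] hermite_series_integral[OF u h \<psi>] by simp
    also have "\<dots> \<le> (C * S * J) * Z"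
      unfolding Z_def
    proof (rule integral_count_space_bound)
      fix \<alpha> :: "'n \<Rightarrow> nat"
      have pt: "cmod (hermite_function \<alpha> x * \<psi> x) \<le> (C * Pm \<alpha> ^ m) * (inverse ((1 + norm x) ^ k) * cmod (\<psi> x))" for x
      proof -
        have "(1 + norm x) ^ k * cmod (hermite_function \<alpha> x) \<le> C * Pm \<alpha> ^ m * 1"
          using order_trans[OF C(2)[of x \<alpha>] mult_left_mono[OF wt_le_1[of x], of "C * Pm \<alpha> ^ m"]] C(1) by simp
        then have "cmod (hermite_function \<alpha> x) \<le> C * Pm \<alpha> ^ m * inverse ((1 + norm x) ^ k)"
          using nk(1)[of x] by (subst divide_inverse[symmetric], subst pos_le_divide_eq) (linarith, simp add: mult.commute)
        then show ?thesis by (simp only: norm_mult mult.assoc[symmetric]) (intro mult_right_mono; simp)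
      qed
      have i1: "integrable lborel (\<lambda>x. hermite_function \<alpha> x * \<psi> x)" by (intro schwartz_integrable schwartz_mult schwartz_hermite \<psi>)
      have "cmod (LBINT x. hermite_function \<alpha> x * \<psi> x) \<le> (LBINT x. cmod (hermite_function \<alpha> x * \<psi> x))" by (rule integral_norm_bound)
      also have "\<dots> \<le> (LBINT x. (C * Pm \<alpha> ^ m) * (inverse ((1 + norm x) ^ k) * cmod (\<psi> x)))"
        by (intro integral_mono_AE AE_I2 pt integrable_norm i1 integrable_mult_right Ji)
      also have "\<dots> = C * Pm \<alpha> ^ m * J" by (simp add: J_def)
      finally have "cmod (hermite_coeff u \<alpha> * (LBINT x. hermite_function \<alpha> x * \<psi> x)) \<le> cmod (hermite_coeff u \<alpha>) * (C * Pm \<alpha> ^ m * J)"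
        by (simp add: norm_mult mult_left_mono)
      also have "\<dots> = (C * J) * (cmod (hermite_coeff u \<alpha>) * Pm \<alpha> ^ m)" by (simp only: mult_ac)
      also have "\<dots> \<le> (C * J) * (S * inverse (Pm \<alpha> ^ (2 * CARD('n))))"
      proof (rule mult_left_mono)
        have "J \<ge> 0" unfolding J_def by (rule Bochner_Integration.integral_nonneg) (simp add: order_trans[OF zero_le_one nk(1)])
        then show "0 \<le> C * J" using C(1) by simp
      qed (use b in blast)
      finally show "cmod (hermite_coeff u \<alpha> * (LBINT x. hermite_function \<alpha> x * \<psi> x)) \<le> C * S * J * inverse (Pm \<alpha> ^ (2 * CARD('n)))"
        by (simp only: mult_ac)
    qed
    also have "\<dots> = (LBINT x. (C * Z * S) * (inverse ((1 + norm x) ^ k) * cmod (\<psi> x)))"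
      by (simp add: J_def mult_ac)
    also have "\<dots> = (LBINT x. C * Z * S * inverse ((1 + norm x) ^ k) * cmod (\<psi> x))" by (simp only: mult.assoc)
    finally show "cmod (LBINT x. g x * \<psi> x) \<le> (LBINT x. C * Z * S * inverse ((1 + norm x) ^ k) * cmod (\<psi> x))" .
  qed
  then show ?thesis using C(1) Z by (intro exI[of _ "C * Z"] conjI exI[of _ m]) auto
qed

lemma series_stft_bound:
  fixes \<phi> :: "real^'n \<Rightarrow> complex"
  assumes \<phi>: "\<phi> \<in> schwartz"
  shows "\<exists>C\<ge>0. \<exists>m. \<forall>u S. tempered_distribution u \<longrightarrow> hermite_series u \<longrightarrow> S \<ge> 0
    \<longrightarrow> (\<forall>\<alpha>. cmod (hermite_coeff u \<alpha>) * Pm \<alpha> ^ m \<le> S * inverse (Pm \<alpha> ^ (2 * CARD('n))))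
    \<longrightarrow> (\<forall>X. cmod (u (atom \<phi> X)) \<le> C * S * inverse ((1 + norm X) ^ k))"
proof -
  have "polyb (\<lambda>z. Pm (fst z)) (\<lambda>z. (1 + norm (snd z)) ^ (k + 2 * DIM((real^'n)\<times>(real^'n))) * cmod (cross (hermite_function (fst z)) (\<lambda>y. cnj (\<phi> y)) (snd z)))"
    by (rule cross_decay[OF schwf_hermite Pm_ge schwartz_cnj[OF \<phi>]])
  from polyb_wt_bound[OF this Pm_ge] obtain C m where C: "C > 0"
    "\<And>\<alpha> X. (1 + norm X) ^ k * cmod (cross (hermite_function \<alpha>) (\<lambda>y. cnj (\<phi> y)) X) \<le> C * Pm \<alpha> ^ m * wt X" by blast
  define Z where "Z = (\<integral>\<alpha>. inverse (Pm \<alpha> ^ (2 * CARD('n))) \<partial>count_space (UNIV :: ('n \<Rightarrow> nat) set))"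
  have Z: "Z \<ge> 0" unfolding Z_def by (rule Bochner_Integration.integral_nonneg) simp
  have "cmod (u (atom \<phi> X)) \<le> (C * Z) * S * inverse ((1 + norm X) ^ k)"
    if u: "tempered_distribution u" "hermite_series u" and S: "S \<ge> 0"
      and b: "\<forall>\<alpha>. cmod (hermite_coeff u \<alpha>) * Pm \<alpha> ^ m \<le> S * inverse (Pm \<alpha> ^ (2 * CARD('n)))" for u S X
  proof -
    \<comment> \<open>The exponential in \<open>cross\<close> has the sign opposite to that in
      \<open>atom\<close>, hence the reflected frequency.\<close>
    define Y where "Y = (fst X, - snd X)"
    have nY: "norm Y = norm X" by (cases X) (simp add: Y_def norm_Pair)
    have nk: "(1 + norm X) ^ k > 0" by (simp add: zero_less_power add_pos_nonneg)
    have "cmod (u (atom \<phi> X)) = cmod (\<integral>\<alpha>. hermite_coeff u \<alpha> * (LBINT y. hermite_function \<alpha> y * atom \<phi> X y) \<partial>count_space UNIV)"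
      using hermite_series_integral[OF u schwartz_atom[OF \<phi>]] by simp
    also have "\<dots> \<le> (C * S * inverse ((1 + norm X) ^ k)) * Z"
      unfolding Z_def
    proof (rule integral_count_space_bound)
      fix \<alpha> :: "'n \<Rightarrow> nat"
      have "(LBINT y. hermite_function \<alpha> y * atom \<phi> X y) = cross (hermite_function \<alpha>) (\<lambda>y. cnj (\<phi> y)) Y"
        by (simp add: cross_def fourier_def atom_def Y_def mult.assoc)
      moreover have "cmod (cross (hermite_function \<alpha>) (\<lambda>y. cnj (\<phi> y)) Y) \<le> C * Pm \<alpha> ^ m * inverse ((1 + norm X) ^ k)"
        using order_trans[OF C(2)[of Y \<alpha>] mult_left_mono[OF wt_le_1[of Y], of "C * Pm \<alpha> ^ m"]] C(1) nk
        unfolding nY by (simp add: field_simps)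
      ultimately have "cmod (hermite_coeff u \<alpha> * (LBINT y. hermite_function \<alpha> y * atom \<phi> X y)) \<le> cmod (hermite_coeff u \<alpha>) * (C * Pm \<alpha> ^ m * inverse ((1 + norm X) ^ k))"
        by (simp add: norm_mult mult_left_mono)
      also have "\<dots> = (C * inverse ((1 + norm X) ^ k)) * (cmod (hermite_coeff u \<alpha>) * Pm \<alpha> ^ m)" by (simp only: mult_ac)
      also have "\<dots> \<le> (C * inverse ((1 + norm X) ^ k)) * (S * inverse (Pm \<alpha> ^ (2 * CARD('n))))"
        using C(1) nk b by (intro mult_left_mono) auto
      finally show "cmod (hermite_coeff u \<alpha> * (LBINT y. hermite_function \<alpha> y * atom \<phi> X y)) \<le> C * S * inverse ((1 + norm X) ^ k) * inverse (Pm \<alpha> ^ (2 * CARD('n)))"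
        by (simp only: mult_ac)
    qed
    finally show ?thesis by (simp only: mult_ac)
  qed
  then show ?thesis using C(1) Z by (intro exI[of _ "C * Z"] conjI exI[of _ m]) auto
qed

text \<open>The transform decays to order M + 2 k: M is spent on the growth of the weight, and k on
  each of the two variables, where k is beyond the thresholds of both p and q.\<close>

lemma modulation_le_series:
  fixes \<phi> :: "real^'n \<Rightarrow> complex" and p q :: ennreal
  assumes pq: "p > 0" "q > 0" and \<omega>: "poly_moderate_weight \<omega>" and \<phi>: "\<phi> \<in> schwartz"
  shows "\<exists>C\<ge>0. \<exists>m. \<forall>u S. tempered_distribution u \<longrightarrow> hermite_series u \<longrightarrow> S \<ge> 0
    \<longrightarrow> (\<forall>\<alpha>. cmod (hermite_coeff u \<alpha>) * Pm \<alpha> ^ m \<le> S * inverse (Pm \<alpha> ^ (2 * CARD('n))))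
    \<longrightarrow> modulation_enorm \<phi> p q \<omega> u \<le> ennreal (C * S)"
proof -
  obtain c C0 M where "c > 0" and C0: "C0 > 0" and "\<And>X. c * inverse ((1 + norm X) ^ M) \<le> \<omega> X"
    and C0': "\<And>X. \<omega> X \<le> C0 * (1 + norm X) ^ M" and \<omega>m: "\<omega> \<in> borel_measurable lebesgue"
    by (rule poly_moderate_bounds[OF \<omega>]) (rule that)
  have \<omega>0: "\<omega> X > 0" for X using \<omega> unfolding poly_moderate_weight_def by blast
  obtain Kp kp where Kp: "Kp \<ge> 0" "\<And>k S (g :: real^'n \<Rightarrow> ennreal). k \<ge> kp \<Longrightarrow> S \<ge> 0 \<Longrightarrow> g \<in> borel_measurable lebesgue \<Longrightarrow>
     (AE x in lebesgue. g x \<le> ennreal (S * inverse ((1 + norm x) ^ k))) \<Longrightarrow> Lp_enorm p lebesgue g \<le> ennreal (Kp * S)"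
    using Lp_enorm_decay_bound[OF pq(1), where 'a="real^'n"] by blast
  obtain Kq kq where Kq: "Kq \<ge> 0" "\<And>k S (g :: real^'n \<Rightarrow> ennreal). k \<ge> kq \<Longrightarrow> S \<ge> 0 \<Longrightarrow> g \<in> borel_measurable lebesgue \<Longrightarrow>
     (AE x in lebesgue. g x \<le> ennreal (S * inverse ((1 + norm x) ^ k))) \<Longrightarrow> Lp_enorm q lebesgue g \<le> ennreal (Kq * S)"
    using Lp_enorm_decay_bound[OF pq(2), where 'a="real^'n"] by blast
  define k where "k = kp + kq"
  obtain C m where C: "C \<ge> 0" "\<And>u S X. tempered_distribution u \<Longrightarrow> hermite_series u \<Longrightarrow> S \<ge> 0
    \<Longrightarrow> (\<forall>\<alpha>. cmod (hermite_coeff u \<alpha>) * Pm \<alpha> ^ m \<le> S * inverse (Pm \<alpha> ^ (2 * CARD('n))))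
    \<Longrightarrow> cmod (u (atom \<phi> X)) \<le> C * S * inverse ((1 + norm X) ^ (M + 2 * k))"
    using series_stft_bound[OF \<phi>, of "M + 2 * k"] by blast
  define a where "a = (2 * pi) powr (- real CARD('n) / 2)"
  have a: "a > 0" by (simp add: a_def)
  have "modulation_enorm \<phi> p q \<omega> u \<le> ennreal ((Kq * Kp * a * C * C0) * S)"
    if u: "tempered_distribution u" "hermite_series u" and S: "S \<ge> 0"
      and b: "\<forall>\<alpha>. cmod (hermite_coeff u \<alpha>) * Pm \<alpha> ^ m \<le> S * inverse (Pm \<alpha> ^ (2 * CARD('n)))" for u S
  proof -
    define h where "h = (\<lambda>X. ennreal (cmod (stft \<phi> u (fst X) (snd X) * of_real (\<omega> X))))"
    have hm: "h \<in> borel_measurable lebesgue"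
    proof -
      have "(\<lambda>X. u (atom \<phi> X)) \<in> borel_measurable lebesgue"
        using stft_inversion(1)[OF u \<phi> \<phi>] by (intro measurable_completion) simp
      then have "(\<lambda>X. ennreal (a * cmod (u (atom \<phi> X)) * \<omega> X)) \<in> borel_measurable lebesgue"
        by (intro measurable_compose[OF _ measurable_ennreal] borel_measurable_times borel_measurable_const \<omega>m measurable_compose[OF _ borel_measurable_norm])
      also have "(\<lambda>X. ennreal (a * cmod (u (atom \<phi> X)) * \<omega> X)) = h"
      proof
        fix X show "ennreal (a * cmod (u (atom \<phi> X)) * \<omega> X) = h X"
          using a \<omega>0[of X] by (simp add: h_def stft_eq norm_mult a_def)
      qed
      finally show ?thesis .
    qed
    have hb: "h (x, \<xi>) \<le> ennreal (((a * C * C0 * S) * inverse ((1 + norm \<xi>) ^ k)) * inverse ((1 + norm x) ^ k))" for x \<xi>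
    proof -
      let ?n = "1 + norm (x, \<xi>)"
      have n: "?n ^ j > 0" for j by (simp add: zero_less_power add_pos_nonneg)
      have nx: "(1 + norm x) ^ k > 0" "(1 + norm \<xi>) ^ k > 0" by (simp_all add: zero_less_power add_pos_nonneg)
      have "cmod (stft \<phi> u x \<xi> * of_real (\<omega> (x, \<xi>))) = a * (cmod (u (atom \<phi> (x, \<xi>))) * \<omega> (x, \<xi>))"
        using a \<omega>0[of "(x, \<xi>)"] by (simp add: stft_eq norm_mult a_def)
      also have "\<dots> \<le> a * ((C * S * inverse (?n ^ (M + 2 * k))) * (C0 * ?n ^ M))"
        using a C(1) S n less_imp_le[OF \<omega>0] by (intro mult_left_mono mult_mono C(2)[OF u S b] C0') (auto simp: less_imp_le)
      also have "\<dots> = (a * C * C0 * S) * inverse (?n ^ (2 * k))"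
      proof -
        have "inverse (y ^ (M + 2 * k)) * y ^ M = inverse (y ^ (2 * k))" if "y > 0" for y :: real
          using that by (simp add: power_add)
        from this[of ?n] n[of 1] have "inverse (?n ^ (M + 2 * k)) * ?n ^ M = inverse (?n ^ (2 * k))" by (simp only: power_one_right)
        then show ?thesis by (metis (no_types, lifting) mult.assoc mult.commute)
      qed
      also have "\<dots> \<le> (a * C * C0 * S) * inverse ((1 + norm \<xi>) ^ k * (1 + norm x) ^ k)"
      proof (intro mult_left_mono le_imp_inverse_le)
        have "(1 + norm \<xi>) ^ k * (1 + norm x) ^ k \<le> ?n ^ k * ?n ^ k"
          using one_plus_norm_pair(2,3)[of "(x, \<xi>)"] by (intro mult_mono power_mono) auto
        then show "(1 + norm \<xi>) ^ k * (1 + norm x) ^ k \<le> ?n ^ (2 * k)" by (simp add: mult_2 power_add)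
      qed (use nx a C(1) C0 S in auto)
      finally show ?thesis unfolding h_def by (simp add: ennreal_leI mult.assoc)
    qed
    define S1 where "S1 = (\<lambda>\<xi>::real^'n. (a * C * C0 * S) * inverse ((1 + norm \<xi>) ^ k))"
    have S1: "S1 \<xi> \<ge> 0" for \<xi> using a C(1) C0 S by (simp add: S1_def zero_le_power add_nonneg_nonneg)
    have in_le: "AE \<xi> in lebesgue. Lp_enorm p lebesgue (\<lambda>x. h (x, \<xi>)) \<le> ennreal ((Kp * (a * C * C0 * S)) * inverse ((1 + norm \<xi>) ^ k))"
      using lebesgue_slices(1)[OF hm]
    proof eventually_elim
      case (elim \<xi>)
      have "Lp_enorm p lebesgue (\<lambda>x. h (x, \<xi>)) \<le> ennreal (Kp * S1 \<xi>)"
        by (rule Kp(2)[of k, OF _ S1 elim]) (use hb in \<open>auto simp: k_def S1_def\<close>)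
      then show ?case by (simp add: S1_def mult.assoc)
    qed
    have "modulation_enorm \<phi> p q \<omega> u = Lp_enorm q lebesgue (\<lambda>\<xi>. Lp_enorm p lebesgue (\<lambda>x. h (x, \<xi>)))"
      by (simp add: modulation_enorm_def h_def)
    also have "\<dots> \<le> ennreal (Kq * (Kp * (a * C * C0 * S)))"
      by (rule Kq(2)[of k, OF _ _ lebesgue_slices(2)[OF hm] in_le]) (use Kp(1) a C(1) C0 S in \<open>auto simp: k_def\<close>)
    finally show ?thesis by (simp only: mult_ac)
  qed
  then show ?thesis using Kp(1) Kq(1) a C(1) C0
    by (intro exI[of _ "Kq * Kp * a * C * C0"] conjI exI[of _ m]) auto
qed

section \<open>Passage between the four conditions\<close>

lemma coeff_sum_bound:
  fixes \<sigma> :: real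
  assumes \<sigma>: "\<sigma> > 0" "real N\<^sub>0 * \<sigma> > 1"
  shows "\<exists>\<kappa>>0. \<forall>r>0. \<forall>m. \<forall>a :: ('n::finite \<Rightarrow> nat) \<Rightarrow> real.
     (\<exists>c>0. \<forall>\<alpha>. a \<alpha> \<le> c * coeff_weight \<sigma> r \<alpha>) \<longrightarrow>
     (\<exists>C>0. \<forall>N\<ge>N\<^sub>0. \<forall>\<alpha>. ((2 * real (mabs \<alpha>) + real CARD('n)) ^ N * a \<alpha>) * Pm \<alpha> ^ m
        \<le> (C * growth_bound \<sigma> (\<kappa> * r powr (2 * \<sigma>)) N) * inverse (Pm \<alpha> ^ (2 * CARD('n))))"
proof -
  obtain \<kappa> where \<kappa>: "\<kappa> > 0" "\<And>r. r > 0 \<Longrightarrow> \<exists>C>0. \<forall>N\<ge>N\<^sub>0. \<forall>\<alpha> :: 'n \<Rightarrow> nat.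
     (2 * real (mabs \<alpha>) + real CARD('n)) ^ N * coeff_weight \<sigma> r \<alpha> \<le> C * growth_bound \<sigma> (\<kappa> * r powr (2 * \<sigma>)) N"
    using weight_le_growth[OF \<sigma>, where 'n='n] by blast
  \<comment> \<open>Replacing r by e r multiplies the weight by exp |\<alpha>|, which absorbs all
    powers of \<open>Pm \<alpha>\<close>; the extra factor e^(2 \<sigma>) is the trace this leaves
    in the parameter.\<close>
  define \<kappa>' where "\<kappa>' = \<kappa> * exp 1 powr (2 * \<sigma>)"
  have "\<exists>C>0. \<forall>N\<ge>N\<^sub>0. \<forall>\<alpha>. ((2 * real (mabs \<alpha>) + real CARD('n)) ^ N * a \<alpha>) * Pm \<alpha> ^ m
        \<le> (C * growth_bound \<sigma> (\<kappa>' * r powr (2 * \<sigma>)) N) * inverse (Pm \<alpha> ^ (2 * CARD('n)))"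
    if r: "r > 0" and c: "c > 0" "\<And>\<alpha>. a \<alpha> \<le> c * coeff_weight \<sigma> r \<alpha>" for r m c and a :: "('n \<Rightarrow> nat) \<Rightarrow> real"
  proof -
    have re: "\<kappa>' * r powr (2 * \<sigma>) = \<kappa> * (exp 1 * r) powr (2 * \<sigma>)" using r by (simp add: \<kappa>'_def powr_mult)
    obtain C where C: "C > 0" "\<And>N \<alpha>. N \<ge> N\<^sub>0 \<Longrightarrow> (2 * real (mabs \<alpha>) + real CARD('n)) ^ N * coeff_weight \<sigma> (exp 1 * r) (\<alpha> :: 'n \<Rightarrow> nat)
        \<le> C * growth_bound \<sigma> (\<kappa>' * r powr (2 * \<sigma>)) N"
      using \<kappa>(2)[of "exp 1 * r"] r unfolding re by auto
    obtain D where D: "D > 0" "\<And>t::nat. (1 + real t) ^ (m + 2 * CARD('n)) \<le> D * exp (real t)" using poly_le_exp by blast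
    have "((2 * real (mabs \<alpha>) + real CARD('n)) ^ N * a \<alpha>) * Pm \<alpha> ^ m
        \<le> ((c * C * D) * growth_bound \<sigma> (\<kappa>' * r powr (2 * \<sigma>)) N) * inverse (Pm \<alpha> ^ (2 * CARD('n)))" if N: "N \<ge> N\<^sub>0" for N \<alpha>
    proof -
      define l where "l = (2 * real (mabs \<alpha>) + real CARD('n)) ^ N"
      define g where "g = growth_bound \<sigma> (\<kappa>' * r powr (2 * \<sigma>)) N"
      have l: "l \<ge> 0" by (simp add: l_def)
      have P: "Pm \<alpha> ^ j > 0" for j by simp
      have w: "coeff_weight \<sigma> (exp 1 * r) \<alpha> = exp (real (mabs \<alpha>)) * coeff_weight \<sigma> r \<alpha>"
        by (simp add: coeff_weight_def power_mult_distrib exp_of_nat_mult[of "mabs \<alpha>" "1::real", symmetric, simplified])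
      have "l * a \<alpha> * (Pm \<alpha> ^ m * Pm \<alpha> ^ (2 * CARD('n))) \<le> l * (c * coeff_weight \<sigma> r \<alpha>) * (D * exp (real (mabs \<alpha>)))"
      proof (rule mult_mono)
        show "l * a \<alpha> \<le> l * (c * coeff_weight \<sigma> r \<alpha>)" by (intro mult_left_mono c l)
        show "Pm \<alpha> ^ m * Pm \<alpha> ^ (2 * CARD('n)) \<le> D * exp (real (mabs \<alpha>))" using D(2)[of "mabs \<alpha>"] by (simp only: power_add)
        show "0 \<le> l * (c * coeff_weight \<sigma> r \<alpha>)" using l c(1) coeff_weight_pos[OF r, of \<sigma> \<alpha>] by simp
      qed (simp add: P less_imp_le)
      also have "\<dots> = c * D * (l * coeff_weight \<sigma> (exp 1 * r) \<alpha>)" unfolding w by (simp only: mult_ac)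
      also have "\<dots> \<le> c * D * (C * g)" using c(1) D(1) C(2)[OF N, of \<alpha>] unfolding l_def g_def by (intro mult_left_mono) auto
      finally have "(l * a \<alpha> * Pm \<alpha> ^ m) * Pm \<alpha> ^ (2 * CARD('n)) \<le> c * C * D * g" by (simp only: mult_ac)
      then have "l * a \<alpha> * Pm \<alpha> ^ m \<le> c * C * D * g / Pm \<alpha> ^ (2 * CARD('n))" using P[of "2 * CARD('n)"] by (simp only: pos_le_divide_eq)
      then show ?thesis by (simp only: l_def g_def divide_inverse)
    qed
    then show ?thesis using c(1) C(1) D(1) by (intro exI[of _ "c * C * D"]) auto
  qed
  then show ?thesis using \<kappa>(1) by (intro exI[of _ \<kappa>']) (auto simp: \<kappa>'_def)
qed

lemma powr_scale_surj:
  fixes \<kappa> e r :: real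
  assumes "\<kappa> > 0" "e > 0" "r > 0"
  shows "\<exists>r'>0. \<kappa> * r' powr e = r"
  using assms by (intro exI[of _ "(r / \<kappa>) powr (1 / e)"]) (auto simp: powr_powr)

text \<open>For the existential form it is enough that the parameter maps preserve positivity. For
  the universal form each positive value must be reached from some r, which is the surjectivity of r
  -> \<kappa> r^e.\<close>

lemma equiv_by_scaling:
  fixes \<kappa> \<kappa>' e e' :: real
  assumes "\<kappa> > 0" "e > 0" "\<kappa>' > 0" "e' > 0"
    and XY: "\<And>r. r > 0 \<Longrightarrow> X r \<Longrightarrow> Y (\<kappa> * r powr e)" and YX: "\<And>r. r > 0 \<Longrightarrow> Y r \<Longrightarrow> X (\<kappa>' * r powr e')"
  shows "(\<exists>r>0. X r) \<longleftrightarrow> (\<exists>r>0. Y r)" "(\<forall>r>0. X r) \<longleftrightarrow> (\<forall>r>0. Y r)"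
proof -
  have p: "\<kappa> * r powr e > 0" "\<kappa>' * r powr e' > 0" if "r > 0" for r using assms that by auto
  show "(\<exists>r>0. X r) \<longleftrightarrow> (\<exists>r>0. Y r)" using XY YX p by meson
  show "(\<forall>r>0. X r) \<longleftrightarrow> (\<forall>r>0. Y r)"
    using XY YX powr_scale_surj[OF assms(1,2)] powr_scale_surj[OF assms(3,4)] by metis
qed

text \<open>A member of the sequence space is bounded by its norm, with the same r. Conversely, for
  finite q, enlarging r by the factor exp (1 / q) inserts exp (- |\<alpha>|) after raising to the
  power q, and this is summable over the multi-indices.\<close>

lemma lq_coefficients_iff:
  fixes q :: ennreal and a :: "('n::finite \<Rightarrow> nat) \<Rightarrow> complex" and \<sigma> :: real
  assumes q: "q > 0"
  defines "A r \<equiv> \<exists>c>0. \<forall>\<alpha>. cmod (a \<alpha>) \<le> c * coeff_weight \<sigma> r \<alpha>"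
    and "B r \<equiv> Lp_enorm q (count_space UNIV) (\<lambda>\<alpha>. ennreal (cmod (a \<alpha>
         * of_real (r powi (- int (mabs \<alpha>)) * real (mfact \<alpha>) powr (1 / (2 * \<sigma>)))))) < top"
  shows "(\<exists>r>0. A r) \<longleftrightarrow> (\<exists>r>0. B r)" "(\<forall>r>0. A r) \<longleftrightarrow> (\<forall>r>0. B r)"
proof -
  define \<kappa> where "\<kappa> = (if q = top then 1 else exp (1 / enn2real q))"
  have \<kappa>: "\<kappa> > 0" by (simp add: \<kappa>_def)
  have w: "cmod (a \<alpha> * of_real (r powi (- int (mabs \<alpha>)) * real (mfact \<alpha>) powr (1 / (2 * \<sigma>)))) = cmod (a \<alpha>) / coeff_weight \<sigma> r \<alpha>" if "r > 0" for r \<alpha>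
  proof -
    have "r powi (- int (mabs \<alpha>)) = inverse (r ^ mabs \<alpha>)" by (simp add: power_int_minus)
    moreover have "real (mfact \<alpha>) powr (1 / (2 * \<sigma>)) = inverse (real (mfact \<alpha>) powr (- 1 / (2 * \<sigma>)))"
      by (simp only: minus_divide_left[symmetric] powr_minus inverse_inverse_eq)
    ultimately have "r powi (- int (mabs \<alpha>)) * real (mfact \<alpha>) powr (1 / (2 * \<sigma>)) = inverse (coeff_weight \<sigma> r \<alpha>)"
      by (simp only: coeff_weight_def inverse_mult_distrib)
    then show ?thesis using coeff_weight_pos[OF that, of \<sigma> \<alpha>]
      by (simp only: norm_mult norm_of_real divide_inverse abs_inverse abs_of_pos)
  qed
  have AB: "B (\<kappa> * r powr 1)" if r: "r > 0" and "A r" for r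
  proof -
    obtain c where c: "c > 0" "\<And>\<alpha>. cmod (a \<alpha>) \<le> c * coeff_weight \<sigma> r \<alpha>" using \<open>A r\<close> unfolding A_def by blast
    have kr: "\<kappa> * r > 0" using \<kappa> r by simp
    have wk: "coeff_weight \<sigma> (\<kappa> * r) \<alpha> = \<kappa> ^ mabs \<alpha> * coeff_weight \<sigma> r \<alpha>" for \<alpha> :: "'n \<Rightarrow> nat"
      by (simp add: coeff_weight_def power_mult_distrib)
    have b: "cmod (a \<alpha>) / coeff_weight \<sigma> (\<kappa> * r) \<alpha> \<le> c / \<kappa> ^ mabs \<alpha>" for \<alpha>
    proof -
      have "cmod (a \<alpha>) / coeff_weight \<sigma> (\<kappa> * r) \<alpha> \<le> (c * coeff_weight \<sigma> r \<alpha>) / coeff_weight \<sigma> (\<kappa> * r) \<alpha>"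
        by (intro divide_right_mono c less_imp_le[OF coeff_weight_pos[OF kr]])
      also have "\<dots> = c / \<kappa> ^ mabs \<alpha>" unfolding wk using coeff_weight_pos[OF r, of \<sigma> \<alpha>] by simp
      finally show ?thesis .
    qed
    have "Lp_enorm q (count_space UNIV) (\<lambda>\<alpha>. ennreal (cmod (a \<alpha>) / coeff_weight \<sigma> (\<kappa> * r) \<alpha>)) < top"
    proof (cases "q = top")
      case True
      have "ennreal (cmod (a \<alpha>) / coeff_weight \<sigma> (\<kappa> * r) \<alpha>) \<le> ennreal c" for \<alpha>
        using b[of \<alpha>] True by (intro ennreal_leI) (simp add: \<kappa>_def)
      then have "esssup (count_space UNIV) (\<lambda>\<alpha>. ennreal (cmod (a \<alpha>) / coeff_weight \<sigma> (\<kappa> * r) \<alpha>)) \<le> ennreal c"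
        by (intro esssup_I AE_I2) simp_all
      then show ?thesis using True by (simp add: Lp_enorm_def le_less_trans)
    next
      case False
      define Q where "Q = enn2real q"
      have Q: "Q > 0" using enn2real_exponent[OF q False] by (simp add: Q_def)
      have k: "\<kappa> ^ j = exp (real j / Q)" for j using False by (simp add: \<kappa>_def Q_def exp_of_nat_mult[symmetric])
      obtain D where D: "D > 0" "\<And>t::nat. (1 + real t) ^ (2 * CARD('n)) \<le> D * exp (real t)" using poly_le_exp by blast
      have "(\<integral>\<^sup>+\<alpha>. ennreal_powr (ennreal (cmod (a \<alpha>) / coeff_weight \<sigma> (\<kappa> * r) \<alpha>)) Q \<partial>count_space UNIV)
         \<le> (\<integral>\<^sup>+\<alpha>. ennreal (c powr Q * D * inverse (Pm \<alpha> ^ (2 * CARD('n)))) \<partial>count_space (UNIV :: ('n \<Rightarrow> nat) set))"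
      proof (rule nn_integral_mono)
        fix \<alpha> :: "'n \<Rightarrow> nat"
        have P: "Pm \<alpha> ^ (2 * CARD('n)) > 0" by simp
        have b0: "0 \<le> cmod (a \<alpha>) / coeff_weight \<sigma> (\<kappa> * r) \<alpha>" using less_imp_le[OF coeff_weight_pos[OF kr, of \<sigma> \<alpha>]] by simp
        have "(cmod (a \<alpha>) / coeff_weight \<sigma> (\<kappa> * r) \<alpha>) powr Q \<le> (c / exp (real (mabs \<alpha>) / Q)) powr Q"
          using b[of \<alpha>] Q b0 unfolding k by (intro powr_mono2) auto
        also have "(c / exp (real (mabs \<alpha>) / Q)) powr Q = (c * exp (- (real (mabs \<alpha>) / Q))) powr Q"
          by (simp add: exp_minus divide_inverse)
        also have "\<dots> = c powr Q * exp (- (real (mabs \<alpha>) / Q) * Q)" using c(1) by (subst powr_mult) (simp_all only: exp_powr_real exp_ge_zero less_imp_le)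
        also have "- (real (mabs \<alpha>) / Q) * Q = - real (mabs \<alpha>)" using Q by simp
        also have "c powr Q * exp (- real (mabs \<alpha>)) \<le> c powr Q * (D * inverse (Pm \<alpha> ^ (2 * CARD('n))))"
          using D(2)[of "mabs \<alpha>"] P by (intro mult_left_mono) (auto simp: exp_minus field_simps)
        finally show "ennreal_powr (ennreal (cmod (a \<alpha>) / coeff_weight \<sigma> (\<kappa> * r) \<alpha>)) Q \<le> ennreal (c powr Q * D * inverse (Pm \<alpha> ^ (2 * CARD('n))))"
          using b0 by (simp add: ennreal_powr_ennreal ennreal_leI mult.assoc)
      qed
      also have "\<dots> = ennreal (\<integral>\<alpha>. c powr Q * D * inverse (Pm \<alpha> ^ (2 * CARD('n))) \<partial>count_space (UNIV :: ('n \<Rightarrow> nat) set))"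
        using D(1) by (intro nn_integral_eq_integral integrable_mult_right summable_Pm AE_I2) simp
      also have "\<dots> < top" by simp
      finally show ?thesis using False unfolding Lp_enorm_def Q_def[symmetric] by (auto simp: ennreal_powr_def)
    qed
    then have "B (\<kappa> * r)" unfolding B_def w[OF kr] .
    then show ?thesis using r by simp
  qed
  have BA: "A (1 * r powr 1)" if r: "r > 0" and "B r" for r
  proof -
    have lt: "Lp_enorm q (count_space UNIV) (\<lambda>\<alpha>. ennreal (cmod (a \<alpha>) / coeff_weight \<sigma> r \<alpha>)) < top"
      using \<open>B r\<close> unfolding B_def by (simp only: w[OF r])
    have b0: "0 \<le> cmod (a \<alpha>) / coeff_weight \<sigma> r \<alpha>" for \<alpha> using less_imp_le[OF coeff_weight_pos[OF r, of \<sigma> \<alpha>]] by simp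
    have "\<exists>c. \<forall>\<alpha>. cmod (a \<alpha>) / coeff_weight \<sigma> r \<alpha> \<le> c"
    proof (cases "q = top")
      case True
      then obtain c where c: "esssup (count_space UNIV) (\<lambda>\<alpha>. ennreal (cmod (a \<alpha>) / coeff_weight \<sigma> r \<alpha>)) = ennreal c" "c \<ge> 0"
        using lt by (auto simp: Lp_enorm_def less_top_ennreal)
      have "ennreal (cmod (a \<alpha>) / coeff_weight \<sigma> r \<alpha>) \<le> ennreal c" for \<alpha>
        using esssup_AE[of "\<lambda>\<alpha>. ennreal (cmod (a \<alpha>) / coeff_weight \<sigma> r \<alpha>)" "count_space UNIV"] unfolding c(1) by (simp add: AE_count_space)
      then show ?thesis using c(2) by (auto simp: ennreal_le_iff)
    next
      case False
      define Q where "Q = enn2real q"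
      have Q: "Q > 0" using enn2real_exponent[OF q False] by (simp add: Q_def)
      let ?I = "\<integral>\<^sup>+\<alpha>. ennreal_powr (ennreal (cmod (a \<alpha>) / coeff_weight \<sigma> r \<alpha>)) Q \<partial>count_space UNIV"
      have "?I \<noteq> top" using lt False unfolding Lp_enorm_def Q_def[symmetric] by (auto simp: ennreal_powr_def split: if_splits)
      then obtain i where i: "?I = ennreal i" "i \<ge> 0" by (cases ?I) auto
      have "cmod (a \<alpha>) / coeff_weight \<sigma> r \<alpha> \<le> i powr (1 / Q)" for \<alpha>
      proof -
        have "ennreal_powr (ennreal (cmod (a \<alpha>) / coeff_weight \<sigma> r \<alpha>)) Q \<le> ?I" by (rule nn_integral_ge_point) simp
        then have "(cmod (a \<alpha>) / coeff_weight \<sigma> r \<alpha>) powr Q \<le> i"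
          using i b0[of \<alpha>] by (simp add: ennreal_powr_ennreal ennreal_le_iff)
        then have "((cmod (a \<alpha>) / coeff_weight \<sigma> r \<alpha>) powr Q) powr (1 / Q) \<le> i powr (1 / Q)" using Q by (intro powr_mono2) auto
        moreover have "(x powr Q) powr (1 / Q) = x" if "x \<ge> 0" for x using that Q by (simp add: powr_powr)
        ultimately show ?thesis using b0[of \<alpha>] by metis
      qed
      then show ?thesis by blast
    qed
    then obtain c where c: "\<And>\<alpha>. cmod (a \<alpha>) / coeff_weight \<sigma> r \<alpha> \<le> c" by blast
    have "cmod (a \<alpha>) \<le> (\<bar>c\<bar> + 1) * coeff_weight \<sigma> r \<alpha>" for \<alpha>
    proof -
      have "cmod (a \<alpha>) / coeff_weight \<sigma> r \<alpha> \<le> \<bar>c\<bar> + 1" using c[of \<alpha>] by linarith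
      then show ?thesis using coeff_weight_pos[OF r, of \<sigma> \<alpha>] by (simp add: pos_divide_le_eq)
    qed
    then show ?thesis unfolding A_def using r by (intro exI[of _ "\<bar>c\<bar> + 1"]) auto
  qed
  show "(\<exists>r>0. A r) \<longleftrightarrow> (\<exists>r>0. B r)" "(\<forall>r>0. A r) \<longleftrightarrow> (\<forall>r>0. B r)"
    by (rule equiv_by_scaling[where X=A and Y=B, OF \<kappa> _ _ _ AB BA]; simp)+
qed

theorem theorem3p1:
  fixes f \<phi> :: "real^'n \<Rightarrow> complex"
    and \<omega> :: "(real^'n) \<times> (real^'n) \<Rightarrow> real"
    and \<sigma> :: real and N\<^sub>0 :: nat and p\<^sub>0 p q :: ennreal
  assumes "\<sigma> > 0" and "real N\<^sub>0 * \<sigma> > 1"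
    and "p\<^sub>0 \<ge> 1" and "p > 0" and "q > 0"
    and "poly_moderate_weight \<omega>"
    and "\<phi> \<in> schwartz" and "\<phi> \<noteq> (\<lambda>_. 0)"
    and "smooth f" and "tempered_function f" and "hermite_series (distribution_of f)"
  defines "coeff_cond r \<equiv>
      Lp_enorm q (count_space UNIV) (\<lambda>\<alpha>. ennreal (cmod (hermite_coeff (distribution_of f) \<alpha>
         * of_real (r powi (- int (mabs \<alpha>)) * real (mfact \<alpha>) powr (1 / (2 * \<sigma>)))))) < top"
    and "lebesgue_cond r \<equiv>
      \<exists>c>0. \<forall>N\<ge>N\<^sub>0. Lp_enorm p\<^sub>0 lebesgue (\<lambda>x. ennreal (cmod ((harmonic_osc ^^ N) f x)))
         \<le> ennreal (c * growth_bound \<sigma> r N)"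
    and "modulation_cond r \<equiv>
      \<exists>c>0. \<forall>N\<ge>N\<^sub>0. modulation_enorm \<phi> p q \<omega> (distribution_of ((harmonic_osc ^^ N) f))
         \<le> ennreal (c * growth_bound \<sigma> r N)"
  shows
    "((distribution_of f \<in> pilipovic \<sigma> \<longleftrightarrow> (\<exists>r>0. coeff_cond r)) \<and>
      ((\<exists>r>0. coeff_cond r) \<longleftrightarrow> (\<exists>r>0. lebesgue_cond r)) \<and>
      ((\<exists>r>0. lebesgue_cond r) \<longleftrightarrow> (\<exists>r>0. modulation_cond r)))
     \<and>
     ((distribution_of f \<in> pilipovic0 \<sigma> \<longleftrightarrow> (\<forall>r>0. coeff_cond r)) \<and>
      ((\<forall>r>0. coeff_cond r) \<longleftrightarrow> (\<forall>r>0. lebesgue_cond r)) \<and>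
      ((\<forall>r>0. lebesgue_cond r) \<longleftrightarrow> (\<forall>r>0. modulation_cond r)))"
proof -
  define u where "u = (\<lambda>N. distribution_of ((harmonic_osc ^^ N) f))"
  define lam where "lam = (\<lambda>\<alpha> :: 'n \<Rightarrow> nat. 2 * real (mabs \<alpha>) + real CARD('n))"
  \<comment> \<open>The condition through which all others are compared; its two quantified forms
    are the two Pilipovic conditions.\<close>
  define P where "P = (\<lambda>r. \<exists>c>0. \<forall>\<alpha>. cmod (hermite_coeff (distribution_of f) \<alpha>) \<le> c * coeff_weight \<sigma> r \<alpha>)"
  have sm: "smooth ((harmonic_osc ^^ N) f)" for N by (rule smooth_harmonic_osc_funpow[OF \<open>smooth f\<close>])
  have rep: "represents ((harmonic_osc ^^ N) f) (u N)" for N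
    unfolding u_def by (rule distribution_of_harmonic_osc(1)) fact+
  have ut: "tempered_distribution (u N)" for N using rep by (simp add: represents_def)
  have uN: "u N \<psi> = distribution_of f ((harmonic_osc ^^ N) \<psi>)" if "\<psi> \<in> schwartz" for N \<psi>
    unfolding u_def by (rule distribution_of_harmonic_osc(2)) fact+
  have t0: "tempered_distribution (distribution_of f)" using ut[of 0] by (simp add: u_def)
  have cN: "hermite_coeff (u N) \<alpha> = of_real (lam \<alpha> ^ N) * hermite_coeff (distribution_of f) \<alpha>" for N \<alpha>
    unfolding hermite_coeff_def uN[OF schwartz_hermite] harmonic_osc_funpow_hermite lam_def
    by (rule tempered_cmult[OF t0 schwartz_hermite])
  have lam0: "lam \<alpha> ^ N \<ge> 0" for \<alpha> N by (simp add: lam_def)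
  have cN_norm: "cmod (hermite_coeff (u N) \<alpha>) = lam \<alpha> ^ N * cmod (hermite_coeff (distribution_of f) \<alpha>)" for N \<alpha>
    unfolding cN norm_mult norm_of_real using lam0 by simp
  \<comment> \<open>The modulation estimates, and the pointwise bound, require the Hermite series of
    every \<open>H^N f\<close>. Symmetry moves \<open>H^N\<close> onto the test function, where the
    series of f is available.\<close>
  have uh: "hermite_series (u N)" for N
    unfolding hermite_series_def
  proof
    fix \<psi> :: "real^'n \<Rightarrow> complex" assume \<psi>: "\<psi> \<in> schwartz"
    have "((\<lambda>\<alpha>. hermite_coeff (distribution_of f) \<alpha> * (LINT x|lebesgue. hermite_function \<alpha> x * (harmonic_osc ^^ N) \<psi> x)) has_sum distribution_of f ((harmonic_osc ^^ N) \<psi>)) UNIV"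
      using \<open>hermite_series (distribution_of f)\<close> schwartz_harmonic_osc_funpow[OF \<psi>] unfolding hermite_series_def by blast
    moreover have "hermite_coeff (distribution_of f) \<alpha> * (LINT x|lebesgue. hermite_function \<alpha> x * (harmonic_osc ^^ N) \<psi> x)
       = hermite_coeff (u N) \<alpha> * (LINT x|lebesgue. hermite_function \<alpha> x * \<psi> x)" for \<alpha>
    proof -
      have "(LBINT x. hermite_function \<alpha> x * (harmonic_osc ^^ N) \<psi> x) = (LBINT x. (harmonic_osc ^^ N) (hermite_function \<alpha>) x * \<psi> x)"
        by (rule harmonic_osc_funpow_symmetric[symmetric]) (simp add: spair_def schwartz_hermite \<psi>)
      also have "\<dots> = of_real (lam \<alpha> ^ N) * (LBINT x. hermite_function \<alpha> x * \<psi> x)"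
        unfolding harmonic_osc_funpow_hermite lam_def mult.assoc by (rule integral_mult_right_zero)
      finally show ?thesis
        unfolding LINT_hermite_schwartz[OF \<psi>] LINT_hermite_schwartz[OF schwartz_harmonic_osc_funpow[OF \<psi>]] cN by (simp only: mult_ac)
    qed
    ultimately show "((\<lambda>\<alpha>. hermite_coeff (u N) \<alpha> * (LINT x|lebesgue. hermite_function \<alpha> x * \<psi> x)) has_sum u N \<psi>) UNIV"
      unfolding uN[OF \<psi>] by simp
  qed
  have gpos: "growth_bound \<sigma> r N > 0" if "r > 0" "N \<ge> N\<^sub>0" for r N
  proof -
    have "real N\<^sub>0 * \<sigma> \<le> real N * \<sigma>" using that(2) assms(1) by (intro mult_right_mono) auto
    then have "real N * \<sigma> > 1" using assms(2) by linarith
    then show ?thesis by (intro ln_growth_bound(1) assms(1) that(1))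
  qed
  obtain \<kappa> where \<kappa>: "\<kappa> > 0" and up0: "\<forall>r>0. \<forall>m. \<forall>a :: ('n \<Rightarrow> nat) \<Rightarrow> real.
     (\<exists>c>0. \<forall>\<alpha>. a \<alpha> \<le> c * coeff_weight \<sigma> r \<alpha>) \<longrightarrow>
     (\<exists>C>0. \<forall>N\<ge>N\<^sub>0. \<forall>\<alpha>. ((2 * real (mabs \<alpha>) + real CARD('n)) ^ N * a \<alpha>) * Pm \<alpha> ^ m
        \<le> (C * growth_bound \<sigma> (\<kappa> * r powr (2 * \<sigma>)) N) * inverse (Pm \<alpha> ^ (2 * CARD('n))))"
    using coeff_sum_bound[OF assms(1,2), where 'n='n] by (elim exE conjE) (rule that)
  have up: "\<exists>C>0. \<forall>N\<ge>N\<^sub>0. \<forall>\<alpha>. cmod (hermite_coeff (u N) \<alpha>) * Pm \<alpha> ^ m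
        \<le> (C * growth_bound \<sigma> (\<kappa> * r powr (2 * \<sigma>)) N) * inverse (Pm \<alpha> ^ (2 * CARD('n)))" if "r > 0" "P r" for r m
    unfolding cN_norm lam_def by (rule up0[rule_format, OF that(1)]) (use that(2) in \<open>simp only: P_def\<close>)
  obtain \<kappa>' where \<kappa>': "\<kappa>' > 0" and down0: "\<forall>r>0. \<forall>m. \<forall>c. \<forall>a :: ('n \<Rightarrow> nat) \<Rightarrow> real.
     (\<forall>\<alpha>. a \<alpha> \<ge> 0) \<longrightarrow> (\<forall>N\<ge>N\<^sub>0. \<forall>\<alpha>. (2 * real (mabs \<alpha>) + real CARD('n)) ^ N * a \<alpha> \<le> c * Pm \<alpha> ^ m * growth_bound \<sigma> r N)
     \<longrightarrow> (\<exists>C>0. \<forall>\<alpha>. a \<alpha> \<le> C * coeff_weight \<sigma> (\<kappa>' * r powr (1 / (2 * \<sigma>))) \<alpha>)"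
    using growth_le_weight[OF assms(1,2), where 'n='n] by (elim exE conjE) (rule that)
  have down: "P (\<kappa>' * r powr (1 / (2 * \<sigma>)))"
    if "r > 0" "\<forall>N\<ge>N\<^sub>0. \<forall>\<alpha>. cmod (hermite_coeff (u N) \<alpha>) \<le> c * Pm \<alpha> ^ m * growth_bound \<sigma> r N" for r m c
  proof -
    have "\<forall>N\<ge>N\<^sub>0. \<forall>\<alpha>. (2 * real (mabs \<alpha>) + real CARD('n)) ^ N * cmod (hermite_coeff (distribution_of f) \<alpha>) \<le> c * Pm \<alpha> ^ m * growth_bound \<sigma> r N"
      using that(2) by (simp only: cN_norm lam_def)
    then show ?thesis
      using down0[THEN spec, THEN mp, OF that(1), THEN spec, of m, THEN spec, of c, THEN spec, of "\<lambda>\<alpha>. cmod (hermite_coeff (distribution_of f) \<alpha>)"]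
      by (simp add: P_def)
  qed
  have PL: "lebesgue_cond (\<kappa> * r powr (2 * \<sigma>))" if r: "r > 0" and "P r" for r
  proof -
    have "p\<^sub>0 > 0" using assms(3) zero_less_one order_less_le_trans by blast
    then obtain K k where K: "K \<ge> 0" "\<And>S (g :: real^'n \<Rightarrow> ennreal). S \<ge> 0 \<Longrightarrow> g \<in> borel_measurable lebesgue \<Longrightarrow>
     (AE x in lebesgue. g x \<le> ennreal (S * inverse ((1 + norm x) ^ k))) \<Longrightarrow> Lp_enorm p\<^sub>0 lebesgue g \<le> ennreal (K * S)"
      using Lp_enorm_decay_bound[of p\<^sub>0, where 'a="real^'n"] by blast
    obtain C m where C: "C \<ge> 0" "\<And>g v S x. represents g v \<Longrightarrow> smooth g \<Longrightarrow> hermite_series v \<Longrightarrow> S \<ge> 0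
      \<Longrightarrow> (\<forall>\<alpha>. cmod (hermite_coeff v \<alpha>) * Pm \<alpha> ^ m \<le> S * inverse (Pm \<alpha> ^ (2 * CARD('n))))
      \<Longrightarrow> cmod (g (x::real^'n)) \<le> C * S * inverse ((1 + norm x) ^ k)"
      using series_pointwise_bound[where 'n='n, of k] by blast
    obtain D where D: "D > 0" "\<forall>N\<ge>N\<^sub>0. \<forall>\<alpha>. cmod (hermite_coeff (u N) \<alpha>) * Pm \<alpha> ^ m
        \<le> (D * growth_bound \<sigma> (\<kappa> * r powr (2 * \<sigma>)) N) * inverse (Pm \<alpha> ^ (2 * CARD('n)))"
      using up[OF r \<open>P r\<close>] by blast
    have "Lp_enorm p\<^sub>0 lebesgue (\<lambda>x. ennreal (cmod ((harmonic_osc ^^ N) f x))) \<le> ennreal ((K * C * D + 1) * growth_bound \<sigma> (\<kappa> * r powr (2 * \<sigma>)) N)"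
      if N: "N \<ge> N\<^sub>0" for N
    proof -
      define g where "g = growth_bound \<sigma> (\<kappa> * r powr (2 * \<sigma>)) N"
      have g: "g > 0" unfolding g_def by (rule gpos[OF _ N]) (use \<kappa> r in simp)
      have "Lp_enorm p\<^sub>0 lebesgue (\<lambda>x. ennreal (cmod ((harmonic_osc ^^ N) f x))) \<le> ennreal (K * (C * (D * g)))"
      proof (rule K(2))
        show "(\<lambda>x. ennreal (cmod ((harmonic_osc ^^ N) f x))) \<in> borel_measurable lebesgue"
          using smooth_measurable[OF sm] by (intro measurable_completion) simp
        show "AE x in lebesgue. ennreal (cmod ((harmonic_osc ^^ N) f x)) \<le> ennreal (C * (D * g) * inverse ((1 + norm x) ^ k))"
          by (intro AE_I2 ennreal_leI C(2)[OF rep sm uh]) (use D N g in \<open>auto simp: g_def\<close>)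
      qed (use C(1) D(1) g in simp)
      \<comment> \<open>The summand 1 keeps the constant strictly positive when K or C is 0.\<close>
      also have "\<dots> \<le> ennreal ((K * C * D + 1) * g)" using g by (intro ennreal_leI) (simp add: algebra_simps)
      finally show ?thesis by (simp only: g_def)
    qed
    moreover have "K * C * D + 1 > 0" using K(1) C(1) D(1) by (simp add: add_nonneg_pos)
    ultimately show ?thesis unfolding lebesgue_cond_def by blast
  qed
  have LP: "P (\<kappa>' * r powr (1 / (2 * \<sigma>)))" if r: "r > 0" and "lebesgue_cond r" for r
  proof -
    obtain c where c: "c > 0" "\<And>N. N \<ge> N\<^sub>0 \<Longrightarrow> Lp_enorm p\<^sub>0 lebesgue (\<lambda>x. ennreal (cmod ((harmonic_osc ^^ N) f x))) \<le> ennreal (c * growth_bound \<sigma> r N)"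
      using \<open>lebesgue_cond r\<close> unfolding lebesgue_cond_def by blast
    obtain C m where C: "C > 0" "\<And>g v B \<alpha>. represents g v \<Longrightarrow> smooth g \<Longrightarrow> B \<ge> 0
      \<Longrightarrow> Lp_enorm p\<^sub>0 lebesgue (\<lambda>x::real^'n. ennreal (cmod (g x))) \<le> ennreal B \<Longrightarrow> cmod (hermite_coeff v \<alpha>) \<le> C * Pm \<alpha> ^ m * B"
      using coeff_le_Lp[OF assms(3), where 'n='n] by blast
    show ?thesis
    proof (rule down[OF r, of "C * c" m], intro allI impI)
      fix N \<alpha> assume N: "N \<ge> N\<^sub>0"
      have "cmod (hermite_coeff (u N) \<alpha>) \<le> C * Pm \<alpha> ^ m * (c * growth_bound \<sigma> r N)"
        by (rule C(2)[OF rep sm _ c(2)[OF N]]) (use c(1) gpos[OF r N] in simp)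
      then show "cmod (hermite_coeff (u N) \<alpha>) \<le> C * c * Pm \<alpha> ^ m * growth_bound \<sigma> r N" by (simp only: mult_ac)
    qed
  qed
  have PM: "modulation_cond (\<kappa> * r powr (2 * \<sigma>))" if r: "r > 0" and "P r" for r
  proof -
    obtain C m where C: "C \<ge> 0" "\<And>v S. tempered_distribution v \<Longrightarrow> hermite_series v \<Longrightarrow> S \<ge> 0
      \<Longrightarrow> (\<forall>\<alpha>. cmod (hermite_coeff v \<alpha>) * Pm \<alpha> ^ m \<le> S * inverse (Pm \<alpha> ^ (2 * CARD('n))))
      \<Longrightarrow> modulation_enorm \<phi> p q \<omega> v \<le> ennreal (C * S)"
      using modulation_le_series[OF assms(4,5,6,7)] by blast
    obtain D where D: "D > 0" "\<forall>N\<ge>N\<^sub>0. \<forall>\<alpha>. cmod (hermite_coeff (u N) \<alpha>) * Pm \<alpha> ^ m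
        \<le> (D * growth_bound \<sigma> (\<kappa> * r powr (2 * \<sigma>)) N) * inverse (Pm \<alpha> ^ (2 * CARD('n)))"
      using up[OF r \<open>P r\<close>] by blast
    have "modulation_enorm \<phi> p q \<omega> (u N) \<le> ennreal ((C * D + 1) * growth_bound \<sigma> (\<kappa> * r powr (2 * \<sigma>)) N)"
      if N: "N \<ge> N\<^sub>0" for N
    proof -
      define g where "g = growth_bound \<sigma> (\<kappa> * r powr (2 * \<sigma>)) N"
      have g: "g > 0" unfolding g_def by (rule gpos[OF _ N]) (use \<kappa> r in simp)
      have "modulation_enorm \<phi> p q \<omega> (u N) \<le> ennreal (C * (D * g))"
        by (rule C(2)[OF ut uh]) (use D N g in \<open>auto simp: g_def\<close>)
      also have "\<dots> \<le> ennreal ((C * D + 1) * g)" using g by (intro ennreal_leI) (simp add: algebra_simps)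
      finally show ?thesis by (simp only: g_def)
    qed
    moreover have "C * D + 1 > 0" using C(1) D(1) by (simp add: add_nonneg_pos)
    ultimately show ?thesis unfolding modulation_cond_def u_def by blast
  qed
  have MP: "P (\<kappa>' * r powr (1 / (2 * \<sigma>)))" if r: "r > 0" and "modulation_cond r" for r
  proof -
    obtain c where c: "c > 0" "\<And>N. N \<ge> N\<^sub>0 \<Longrightarrow> modulation_enorm \<phi> p q \<omega> (u N) \<le> ennreal (c * growth_bound \<sigma> r N)"
      using \<open>modulation_cond r\<close> unfolding modulation_cond_def u_def by blast
    obtain C m where C: "C > 0" "\<And>v B \<alpha>. tempered_distribution v \<Longrightarrow> hermite_series v \<Longrightarrow> B \<ge> 0
      \<Longrightarrow> modulation_enorm \<phi> p q \<omega> v \<le> ennreal B \<Longrightarrow> cmod (hermite_coeff v \<alpha>) \<le> C * Pm \<alpha> ^ m * B"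
      using coeff_le_modulation[OF assms(4-8)] by blast
    show ?thesis
    proof (rule down[OF r, of "C * c" m], intro allI impI)
      fix N \<alpha> assume N: "N \<ge> N\<^sub>0"
      have "cmod (hermite_coeff (u N) \<alpha>) \<le> C * Pm \<alpha> ^ m * (c * growth_bound \<sigma> r N)"
        by (rule C(2)[OF ut uh _ c(2)[OF N]]) (use c(1) gpos[OF r N] in simp)
      then show "cmod (hermite_coeff (u N) \<alpha>) \<le> C * c * Pm \<alpha> ^ m * growth_bound \<sigma> r N" by (simp only: mult_ac)
    qed
  qed
  have e: "2 * \<sigma> > 0" "1 / (2 * \<sigma>) > 0" using assms(1) by auto
  note L = equiv_by_scaling[where X=P and Y=lebesgue_cond, OF \<kappa> e(1) \<kappa>' e(2) PL LP]
  note M = equiv_by_scaling[where X=P and Y=modulation_cond, OF \<kappa> e(1) \<kappa>' e(2) PM MP]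
  have Cf: "(\<exists>r>0. P r) \<longleftrightarrow> (\<exists>r>0. coeff_cond r)" "(\<forall>r>0. P r) \<longleftrightarrow> (\<forall>r>0. coeff_cond r)"
    unfolding coeff_cond_def P_def by (rule lq_coefficients_iff[OF assms(5)])+
  have pil: "distribution_of f \<in> pilipovic \<sigma> \<longleftrightarrow> (\<exists>r>0. P r)" "distribution_of f \<in> pilipovic0 \<sigma> \<longleftrightarrow> (\<forall>r>0. P r)"
    using t0 assms(11) by (simp_all add: pilipovic_def pilipovic0_def P_def coeff_weight_def)
  show ?thesis by (simp only: pil L[symmetric] M[symmetric] Cf[symmetric] simp_thms)
qed

end
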